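(* Let $n\ge1$, $l\ge2$ an integer, $0<\rho<1$, $1<r\le2$, and $m=-\frac{nl}{r}(1-\rho)$. Then every $\sigma\in\mathbb{M}_lS^m_{\rho,\rho}(\mathbb{R}^n)$ satisfies: there is $C>0$ such that for all $f_1,\dots,f_l\in\mathscr{S}(\mathbb{R}^n)$ and all $x\in\mathbb{R}^n$, $$\mathcal{M}^\sharp_{r/l}\big(T_\sigma(f_1,\dots,f_l)\big)(x)\le C\,\mathbf{M}_r(f_1,\dots,f_l)(x).$$
   Context: $\mathbb{M}_lS^m_{\rho,\rho}(\mathbb{R}^n)$: smooth $\sigma(x,\xi_1,\dots,\xi_l)$ on $(\mathbb{R}^n)^{l+1}$ with $|\partial_x^\alpha\partial_{\xi_1}^{\beta_1}\cdots\partial_{\xi_l}^{\beta_l}\sigma|\le C_{\alpha,\beta}(1+|\xi_1|+\dots+|\xi_l|)^{m+\rho|\alpha|-\rho(|\beta_1|+\dots+|\beta_l|)}$ for all multi-indices. $T_\sigma(f_1,\dots,f_l)(x)=\int_{(\mathbb{R}^n)^l}\sigma(x,\xi_1,\dots,\xi_l)\prod_j\widehat{f_j}(\xi_j)e^{2\pi i\langle x,\xi_1+\dots+\xi_l\rangle}d\xi_1\cdots d\xi_l$. For $0<t<\infty$, $\mathcal{M}^\sharp_t F(x)=\sup_{Q\ni x,\ell(Q)\ge1}\big(\frac1{|Q|}\int_Q|F|^t\big)^{1/t}+\sup_{Q\ni x,\ell(Q)<1}\inf_{c_Q\in\mathbb{C}}\big(\frac1{|Q|}\int_Q|F-c_Q|^t\big)^{1/t}$,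 suprema over cubes with sides parallel to the axes containing $x$, $\ell(Q)$ the side-length. The multi-sublinear maximal function is $\mathbf{M}(f_1,\dots,f_l)(x)=\sup_{Q\ni x}\frac1{|Q|^l}\int_{Q^l}\prod_{j=1}^l|f_j(u_j)|\,du_1\cdots du_l$, and $\mathbf{M}_r(f_1,\dots,f_l)=\big(\mathbf{M}(|f_1|^r,\dots,|f_l|^r)\big)^{1/r}$. *)

theory Defs
  imports "HOL-Analysis.Analysis"
begin

definition dirderiv :: "'a::real_normed_vector \<Rightarrow> ('a \<Rightarrow> 'b::real_normed_vector) \<Rightarrow> 'a \<Rightarrow> 'b" where
  "dirderiv v f x = vector_derivative (\<lambda>t::real. f (x + t *\<^sub>R v)) (at 0)"

fun iter_deriv :: "'a::real_normed_vector list \<Rightarrow> ('a \<Rightarrow> 'b::real_normed_vector) \<Rightarrow> 'a \<Rightarrow> 'b" where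
  "iter_deriv [] f = f"
| "iter_deriv (v # vs) f = dirderiv v (iter_deriv vs f)"

definition smooth_fun :: "('a::euclidean_space \<Rightarrow> 'b::real_normed_vector) \<Rightarrow> bool" where
  "smooth_fun f \<longleftrightarrow> (\<forall>ds. set ds \<subseteq> Basis \<longrightarrow> iter_deriv ds f differentiable_on UNIV)"

definition schwartz :: "(real^'n \<Rightarrow> complex) \<Rightarrow> bool" where
  "schwartz f \<longleftrightarrow> smooth_fun f \<and>
     (\<forall>ds (k::nat). set ds \<subseteq> Basis \<longrightarrow>
        (\<exists>C. \<forall>x. (1 + norm x) ^ k * norm (iter_deriv ds f x) \<le> C))"

definition fourier :: "(real^'n \<Rightarrow> complex) \<Rightarrow> real^'n \<Rightarrow> complex" where
  "fourier f \<xi> = (\<integral>y. f y * exp (- 2 * pi * \<i> * complex_of_real (y \<bullet> \<xi>)) \<partial>lborel)"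

text \<open>Symbols are functions of (x, (xi_1,...,xi_l)), the index set being the finite type 'l.
  For a list ds of basis directions of (R^n)^(l+1), the number of x-directions is |alpha|
  and the number of xi-directions is |beta_1|+...+|beta_l|.\<close>
definition n_xdirs :: "((real^'n) \<times> (real^'n^'l)) list \<Rightarrow> nat" where
  "n_xdirs ds = length (filter (\<lambda>v. snd v = 0) ds)"

definition n_xidirs :: "((real^'n) \<times> (real^'n^'l)) list \<Rightarrow> nat" where
  "n_xidirs ds = length (filter (\<lambda>v. fst v = 0) ds)"

definition multi_symbol_class :: "real \<Rightarrow> real \<Rightarrow> real \<Rightarrow> ((real^'n) \<times> (real^'n^'l) \<Rightarrow> complex) set" where
  "multi_symbol_class m \<rho> \<delta> = {\<sigma>. smooth_fun \<sigma> \<and>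
     (\<forall>ds. set ds \<subseteq> Basis \<longrightarrow>
       (\<exists>C. \<forall>x \<xi>. norm (iter_deriv ds \<sigma> (x, \<xi>)) \<le>
          C * (1 + (\<Sum>j\<in>UNIV. norm (\<xi> $ j))) powr
              (m + \<delta> * real (n_xdirs ds) - \<rho> * real (n_xidirs ds))))}"

definition T_op :: "((real^'n) \<times> (real^'n^'l) \<Rightarrow> complex) \<Rightarrow> ('l \<Rightarrow> real^'n \<Rightarrow> complex) \<Rightarrow> real^'n \<Rightarrow> complex" where
  "T_op \<sigma> fs x = (\<integral>\<xi>. \<sigma> (x, \<xi>) * (\<Prod>j\<in>UNIV. fourier (fs j) (\<xi> $ j)) *
        exp (2 * pi * \<i> * complex_of_real (x \<bullet> (\<Sum>j\<in>UNIV. \<xi> $ j))) \<partial>lborel)"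

definition cube :: "real^'n \<Rightarrow> real \<Rightarrow> (real^'n) set" where
  "cube a s = cbox a (a + s *\<^sub>R One)"

definition ennroot :: "real \<Rightarrow> ennreal \<Rightarrow> ennreal" where
  "ennroot p a = (if a = \<infinity> then \<infinity> else ennreal (enn2real a powr (1 / p)))"

definition avg_t :: "real \<Rightarrow> (real^'n \<Rightarrow> complex) \<Rightarrow> (real^'n) set \<Rightarrow> ennreal" where
  "avg_t t F Q = ennroot t ((\<integral>\<^sup>+ y\<in>Q. ennreal (norm (F y) powr t) \<partial>lborel) / emeasure lborel Q)"

definition sharp_max :: "real \<Rightarrow> (real^'n \<Rightarrow> complex) \<Rightarrow> real^'n \<Rightarrow> ennreal" where
  "sharp_max t F x =
     (SUP (a, s) \<in> {(a, s). 1 \<le> s \<and> x \<in> cube a s}. avg_t t F (cube a s)) +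
     (SUP (a, s) \<in> {(a, s). 0 < s \<and> s < 1 \<and> x \<in> cube a s}.
        (INF c::complex. avg_t t (\<lambda>y. F y - c) (cube a s)))"

definition multi_max :: "('l::finite \<Rightarrow> real^'n \<Rightarrow> complex) \<Rightarrow> real^'n \<Rightarrow> ennreal" where
  "multi_max fs x =
     (SUP (a, s) \<in> {(a, s). 0 < s \<and> x \<in> cube a s}.
        (\<integral>\<^sup>+ u\<in>{u::real^'n^'l. \<forall>j. u $ j \<in> cube a s}. ennreal (\<Prod>j\<in>UNIV. norm (fs j (u $ j))) \<partial>lborel)
        / (emeasure lborel (cube a s)) ^ CARD('l))"

definition multi_max_r :: "real \<Rightarrow> ('l::finite \<Rightarrow> real^'n \<Rightarrow> complex) \<Rightarrow> real^'n \<Rightarrow> ennreal" where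
  "multi_max_r r fs x = ennroot r (multi_max (\<lambda>j y. complex_of_real (norm (fs j y) powr r)) x)"

end

theory Submission
  imports Defs "HOL-Probability.Characteristic_Functions"
begin

text \<open>
  Cut the symbol smoothly into pieces \<open>\<sigma>\<^sub>k\<close> living at frequency \<open>R = 2\<^sup>k\<close>. Such a piece is smooth at scale
  \<open>R\<^sup>\<rho>\<close> in \<open>\<xi>\<close>, so its kernel is concentrated at distance \<open>R\<^sup>-\<^sup>\<rho>\<close>, and interpolating between the trivial
  bound and Plancherel gives \<open>L\<^sup>r\<^sup>'\<close> bounds for it; the order \<open>m\<close> is exactly the one for which these bound
  \<open>T\<^sub>k f\<close> pointwise by \<open>M\<^sub>r f\<close>, uniformly in \<open>k\<close>. What remains is to gain a summable factor in \<open>k\<close> on a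
  cube \<open>Q\<close> of side \<open>L\<close>.

  If \<open>R L < 1\<close>, replacing \<open>T\<^sub>k f\<close> by its oscillation on \<open>Q\<close> gains \<open>R L\<close>. If \<open>R L \<ge> 1\<close>, average over
  cubes of side \<open>s = min L R\<^sup>-\<^sup>(\<^sup>1\<^sup>+\<^sup>\<rho>\<^sup>)\<^sup>/\<^sup>2\<close>. There the symbol may be frozen in \<open>x\<close> up to an error gaining
  \<open>R\<^sup>\<rho> s\<close>, and \<open>T\<^sub>k f\<close> becomes the restriction to the diagonal of a function on \<open>(\<real>\<^sup>n)\<^sup>l\<close> with frequencies
  of size \<open>R\<close>; by duality and Plancherel in both \<open>(\<real>\<^sup>n)\<^sup>l\<close> and \<open>\<real>\<^sup>n\<close> its mean gains \<open>(R s)\<^sup>-\<^sup>n\<^sup>/\<^sup>r\<^sup>'\<close>. Summing the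
  small cubes with Hoelder's inequality is what forces the exponent \<open>t = r / l\<close>, and since \<open>t \<le> 1\<close> the
  \<open>t\<close>-th powers of the pieces may simply be added.
\<close>


text \<open>The gain on a cube of side \<open>s\<close> has a geometric source. Testing on the
  diagonal sees only \<open>vsum \<xi>\<close>, the sum of the components of \<xi>, and the
  transform of a bounded function on the cube reaches its maximal size s^n on a set of volume at
  most s^(-n): a fraction about (R s)^(-n) of the \<xi> with |\<xi>| <= R. The dual multiplier has a
  square integral smaller by this fraction, of which interpolation with the trivial bound keeps the
  power 1/q, q = r/(r-1). The exponent (1+\<rho>)/2 is the midpoint of 1 and \<rho>: shorter cubes
  lose the gain, longer ones make the freezing error too large.

  The obstacle is that the maximal function is given at one point x0 only. At another x in Q the
  kernel bounds yield a weighted mean \<open>Phi\<close> of |F|^r about (x,...,x), on a scale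
  possibly far below L, and M_r(x0) does not dominate it pointwise. What it does dominate is the
  integral over Q of \<open>Phi\<close> to the power 1/l: \<open>Phi\<close> is at most a product of
  l one-variable means, which Hoelder separates. A piece is bounded by \<open>Phi\<close> to the
  power 1/r, and its t-th power is \<open>Phi\<close> to the power 1/l exactly for t = r/l.\<close>

section \<open>Translation invariance and Fubini with bounded kernels\<close>

lemma nn_integral_lborel_translate:
  fixes f :: "'a::euclidean_space \<Rightarrow> ennreal"
  assumes [measurable]: "f \<in> borel_measurable borel"
  shows "(\<integral>\<^sup>+x. f (c + x) \<partial>lborel) = (\<integral>\<^sup>+x. f x \<partial>lborel)"
  by (subst lborel_distr_plus[of c, symmetric]) (simp add: nn_integral_distr)

lemma nn_integral_lborel_reflect:
  fixes f :: "'a::euclidean_space \<Rightarrow> ennreal"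
  assumes [measurable]: "f \<in> borel_measurable borel"
  shows "(\<integral>\<^sup>+x. f (c - x) \<partial>lborel) = (\<integral>\<^sup>+x. f x \<partial>lborel)"
proof -
  have "(\<integral>\<^sup>+x. f x \<partial>lborel) = (\<integral>\<^sup>+x. f x \<partial>density (distr lborel borel (\<lambda>x. c + (-1) *\<^sub>R x)) (\<lambda>_. ennreal (\<bar>-1\<bar>^DIM('a))))"
    by (subst lborel_affine[of "-1" c]) auto
  also have "\<dots> = (\<integral>\<^sup>+x. f (c - x) \<partial>lborel)"
    by (simp add: nn_integral_density nn_integral_distr)
  finally show ?thesis by simp
qed

lemma integral_lborel_translate:
  fixes f :: "'a::euclidean_space \<Rightarrow> 'b::{banach, second_countable_topology}"
  assumes [measurable]: "f \<in> borel_measurable borel"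
  shows "(\<integral>x. f (c + x) \<partial>lborel) = (\<integral>x. f x \<partial>lborel)"
  by (subst lborel_distr_plus[of c, symmetric]) (simp add: integral_distr)

lemma integrable_mult_bounded:
  fixes f h :: "'a \<Rightarrow> complex"
  assumes "integrable M f" "h \<in> borel_measurable M" "\<And>x. norm (h x) \<le> B"
  shows "integrable M (\<lambda>x. f x * h x)"
proof (rule Bochner_Integration.integrable_bound)
  show "integrable M (\<lambda>x. B * norm (f x))" using assms by auto
  show "(\<lambda>x. f x * h x) \<in> borel_measurable M" using assms by auto
  show "AE x in M. norm (f x * h x) \<le> norm (B * norm (f x))"
  proof (rule AE_I2)
    fix x
    have "norm (f x) * norm (h x) \<le> norm (f x) * B" using assms(3) by (intro mult_left_mono) auto
    also have "\<dots> \<le> \<bar>B * norm (f x)\<bar>" by (simp add: mult.commute)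
    finally show "norm (f x * h x) \<le> norm (B * norm (f x))" by (simp add: norm_mult)
  qed
qed

lemma integrable_prod_bounded_kernel:
  fixes f :: "'a \<Rightarrow> complex" and g :: "'b \<Rightarrow> complex"
  assumes "sigma_finite_measure M" "sigma_finite_measure N"
    and f: "integrable M f" and g: "integrable N g"
    and h: "(\<lambda>(x, y). h x y) \<in> borel_measurable (M \<Otimes>\<^sub>M N)" and B: "\<And>x y. norm (h x y :: complex) \<le> B"
  shows "integrable (M \<Otimes>\<^sub>M N) (\<lambda>(x, y). f x * (g y * h x y))"
proof -
  interpret M: sigma_finite_measure M by fact
  interpret N: sigma_finite_measure N by fact
  interpret pair_sigma_finite M N ..
  have [measurable]: "f \<in> borel_measurable M" "g \<in> borel_measurable N" using f g by auto
  have "integrable (M \<Otimes>\<^sub>M N) (\<lambda>(x, y). f x * g y)"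
  proof (rule Fubini_integrable)
    show "integrable M (\<lambda>x. \<integral>y. norm (case (x, y) of (x, y) \<Rightarrow> f x * g y) \<partial>N)"
      using f by (simp add: norm_mult)
    show "AE x in M. integrable N (\<lambda>y. case (x, y) of (x, y) \<Rightarrow> f x * g y)"
      using g by simp
  qed measurable
  from integrable_mult_bounded[OF this h, of B] B
  show ?thesis by (simp add: case_prod_unfold mult.assoc)
qed

text \<open>The form in which most complex-valued integrals are interchanged: \<open>f\<close> and
  \<open>g\<close> carry the integrability, and \<open>h\<close> is an oscillating factor or a
  symbol of which only boundedness has to be checked.\<close>

lemma integral_swap_bounded_kernel:
  fixes f :: "'a \<Rightarrow> complex" and g :: "'b \<Rightarrow> complex"
  assumes "sigma_finite_measure M" "sigma_finite_measure N"
    and f: "integrable M f" and g: "integrable N g"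
    and h: "(\<lambda>(x, y). h x y) \<in> borel_measurable (M \<Otimes>\<^sub>M N)" and B: "\<And>x y. norm (h x y :: complex) \<le> B"
  shows "(\<integral>x. f x * (\<integral>y. g y * h x y \<partial>N) \<partial>M) = (\<integral>y. g y * (\<integral>x. f x * h x y \<partial>M) \<partial>N)"
proof -
  interpret M: sigma_finite_measure M by fact
  interpret N: sigma_finite_measure N by fact
  interpret pair_sigma_finite M N ..
  have *: "integrable (M \<Otimes>\<^sub>M N) (\<lambda>(x, y). f x * (g y * h x y))"
    by (rule integrable_prod_bounded_kernel) (use assms in auto)
  have "(\<integral>x. f x * (\<integral>y. g y * h x y \<partial>N) \<partial>M) = (\<integral>x. (\<integral>y. f x * (g y * h x y) \<partial>N) \<partial>M)"
    by simp
  also have "\<dots> = (\<integral>y. (\<integral>x. f x * (g y * h x y) \<partial>M) \<partial>N)"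
    using Fubini_integral[OF *] by simp
  also have "\<dots> = (\<integral>y. (\<integral>x. g y * (f x * h x y) \<partial>M) \<partial>N)"
    by (simp add: mult.left_commute)
  finally show ?thesis by simp
qed

text \<open>When \<open>f\<close> is not integrable the left side is 0, the default value of the
  Bochner integral, so the bound can be applied before integrability has been established.\<close>

lemma norm_integral_le_nn_integral:
  fixes f :: "'a \<Rightarrow> 'b::{banach, second_countable_topology}"
  shows "ennreal (norm (\<integral>x. f x \<partial>M)) \<le> (\<integral>\<^sup>+x. norm (f x) \<partial>M)"
proof (cases "integrable M f")
  case True
  then show ?thesis
    by (subst nn_integral_eq_integral) (auto intro: integral_norm_bound)
next
  case False
  then show ?thesis by (simp add: not_integrable_integral_eq)
qed

section \<open>The Plancherel inequality\<close>

lemma integral_lborel_prod_Basis: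
  fixes f :: "'a::euclidean_space \<Rightarrow> real \<Rightarrow> complex"
  assumes "\<And>b. b \<in> Basis \<Longrightarrow> integrable lborel (f b)"
  shows "integrable lborel (\<lambda>x::'a. \<Prod>b\<in>Basis. f b (x \<bullet> b))"
    and "(\<integral>x. (\<Prod>b\<in>Basis. f b (x \<bullet> b)) \<partial>(lborel :: 'a measure)) = (\<Prod>b\<in>Basis. \<integral>x. f b x \<partial>lborel)"
proof -
  interpret product_sigma_finite "\<lambda>b::'a. lborel :: real measure" ..
  have [measurable]: "f b \<in> borel_measurable borel" if "b \<in> Basis" for b using assms[OF that] by auto
  have *: "(\<Prod>b\<in>Basis. f b ((\<Sum>c\<in>Basis. x c *\<^sub>R c) \<bullet> b)) = (\<Prod>b\<in>Basis. f b (x b))" for x :: "'a \<Rightarrow> real"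
    by (intro prod.cong refl) simp
  show "integrable lborel (\<lambda>x::'a. \<Prod>b\<in>Basis. f b (x \<bullet> b))"
    by (subst lborel_eq, subst integrable_distr_eq) (use assms in \<open>simp_all add: * product_integrable_prod\<close>)
  show "(\<integral>x. (\<Prod>b\<in>Basis. f b (x \<bullet> b)) \<partial>(lborel :: 'a measure)) = (\<Prod>b\<in>Basis. \<integral>x. f b x \<partial>lborel)"
    by (subst lborel_eq, subst integral_distr) (use assms in \<open>simp_all add: * product_integral_prod\<close>)
qed

text \<open>The sign in the exponent is that of the inverse transform, because \<open>ft\<close>
  mostly turns a symbol into its kernel; the usual Fourier transform of \<open>F\<close> at \<xi> is
  \<open>ft F (- \<xi>)\<close>.\<close>

definition ft :: "('a::euclidean_space \<Rightarrow> complex) \<Rightarrow> 'a \<Rightarrow> complex" where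
  "ft b y = (\<integral>\<xi>. b \<xi> * cis (2 * pi * (\<xi> \<bullet> y)) \<partial>lborel)"

lemma cis_measurable[measurable (raw)]:
  "f \<in> borel_measurable M \<Longrightarrow> (\<lambda>x. cis (f x)) \<in> borel_measurable M"
  unfolding cis_conv_exp by measurable

lemma cnj_measurable[measurable (raw)]:
  "f \<in> borel_measurable M \<Longrightarrow> (\<lambda>x. cnj (f x)) \<in> borel_measurable M"
  by (rule measurable_compose[OF _ borel_measurable_continuous_onI[of cnj]]) (auto intro!: continuous_intros)

lemma ft_measurable[measurable (raw)]:
  fixes b :: "'a::euclidean_space \<Rightarrow> complex"
  assumes [measurable]: "b \<in> borel_measurable borel" "g \<in> borel_measurable M"
  shows "(\<lambda>x. ft b (g x)) \<in> borel_measurable M"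
proof -
  have "ft b \<in> borel_measurable borel"
    unfolding ft_def by (rule lborel.borel_measurable_lebesgue_integral) measurable
  then show ?thesis by measurable
qed

lemma norm_ft_le: "norm (ft b y) \<le> (\<integral>\<xi>. norm (b \<xi>) \<partial>lborel)"
  unfolding ft_def using integral_norm_bound[of lborel "\<lambda>\<xi>. b \<xi> * cis (2 * pi * (\<xi> \<bullet> y))"]
  by (simp add: norm_mult)

text \<open>A rescaling of the characteristic function of the standard normal distribution.\<close>

lemma gaussian_ft_real:
  assumes "0 < e"
  shows "integrable lborel (\<lambda>x::real. complex_of_real (exp (- (e * x)\<^sup>2 / 2)) * cis (2 * pi * (x * t)))" (is ?int)
    and "(\<integral>x. complex_of_real (exp (- (e * x)\<^sup>2 / 2)) * cis (2 * pi * (x * t)) \<partial>lborel)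
      = complex_of_real (sqrt (2 * pi) / e * exp (- (2 * pi * t / e)\<^sup>2 / 2))" (is ?eq)
proof -
  let ?g = "\<lambda>x::real. complex_of_real (std_normal_density x) * cis (2 * pi * t / e * x)"
  have int: "integrable lborel ?g"
    by (rule integrable_mult_bounded[where B = 1]) (auto intro!: integrable_normal_density)
  have "(\<integral>x. ?g x \<partial>lborel) = char std_normal_distribution (2 * pi * t / e)"
    unfolding char_def by (subst integral_density) (auto simp: scaleR_conv_of_real cis_conv_exp mult_ac)
  then have val: "(\<integral>x. ?g x \<partial>lborel) = complex_of_real (exp (- (2 * pi * t / e)\<^sup>2 / 2))"
    by (simp add: char_std_normal_distribution)
  have eq: "complex_of_real (exp (- (e * x)\<^sup>2 / 2)) * cis (2 * pi * (x * t))
      = complex_of_real (sqrt (2 * pi)) * ?g (0 + e * x)" for x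
    using assms by (simp add: std_normal_density_def field_simps)
  show ?int
    unfolding eq using assms by (intro integrable_mult_right lborel_integrable_real_affine int) auto
  have "(\<integral>x. ?g x \<partial>lborel) = \<bar>e\<bar> *\<^sub>R (\<integral>x. ?g (0 + e * x) \<partial>lborel)"
    by (rule lborel_integral_real_affine) (use assms in auto)
  then have "(\<integral>x. ?g (0 + e * x) \<partial>lborel) = complex_of_real (exp (- (2 * pi * t / e)\<^sup>2 / 2) / e)"
    using assms val by (simp add: scaleR_conv_of_real field_simps)
  then show ?eq unfolding eq using assms by simp
qed

lemma nn_integral_gaussian_ft_real:
  assumes "0 < e"
  shows "(\<integral>\<^sup>+t. ennreal (sqrt (2 * pi) / e * exp (- (2 * pi * t / e)\<^sup>2 / 2)) \<partial>lborel) = 1"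
proof -
  have "1 = (\<integral>\<^sup>+x. ennreal (std_normal_density x) \<partial>lborel)"
    by (subst nn_integral_eq_integral) (auto intro!: integrable_normal_density)
  also have "\<dots> = ennreal (2 * pi / e) * (\<integral>\<^sup>+t. ennreal (std_normal_density (0 + (2 * pi / e) * t)) \<partial>lborel)"
    using assms by (subst nn_integral_real_affine[where c = "2 * pi / e" and t = 0]) auto
  also have "\<dots> = (\<integral>\<^sup>+t. ennreal (2 * pi / e) * ennreal (std_normal_density (0 + (2 * pi / e) * t)) \<partial>lborel)"
    by (rule nn_integral_cmult[symmetric]) measurable
  also have "\<dots> = (\<integral>\<^sup>+t. ennreal (sqrt (2 * pi) / e * exp (- (2 * pi * t / e)\<^sup>2 / 2)) \<partial>lborel)"
  proof (rule nn_integral_cong)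
    fix t
    have "2 * pi / e * std_normal_density (2 * pi / e * t) =
        (2 * pi / sqrt (2 * pi)) / e * exp (- (2 * pi * t / e)\<^sup>2 / 2)"
      by (simp add: std_normal_density_def)
    also have "2 * pi / sqrt (2 * pi) = sqrt (2 * pi)" by (simp add: real_div_sqrt)
    finally have "2 * pi / e * std_normal_density (2 * pi / e * t) =
        sqrt (2 * pi) / e * exp (- (2 * pi * t / e)\<^sup>2 / 2)" .
    then show "ennreal (2 * pi / e) * ennreal (std_normal_density (0 + (2 * pi / e) * t))
        = ennreal (sqrt (2 * pi) / e * exp (- (2 * pi * t / e)\<^sup>2 / 2))"
      using assms by (subst ennreal_mult[symmetric]) auto
  qed
  finally show ?thesis by simp
qed

lemma prod_cis: "finite A \<Longrightarrow> (\<Prod>b\<in>A. cis (f b)) = cis (\<Sum>b\<in>A. f b)"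
  by (induction rule: finite_induct) (auto simp: cis_mult)

lemma gaussian_ft:
  fixes y :: "'a::euclidean_space"
  assumes "0 < e"
  shows "integrable lborel (\<lambda>x::'a. complex_of_real (exp (- (e * norm x)\<^sup>2 / 2)))"
    and "(\<integral>x. complex_of_real (exp (- (e * norm x)\<^sup>2 / 2)) * cis (2 * pi * (x \<bullet> y)) \<partial>lborel)
      = complex_of_real (\<Prod>b\<in>Basis. sqrt (2 * pi) / e * exp (- (2 * pi * (y \<bullet> b) / e)\<^sup>2 / 2))"
proof -
  have norm_eq: "(norm x)\<^sup>2 = (\<Sum>b\<in>Basis. (x \<bullet> b)\<^sup>2)" for x :: 'a
    unfolding power2_norm_eq_inner by (subst euclidean_inner) (simp add: power2_eq_square)
  have eq: "complex_of_real (exp (- (e * norm x)\<^sup>2 / 2)) * cis (2 * pi * (x \<bullet> z))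
     = (\<Prod>b\<in>Basis. complex_of_real (exp (- (e * (x \<bullet> b))\<^sup>2 / 2)) * cis (2 * pi * ((x \<bullet> b) * (z \<bullet> b))))" for x z :: 'a
  proof -
    have "- (e * norm x)\<^sup>2 / 2 = (\<Sum>b\<in>Basis. - (e * (x \<bullet> b))\<^sup>2 / 2)"
      by (simp add: power_mult_distrib norm_eq sum_distrib_left sum_negf sum_divide_distrib)
    moreover have "2 * pi * (x \<bullet> z) = (\<Sum>b\<in>Basis. 2 * pi * ((x \<bullet> b) * (z \<bullet> b)))"
      by (subst euclidean_inner) (simp add: sum_distrib_left)
    ultimately show ?thesis
      by (simp only: prod.distrib prod_cis[OF finite_Basis] exp_sum[OF finite_Basis] of_real_prod)
  qed
  have "integrable lborel (\<lambda>x::'a. complex_of_real (exp (- (e * norm x)\<^sup>2 / 2)) * cis (2 * pi * (x \<bullet> 0)))"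
    unfolding eq by (intro integral_lborel_prod_Basis gaussian_ft_real assms)
  then show "integrable lborel (\<lambda>x::'a. complex_of_real (exp (- (e * norm x)\<^sup>2 / 2)))" by simp
  show "(\<integral>x. complex_of_real (exp (- (e * norm x)\<^sup>2 / 2)) * cis (2 * pi * (x \<bullet> y)) \<partial>lborel)
      = complex_of_real (\<Prod>b\<in>Basis. sqrt (2 * pi) / e * exp (- (2 * pi * (y \<bullet> b) / e)\<^sup>2 / 2))"
    unfolding eq
    by (subst integral_lborel_prod_Basis(2), rule gaussian_ft_real(1)[OF assms])
       (simp only: gaussian_ft_real(2)[OF assms] of_real_prod)
qed

text \<open>The transform of the Gaussian has mass 1 for every \<open>e\<close>; this keeps the
  constant in the Plancherel inequality equal to 1, uniformly in \<open>e\<close>.\<close>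

lemma nn_integral_gaussian_ft:
  assumes "0 < e"
  shows "(\<integral>\<^sup>+y. ennreal (\<Prod>b\<in>Basis. sqrt (2 * pi) / e * exp (- (2 * pi * (y \<bullet> b) / e)\<^sup>2 / 2)) \<partial>(lborel :: 'a::euclidean_space measure)) = 1"
proof -
  have "(\<integral>\<^sup>+y. ennreal (\<Prod>b\<in>Basis. sqrt (2 * pi) / e * exp (- (2 * pi * (y \<bullet> b) / e)\<^sup>2 / 2)) \<partial>(lborel :: 'a measure))
      = (\<integral>\<^sup>+y. (\<Prod>b\<in>Basis. ennreal (sqrt (2 * pi) / e * exp (- (2 * pi * (y \<bullet> b) / e)\<^sup>2 / 2))) \<partial>(lborel :: 'a measure))"
    using assms by (subst prod_ennreal) auto
  also have "\<dots> = 1"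
    by (subst nn_integral_lborel_prod) (simp_all only: nn_integral_gaussian_ft_real[OF assms], simp_all)
  finally show ?thesis .
qed

text \<open>The Gaussian makes the triple integral absolutely convergent. Expanding |ft b|^2 and
  integrating in y first leaves the double integral of b(\<xi>) conj(b(\<eta>)) \<Gamma>(\<xi> -
  \<eta>), where \<Gamma> is a positive kernel of mass 1; then 2 |b(\<xi>) b(\<eta>)| <=
  |b(\<xi>)|^2 + |b(\<eta>)|^2.\<close>

lemma plancherel_gaussian_weight:
  fixes b :: "'a::euclidean_space \<Rightarrow> complex"
  assumes b: "integrable lborel b" and e: "0 < e"
  shows "(\<integral>\<^sup>+y. ennreal (exp (- (e * norm y)\<^sup>2 / 2) * (norm (ft b y))\<^sup>2) \<partial>lborel)
     \<le> (\<integral>\<^sup>+\<xi>. ennreal ((norm (b \<xi>))\<^sup>2) \<partial>lborel)"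
proof -
  have [measurable]: "b \<in> borel_measurable borel" using b by auto
  define \<gamma> where "\<gamma> y = complex_of_real (exp (- (e * norm y)\<^sup>2 / 2))" for y :: 'a
  define \<Gamma> where "\<Gamma> y = (\<Prod>b\<in>Basis. sqrt (2 * pi) / e * exp (- (2 * pi * (y \<bullet> b) / e)\<^sup>2 / 2))" for y :: 'a
  have \<gamma>: "integrable lborel \<gamma>" unfolding \<gamma>_def by (rule gaussian_ft(1)[OF e])
  then have [measurable]: "\<gamma> \<in> borel_measurable borel" by auto
  have [measurable]: "\<Gamma> \<in> borel_measurable borel" unfolding \<Gamma>_def by measurable
  have \<Gamma>0: "0 \<le> \<Gamma> y" for y unfolding \<Gamma>_def using e by (intro prod_nonneg) auto
  have \<gamma>\<Gamma>: "(\<integral>y. \<gamma> y * cis (2 * pi * (y \<bullet> z)) \<partial>lborel) = \<Gamma> z" for z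
    unfolding \<gamma>_def \<Gamma>_def by (rule gaussian_ft(2)[OF e])
  define B where "B = (\<integral>\<xi>. norm (b \<xi>) \<partial>lborel)"
  have ftB: "norm (ft b y) \<le> B" for y unfolding B_def by (rule norm_ft_le)
  have \<gamma>ft: "integrable lborel (\<lambda>y. \<gamma> y * cnj (ft b y))"
    by (rule integrable_mult_bounded[OF \<gamma>, of _ B]) (use ftB in auto)
  have cnj_ft: "cnj (ft b y) = (\<integral>\<eta>. cnj (b \<eta>) * cis (- (2 * pi * (\<eta> \<bullet> y))) \<partial>lborel)" for y
  proof -
    have "integrable lborel (\<lambda>\<xi>. b \<xi> * cis (2 * pi * (\<xi> \<bullet> y)))"
      by (rule integrable_mult_bounded[OF b, of _ 1]) auto
    from integral_bounded_linear[OF bounded_linear_cnj this] show ?thesis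
      unfolding ft_def by (simp add: cis_cnj)
  qed
  have inner: "(\<integral>y. (\<gamma> y * cnj (ft b y)) * cis (2 * pi * (\<xi> \<bullet> y)) \<partial>lborel) = (\<integral>\<eta>. cnj (b \<eta>) * \<Gamma> (\<xi> - \<eta>) \<partial>lborel)" for \<xi>
  proof -
    have "(\<integral>y. (\<gamma> y * cnj (ft b y)) * cis (2 * pi * (\<xi> \<bullet> y)) \<partial>lborel)
        = (\<integral>y. \<gamma> y * (\<integral>\<eta>. cnj (b \<eta>) * cis (2 * pi * (y \<bullet> (\<xi> - \<eta>))) \<partial>lborel) \<partial>lborel)"
    proof (intro Bochner_Integration.integral_cong refl)
      fix y
      have "cnj (ft b y) * cis (2 * pi * (\<xi> \<bullet> y)) = (\<integral>\<eta>. cnj (b \<eta>) * cis (- (2 * pi * (\<eta> \<bullet> y))) * cis (2 * pi * (\<xi> \<bullet> y)) \<partial>lborel)"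
        unfolding cnj_ft by simp
      also have "\<dots> = (\<integral>\<eta>. cnj (b \<eta>) * cis (2 * pi * (y \<bullet> (\<xi> - \<eta>))) \<partial>lborel)"
        by (simp add: mult.assoc cis_mult algebra_simps inner_commute)
      finally show "(\<gamma> y * cnj (ft b y)) * cis (2 * pi * (\<xi> \<bullet> y)) = \<gamma> y * (\<integral>\<eta>. cnj (b \<eta>) * cis (2 * pi * (y \<bullet> (\<xi> - \<eta>))) \<partial>lborel)"
        by (simp add: mult.assoc)
    qed
    also have "\<dots> = (\<integral>\<eta>. cnj (b \<eta>) * (\<integral>y. \<gamma> y * cis (2 * pi * (y \<bullet> (\<xi> - \<eta>))) \<partial>lborel) \<partial>lborel)"
      by (rule integral_swap_bounded_kernel[where B = 1]) (auto simp: \<gamma> b lborel.sigma_finite_measure_axioms)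
    also have "\<dots> = (\<integral>\<eta>. cnj (b \<eta>) * \<Gamma> (\<xi> - \<eta>) \<partial>lborel)" by (simp add: \<gamma>\<Gamma>)
    finally show ?thesis .
  qed
  have sq: "complex_of_real (exp (- (e * norm y)\<^sup>2 / 2) * (norm (ft b y))\<^sup>2) = (\<gamma> y * cnj (ft b y)) * ft b y" for y
    unfolding \<gamma>_def by (simp only: of_real_mult complex_norm_square mult_ac)
  have int_sq: "integrable lborel (\<lambda>y. (\<gamma> y * cnj (ft b y)) * ft b y)"
    by (rule integrable_mult_bounded[OF \<gamma>ft, of _ B]) (use ftB in auto)
  then have int_sq': "integrable lborel (\<lambda>y. exp (- (e * norm y)\<^sup>2 / 2) * (norm (ft b y))\<^sup>2)"
    unfolding sq[symmetric] complex_of_real_integrable_eq .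
  have "(\<integral>\<^sup>+y. ennreal (exp (- (e * norm y)\<^sup>2 / 2) * (norm (ft b y))\<^sup>2) \<partial>lborel)
      = ennreal (\<integral>y. exp (- (e * norm y)\<^sup>2 / 2) * (norm (ft b y))\<^sup>2 \<partial>lborel)"
    by (rule nn_integral_eq_integral[OF int_sq']) auto
  also have "\<dots> = ennreal (norm (\<integral>y. (\<gamma> y * cnj (ft b y)) * ft b y \<partial>lborel))"
    unfolding sq[symmetric] integral_complex_of_real norm_of_real
    by (subst abs_of_nonneg) (auto intro!: Bochner_Integration.integral_nonneg)
  also have "(\<integral>y. (\<gamma> y * cnj (ft b y)) * ft b y \<partial>lborel)
      = (\<integral>\<xi>. b \<xi> * (\<integral>y. (\<gamma> y * cnj (ft b y)) * cis (2 * pi * (\<xi> \<bullet> y)) \<partial>lborel) \<partial>lborel)"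
    unfolding ft_def[of b]
    by (rule integral_swap_bounded_kernel[where B = 1])
       (use \<gamma>ft b in \<open>auto simp: lborel.sigma_finite_measure_axioms ft_def[abs_def]\<close>)
  also have "\<dots> = (\<integral>\<xi>. b \<xi> * (\<integral>\<eta>. cnj (b \<eta>) * \<Gamma> (\<xi> - \<eta>) \<partial>lborel) \<partial>lborel)"
    unfolding inner ..
  also have "ennreal (norm \<dots>) \<le> (\<integral>\<^sup>+\<xi>. norm (b \<xi> * (\<integral>\<eta>. cnj (b \<eta>) * \<Gamma> (\<xi> - \<eta>) \<partial>lborel)) \<partial>lborel)"
    by (rule norm_integral_le_nn_integral)
  also have "\<dots> \<le> (\<integral>\<^sup>+\<xi>. \<integral>\<^sup>+\<eta>. ennreal ((norm (b \<xi>))\<^sup>2 / 2 * \<Gamma> (\<xi> - \<eta>)) + ennreal ((norm (b \<eta>))\<^sup>2 / 2 * \<Gamma> (\<xi> - \<eta>)) \<partial>lborel \<partial>lborel)"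
  proof (rule nn_integral_mono)
    fix \<xi>
    have "ennreal (norm (b \<xi> * (\<integral>\<eta>. cnj (b \<eta>) * \<Gamma> (\<xi> - \<eta>) \<partial>lborel)))
        = ennreal (norm (\<integral>\<eta>. b \<xi> * (cnj (b \<eta>) * \<Gamma> (\<xi> - \<eta>)) \<partial>lborel))" by simp
    also have "\<dots> \<le> (\<integral>\<^sup>+\<eta>. norm (b \<xi> * (cnj (b \<eta>) * \<Gamma> (\<xi> - \<eta>))) \<partial>lborel)"
      by (rule norm_integral_le_nn_integral)
    also have "\<dots> \<le> (\<integral>\<^sup>+\<eta>. ennreal ((norm (b \<xi>))\<^sup>2 / 2 * \<Gamma> (\<xi> - \<eta>)) + ennreal ((norm (b \<eta>))\<^sup>2 / 2 * \<Gamma> (\<xi> - \<eta>)) \<partial>lborel)"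
    proof (rule nn_integral_mono)
      fix \<eta>
      have "norm (b \<xi>) * norm (b \<eta>) \<le> (norm (b \<xi>))\<^sup>2 / 2 + (norm (b \<eta>))\<^sup>2 / 2"
        using sum_squares_bound[of "norm (b \<xi>)" "norm (b \<eta>)"] by simp
      from mult_right_mono[OF this \<Gamma>0[of "\<xi> - \<eta>"]]
      have "norm (b \<xi> * (cnj (b \<eta>) * \<Gamma> (\<xi> - \<eta>))) \<le> (norm (b \<xi>))\<^sup>2 / 2 * \<Gamma> (\<xi> - \<eta>) + (norm (b \<eta>))\<^sup>2 / 2 * \<Gamma> (\<xi> - \<eta>)"
        using \<Gamma>0[of "\<xi> - \<eta>"] by (simp add: norm_mult algebra_simps)
      then show "ennreal (norm (b \<xi> * (cnj (b \<eta>) * \<Gamma> (\<xi> - \<eta>)))) \<le> ennreal ((norm (b \<xi>))\<^sup>2 / 2 * \<Gamma> (\<xi> - \<eta>)) + ennreal ((norm (b \<eta>))\<^sup>2 / 2 * \<Gamma> (\<xi> - \<eta>))"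
        using \<Gamma>0 by (subst ennreal_plus[symmetric]) (auto intro!: ennreal_leI simp del: ennreal_plus)
    qed
    finally show "ennreal (norm (b \<xi> * (\<integral>\<eta>. cnj (b \<eta>) * \<Gamma> (\<xi> - \<eta>) \<partial>lborel))) \<le> \<dots>" .
  qed
  also have "\<dots> = (\<integral>\<^sup>+\<xi>. \<integral>\<^sup>+\<eta>. ennreal ((norm (b \<xi>))\<^sup>2 / 2 * \<Gamma> (\<xi> - \<eta>)) \<partial>lborel \<partial>lborel)
      + (\<integral>\<^sup>+\<xi>. \<integral>\<^sup>+\<eta>. ennreal ((norm (b \<eta>))\<^sup>2 / 2 * \<Gamma> (\<xi> - \<eta>)) \<partial>lborel \<partial>lborel)"
    by (simp add: nn_integral_add)
  also have "(\<integral>\<^sup>+\<xi>. \<integral>\<^sup>+\<eta>. ennreal ((norm (b \<eta>))\<^sup>2 / 2 * \<Gamma> (\<xi> - \<eta>)) \<partial>lborel \<partial>lborel)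
      = (\<integral>\<^sup>+\<eta>. \<integral>\<^sup>+\<xi>. ennreal ((norm (b \<eta>))\<^sup>2 / 2 * \<Gamma> (\<xi> - \<eta>)) \<partial>lborel \<partial>lborel)"
    by (rule lborel_pair.Fubini') measurable
  also have "(\<integral>\<^sup>+\<xi>. \<integral>\<^sup>+\<eta>. ennreal ((norm (b \<xi>))\<^sup>2 / 2 * \<Gamma> (\<xi> - \<eta>)) \<partial>lborel \<partial>lborel) = (\<integral>\<^sup>+\<xi>. ennreal ((norm (b \<xi>))\<^sup>2 / 2) \<partial>lborel)"
  proof (rule nn_integral_cong)
    fix \<xi>
    have "(\<integral>\<^sup>+\<eta>. ennreal ((norm (b \<xi>))\<^sup>2 / 2 * \<Gamma> (\<xi> - \<eta>)) \<partial>lborel) = ennreal ((norm (b \<xi>))\<^sup>2 / 2) * (\<integral>\<^sup>+\<eta>. \<Gamma> (\<xi> - \<eta>) \<partial>lborel)"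
      by (simp add: ennreal_mult' \<Gamma>0 nn_integral_cmult del: times_divide_eq_left)
    also have "(\<integral>\<^sup>+\<eta>. \<Gamma> (\<xi> - \<eta>) \<partial>lborel) = 1"
      using nn_integral_lborel_reflect[of "\<lambda>x. ennreal (\<Gamma> x)" \<xi>] nn_integral_gaussian_ft[OF e] unfolding \<Gamma>_def by simp
    finally show "(\<integral>\<^sup>+\<eta>. ennreal ((norm (b \<xi>))\<^sup>2 / 2 * \<Gamma> (\<xi> - \<eta>)) \<partial>lborel) = ennreal ((norm (b \<xi>))\<^sup>2 / 2)" by simp
  qed
  also have "(\<integral>\<^sup>+\<eta>. \<integral>\<^sup>+\<xi>. ennreal ((norm (b \<eta>))\<^sup>2 / 2 * \<Gamma> (\<xi> - \<eta>)) \<partial>lborel \<partial>lborel) = (\<integral>\<^sup>+\<eta>. ennreal ((norm (b \<eta>))\<^sup>2 / 2) \<partial>lborel)"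
  proof (rule nn_integral_cong)
    fix \<eta>
    have "(\<integral>\<^sup>+\<xi>. ennreal ((norm (b \<eta>))\<^sup>2 / 2 * \<Gamma> (\<xi> - \<eta>)) \<partial>lborel) = ennreal ((norm (b \<eta>))\<^sup>2 / 2) * (\<integral>\<^sup>+\<xi>. \<Gamma> (- \<eta> + \<xi>) \<partial>lborel)"
      by (simp add: ennreal_mult' \<Gamma>0 nn_integral_cmult del: times_divide_eq_left)
    also have "(\<integral>\<^sup>+\<xi>. \<Gamma> (- \<eta> + \<xi>) \<partial>lborel) = 1"
      using nn_integral_lborel_translate[of "\<lambda>x. ennreal (\<Gamma> x)" "- \<eta>"] nn_integral_gaussian_ft[OF e] unfolding \<Gamma>_def by simp
    finally show "(\<integral>\<^sup>+\<xi>. ennreal ((norm (b \<eta>))\<^sup>2 / 2 * \<Gamma> (\<xi> - \<eta>)) \<partial>lborel) = ennreal ((norm (b \<eta>))\<^sup>2 / 2)" by simp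
  qed
  also have "(\<integral>\<^sup>+\<xi>. ennreal ((norm (b \<xi>))\<^sup>2 / 2) \<partial>lborel) + (\<integral>\<^sup>+\<xi>. ennreal ((norm (b \<xi>))\<^sup>2 / 2) \<partial>lborel)
      = (\<integral>\<^sup>+\<xi>. ennreal ((norm (b \<xi>))\<^sup>2 / 2) + ennreal ((norm (b \<xi>))\<^sup>2 / 2) \<partial>lborel)"
    by (rule nn_integral_add[symmetric]) measurable
  also have "\<dots> = (\<integral>\<^sup>+\<xi>. ennreal ((norm (b \<xi>))\<^sup>2) \<partial>lborel)"
    by (intro nn_integral_cong) (simp add: ennreal_plus[symmetric] del: ennreal_plus)
  finally show ?thesis .
qed

text \<open>Fatou's lemma for the Gaussian weights with e = 1/(n+1), which tend to 1.\<close>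

lemma plancherel_le:
  fixes b :: "'a::euclidean_space \<Rightarrow> complex"
  assumes b: "integrable lborel b"
  shows "(\<integral>\<^sup>+y. ennreal ((norm (ft b y))\<^sup>2) \<partial>lborel) \<le> (\<integral>\<^sup>+\<xi>. ennreal ((norm (b \<xi>))\<^sup>2) \<partial>lborel)"
proof -
  have [measurable]: "b \<in> borel_measurable borel" using b by auto
  let ?u = "\<lambda>n y. exp (- (inverse (real (Suc n)) * norm y)\<^sup>2 / 2) * (norm (ft b y))\<^sup>2"
  have "liminf (\<lambda>n. ennreal (?u n y)) = ennreal ((norm (ft b y))\<^sup>2)" for y
  proof -
    have "(\<lambda>n. ?u n y) \<longlonglongrightarrow> exp (- (0 * norm y)\<^sup>2 / 2) * (norm (ft b y))\<^sup>2"
      by (intro tendsto_intros LIMSEQ_inverse_real_of_nat) auto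
    then have "(\<lambda>n. ennreal (?u n y)) \<longlonglongrightarrow> ennreal ((norm (ft b y))\<^sup>2)"
      by (intro tendsto_ennrealI) simp
    then show ?thesis by (intro lim_imp_Liminf) auto
  qed
  then have "(\<integral>\<^sup>+y. ennreal ((norm (ft b y))\<^sup>2) \<partial>lborel) = (\<integral>\<^sup>+y. liminf (\<lambda>n. ennreal (?u n y)) \<partial>lborel)"
    by simp
  also have "\<dots> \<le> liminf (\<lambda>n. \<integral>\<^sup>+y. ennreal (?u n y) \<partial>lborel)"
    by (rule nn_integral_liminf) measurable
  also have "\<dots> \<le> liminf (\<lambda>n. \<integral>\<^sup>+\<xi>. ennreal ((norm (b \<xi>))\<^sup>2) \<partial>lborel)"
    by (intro Liminf_mono always_eventually allI plancherel_gaussian_weight[OF b]) auto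
  also have "\<dots> = (\<integral>\<^sup>+\<xi>. ennreal ((norm (b \<xi>))\<^sup>2) \<partial>lborel)"
    by (intro lim_imp_Liminf) auto
  finally show ?thesis .
qed


section \<open>Iterated directional derivatives\<close>

text \<open>A finite chain of pure derivatives along one direction, carried as explicit data.
  Cutoffs come with formulas and the given symbol comes through \<open>iter_deriv\<close>; this
  interface lets both be multiplied and subtracted on the same footing. Pure derivatives suffice for
  kernel decay by \<open>weight_le_coordinates\<close>.\<close>

definition derseq :: "nat \<Rightarrow> 'a::euclidean_space \<Rightarrow> (nat \<Rightarrow> 'a \<Rightarrow> complex) \<Rightarrow> bool" where
  "derseq N \<beta> D \<longleftrightarrow> (\<forall>j\<le>N. continuous_on UNIV (D j)) \<and>
     (\<forall>j<N. \<forall>\<xi>. ((\<lambda>t::real. D j (\<xi> + t *\<^sub>R \<beta>)) has_vector_derivative D (Suc j) \<xi>) (at 0))"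

lemma derseq_at:
  assumes "derseq N \<beta> D" "j < N"
  shows "((\<lambda>t. D j (\<xi> + t *\<^sub>R \<beta>)) has_vector_derivative D (Suc j) (\<xi> + t *\<^sub>R \<beta>)) (at t)"
proof -
  have "((\<lambda>s. D j ((\<xi> + t *\<^sub>R \<beta>) + s *\<^sub>R \<beta>)) has_vector_derivative D (Suc j) (\<xi> + t *\<^sub>R \<beta>)) (at (- t + t))"
    using assms unfolding derseq_def by auto
  then have "((\<lambda>s. D j ((\<xi> + t *\<^sub>R \<beta>) + s *\<^sub>R \<beta>)) \<circ> (\<lambda>s. - t + s) has_vector_derivative 1 *\<^sub>R D (Suc j) (\<xi> + t *\<^sub>R \<beta>)) (at t)"
    by (intro vector_diff_chain_at) (auto intro!: derivative_eq_intros simp: has_vector_derivative_def)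
  moreover have "(\<lambda>s. D j ((\<xi> + t *\<^sub>R \<beta>) + s *\<^sub>R \<beta>)) \<circ> (\<lambda>s. - t + s) = (\<lambda>s. D j (\<xi> + s *\<^sub>R \<beta>))"
    by (auto simp: fun_eq_iff algebra_simps)
  ultimately show ?thesis by simp
qed

lemma derseq_measurable: "derseq N \<beta> D \<Longrightarrow> j \<le> N \<Longrightarrow> D j \<in> borel_measurable borel"
  unfolding derseq_def by (auto intro: borel_measurable_continuous_onI)

lemma derseq_diff: "derseq N \<beta> D \<Longrightarrow> derseq N \<beta> E \<Longrightarrow> derseq N \<beta> (\<lambda>j \<xi>. D j \<xi> - E j \<xi>)"
  unfolding derseq_def by (auto intro!: continuous_intros derivative_intros)

text \<open>By translation invariance the integral of \<open>h (x + \<beta>) - h x\<close> vanishes, and by Fubini it is the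
  integral of the derivative.\<close>
lemma integral_directional_derivative_eq_0:
  fixes h :: "'a::euclidean_space \<Rightarrow> complex"
  assumes h: "integrable lborel h" and h': "integrable lborel h'" and cont: "continuous_on UNIV h'"
    and D: "\<And>x t. ((\<lambda>t. h (x + t *\<^sub>R \<beta>)) has_vector_derivative h' (x + t *\<^sub>R \<beta>)) (at t)"
  shows "(\<integral>x. h' x \<partial>lborel) = 0"
proof -
  have [measurable]: "h' \<in> borel_measurable borel" "h \<in> borel_measurable borel" using h h' by auto
  let ?I = "indicator {0..1::real} :: real \<Rightarrow> real"
  have trans: "(\<integral>x. h' (x + s *\<^sub>R \<beta>) \<partial>lborel) = (\<integral>x. h' x \<partial>lborel)" for s
    using integral_lborel_translate[of h' "s *\<^sub>R \<beta>"] by (simp add: add.commute)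
  have transn: "(\<integral>x. norm (h' (x + s *\<^sub>R \<beta>)) \<partial>lborel) = (\<integral>x. norm (h' x) \<partial>lborel)" for s
    using integral_lborel_translate[of "\<lambda>x. norm (h' x)" "s *\<^sub>R \<beta>"] by (simp add: add.commute)
  have int_trans: "integrable lborel (\<lambda>x. u (x + v))" if "integrable lborel u" for u :: "'a \<Rightarrow> complex" and v
  proof -
    have "integrable (distr lborel borel ((+) v)) u" using that by (simp add: lborel_distr_plus)
    then show ?thesis using that by (subst (asm) integrable_distr_eq) (auto simp: add.commute)
  qed
  have ftc: "(\<integral>s. ?I s *\<^sub>R h' (x + s *\<^sub>R \<beta>) \<partial>lborel) = h (x + 1 *\<^sub>R \<beta>) - h (x + 0 *\<^sub>R \<beta>)" for x
    by (rule integral_FTC_Icc)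
       (auto intro!: has_vector_derivative_at_within[OF D] continuous_on_compose2[OF cont] continuous_intros)
  have prod: "integrable (lborel \<Otimes>\<^sub>M lborel) (\<lambda>(s, x). ?I s *\<^sub>R h' (x + s *\<^sub>R \<beta>))"
  proof (rule lborel_pair.Fubini_integrable)
    show "integrable lborel (\<lambda>s. \<integral>x. norm (case (s, x) of (s, x) \<Rightarrow> ?I s *\<^sub>R h' (x + s *\<^sub>R \<beta>)) \<partial>lborel)"
      by (simp add: transn)
    show "AE s in lborel. integrable lborel (\<lambda>x. case (s, x) of (s, x) \<Rightarrow> ?I s *\<^sub>R h' (x + s *\<^sub>R \<beta>))"
      using int_trans[OF h'] by auto
  qed measurable
  have "0 = (\<integral>x. h (x + 1 *\<^sub>R \<beta>) - h (x + 0 *\<^sub>R \<beta>) \<partial>lborel)"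
    using integral_lborel_translate[of h \<beta>] h int_trans[OF h, of \<beta>]
    by (subst Bochner_Integration.integral_diff) (auto simp: add.commute)
  also have "\<dots> = (\<integral>x. \<integral>s. ?I s *\<^sub>R h' (x + s *\<^sub>R \<beta>) \<partial>lborel \<partial>lborel)"
    by (simp only: ftc)
  also have "\<dots> = (\<integral>s. \<integral>x. ?I s *\<^sub>R h' (x + s *\<^sub>R \<beta>) \<partial>lborel \<partial>lborel)"
    by (rule lborel_pair.Fubini_integral[OF prod])
  also have "\<dots> = (\<integral>x. h' x \<partial>lborel)"
    by (simp add: trans)
  finally show ?thesis by simp
qed

lemma cis_line_derivative:
  fixes \<xi> \<beta> y :: "'a::euclidean_space"
  shows "((\<lambda>t. cis (2 * pi * ((\<xi> + t *\<^sub>R \<beta>) \<bullet> y))) has_vector_derivative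
     (2 * pi * \<i> * (\<beta> \<bullet> y)) * cis (2 * pi * ((\<xi> + t *\<^sub>R \<beta>) \<bullet> y))) (at t)"
proof -
  define a b where "a = 2 * pi * (\<xi> \<bullet> y)" and "b = 2 * pi * (\<beta> \<bullet> y)"
  have eq: "2 * pi * ((\<xi> + t *\<^sub>R \<beta>) \<bullet> y) = a + t * b" for t
    unfolding a_def b_def by (simp add: inner_add_left distrib_left)
  have 1: "((\<lambda>t. exp (\<i> * a + of_real t * (\<i> * b))) has_vector_derivative (\<i> * b) * exp (\<i> * a + of_real t * (\<i> * b))) (at t)"
    by (rule has_vector_derivative_real_field) (auto intro!: derivative_eq_intros)
  have 2: "exp (\<i> * a + of_real t * (\<i> * b)) = cis (a + t * b)" for t
    by (simp add: cis_conv_exp distrib_left mult.left_commute)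
  have 3: "2 * pi * \<i> * (\<beta> \<bullet> y) = \<i> * b" by (simp add: b_def mult_ac)
  show ?thesis unfolding eq 3 by (rule 1[unfolded 2])
qed

text \<open>Integration by parts: the directional derivative of \<open>D j\<close> times the
  character has integral 0, and the product rule splits it into the two transforms.\<close>

lemma ft_derivative:
  fixes D :: "nat \<Rightarrow> 'a::euclidean_space \<Rightarrow> complex"
  assumes D: "derseq N \<beta> D" and j: "j < N" and int: "integrable lborel (D j)" "integrable lborel (D (Suc j))"
  shows "ft (D (Suc j)) y = - (2 * pi * \<i> * (\<beta> \<bullet> y)) * ft (D j) y"
proof -
  let ?e = "\<lambda>\<xi>::'a. cis (2 * pi * (\<xi> \<bullet> y))" and ?c = "2 * pi * \<i> * (\<beta> \<bullet> y)"
  have i1: "integrable lborel (\<lambda>\<xi>. D i \<xi> * ?e \<xi>)" if "integrable lborel (D i)" for i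
    by (rule integrable_mult_bounded[OF that, of _ 1]) auto
  have cont: "continuous_on UNIV (D j)" "continuous_on UNIV (D (Suc j))"
    using D j unfolding derseq_def by auto
  have "(\<integral>\<xi>. D (Suc j) \<xi> * ?e \<xi> + ?c * (D j \<xi> * ?e \<xi>) \<partial>lborel) = 0"
  proof (rule integral_directional_derivative_eq_0[where h = "\<lambda>\<xi>. D j \<xi> * ?e \<xi>" and \<beta> = \<beta>])
    show "integrable lborel (\<lambda>\<xi>. D j \<xi> * ?e \<xi>)" by (rule i1[OF int(1)])
    show "integrable lborel (\<lambda>\<xi>. D (Suc j) \<xi> * ?e \<xi> + ?c * (D j \<xi> * ?e \<xi>))"
      by (intro Bochner_Integration.integrable_add integrable_mult_right i1 int)
    show "continuous_on UNIV (\<lambda>\<xi>. D (Suc j) \<xi> * ?e \<xi> + ?c * (D j \<xi> * ?e \<xi>))"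
      by (intro continuous_intros cont)
    show "((\<lambda>t. D j (x + t *\<^sub>R \<beta>) * ?e (x + t *\<^sub>R \<beta>)) has_vector_derivative
        D (Suc j) (x + t *\<^sub>R \<beta>) * ?e (x + t *\<^sub>R \<beta>) + ?c * (D j (x + t *\<^sub>R \<beta>) * ?e (x + t *\<^sub>R \<beta>))) (at t)" for x t
      using has_vector_derivative_mult[OF derseq_at[OF D j, of x t] cis_line_derivative[of x \<beta> y t]]
      by (simp add: algebra_simps)
  qed
  then have "ft (D (Suc j)) y + ?c * ft (D j) y = 0"
    unfolding ft_def by (subst (asm) Bochner_Integration.integral_add) (auto intro!: i1 int integrable_mult_right)
  then show ?thesis by (simp add: eq_neg_iff_add_eq_0)
qed

lemma ft_iterated_derivative:
  assumes D: "derseq N \<beta> D" and int: "\<And>j. j \<le> N \<Longrightarrow> integrable lborel (D j)"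
  shows "ft (D N) y = (- (2 * pi * \<i> * (\<beta> \<bullet> y))) ^ N * ft (D 0) y"
proof -
  have "ft (D j) y = (- (2 * pi * \<i> * (\<beta> \<bullet> y))) ^ j * ft (D 0) y" if "j \<le> N" for j
    using that
  proof (induction j)
    case (Suc j)
    then have "ft (D (Suc j)) y = - (2 * pi * \<i> * (\<beta> \<bullet> y)) * ft (D j) y"
      by (intro ft_derivative[OF D]) (auto intro!: int)
    also have "ft (D j) y = (- (2 * pi * \<i> * (\<beta> \<bullet> y))) ^ j * ft (D 0) y"
      by (rule Suc.IH) (use Suc.prems in simp)
    finally show ?case by (simp only: power_Suc mult.assoc)
  qed simp
  from this[OF order_refl] show ?thesis .
qed

lemma norm_ft_iterated_derivative:
  assumes "ft f y = (- (2 * pi * \<i> * (\<beta> \<bullet> y))) ^ N * ft g y"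
  shows "norm (ft f y) = (2 * pi * \<bar>\<beta> \<bullet> y\<bar>) ^ N * norm (ft g y)"
proof -
  have "norm (- (2 * pi * \<i> * (\<beta> \<bullet> y))) = 2 * pi * \<bar>\<beta> \<bullet> y\<bar>"
    by (simp add: norm_mult abs_mult)
  then show ?thesis unfolding assms norm_mult norm_power by (simp only:)
qed

text \<open>Pascal's rule, arranged so that each summand on the right is the derivative of one
  summand of the Leibniz sum of order \<open>j\<close>.\<close>

lemma leibniz_sum_Suc:
  fixes a b :: "nat \<Rightarrow> 'a::comm_ring_1"
  shows "(\<Sum>i\<le>Suc j. of_nat (Suc j choose i) * a (Suc j - i) * b i)
    = (\<Sum>i\<le>j. of_nat (j choose i) * (a (Suc (j - i)) * b i + a (j - i) * b (Suc i)))"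
proof -
  have "(\<Sum>i\<le>Suc j. of_nat (Suc j choose i) * a (Suc j - i) * b i)
     = a (Suc j) * b 0 + (\<Sum>i\<le>j. of_nat (j choose Suc i) * a (j - i) * b (Suc i))
       + (\<Sum>i\<le>j. of_nat (j choose i) * a (j - i) * b (Suc i))"
    by (subst sum.atMost_Suc_shift) (simp add: algebra_simps sum.distrib)
  also have "a (Suc j) * b 0 + (\<Sum>i\<le>j. of_nat (j choose Suc i) * a (j - i) * b (Suc i))
     = (\<Sum>i\<le>Suc j. of_nat (j choose i) * a (Suc j - i) * b i)"
    by (subst sum.atMost_Suc_shift) simp
  also have "\<dots> = (\<Sum>i\<le>j. of_nat (j choose i) * a (Suc (j - i)) * b i)"
    by (simp add: binomial_eq_0 Suc_diff_le)
  finally show ?thesis by (simp add: sum.distrib[symmetric] algebra_simps)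
qed

definition leibniz :: "(nat \<Rightarrow> 'a \<Rightarrow> complex) \<Rightarrow> (nat \<Rightarrow> 'a \<Rightarrow> complex) \<Rightarrow> nat \<Rightarrow> 'a \<Rightarrow> complex" where
  "leibniz D E j \<xi> = (\<Sum>i\<le>j. of_nat (j choose i) * D (j - i) \<xi> * E i \<xi>)"

lemma leibniz_0 [simp]: "leibniz D E 0 \<xi> = D 0 \<xi> * E 0 \<xi>"
  by (simp add: leibniz_def)

lemma derseq_leibniz:
  assumes D: "derseq N \<beta> D" and E: "derseq N \<beta> E"
  shows "derseq N \<beta> (leibniz D E)"
  unfolding derseq_def
proof (intro conjI allI impI)
  fix j assume "j \<le> N"
  then show "continuous_on UNIV (leibniz D E j)"
    using D E unfolding leibniz_def derseq_def by (intro continuous_intros) auto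
next
  fix j \<xi> assume j: "j < N"
  have "((\<lambda>t. \<Sum>i\<le>j. of_nat (j choose i) * (D (j - i) (\<xi> + t *\<^sub>R \<beta>) * E i (\<xi> + t *\<^sub>R \<beta>))) has_vector_derivative
      (\<Sum>i\<le>j. of_nat (j choose i) * (D (j - i) \<xi> * E (Suc i) \<xi> + D (Suc (j - i)) \<xi> * E i \<xi>))) (at 0)"
  proof (intro has_vector_derivative_sum has_vector_derivative_mult_right)
    fix i assume i: "i \<in> {..j}"
    have "((\<lambda>t. D (j - i) (\<xi> + t *\<^sub>R \<beta>)) has_vector_derivative D (Suc (j - i)) \<xi>) (at 0)"
      "((\<lambda>t. E i (\<xi> + t *\<^sub>R \<beta>)) has_vector_derivative E (Suc i) \<xi>) (at 0)"
      using D E i j unfolding derseq_def by auto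
    from has_vector_derivative_mult[OF this]
    show "((\<lambda>t. D (j - i) (\<xi> + t *\<^sub>R \<beta>) * E i (\<xi> + t *\<^sub>R \<beta>)) has_vector_derivative
      D (j - i) \<xi> * E (Suc i) \<xi> + D (Suc (j - i)) \<xi> * E i \<xi>) (at 0)" by simp
  qed
  then show "((\<lambda>t. leibniz D E j (\<xi> + t *\<^sub>R \<beta>)) has_vector_derivative leibniz D E (Suc j) \<xi>) (at 0)"
    unfolding leibniz_def leibniz_sum_Suc[of j "\<lambda>i. D i \<xi>" "\<lambda>i. E i \<xi>"] by (simp add: mult.assoc add.commute)
qed

text \<open>Both factors live at the same scale \<mu>, so each product of derivatives is at most A B
  \<mu>^j, and the binomial coefficients sum to 2^j.\<close>

lemma norm_leibniz_le:
  assumes "\<And>i. i \<le> j \<Longrightarrow> norm (D i \<xi>) \<le> A * \<mu> ^ i" "\<And>i. i \<le> j \<Longrightarrow> norm (E i \<xi>) \<le> B * \<mu> ^ i"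
    and "0 \<le> A" "0 \<le> \<mu>"
  shows "norm (leibniz D E j \<xi>) \<le> 2 ^ j * (A * B) * \<mu> ^ j"
proof -
  have "norm (leibniz D E j \<xi>) \<le> (\<Sum>i\<le>j. real (j choose i) * (A * B * \<mu> ^ j))"
    unfolding leibniz_def
  proof (rule sum_norm_le)
    fix i assume i: "i \<in> {..j}"
    have "norm (D (j - i) \<xi>) * norm (E i \<xi>) \<le> (A * \<mu> ^ (j - i)) * (B * \<mu> ^ i)"
      by (intro mult_mono assms) (use i assms in auto)
    also have "\<dots> = A * B * \<mu> ^ j"
      using i by (simp add: power_add[symmetric] mult_ac)
    finally show "norm (of_nat (j choose i) * D (j - i) \<xi> * E i \<xi>) \<le> real (j choose i) * (A * B * \<mu> ^ j)"
      by (simp add: norm_mult mult.assoc mult_left_mono)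
  qed
  also have "\<dots> = 2 ^ j * (A * B) * \<mu> ^ j"
    using choose_row_sum[of j] by (simp add: sum_distrib_right[symmetric] of_nat_sum[symmetric] del: of_nat_sum)
  finally show ?thesis .
qed

section \<open>Cutoff functions\<close>

text \<open>Induction on the number of derivatives. Averaging over a window of half-width \<delta>
  gains one derivative, since the derivative of the average is a difference quotient of the function
  averaged. The base case is a trapezoid.\<close>

lemma bump_exists:
  fixes a b :: real
  assumes "0 \<le> a" "a < b"
  shows "\<exists>D::nat \<Rightarrow> real \<Rightarrow> real. (\<forall>j\<le>N. continuous_on UNIV (D j)) \<and>
    (\<forall>j<N. \<forall>t. (D j has_real_derivative D (Suc j) t) (at t)) \<and>
    (\<forall>t. \<bar>t\<bar> \<le> a \<longrightarrow> D 0 t = 1 \<and> (\<forall>j. 1 \<le> j \<and> j \<le> N \<longrightarrow> D j t = 0)) \<and>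
    (\<forall>t. b \<le> \<bar>t\<bar> \<longrightarrow> (\<forall>j\<le>N. D j t = 0)) \<and>
    (\<exists>B. \<forall>j\<le>N. \<forall>t. \<bar>D j t\<bar> \<le> B)"
  using assms
proof (induction N arbitrary: a b)
  case 0
  let ?h = "\<lambda>t::real. max 0 (min 1 ((b - \<bar>t\<bar>) / (b - a)))"
  have "continuous_on UNIV ?h" using 0 by (intro continuous_intros) auto
  moreover have "?h t = 1" if "\<bar>t\<bar> \<le> a" for t using 0 that by (auto simp: field_simps min_def max_def)
  moreover have "?h t = 0" if "b \<le> \<bar>t\<bar>" for t
  proof -
    have "(b - \<bar>t\<bar>) / (b - a) \<le> 0" using 0 that by (intro divide_nonpos_pos) auto
    then show ?thesis by (simp add: max_def min_def)
  qed
  moreover have "\<exists>B. \<forall>t. \<bar>?h t\<bar> \<le> B" by (intro exI[of _ 1]) auto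
  ultimately show ?case by (intro exI[of _ "\<lambda>_. ?h"]) simp
next
  case (Suc N)
  \<comment> \<open>A third of the gap leaves \<open>a + \<delta> < b - \<delta>\<close>: the
    induction hypothesis is used with these two radii, and the window then costs one \<delta> on
    each side.\<close>
  define \<delta> where "\<delta> = (b - a) / 3"
  have \<delta>: "0 < \<delta>" "a + \<delta> < b - \<delta>" using Suc.prems by (auto simp: \<delta>_def field_simps)
  obtain D B where cont: "\<And>j. j \<le> N \<Longrightarrow> continuous_on UNIV (D j)"
    and der: "\<And>j t. j < N \<Longrightarrow> (D j has_real_derivative D (Suc j) t) (at t)"
    and one: "\<And>t. \<bar>t\<bar> \<le> a + \<delta> \<Longrightarrow> D 0 t = (1::real)" "\<And>t j. \<bar>t\<bar> \<le> a + \<delta> \<Longrightarrow> 1 \<le> j \<Longrightarrow> j \<le> N \<Longrightarrow> D j t = 0"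
    and zero: "\<And>t j. b - \<delta> \<le> \<bar>t\<bar> \<Longrightarrow> j \<le> N \<Longrightarrow> D j t = 0"
    and bd: "\<And>j t. j \<le> N \<Longrightarrow> \<bar>D j t\<bar> \<le> B"
  proof -
    have "0 \<le> a + \<delta>" using \<delta> Suc.prems by simp
    from Suc.IH[OF this \<delta>(2)] show thesis
      apply (elim exE conjE)
      subgoal premises prems for D B
        by (rule that[of D B]; use prems in blast)
      done
  qed
  have "isCont (D 0) t" for t using cont[of 0] by (simp add: continuous_on_eq_continuous_at)
  then obtain H where "\<forall>t. - \<infinity> < ereal t \<longrightarrow> ereal t < \<infinity> \<longrightarrow> (H has_vector_derivative D 0 t) (at t)"
    using einterval_antiderivative[of "-\<infinity>" "\<infinity>" "D 0"] by auto
  then have H: "(H has_real_derivative D 0 t) (at t)" for t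
    by (simp add: has_real_derivative_iff_has_vector_derivative)
  \<comment> \<open>\<open>H\<close> is an antiderivative of \<open>D 0\<close>, so
    \<open>E 0\<close> is the mean of \<open>D 0\<close> over the window about t, and
    \<open>E (Suc i)\<close> is the matching difference quotient of \<open>D i\<close>.\<close>
  define E where "E j t = (case j of 0 \<Rightarrow> (H (t + \<delta>) - H (t - \<delta>)) / (2 * \<delta>) | Suc i \<Rightarrow> (D i (t + \<delta>) - D i (t - \<delta>)) / (2 * \<delta>))" for j t
  \<comment> \<open>The mean value theorem transfers the values 1 and 0 and the bound
    \<open>B\<close> from \<open>D 0\<close> to its mean.\<close>
  have mvt: "\<exists>z. t - \<delta> < z \<and> z < t + \<delta> \<and> E 0 t = D 0 z" for t
  proof -
    obtain z where "t - \<delta> < z" "z < t + \<delta>" "H (t + \<delta>) - H (t - \<delta>) = (t + \<delta> - (t - \<delta>)) * D 0 z"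
      using MVT2[of "t - \<delta>" "t + \<delta>" H "D 0"] H \<delta> by auto
    then show ?thesis using \<delta> by (intro exI[of _ z]) (auto simp: E_def field_simps)
  qed
  have Eder: "(E j has_real_derivative E (Suc j) t) (at t)" if "j < Suc N" for j t
  proof (cases j)
    case 0
    have "((\<lambda>t. (H (t + \<delta>) - H (t - \<delta>)) / (2 * \<delta>)) has_real_derivative (D 0 (t + \<delta>) - D 0 (t - \<delta>)) / (2 * \<delta>)) (at t)"
      using \<delta> by (auto intro!: derivative_eq_intros DERIV_chain2[OF H] simp: field_simps)
    then show ?thesis using 0 by (simp add: E_def[abs_def])
  next
    case (Suc i)
    then have "i < N" using that by simp
    then have "((\<lambda>t. (D i (t + \<delta>) - D i (t - \<delta>)) / (2 * \<delta>)) has_real_derivative (D (Suc i) (t + \<delta>) - D (Suc i) (t - \<delta>)) / (2 * \<delta>)) (at t)"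
      using \<delta> by (auto intro!: derivative_eq_intros DERIV_chain2[OF der] simp: field_simps)
    then show ?thesis using Suc by (simp add: E_def[abs_def])
  qed
  have Econt: "continuous_on UNIV (E j)" if "j \<le> Suc N" for j
  proof (cases "j < Suc N")
    case True
    then show ?thesis using Eder[of j] by (auto intro!: DERIV_continuous_on)
  next
    case False
    then have "E j = (\<lambda>t. (D N (t + \<delta>) - D N (t - \<delta>)) / (2 * \<delta>))" using that by (simp add: E_def fun_eq_iff le_Suc_eq)
    then show ?thesis using \<delta> cont[of N] by (auto intro!: continuous_intros continuous_on_compose2[of UNIV "D N"])
  qed
  have E1: "E 0 t = 1" if "\<bar>t\<bar> \<le> a" for t
    using mvt[of t] that one by auto
  have E2: "E j t = 0" if "\<bar>t\<bar> \<le> a" "1 \<le> j" "j \<le> Suc N" for j t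
  proof -
    define i where "i = j - 1"
    have i: "j = Suc i" "i \<le> N" using that by (auto simp: i_def)
    then have "D i (t + \<delta>) = D i (t - \<delta>)" using that one \<delta> by (cases i) auto
    then show ?thesis using i by (simp add: E_def)
  qed
  have E3: "E j t = 0" if "b \<le> \<bar>t\<bar>" "j \<le> Suc N" for j t
  proof (cases j)
    case 0
    then show ?thesis using mvt[of t] that zero[of _ 0] by auto
  next
    case (Suc i)
    then have "D i (t + \<delta>) = 0" "D i (t - \<delta>) = 0" using that \<delta> by (auto intro!: zero)
    then show ?thesis using Suc by (simp add: E_def)
  qed
  have B0: "0 \<le> B" using bd[of 0 0] by auto
  have E4: "\<bar>E j t\<bar> \<le> B + B / \<delta>" if "j \<le> Suc N" for j t
  proof (cases j)
    case 0
    then obtain z where "E j t = D 0 z" using mvt[of t] by auto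
    then show ?thesis using bd[of 0 z] B0 \<delta> by (auto intro!: add_increasing2)
  next
    case (Suc i)
    have "\<bar>E j t\<bar> = \<bar>D i (t + \<delta>) - D i (t - \<delta>)\<bar> / (2 * \<delta>)" using Suc \<delta> by (simp add: E_def abs_divide)
    also have "\<dots> \<le> (B + B) / (2 * \<delta>)"
      using bd[of i "t + \<delta>"] bd[of i "t - \<delta>"] Suc that \<delta> by (intro divide_right_mono) auto
    finally show ?thesis using B0 \<delta> by simp
  qed
  show ?case
  proof (intro exI[of _ E] conjI allI impI)
    show "\<exists>B. \<forall>j\<le>Suc N. \<forall>t. \<bar>E j t\<bar> \<le> B" using E4 by blast
  qed (use Econt Eder E1 E2 E3 in auto)
qed


section \<open>Kernel estimates\<close>

lemma emeasure_cball_le: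
  fixes c :: "'a::euclidean_space"
  assumes "0 \<le> \<rho>"
  shows "emeasure lborel (cball c \<rho>) \<le> ennreal ((2 * \<rho>) ^ DIM('a))"
proof -
  have "cball c \<rho> \<subseteq> cbox (c - \<rho> *\<^sub>R One) (c + \<rho> *\<^sub>R One)"
  proof
    fix x assume "x \<in> cball c \<rho>"
    then have n: "norm (x - c) \<le> \<rho>" by (simp add: dist_norm norm_minus_commute)
    show "x \<in> cbox (c - \<rho> *\<^sub>R One) (c + \<rho> *\<^sub>R One)"
      unfolding mem_box
    proof
      fix i :: 'a assume i: "i \<in> Basis"
      have "\<bar>(x - c) \<bullet> i\<bar> \<le> \<rho>" using Basis_le_norm[OF i, of "x - c"] n by linarith
      then show "(c - \<rho> *\<^sub>R One) \<bullet> i \<le> x \<bullet> i \<and> x \<bullet> i \<le> (c + \<rho> *\<^sub>R One) \<bullet> i"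
        using i by (auto simp: inner_diff_left inner_add_left)
    qed
  qed
  then have "emeasure lborel (cball c \<rho>) \<le> emeasure lborel (cbox (c - \<rho> *\<^sub>R One) (c + \<rho> *\<^sub>R One))"
    by (intro emeasure_mono) auto
  also have "\<dots> = ennreal ((2 * \<rho>) ^ DIM('a))"
    using assms by (subst emeasure_lborel_cbox) (auto simp: inner_diff_left inner_add_left inner_Basis)
  finally show ?thesis .
qed

text \<open>For the least i with v <= 2^i one has 2^i <= 2 (1 + v): by minimality if i > 0, and
  trivially if i = 0.\<close>

lemma decay_weight_le_dyadic:
  fixes v p :: real
  assumes "0 \<le> v" "0 \<le> p"
  shows "\<exists>i::nat. v \<le> 2 ^ i \<and> (1 + v) powr (- p) \<le> 2 powr p * (2 ^ i) powr (- p)"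
proof -
  obtain n :: nat where "v \<le> 2 ^ n"
    by (metis less_imp_le one_less_numeral_iff real_arch_pow semiring_norm(76))
  define i where "i = (LEAST n::nat. v \<le> 2 ^ n)"
  have i: "v \<le> 2 ^ i" unfolding i_def by (rule LeastI) fact
  have lower: "2 ^ i \<le> 2 * (1 + v)"
  proof (cases i)
    case (Suc k)
    then have "\<not> v \<le> 2 ^ k" using not_less_Least[of k "\<lambda>n. v \<le> 2 ^ n"] by (auto simp: i_def)
    then show ?thesis using Suc by simp
  qed (use assms in simp)
  have "(1 + v) powr (- p) = 2 powr p * (2 * (1 + v)) powr (- p)"
  proof -
    have "(2 * (1 + v)) powr (- p) = 2 powr (- p) * (1 + v) powr (- p)"
      by (rule powr_mult)
    moreover have "(2::real) powr p * 2 powr (- p) = 1" unfolding powr_add[symmetric] by simp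
    ultimately show ?thesis by (simp add: mult.assoc[symmetric])
  qed
  also have "\<dots> \<le> 2 powr p * (2 ^ i) powr (- p)"
    using lower assms by (intro mult_left_mono powr_mono2') auto
  finally show ?thesis using i by blast
qed

text \<open>The bridge from maximal functions to weighted means. The weight is dominated by the sum
  over i of 2^p 2^(-ip) times the indicator of the ball of radius 2^i/\<mu>. With growth B \<rho>^d
  on balls, the i-th term costs 2^(i(d-p)), at most 2^(-i) because p >= d + 1. The constant is 2^p
  times the sum 2 of the geometric series.\<close>

lemma nn_integral_decay_weight:
  fixes h :: "'a::euclidean_space \<Rightarrow> ennreal"
  assumes h: "h \<in> borel_measurable borel"
    and \<mu>: "0 < \<mu>" and p: "real DIM('a) + 1 \<le> p"
    and bound: "\<And>\<rho>. 0 < \<rho> \<Longrightarrow> (\<integral>\<^sup>+y. h y * indicator (cball c \<rho>) y \<partial>lborel) \<le> B * ennreal (\<rho> ^ DIM('a))"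
  shows "(\<integral>\<^sup>+y. h y * ennreal ((1 + \<mu> * dist c y) powr (- p)) \<partial>lborel)
    \<le> ennreal (2 powr (p + 1)) * B * ennreal ((1 / \<mu>) ^ DIM('a))"
proof -
  let ?d = "DIM('a)"
  have p0: "0 \<le> p" using p by simp
  let ?t = "\<lambda>i y. ennreal (2 powr p * (2 ^ i) powr (- p)) * (h y * indicator (cball c (2 ^ i / \<mu>)) y)"
  have "(\<integral>\<^sup>+y. h y * ennreal ((1 + \<mu> * dist c y) powr (- p)) \<partial>lborel) \<le> (\<integral>\<^sup>+y. (\<Sum>i. ?t i y) \<partial>lborel)"
  proof (rule nn_integral_mono)
    fix y
    obtain i :: nat where i: "\<mu> * dist c y \<le> 2 ^ i"
      "(1 + \<mu> * dist c y) powr (- p) \<le> 2 powr p * (2 ^ i) powr (- p)"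
      using decay_weight_le_dyadic[of "\<mu> * dist c y" p] p0 \<mu> by auto
    have "y \<in> cball c (2 ^ i / \<mu>)" using i \<mu> by (simp add: field_simps)
    then have ind: "indicator (cball c (2 ^ i / \<mu>)) y = (1::ennreal)" by simp
    have "?t i y = h y * ennreal (2 powr p * (2 ^ i) powr (- p))"
      unfolding ind mult_1_right by (rule mult.commute)
    moreover have "h y * ennreal ((1 + \<mu> * dist c y) powr (- p)) \<le> h y * ennreal (2 powr p * (2 ^ i) powr (- p))"
      by (intro mult_left_mono ennreal_leI i) simp
    ultimately have "h y * ennreal ((1 + \<mu> * dist c y) powr (- p)) \<le> ?t i y" by (simp only:)
    also have "\<dots> = (\<Sum>j\<in>{i}. ?t j y)" by simp
    also have "\<dots> \<le> (\<Sum>j. ?t j y)" by (rule sum_le_suminf) auto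
    finally show "h y * ennreal ((1 + \<mu> * dist c y) powr (- p)) \<le> (\<Sum>j. ?t j y)" .
  qed
  also have "\<dots> = (\<Sum>i. \<integral>\<^sup>+y. ?t i y \<partial>lborel)"
    by (rule nn_integral_suminf) (intro borel_measurable_times_ennreal borel_measurable_const borel_measurable_indicator; simp add: h)
  also have "\<dots> \<le> (\<Sum>i. ennreal (2 powr p * (1 / \<mu>) ^ ?d) * B * ennreal ((1 / 2) ^ i))"
  proof (rule suminf_le)
    fix i :: nat
    have "(\<integral>\<^sup>+y. ?t i y \<partial>lborel) = ennreal (2 powr p * (2 ^ i) powr (- p)) * (\<integral>\<^sup>+y. h y * indicator (cball c (2 ^ i / \<mu>)) y \<partial>lborel)"
      by (rule nn_integral_cmult) (intro borel_measurable_times_ennreal borel_measurable_indicator; simp add: h)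
    also have "\<dots> \<le> ennreal (2 powr p * (2 ^ i) powr (- p)) * (B * ennreal ((2 ^ i / \<mu>) ^ ?d))"
      using \<mu> by (intro mult_left_mono bound) auto
    also have "\<dots> = B * ennreal (2 powr p * (2 ^ i) powr (- p) * (2 ^ i / \<mu>) ^ ?d)"
      using \<mu> by (subst (2) ennreal_mult) (auto simp: mult_ac)
    also have "\<dots> \<le> B * ennreal (2 powr p * (1 / \<mu>) ^ ?d * (1 / 2) ^ i)"
    proof (intro mult_left_mono ennreal_leI)
      have "(2 ^ i) powr (- p) * (2 ^ i) ^ ?d = (2 ^ i :: real) powr (real ?d - p)"
        using powr_add[of "2 ^ i :: real" "- p" "real ?d"] powr_realpow[of "2 ^ i :: real" ?d] by simp
      also have "\<dots> \<le> (2 ^ i) powr (- 1)" using p by (intro powr_mono) auto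
      also have "\<dots> = (1 / 2) ^ i" by (simp add: powr_minus_divide power_one_over)
      finally have "(2 ^ i :: real) powr (- p) * (2 ^ i) ^ ?d \<le> (1 / 2) ^ i" .
      from mult_left_mono[OF this, of "2 powr p * (1 / \<mu>) ^ ?d"]
      show "2 powr p * (2 ^ i) powr (- p) * (2 ^ i / \<mu>) ^ ?d \<le> 2 powr p * (1 / \<mu>) ^ ?d * (1 / 2) ^ i"
        using \<mu> by (simp add: power_divide mult_ac zero_le_divide_iff)
    qed auto
    also have "\<dots> = ennreal (2 powr p * (1 / \<mu>) ^ ?d) * B * ennreal ((1 / 2) ^ i)"
      using \<mu> by (subst ennreal_mult) (auto simp: mult_ac)
    finally show "(\<integral>\<^sup>+y. ?t i y \<partial>lborel) \<le> \<dots>" .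
  qed auto
  also have "\<dots> = ennreal (2 powr p * (1 / \<mu>) ^ ?d) * B * (\<Sum>i. ennreal ((1 / 2) ^ i))"
    by (rule ennreal_suminf_cmult)
  also have "(\<Sum>i. ennreal ((1 / 2) ^ i)) = ennreal 2"
    by (subst suminf_ennreal2) (auto simp: suminf_geometric summable_geometric)
  also have "ennreal (2 powr p * (1 / \<mu>) ^ ?d) * B * ennreal 2 = ennreal (2 powr (p + 1)) * B * ennreal ((1 / \<mu>) ^ ?d)"
    using \<mu> by (simp add: ennreal_mult powr_add mult_ac)
  finally show ?thesis .
qed

lemma integrable_decay_weight:
  fixes c :: "'a::euclidean_space"
  assumes "0 < \<mu>" and "real DIM('a) + 1 \<le> p"
  shows "integrable lborel (\<lambda>y. (1 + \<mu> * dist c y) powr (- p))"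
proof (rule integrableI_bounded)
  have "(\<integral>\<^sup>+y. ennreal (norm ((1 + \<mu> * dist c y) powr (- p))) \<partial>lborel) = (\<integral>\<^sup>+y. 1 * ennreal ((1 + \<mu> * dist c y) powr (- p)) \<partial>lborel)"
    by simp
  also have "\<dots> \<le> ennreal (2 powr (p + 1)) * ennreal (2 ^ DIM('a)) * ennreal ((1 / \<mu>) ^ DIM('a))"
  proof (rule nn_integral_decay_weight)
    fix \<rho> :: real assume "0 < \<rho>"
    then show "(\<integral>\<^sup>+y. 1 * indicator (cball c \<rho>) y \<partial>lborel) \<le> ennreal (2 ^ DIM('a)) * ennreal (\<rho> ^ DIM('a))"
      using emeasure_cball_le[of \<rho> c] by (simp add: ennreal_mult[symmetric] power_mult_distrib)
  qed (use assms in auto)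
  also have "\<dots> < \<infinity>" by (simp add: ennreal_mult_less_top)
  finally show "(\<integral>\<^sup>+y. ennreal (norm ((1 + \<mu> * dist c y) powr (- p))) \<partial>lborel) < \<infinity>" .
qed measurable

text \<open>Phrased with upper bounds \<open>P\<close> and \<open>G\<close> in place of the norms,
  so that estimates can be inserted directly. It is Young's inequality after normalisation; P = 0 is
  treated apart because the normalisation divides by it.\<close>

lemma nn_integral_holder:
  fixes f g :: "'a \<Rightarrow> real"
  assumes pq: "1 < p" "1 < q" "1 / p + 1 / q = 1"
    and [measurable]: "f \<in> borel_measurable M" "g \<in> borel_measurable M"
    and f0: "\<And>x. 0 \<le> f x" and g0: "\<And>x. 0 \<le> g x"
    and fP: "(\<integral>\<^sup>+x. ennreal (f x powr p) \<partial>M) \<le> ennreal P" and gG: "(\<integral>\<^sup>+x. ennreal (g x powr q) \<partial>M) \<le> ennreal G"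
    and P: "0 \<le> P" and G: "0 < G"
  shows "(\<integral>\<^sup>+x. ennreal (f x * g x) \<partial>M) \<le> ennreal (P powr (1 / p) * G powr (1 / q))"
proof (cases "P = 0")
  case True
  then have "(\<integral>\<^sup>+x. ennreal (f x powr p) \<partial>M) = 0" using fP by simp
  then have "AE x in M. ennreal (f x powr p) = 0" by (subst (asm) nn_integral_0_iff_AE) auto
  then have "AE x in M. ennreal (f x * g x) = 0" by eventually_elim (auto simp: ennreal_eq_0_iff)
  then have "(\<integral>\<^sup>+x. ennreal (f x * g x) \<partial>M) = 0" by (subst nn_integral_0_iff_AE) auto
  then show ?thesis by simp
next
  case False
  then have P: "0 < P" using P by simp
  define a b where "a = P powr (1 / p)" and "b = G powr (1 / q)"
  have ab: "0 < a" "0 < b" "a powr p = P" "b powr q = G"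
    using P G pq by (auto simp: a_def b_def powr_powr)
  have young: "f x * g x \<le> (a * b / (p * P)) * f x powr p + (a * b / (q * G)) * g x powr q" for x
  proof -
    have "(f x / a) * (g x / b) \<le> (f x / a) powr p / p + (g x / b) powr q / q"
      using f0[of x] g0[of x] ab by (intro Youngs_inequality pq) auto
    also have "\<dots> = f x powr p / (p * P) + g x powr q / (q * G)"
      using f0[of x] g0[of x] ab by (simp add: powr_divide mult.commute)
    finally have "(f x / a) * (g x / b) * (a * b) \<le> (f x powr p / (p * P) + g x powr q / (q * G)) * (a * b)"
      using ab by (intro mult_right_mono) auto
    then show ?thesis using ab by (simp add: algebra_simps)
  qed
  have "(\<integral>\<^sup>+x. ennreal (f x * g x) \<partial>M) \<le> (\<integral>\<^sup>+x. ennreal (a * b / (p * P)) * ennreal (f x powr p) + ennreal (a * b / (q * G)) * ennreal (g x powr q) \<partial>M)"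
  proof (rule nn_integral_mono)
    fix x
    have nn: "0 \<le> a * b / (p * P)" "0 \<le> a * b / (q * G)" using ab P G pq by auto
    have "ennreal (f x * g x) \<le> ennreal ((a * b / (p * P)) * f x powr p + (a * b / (q * G)) * g x powr q)"
      by (intro ennreal_leI young)
    also have "\<dots> = ennreal (a * b / (p * P)) * ennreal (f x powr p) + ennreal (a * b / (q * G)) * ennreal (g x powr q)"
      using nn by (subst ennreal_plus) (auto simp: ennreal_mult simp del: times_divide_eq_left)
    finally show "ennreal (f x * g x) \<le> \<dots>" .
  qed
  also have "\<dots> = ennreal (a * b / (p * P)) * (\<integral>\<^sup>+x. ennreal (f x powr p) \<partial>M) + ennreal (a * b / (q * G)) * (\<integral>\<^sup>+x. ennreal (g x powr q) \<partial>M)"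
    by (simp add: nn_integral_add nn_integral_cmult)
  also have "\<dots> \<le> ennreal (a * b / (p * P)) * ennreal P + ennreal (a * b / (q * G)) * ennreal G"
    by (intro add_mono mult_left_mono fP gG) auto
  also have "\<dots> = ennreal (a * b / p + a * b / q)"
    using ab P G pq by (simp add: ennreal_mult[symmetric] ennreal_plus[symmetric] del: ennreal_plus)
  also have "a * b / p + a * b / q = a * b * (1 / p + 1 / q)" by (simp add: algebra_simps)
  finally show ?thesis using pq by (simp add: a_def b_def)
qed

section \<open>Multiplier operators and weighted means\<close>

text \<open>The mean of |F|^r about \<open>y\<close> at scale 1/\<kappa>, with a decaying weight in
  place of a sharp ball. The power of \<kappa> makes the mass of the weight independent of
  \<kappa>.\<close>

definition Phi :: "real \<Rightarrow> real \<Rightarrow> real \<Rightarrow> ('a::euclidean_space \<Rightarrow> complex) \<Rightarrow> 'a \<Rightarrow> real" where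
  "Phi r p \<kappa> F y = (\<integral>z. \<kappa> ^ DIM('a) * (norm (F z) powr r * (1 + \<kappa> * dist y z) powr (- p)) \<partial>lborel)"

text \<open>The Fourier multiplier operator with symbol \<open>b\<close>, as
  \<open>ft F (- \<xi>)\<close> is the Fourier transform of \<open>F\<close>; its kernel is
  \<open>ft b\<close>.\<close>

definition fmult :: "('a::euclidean_space \<Rightarrow> complex) \<Rightarrow> ('a \<Rightarrow> complex) \<Rightarrow> 'a \<Rightarrow> complex" where
  "fmult F b y = (\<integral>\<xi>. b \<xi> * ft F (- \<xi>) * cis (2 * pi * (\<xi> \<bullet> y)) \<partial>lborel)"

lemma Phi_nonneg: "0 \<le> \<kappa> \<Longrightarrow> 0 \<le> Phi r p \<kappa> F y"
  unfolding Phi_def by (intro Bochner_Integration.integral_nonneg) auto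

lemma Phi_integrable:
  fixes F :: "'a::euclidean_space \<Rightarrow> complex"
  assumes F: "integrable lborel (\<lambda>z. norm (F z) powr r)" and "0 \<le> \<kappa>" "0 \<le> p"
  shows "integrable lborel (\<lambda>z. norm (F z) powr r * (1 + \<kappa> * dist y z) powr (- p))"
proof (rule Bochner_Integration.integrable_bound[OF F])
  have [measurable]: "(\<lambda>z. norm (F z) powr r) \<in> borel_measurable borel" using F by auto
  show "(\<lambda>z. norm (F z) powr r * (1 + \<kappa> * dist y z) powr (- p)) \<in> borel_measurable lborel" by measurable
  show "AE z in lborel. norm (norm (F z) powr r * (1 + \<kappa> * dist y z) powr (- p)) \<le> norm (norm (F z) powr r)"
  proof (rule AE_I2)
    fix z
    have "(1 + \<kappa> * dist y z) powr (- p) \<le> (1 + \<kappa> * dist y z) powr 0"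
      using assms by (intro powr_mono) auto
    also have "\<dots> = 1" using assms by (simp add: add_nonneg_eq_0_iff)
    finally show "norm (norm (F z) powr r * (1 + \<kappa> * dist y z) powr (- p)) \<le> norm (norm (F z) powr r)"
      by (simp add: mult_left_le)
  qed
qed

lemma ennreal_Phi:
  fixes F :: "'a::euclidean_space \<Rightarrow> complex"
  assumes F: "integrable lborel (\<lambda>z. norm (F z) powr r)" and "0 \<le> \<kappa>" "0 \<le> p"
  shows "ennreal (Phi r p \<kappa> F y) = ennreal (\<kappa> ^ DIM('a)) * (\<integral>\<^sup>+z. ennreal (norm (F z) powr r * (1 + \<kappa> * dist y z) powr (- p)) \<partial>lborel)"
  unfolding Phi_def using Phi_integrable[OF assms, of y] assms
  by (subst nn_integral_eq_integral) (auto simp: ennreal_mult' intro!: Bochner_Integration.integral_nonneg)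

lemma fmult_eq_convolution:
  fixes F b :: "'a::euclidean_space \<Rightarrow> complex"
  assumes F: "integrable lborel F" and b: "integrable lborel b"
  shows "fmult F b y = (\<integral>z. F z * ft b (y - z) \<partial>lborel)"
proof -
  have [measurable]: "F \<in> borel_measurable borel" "b \<in> borel_measurable borel" using F b by auto
  have "fmult F b y = (\<integral>\<xi>. b \<xi> * (\<integral>z. F z * cis (2 * pi * (\<xi> \<bullet> (y - z))) \<partial>lborel) \<partial>lborel)"
    unfolding fmult_def
  proof (intro Bochner_Integration.integral_cong refl)
    fix \<xi>
    have "ft F (- \<xi>) * cis (2 * pi * (\<xi> \<bullet> y)) = (\<integral>z. F z * cis (2 * pi * (z \<bullet> - \<xi>)) * cis (2 * pi * (\<xi> \<bullet> y)) \<partial>lborel)"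
      unfolding ft_def by simp
    also have "\<dots> = (\<integral>z. F z * cis (2 * pi * (\<xi> \<bullet> (y - z))) \<partial>lborel)"
      by (simp add: mult.assoc cis_mult inner_diff_right right_diff_distrib inner_commute)
    finally show "b \<xi> * ft F (- \<xi>) * cis (2 * pi * (\<xi> \<bullet> y)) = b \<xi> * (\<integral>z. F z * cis (2 * pi * (\<xi> \<bullet> (y - z))) \<partial>lborel)"
      by (simp add: mult.assoc)
  qed
  also have "\<dots> = (\<integral>z. F z * (\<integral>\<xi>. b \<xi> * cis (2 * pi * (\<xi> \<bullet> (y - z))) \<partial>lborel) \<partial>lborel)"
    by (rule integral_swap_bounded_kernel[where B = 1]) (use F b in \<open>auto simp: lborel.sigma_finite_measure_axioms\<close>)
  finally show ?thesis unfolding ft_def .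
qed

text \<open>Interpolation by hand: |ft b|^q is |ft b|^(q-2), bounded by the L^1 norm of
  \<open>b\<close>, times |ft b|^2, integrated by Plancherel. For a symbol of constant size on a
  ball this yields the same power of the radius as Hausdorff-Young.\<close>

lemma nn_integral_ft_powr_le:
  fixes b :: "'a::euclidean_space \<Rightarrow> complex"
  assumes b: "integrable lborel b" and q: "2 \<le> q"
    and A1: "(\<integral>\<xi>. norm (b \<xi>) \<partial>lborel) \<le> A1" and A2: "(\<integral>\<^sup>+\<xi>. ennreal ((norm (b \<xi>))\<^sup>2) \<partial>lborel) \<le> ennreal A2"
  shows "(\<integral>\<^sup>+y. ennreal (norm (ft b y) powr q) \<partial>lborel) \<le> ennreal (A1 powr (q - 2) * A2)"
proof -
  have [measurable]: "b \<in> borel_measurable borel" using b by auto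
  have A10: "0 \<le> A1" using A1 by (rule order_trans[rotated]) (simp add: Bochner_Integration.integral_nonneg)
  have "(\<integral>\<^sup>+y. ennreal (norm (ft b y) powr q) \<partial>lborel) \<le> (\<integral>\<^sup>+y. ennreal (A1 powr (q - 2)) * ennreal ((norm (ft b y))\<^sup>2) \<partial>lborel)"
  proof (rule nn_integral_mono)
    fix y
    have "norm (ft b y) \<le> A1" using norm_ft_le[of b y] A1 by simp
    then have "norm (ft b y) powr (q - 2) * (norm (ft b y))\<^sup>2 \<le> A1 powr (q - 2) * (norm (ft b y))\<^sup>2"
      using q by (intro mult_right_mono powr_mono2) auto
    moreover have "norm (ft b y) powr q = norm (ft b y) powr (q - 2) * (norm (ft b y))\<^sup>2"
      using powr_add[of "norm (ft b y)" "q - 2" 2] by (cases "ft b y = 0") auto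
    ultimately show "ennreal (norm (ft b y) powr q) \<le> ennreal (A1 powr (q - 2)) * ennreal ((norm (ft b y))\<^sup>2)"
      by (auto simp: ennreal_mult[symmetric] intro!: ennreal_leI)
  qed
  also have "\<dots> = ennreal (A1 powr (q - 2)) * (\<integral>\<^sup>+y. ennreal ((norm (ft b y))\<^sup>2) \<partial>lborel)"
    by (rule nn_integral_cmult) measurable
  also have "\<dots> \<le> ennreal (A1 powr (q - 2)) * ennreal A2"
    using plancherel_le[OF b] A2 by (intro mult_left_mono) auto
  also have "\<dots> = ennreal (A1 powr (q - 2) * A2)" by (simp add: ennreal_mult')
  finally show ?thesis .
qed

text \<open>The largest of 1 and the terms \<kappa> |\<beta> . z| controls 1 + \<kappa> |z| up to
  the factor d + 1. Only N-th powers of single coordinates remain on the right, and these correspond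
  to pure derivatives of the symbol.\<close>

lemma weight_le_coordinates:
  fixes z :: "'a::euclidean_space"
  assumes "0 \<le> \<kappa>"
  shows "(1 + \<kappa> * norm z) ^ N \<le> real (DIM('a) + 1) ^ N * (1 + (\<Sum>\<beta>\<in>Basis. (\<kappa> * \<bar>\<beta> \<bullet> z\<bar>) ^ N))"
proof -
  define m where "m = Max (insert 1 ((\<lambda>\<beta>. \<kappa> * \<bar>\<beta> \<bullet> z\<bar>) ` Basis))"
  have m1: "1 \<le> m" and mb: "\<kappa> * \<bar>\<beta> \<bullet> z\<bar> \<le> m" if "\<beta> \<in> Basis" for \<beta>
    unfolding m_def by (rule Max_ge; use that in auto)+
  then have m1: "1 \<le> m" using nonempty_Basis by blast
  have "norm z \<le> (\<Sum>\<beta>\<in>Basis. \<bar>z \<bullet> \<beta>\<bar>)" by (rule norm_le_l1)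
  then have "\<kappa> * norm z \<le> (\<Sum>\<beta>\<in>Basis. \<kappa> * \<bar>\<beta> \<bullet> z\<bar>)"
    using mult_left_mono[OF _ assms] by (simp add: sum_distrib_left[symmetric] inner_commute)
  also have "\<dots> \<le> (\<Sum>\<beta>\<in>(Basis::'a set). m)" by (intro sum_mono mb)
  finally have "1 + \<kappa> * norm z \<le> real (DIM('a) + 1) * m" using m1 by (simp add: algebra_simps)
  then have "(1 + \<kappa> * norm z) ^ N \<le> real (DIM('a) + 1) ^ N * m ^ N"
    using assms by (subst power_mult_distrib[symmetric]) (intro power_mono, auto)
  also have "m ^ N \<le> 1 + (\<Sum>\<beta>\<in>Basis. (\<kappa> * \<bar>\<beta> \<bullet> z\<bar>) ^ N)"
  proof -
    have "m \<in> insert 1 ((\<lambda>\<beta>. \<kappa> * \<bar>\<beta> \<bullet> z\<bar>) ` Basis)" unfolding m_def by (rule Max_in) auto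
    then consider "m = 1" | \<beta> where "\<beta> \<in> Basis" "m = \<kappa> * \<bar>\<beta> \<bullet> z\<bar>" by auto
    then show ?thesis
    proof cases
      case 1
      then show ?thesis using assms by (auto intro!: sum_nonneg)
    next
      case 2
      then show ?thesis using assms member_le_sum[of \<beta> Basis "\<lambda>\<beta>. (\<kappa> * \<bar>\<beta> \<bullet> z\<bar>) ^ N"] by auto
    qed
  qed
  finally show ?thesis by (simp add: mult_left_mono)
qed

lemma powr_sum_le:
  fixes h :: "'i \<Rightarrow> real"
  assumes I: "finite I" "I \<noteq> {}" and h: "\<And>i. i \<in> I \<Longrightarrow> 0 \<le> h i" and q: "0 \<le> q"
  shows "(\<Sum>i\<in>I. h i) powr q \<le> real (card I) powr q * (\<Sum>i\<in>I. h i powr q)"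
proof -
  define m where "m = Max (h ` I)"
  have "m \<in> h ` I" unfolding m_def using I by (intro Max_in) auto
  then obtain i where i: "i \<in> I" "m = h i" by auto
  have "(\<Sum>i\<in>I. h i) \<le> (\<Sum>i\<in>I. m)" using I by (intro sum_mono) (auto simp: m_def)
  then have "(\<Sum>i\<in>I. h i) powr q \<le> (real (card I) * m) powr q"
    using h q by (intro powr_mono2) (auto intro!: sum_nonneg)
  also have "\<dots> = real (card I) powr q * m powr q" using h i by (simp add: powr_mult)
  also have "m powr q \<le> (\<Sum>i\<in>I. h i powr q)" using i I member_le_sum[of i I "\<lambda>i. h i powr q"] by auto
  finally show ?thesis by (simp add: mult_left_mono)
qed

text \<open>Hoelder for the convolution with \<open>ft b\<close>, after moving the weight (1 +
  \<kappa> |y - z|)^N from \<open>F\<close> to the kernel: the factor with \<open>F\<close> becomes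
  \<open>Phi\<close>, and the weighted kernel is bounded in L^q by Plancherel. Derivatives enter
  only through the functions \<open>bb\<close> and the modulus of their transforms, so that the
  lemma also covers multipliers produced by integrating over a parameter, as in
  \<open>fmult_dual_bound\<close>.\<close>

lemma fmult_bound:
  fixes F b :: "'a::euclidean_space \<Rightarrow> complex" and bb :: "'a \<Rightarrow> 'a \<Rightarrow> complex"
  assumes r: "1 < r" "r \<le> 2" and q: "q = r / (r - 1)" and \<kappa>: "0 < \<kappa>"
    and F: "integrable lborel F" and Fr: "integrable lborel (\<lambda>z. norm (F z) powr r)"
    and b: "integrable lborel b" and bb: "\<And>\<beta>. \<beta> \<in> Basis \<Longrightarrow> integrable lborel (bb \<beta>)"
    and ftbb: "\<And>\<beta> y. \<beta> \<in> Basis \<Longrightarrow> norm (ft (bb \<beta>) y) = (2 * pi * \<bar>\<beta> \<bullet> y\<bar>) ^ N * norm (ft b y)"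
    and A0: "0 < A1" "0 < A2"
    and A1: "(\<integral>\<xi>. norm (b \<xi>) \<partial>lborel) \<le> A1" "\<And>\<beta>. \<beta> \<in> Basis \<Longrightarrow> \<kappa> ^ N * (\<integral>\<xi>. norm (bb \<beta> \<xi>) \<partial>lborel) \<le> A1"
    and A2: "(\<integral>\<^sup>+\<xi>. ennreal ((norm (b \<xi>))\<^sup>2) \<partial>lborel) \<le> ennreal A2"
      "\<And>\<beta>. \<beta> \<in> Basis \<Longrightarrow> (\<integral>\<^sup>+\<xi>. ennreal ((\<kappa> ^ N * norm (bb \<beta> \<xi>))\<^sup>2) \<partial>lborel) \<le> ennreal A2"
  shows "norm (fmult F b y) \<le> real (DIM('a) + 1) ^ (N + 2) * (A1 powr (q - 2) * A2) powr (1 / q)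
      * (\<kappa> powr (- real DIM('a) / r) * Phi r (real N * r) \<kappa> F y powr (1 / r))"
proof -
  let ?d = "real (DIM('a) + 1)"
  have q2: "2 \<le> q" using r by (simp add: q pos_le_divide_eq)
  have pq: "1 / r + 1 / q = 1" using r unfolding q by (simp add: field_simps)
  have [measurable]: "F \<in> borel_measurable borel" "b \<in> borel_measurable borel" using F b by auto
  have [measurable]: "bb \<beta> \<in> borel_measurable borel" if "\<beta> \<in> Basis" for \<beta> using bb[OF that] by auto
  define T where "T = A1 powr (q - 2) * A2"
  have T0: "0 < T" using A0 by (simp add: T_def)
  \<comment> \<open>\<open>None\<close> stands for the kernel itself, \<open>Some \<beta>\<close>
    for the kernel of the N-th derivative along \<beta>, rescaled by \<kappa>^N.\<close>
  define H where "H i z = (case i of None \<Rightarrow> norm (ft b z) | Some \<beta> \<Rightarrow> norm (ft (\<lambda>\<xi>. \<kappa> ^ N * bb \<beta> \<xi>) z))" for i z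
  define I where "I = insert None (Some ` (Basis :: 'a set))"
  have I: "finite I" "I \<noteq> {}" "card I = DIM('a) + 1"
    by (auto simp: I_def card_insert_if card_image)
  have H0: "0 \<le> H i z" for i z by (auto simp: H_def split: option.split)
  have [measurable]: "H i \<in> borel_measurable borel" if "i \<in> I" for i
    using that unfolding I_def by (auto simp: H_def[abs_def])
  have HT: "(\<integral>\<^sup>+z. ennreal (H i z powr q) \<partial>lborel) \<le> ennreal T" if "i \<in> I" for i
  proof (cases i)
    case None
    then show ?thesis unfolding H_def T_def using nn_integral_ft_powr_le[OF b q2 A1(1) A2(1)] by simp
  next
    case (Some \<beta>)
    then have \<beta>: "\<beta> \<in> Basis" using that by (auto simp: I_def)
    have "(\<integral>\<^sup>+z. ennreal (norm (ft (\<lambda>\<xi>. complex_of_real (\<kappa> ^ N) * bb \<beta> \<xi>) z) powr q) \<partial>lborel) \<le> ennreal (A1 powr (q - 2) * A2)"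
    proof (rule nn_integral_ft_powr_le[OF _ q2])
      show "integrable lborel (\<lambda>\<xi>. complex_of_real (\<kappa> ^ N) * bb \<beta> \<xi>)" using bb[OF \<beta>] by simp
      show "(\<integral>\<xi>. norm (complex_of_real (\<kappa> ^ N) * bb \<beta> \<xi>) \<partial>lborel) \<le> A1"
        using A1(2)[OF \<beta>] \<kappa> by (simp add: norm_mult norm_power)
      show "(\<integral>\<^sup>+\<xi>. ennreal ((norm (complex_of_real (\<kappa> ^ N) * bb \<beta> \<xi>))\<^sup>2) \<partial>lborel) \<le> ennreal A2"
        using A2(2)[OF \<beta>] \<kappa> by (simp add: norm_mult norm_power)
    qed
    then show ?thesis unfolding H_def T_def Some by simp
  qed
  have wH: "(1 + \<kappa> * norm z) ^ N * norm (ft b z) \<le> ?d ^ N * (\<Sum>i\<in>I. H i z)" for z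
  proof -
    have "(1 + \<kappa> * norm z) ^ N * norm (ft b z) \<le> ?d ^ N * (1 + (\<Sum>\<beta>\<in>Basis. (\<kappa> * \<bar>\<beta> \<bullet> z\<bar>) ^ N)) * norm (ft b z)"
      using \<kappa> by (intro mult_right_mono weight_le_coordinates) auto
    also have "\<dots> = ?d ^ N * (norm (ft b z) + (\<Sum>\<beta>\<in>Basis. (\<kappa> * \<bar>\<beta> \<bullet> z\<bar>) ^ N * norm (ft b z)))"
      by (simp add: algebra_simps sum_distrib_left)
    also have "\<dots> \<le> ?d ^ N * (norm (ft b z) + (\<Sum>\<beta>\<in>Basis. H (Some \<beta>) z))"
    proof (intro mult_left_mono add_left_mono sum_mono)
      fix \<beta> :: 'a assume \<beta>: "\<beta> \<in> Basis"
      have "\<kappa> ^ N * \<bar>\<beta> \<bullet> z\<bar> ^ N \<le> \<kappa> ^ N * (2 * pi * \<bar>\<beta> \<bullet> z\<bar>) ^ N"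
        using \<kappa> pi_gt3 by (intro mult_left_mono power_mono) (auto simp: mult_le_cancel_right1)
      then have "(\<kappa> * \<bar>\<beta> \<bullet> z\<bar>) ^ N * norm (ft b z) \<le> \<kappa> ^ N * (2 * pi * \<bar>\<beta> \<bullet> z\<bar>) ^ N * norm (ft b z)"
        unfolding power_mult_distrib by (intro mult_right_mono) auto
      also have "\<dots> = \<kappa> ^ N * norm (ft (bb \<beta>) z)" by (simp add: ftbb[OF \<beta>])
      also have "\<dots> = H (Some \<beta>) z"
        using \<kappa> by (simp add: H_def ft_def mult.assoc norm_mult norm_power)
      finally show "(\<kappa> * \<bar>\<beta> \<bullet> z\<bar>) ^ N * norm (ft b z) \<le> H (Some \<beta>) z" .
    qed auto
    also have "norm (ft b z) + (\<Sum>\<beta>\<in>Basis. H (Some \<beta>) z) = (\<Sum>i\<in>I. H i z)"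
      unfolding I_def by (subst sum.insert) (auto simp: sum.reindex H_def)
    finally show ?thesis .
  qed
  define f where "f z = norm (F z) * (1 + \<kappa> * dist y z) powr (- real N)" for z
  define g where "g z = ?d ^ N * (\<Sum>i\<in>I. H i (y - z))" for z
  define P where "P = \<kappa> powr (- real DIM('a)) * Phi r (real N * r) \<kappa> F y"
  \<comment> \<open>Exponents of \<open>?d\<close>: N q from the factor \<open>?d ^ N\<close>, q
    from \<open>powr_sum_le\<close>, and 1 from the number of summands.\<close>
  define G where "G = ?d powr (real N * q + q + 1) * T"
  have P0: "0 \<le> P" unfolding P_def using \<kappa> by (intro mult_nonneg_nonneg Phi_nonneg) auto
  have G0: "0 < G" unfolding G_def using T0 by simp
  have wpos: "0 < 1 + \<kappa> * dist y z" for z using \<kappa> by (auto intro: add_pos_nonneg)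
  have [measurable]: "f \<in> borel_measurable lborel" "g \<in> borel_measurable lborel"
    unfolding f_def g_def by measurable
  have fP: "(\<integral>\<^sup>+z. ennreal (f z powr r) \<partial>lborel) \<le> ennreal P"
  proof -
    have "f z powr r = norm (F z) powr r * (1 + \<kappa> * dist y z) powr (- (real N * r))" for z
      unfolding f_def using wpos[of z] by (simp add: powr_mult powr_powr)
    then have "ennreal (\<kappa> ^ DIM('a)) * (\<integral>\<^sup>+z. ennreal (f z powr r) \<partial>lborel) = ennreal (Phi r (real N * r) \<kappa> F y)"
      using ennreal_Phi[OF Fr, of \<kappa> "real N * r" y] \<kappa> r by simp
    then have "ennreal (\<kappa> powr (- real DIM('a))) * (ennreal (\<kappa> ^ DIM('a)) * (\<integral>\<^sup>+z. ennreal (f z powr r) \<partial>lborel)) = ennreal P"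
      unfolding P_def using \<kappa> by (simp add: ennreal_mult')
    then show ?thesis using \<kappa> by (simp add: mult.assoc[symmetric] ennreal_mult[symmetric] powr_minus powr_realpow)
  qed
  have gG: "(\<integral>\<^sup>+z. ennreal (g z powr q) \<partial>lborel) \<le> ennreal G"
  proof -
    have "(\<integral>\<^sup>+z. ennreal (g z powr q) \<partial>lborel) \<le> (\<integral>\<^sup>+z. (\<Sum>i\<in>I. ennreal (?d powr (real N * q + q)) * ennreal (H i (y - z) powr q)) \<partial>lborel)"
    proof (rule nn_integral_mono)
      fix z
      have "g z powr q = (?d ^ N) powr q * (\<Sum>i\<in>I. H i (y - z)) powr q"
        unfolding g_def using H0 by (simp add: powr_mult sum_nonneg)
      also have "\<dots> \<le> (?d ^ N) powr q * (?d powr q * (\<Sum>i\<in>I. H i (y - z) powr q))"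
        using powr_sum_le[OF I(1,2), of "\<lambda>i. H i (y - z)" q] H0 q2 I(3) by (intro mult_left_mono) auto
      also have "\<dots> = (\<Sum>i\<in>I. ?d powr (real N * q + q) * H i (y - z) powr q)"
      proof -
        have "(?d ^ N) powr q = ?d powr (real N * q)"
          using powr_realpow[of ?d N] by (simp only: powr_powr[symmetric])
        then show ?thesis by (simp add: powr_add sum_distrib_left mult.assoc)
      qed
      finally have "ennreal (g z powr q) \<le> ennreal (\<Sum>i\<in>I. ?d powr (real N * q + q) * H i (y - z) powr q)"
        by (rule ennreal_leI)
      then show "ennreal (g z powr q) \<le> (\<Sum>i\<in>I. ennreal (?d powr (real N * q + q)) * ennreal (H i (y - z) powr q))"
        by (subst (asm) sum_ennreal[symmetric]) (auto simp: ennreal_mult)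
    qed
    also have "\<dots> = (\<Sum>i\<in>I. ennreal (?d powr (real N * q + q)) * (\<integral>\<^sup>+z. ennreal (H i (y - z) powr q) \<partial>lborel))"
      by (subst nn_integral_sum) (auto simp: nn_integral_cmult)
    also have "\<dots> \<le> (\<Sum>i\<in>I. ennreal (?d powr (real N * q + q)) * ennreal T)"
    proof (intro sum_mono mult_left_mono)
      fix i assume i: "i \<in> I"
      have "(\<integral>\<^sup>+z. ennreal (H i (y - z) powr q) \<partial>lborel) = (\<integral>\<^sup>+z. ennreal (H i z powr q) \<partial>lborel)"
        using i by (intro nn_integral_lborel_reflect[of "\<lambda>z. ennreal (H i z powr q)" y]) measurable
      also have "\<dots> \<le> ennreal T" by (rule HT[OF i])
      finally show "(\<integral>\<^sup>+z. ennreal (H i (y - z) powr q) \<partial>lborel) \<le> ennreal T" .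
    qed auto
    also have "\<dots> = ennreal (\<Sum>i\<in>I. ?d powr (real N * q + q) * T)"
      using T0 by (subst sum_ennreal[symmetric]) (auto simp: ennreal_mult)
    also have "(\<Sum>i\<in>I. ?d powr (real N * q + q) * T) = G"
      unfolding G_def powr_add[of _ _ 1] using I(3) by simp
    finally show ?thesis .
  qed
  have "ennreal (norm (fmult F b y)) \<le> (\<integral>\<^sup>+z. norm (F z * ft b (y - z)) \<partial>lborel)"
    unfolding fmult_eq_convolution[OF F b] by (rule norm_integral_le_nn_integral)
  also have "\<dots> \<le> (\<integral>\<^sup>+z. ennreal (f z * g z) \<partial>lborel)"
  proof (intro nn_integral_mono ennreal_leI)
    fix z
    have "norm (F z * ft b (y - z)) = f z * ((1 + \<kappa> * norm (y - z)) ^ N * norm (ft b (y - z)))"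
      unfolding f_def using wpos[of z] by (simp add: norm_mult dist_norm powr_minus powr_realpow field_simps)
    also have "\<dots> \<le> f z * g z"
      unfolding g_def by (intro mult_left_mono wH) (auto simp: f_def)
    finally show "norm (F z * ft b (y - z)) \<le> f z * g z" .
  qed
  also have "\<dots> \<le> ennreal (P powr (1 / r) * G powr (1 / q))"
    by (rule nn_integral_holder[where p = r and q = q])
       (use r q2 pq P0 G0 fP gG H0 in \<open>auto simp: f_def g_def intro!: sum_nonneg mult_nonneg_nonneg\<close>)
  finally have main: "norm (fmult F b y) \<le> P powr (1 / r) * G powr (1 / q)" by (simp add: ennreal_le_iff)
  have "G powr (1 / q) = ?d powr ((real N * q + q + 1) / q) * T powr (1 / q)"
    unfolding G_def using T0 by (simp add: powr_mult powr_powr)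
  also have "?d powr ((real N * q + q + 1) / q) \<le> ?d powr real (N + 2)"
    using q2 by (intro powr_mono) (auto simp: field_simps)
  finally have "G powr (1 / q) \<le> ?d powr real (N + 2) * T powr (1 / q)" by (simp add: mult_right_mono)
  also have "?d powr real (N + 2) = ?d ^ (N + 2)" by (rule powr_realpow) simp
  finally have G': "G powr (1 / q) \<le> ?d ^ (N + 2) * T powr (1 / q)" .
  have "P powr (1 / r) = \<kappa> powr (- real DIM('a) / r) * Phi r (real N * r) \<kappa> F y powr (1 / r)"
    unfolding P_def using \<kappa> Phi_nonneg[of \<kappa>] by (simp add: powr_mult powr_powr)
  with main mult_left_mono[OF G', of "P powr (1 / r)"] show ?thesis
    unfolding T_def by (simp add: mult_ac)
qed

text \<open>Smoothness at scale 1/\<mu> and support in the ball of radius \<rho>. Here \<rho> is a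
  radius, not the exponent of the symbol class: for a piece at frequency R it is a multiple of R,
  while \<mu> is R to the power minus the exponent.\<close>

definition symb :: "nat \<Rightarrow> real \<Rightarrow> real \<Rightarrow> real \<Rightarrow> ('a::euclidean_space \<Rightarrow> complex) \<Rightarrow> bool" where
  "symb N A \<mu> \<rho> b \<longleftrightarrow> (\<forall>\<beta>\<in>Basis. \<exists>D. derseq N \<beta> D \<and> D 0 = b \<and>
     (\<forall>j\<le>N. \<forall>\<xi>. norm (D j \<xi>) \<le> A * \<mu> ^ j \<and> (\<rho> < norm \<xi> \<longrightarrow> D j \<xi> = 0)))"

lemma integrable_bounded_support:
  fixes b :: "'a::euclidean_space \<Rightarrow> complex"
  assumes [measurable]: "b \<in> borel_measurable borel" and \<rho>: "0 \<le> \<rho>"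
    and bd: "\<And>\<xi>. norm (b \<xi>) \<le> A" and supp: "\<And>\<xi>. \<rho> < norm \<xi> \<Longrightarrow> b \<xi> = 0"
  shows "integrable lborel b" "(\<integral>\<xi>. norm (b \<xi>) \<partial>lborel) \<le> A * (2 * \<rho>) ^ DIM('a)"
    "(\<integral>\<^sup>+\<xi>. ennreal ((norm (b \<xi>))\<^sup>2) \<partial>lborel) \<le> ennreal (A\<^sup>2 * (2 * \<rho>) ^ DIM('a))"
proof -
  have A: "0 \<le> A" using bd[of 0] by (rule order_trans[rotated]) simp
  have gen: "(\<integral>\<^sup>+\<xi>. ennreal (u \<xi>) \<partial>lborel) \<le> ennreal (B * (2 * \<rho>) ^ DIM('a))"
    if "\<And>\<xi>. u \<xi> \<le> B" "\<And>\<xi>. \<rho> < norm \<xi> \<Longrightarrow> u \<xi> = 0" "0 \<le> B" for u :: "'a \<Rightarrow> real" and B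
  proof -
    have "(\<integral>\<^sup>+\<xi>. ennreal (u \<xi>) \<partial>lborel) \<le> (\<integral>\<^sup>+\<xi>. ennreal B * indicator (cball (0::'a) \<rho>) \<xi> \<partial>lborel)"
      by (intro nn_integral_mono) (use that in \<open>auto split: split_indicator intro!: ennreal_leI simp: not_le\<close>)
    also have "\<dots> = ennreal B * emeasure lborel (cball (0::'a) \<rho>)"
      by (rule nn_integral_cmult_indicator) simp
    also have "\<dots> \<le> ennreal B * ennreal ((2 * \<rho>) ^ DIM('a))"
      by (intro mult_left_mono emeasure_cball_le \<rho>) auto
    finally show ?thesis using that \<rho> by (simp add: ennreal_mult)
  qed
  have *: "(\<integral>\<^sup>+\<xi>. ennreal (norm (b \<xi>)) \<partial>lborel) \<le> ennreal (A * (2 * \<rho>) ^ DIM('a))"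
    by (rule gen) (use bd supp A in auto)
  then show int: "integrable lborel b"
    by (intro integrableI_bounded) (auto simp: less_top[symmetric] top_unique)
  show "(\<integral>\<xi>. norm (b \<xi>) \<partial>lborel) \<le> A * (2 * \<rho>) ^ DIM('a)"
    using * A \<rho> int by (subst (asm) nn_integral_eq_integral) (auto simp: ennreal_le_iff)
  show "(\<integral>\<^sup>+\<xi>. ennreal ((norm (b \<xi>))\<^sup>2) \<partial>lborel) \<le> ennreal (A\<^sup>2 * (2 * \<rho>) ^ DIM('a))"
    by (rule gen) (use bd supp A in \<open>auto intro!: power_mono\<close>)
qed

text \<open>For a symbol of size A on a ball of radius \<rho> the hypotheses of
  \<open>fmult_bound\<close> hold with A1 = A (2\<rho>)^d and A2 = A^2 (2\<rho>)^d, and (A1^(q-2)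
  A2)^(1/q) = A (2\<rho>)^(d/r) because (q-1)/q = 1/r.\<close>

lemma symb_fmult_bound:
  fixes F b :: "'a::euclidean_space \<Rightarrow> complex"
  assumes r: "1 < r" "r \<le> 2" and \<kappa>: "0 < \<kappa>" and A: "0 < A" and \<rho>: "0 < \<rho>"
    and F: "integrable lborel F" and Fr: "integrable lborel (\<lambda>z. norm (F z) powr r)"
    and symb: "symb N A (1 / \<kappa>) \<rho> b"
  shows "norm (fmult F b y) \<le> real (DIM('a) + 1) ^ (N + 2) *
     (A * (2 * \<rho> / \<kappa>) powr (real DIM('a) / r) * Phi r (real N * r) \<kappa> F y powr (1 / r))"
proof -
  define q where "q = r / (r - 1)"
  have q0: "q \<noteq> 0" and qr: "(q - 1) / q = 1 / r" using r by (auto simp: q_def field_simps)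
  obtain D where D: "\<And>\<beta>. \<beta> \<in> Basis \<Longrightarrow> derseq N \<beta> (D \<beta>)" "\<And>\<beta>. \<beta> \<in> Basis \<Longrightarrow> D \<beta> 0 = b"
    "\<And>\<beta> j \<xi>. \<beta> \<in> Basis \<Longrightarrow> j \<le> N \<Longrightarrow> norm (D \<beta> j \<xi>) \<le> A * (1 / \<kappa>) ^ j"
    "\<And>\<beta> j \<xi>. \<beta> \<in> Basis \<Longrightarrow> j \<le> N \<Longrightarrow> \<rho> < norm \<xi> \<Longrightarrow> D \<beta> j \<xi> = 0"
    using bchoice[OF symb[unfolded symb_def]] by blast
  note Dint = integrable_bounded_support[OF derseq_measurable[OF D(1)] less_imp_le[OF \<rho>] D(3) D(4)]
  obtain \<beta>0 :: 'a where \<beta>0: "\<beta>0 \<in> Basis" using nonempty_Basis by blast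
  define A1 A2 where "A1 = A * (2 * \<rho>) ^ DIM('a)" and "A2 = A\<^sup>2 * (2 * \<rho>) ^ DIM('a)"
  have "norm (fmult F b y) \<le> real (DIM('a) + 1) ^ (N + 2) * (A1 powr (q - 2) * A2) powr (1 / q)
      * (\<kappa> powr (- real DIM('a) / r) * Phi r (real N * r) \<kappa> F y powr (1 / r))"
  proof (rule fmult_bound[OF r q_def \<kappa> F Fr, where bb = "\<lambda>\<beta>. D \<beta> N"])
    show "integrable lborel b" using Dint(1)[of \<beta>0 0] \<beta>0 D(2) by simp
    show "integrable lborel (D \<beta> N)" if "\<beta> \<in> Basis" for \<beta> by (rule Dint) (use that in auto)
    show "norm (ft (D \<beta> N) y) = (2 * pi * \<bar>\<beta> \<bullet> y\<bar>) ^ N * norm (ft b y)" if "\<beta> \<in> Basis" for \<beta> y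
    proof (rule norm_ft_iterated_derivative)
      have "integrable lborel (D \<beta> j)" if "j \<le> N" for j by (rule Dint(1)) (use that \<open>\<beta> \<in> Basis\<close> in auto)
      from ft_iterated_derivative[OF D(1)[OF that] this, of y]
      show "ft (D \<beta> N) y = (- (2 * pi * \<i> * (\<beta> \<bullet> y))) ^ N * ft b y" unfolding D(2)[OF that] .
    qed
    show "0 < A1" "0 < A2" using A \<rho> by (auto simp: A1_def A2_def)
    show "(\<integral>\<xi>. norm (b \<xi>) \<partial>lborel) \<le> A1" "(\<integral>\<^sup>+\<xi>. ennreal ((norm (b \<xi>))\<^sup>2) \<partial>lborel) \<le> ennreal A2"
      using Dint(2,3)[of \<beta>0 0] \<beta>0 D(2) by (simp_all add: A1_def A2_def)
    fix \<beta> :: 'a assume \<beta>: "\<beta> \<in> Basis"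
    show "\<kappa> ^ N * (\<integral>\<xi>. norm (D \<beta> N \<xi>) \<partial>lborel) \<le> A1"
      using mult_left_mono[OF Dint(2)[of \<beta> N], of "\<kappa> ^ N"] \<beta> \<kappa> by (simp add: A1_def power_divide)
    have "\<kappa> ^ N * norm (D \<beta> N \<xi>) \<le> A" for \<xi>
      using mult_left_mono[OF D(3)[OF \<beta>, of N \<xi>], of "\<kappa> ^ N"] \<kappa> by (simp add: power_divide)
    then have "(\<integral>\<^sup>+\<xi>. ennreal ((norm (complex_of_real (\<kappa> ^ N) * D \<beta> N \<xi>))\<^sup>2) \<partial>lborel) \<le> ennreal A2"
      unfolding A2_def using \<kappa> D(4)[OF \<beta>] derseq_measurable[OF D(1)[OF \<beta>], of N] \<rho>
      by (intro integrable_bounded_support(3)) (auto simp: norm_mult norm_power)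
    then show "(\<integral>\<^sup>+\<xi>. ennreal ((\<kappa> ^ N * norm (D \<beta> N \<xi>))\<^sup>2) \<partial>lborel) \<le> ennreal A2"
      using \<kappa> by (simp add: norm_mult norm_power)
  qed
  also have "(A1 powr (q - 2) * A2) powr (1 / q) = A * (2 * \<rho>) powr (real DIM('a) / r)"
  proof -
    define X where "X = (2 * \<rho>) powr real DIM('a)"
    have X: "0 < X" "(2 * \<rho>) ^ DIM('a) = X" using \<rho> by (auto simp: X_def powr_realpow)
    have "A1 powr (q - 2) * A2 = (A powr (q - 2) * A powr 2) * (X powr (q - 2) * X powr 1)"
      unfolding A1_def A2_def X(2) using A X(1) by (simp add: powr_mult)
    also have "\<dots> = A powr q * X powr (q - 1)"
      unfolding powr_add[symmetric] by simp
    finally have "(A1 powr (q - 2) * A2) powr (1 / q) = A powr (q / q) * X powr ((q - 1) / q)"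
      using A X by (simp add: powr_mult powr_powr)
    also have "X powr ((q - 1) / q) = (2 * \<rho>) powr (real DIM('a) / r)"
      unfolding qr X_def powr_powr by simp
    finally have "(A1 powr (q - 2) * A2) powr (1 / q) = A powr (q / q) * (2 * \<rho>) powr (real DIM('a) / r)" .
    then show ?thesis using q0 A by simp
  qed
  also have "real (DIM('a) + 1) ^ (N + 2) * (A * (2 * \<rho>) powr (real DIM('a) / r)) * (\<kappa> powr (- real DIM('a) / r) * Phi r (real N * r) \<kappa> F y powr (1 / r))
     = real (DIM('a) + 1) ^ (N + 2) * (A * (2 * \<rho> / \<kappa>) powr (real DIM('a) / r) * Phi r (real N * r) \<kappa> F y powr (1 / r))"
  proof -
    have "(2 * \<rho> / \<kappa>) powr (real DIM('a) / r) = (2 * \<rho>) powr (real DIM('a) / r) * \<kappa> powr (- real DIM('a) / r)"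
      using \<rho> \<kappa> powr_minus_divide[of \<kappa> "real DIM('a) / r"]
      by (subst powr_divide) auto
    then show ?thesis by (simp only: mult_ac)
  qed
  finally show ?thesis .
qed


section \<open>Averages over small cubes\<close>

text \<open>The multilinear operator is a linear one on \<open>real^'n^'l\<close> restricted to the
  diagonal; \<open>vsum\<close> is the adjoint of \<open>diag\<close>, by
  \<open>inner_diag\<close>.\<close>

definition diag :: "real^'n \<Rightarrow> real^'n^'l" where
  "diag x = (\<chi> j. x)"

definition vsum :: "real^'n^'l \<Rightarrow> real^'n" where
  "vsum \<xi> = (\<Sum>j\<in>UNIV. \<xi> $ j)"

lemma inner_diag: "\<xi> \<bullet> diag x = x \<bullet> vsum \<xi>"
  unfolding diag_def vsum_def inner_sum_right by (subst inner_vec_def) (simp add: inner_commute)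

lemma diag_diff: "diag (x - y) = diag x - diag y"
  by (simp add: diag_def vec_eq_iff)

lemma continuous_on_diag [continuous_intros]: "continuous_on S f \<Longrightarrow> continuous_on S (\<lambda>x. diag (f x))"
  unfolding diag_def by (intro continuous_intros)

lemma continuous_on_vsum [continuous_intros]: "continuous_on S f \<Longrightarrow> continuous_on S (\<lambda>x. vsum (f x))"
  unfolding vsum_def by (intro continuous_intros)

lemma diag_measurable [measurable (raw)]:
  "f \<in> borel_measurable M \<Longrightarrow> (\<lambda>x. diag (f x)) \<in> borel_measurable M"
  by (rule measurable_compose[OF _ borel_measurable_continuous_onI]) (auto intro!: continuous_intros)

lemma vsum_measurable [measurable (raw)]:
  "f \<in> borel_measurable M \<Longrightarrow> (\<lambda>x. vsum (f x)) \<in> borel_measurable M"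
  by (rule measurable_compose[OF _ borel_measurable_continuous_onI]) (auto intro!: continuous_intros)

lemma cball_measurable [measurable]: "cball (a :: 'a::euclidean_space) e \<in> sets borel"
  by simp

lemma abs_diag_inner_Basis_le:
  fixes \<beta> :: "real^'n^'l"
  assumes \<beta>: "\<beta> \<in> Basis" and x: "x \<in> cube a s"
  shows "\<bar>\<beta> \<bullet> diag (x - a)\<bar> \<le> s"
proof -
  obtain j v where v: "v \<in> Basis" "\<beta> = axis j v" using \<beta> by (auto simp: Basis_vec_def)
  have "\<beta> \<bullet> diag (x - a) = v \<bullet> (x - a)" unfolding v by (simp add: inner_axis' diag_def)
  moreover have "a \<bullet> v \<le> x \<bullet> v" "x \<bullet> v \<le> (a + s *\<^sub>R One) \<bullet> v"
    using x v by (auto simp: cube_def mem_box)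
  moreover have "(a + s *\<^sub>R One) \<bullet> v = a \<bullet> v + s" using v by (simp add: inner_add_left)
  ultimately show ?thesis by (simp add: inner_diff_right inner_commute)
qed

lemma emeasure_cube: "0 \<le> s \<Longrightarrow> emeasure lborel (cube (a :: real^'n) s) = ennreal (s ^ CARD('n))"
  unfolding cube_def by (subst emeasure_lborel_cbox) (auto simp: inner_add_left)

lemma cube_measurable [measurable, simp]: "cube a s \<in> sets borel"
  unfolding cube_def by simp

text \<open>Averaging over translations of one component of \<open>\<xi>\<close> replaces a change of variables.\<close>
lemma nn_integral_ball_vsum_le:
  fixes h :: "real^'n \<Rightarrow> ennreal"
  assumes h [measurable]: "h \<in> borel_measurable borel" and \<rho>: "0 < \<rho>"
  shows "(\<integral>\<^sup>+\<xi>. indicator (cball (0 :: real^'n^'l) \<rho>) \<xi> * h (vsum \<xi>) \<partial>lborel)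
    \<le> ennreal ((4 * \<rho>) ^ DIM(real^'n^'l) * (real CARD('n) / \<rho>) ^ CARD('n)) * (\<integral>\<^sup>+y. h y \<partial>lborel)"
proof -
  let ?L = "\<integral>\<^sup>+\<xi>. indicator (cball (0 :: real^'n^'l) \<rho>) \<xi> * h (vsum \<xi>) \<partial>lborel"
  \<comment> \<open>A vector of the cube of side \<open>c\<close> at the origin has norm at most
    \<rho>, as each of its n coordinates is at most \<rho>/n.\<close>
  define c where "c = \<rho> / real CARD('n)"
  have c: "0 < c" using \<rho> by (simp add: c_def)
  \<comment> \<open>An arbitrary component. Shifting it by \<open>v\<close> moves
    \<open>vsum \<xi>\<close> by \<open>v\<close> and leaves \<xi> in the ball of twice the
    radius.\<close>
  obtain j0 :: 'l where True by simp
  have sub: "?L \<le> (\<integral>\<^sup>+\<xi>. indicator (cball (0 :: real^'n^'l) (2 * \<rho>)) \<xi> * h (v + vsum \<xi>) \<partial>lborel)"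
    if v: "v \<in> cube 0 c" for v
  proof -
    have "norm v \<le> (\<Sum>i\<in>Basis. \<bar>v \<bullet> i\<bar>)" by (rule norm_le_l1)
    also have "\<dots> \<le> (\<Sum>i\<in>(Basis :: (real^'n) set). c)"
    proof (rule sum_mono)
      fix i :: "real^'n" assume "i \<in> Basis"
      then show "\<bar>v \<bullet> i\<bar> \<le> c" using v by (auto simp: cube_def mem_box)
    qed
    also have "\<dots> = \<rho>" by (simp add: c_def)
    finally have nv: "norm v \<le> \<rho>" .
    have "?L = (\<integral>\<^sup>+\<xi>. indicator (cball (0 :: real^'n^'l) \<rho>) (axis j0 v + \<xi>) * h (vsum (axis j0 v + \<xi>)) \<partial>lborel)"
      by (rule nn_integral_lborel_translate[symmetric])
         (intro borel_measurable_times_ennreal borel_measurable_indicator measurable_compose[OF vsum_measurable h]; simp)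
    also have "\<dots> \<le> (\<integral>\<^sup>+\<xi>. indicator (cball (0 :: real^'n^'l) (2 * \<rho>)) \<xi> * h (v + vsum \<xi>) \<partial>lborel)"
    proof (rule nn_integral_mono)
      fix \<xi> :: "real^'n^'l"
      have "vsum (axis j0 v + \<xi>) = v + vsum \<xi>"
        unfolding vsum_def vector_add_component sum.distrib by (simp add: axis_def)
      moreover have "\<xi> \<in> cball 0 (2 * \<rho>)" if "axis j0 v + \<xi> \<in> cball 0 \<rho>"
      proof -
        have "norm \<xi> \<le> norm (axis j0 v + \<xi>) + norm (axis j0 v)" using norm_triangle_ineq4[of "axis j0 v + \<xi>" "axis j0 v"] by simp
        moreover have "norm (axis j0 v) = norm v" by (simp add: norm_eq_sqrt_inner inner_axis_axis)
        ultimately show ?thesis using that nv by simp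
      qed
      ultimately show "indicator (cball 0 \<rho>) (axis j0 v + \<xi>) * h (vsum (axis j0 v + \<xi>)) \<le> indicator (cball 0 (2 * \<rho>)) \<xi> * h (v + vsum \<xi>)"
        by (auto split: split_indicator)
    qed
    finally show ?thesis .
  qed
  have "ennreal (c ^ CARD('n)) * ?L = (\<integral>\<^sup>+v. ?L * indicator (cube (0::real^'n) c) v \<partial>lborel)"
    using c by (subst nn_integral_cmult_indicator) (auto simp: emeasure_cube mult.commute)
  also have "\<dots> \<le> (\<integral>\<^sup>+v. (\<integral>\<^sup>+\<xi>. indicator (cball (0 :: real^'n^'l) (2 * \<rho>)) \<xi> * h (v + vsum \<xi>) \<partial>lborel) \<partial>lborel)"
    using sub by (intro nn_integral_mono) (auto split: split_indicator)
  also have "\<dots> = (\<integral>\<^sup>+\<xi>. (\<integral>\<^sup>+v. indicator (cball (0 :: real^'n^'l) (2 * \<rho>)) \<xi> * h (v + vsum \<xi>) \<partial>lborel) \<partial>lborel)"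
    by (rule lborel_pair.Fubini') measurable
  also have "\<dots> = (\<integral>\<^sup>+\<xi>. (\<integral>\<^sup>+y. h y \<partial>lborel) * indicator (cball (0 :: real^'n^'l) (2 * \<rho>)) \<xi> \<partial>lborel)"
  proof (rule nn_integral_cong)
    fix \<xi> :: "real^'n^'l"
    have "(\<integral>\<^sup>+v. h (v + vsum \<xi>) \<partial>lborel) = (\<integral>\<^sup>+y. h y \<partial>lborel)"
      using nn_integral_lborel_translate[OF h, of "vsum \<xi>"] by (simp add: add.commute)
    then show "(\<integral>\<^sup>+v. indicator (cball (0 :: real^'n^'l) (2 * \<rho>)) \<xi> * h (v + vsum \<xi>) \<partial>lborel) = (\<integral>\<^sup>+y. h y \<partial>lborel) * indicator (cball 0 (2 * \<rho>)) \<xi>"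
      by (subst nn_integral_cmult) (auto simp: mult.commute)
  qed
  also have "\<dots> = (\<integral>\<^sup>+y. h y \<partial>lborel) * emeasure lborel (cball (0 :: real^'n^'l) (2 * \<rho>))"
    by (rule nn_integral_cmult_indicator) simp
  also have "\<dots> \<le> (\<integral>\<^sup>+y. h y \<partial>lborel) * ennreal ((2 * (2 * \<rho>)) ^ DIM(real^'n^'l))"
    using \<rho> by (intro mult_left_mono emeasure_cball_le) auto
  finally have main: "ennreal (c ^ CARD('n)) * ?L \<le> (\<integral>\<^sup>+y. h y \<partial>lborel) * ennreal ((2 * (2 * \<rho>)) ^ DIM(real^'n^'l))" .
  have inv: "(1 / c) ^ CARD('n) * c ^ CARD('n) = 1" using c by (simp add: power_mult_distrib[symmetric])
  have "?L = ennreal ((1 / c) ^ CARD('n)) * (ennreal (c ^ CARD('n)) * ?L)"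
    unfolding mult.assoc[symmetric] using c inv by (simp add: ennreal_mult[symmetric])
  also have "\<dots> \<le> ennreal ((1 / c) ^ CARD('n)) * ((\<integral>\<^sup>+y. h y \<partial>lborel) * ennreal ((2 * (2 * \<rho>)) ^ DIM(real^'n^'l)))"
    by (intro mult_left_mono main) simp
  also have "\<dots> = ennreal ((4 * \<rho>) ^ DIM(real^'n^'l) * (real CARD('n) / \<rho>) ^ CARD('n)) * (\<integral>\<^sup>+y. h y \<partial>lborel)"
    using \<rho> by (subst ennreal_mult) (auto simp: c_def mult_ac)
  finally show ?thesis .
qed

section \<open>Duality on a small cube\<close>

lemma derseq_cis:
  fixes v :: "'a::euclidean_space"
  shows "derseq N \<beta> (\<lambda>j \<xi>. (2 * pi * \<i> * (\<beta> \<bullet> v)) ^ j * cis (2 * pi * (\<xi> \<bullet> v)))"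
  unfolding derseq_def
proof (intro conjI allI impI)
  fix j \<xi>
  show "continuous_on UNIV (\<lambda>\<xi>. (2 * pi * \<i> * (\<beta> \<bullet> v)) ^ j * cis (2 * pi * (\<xi> \<bullet> v)))"
    by (intro continuous_intros)
  have "((\<lambda>t. (2 * pi * \<i> * (\<beta> \<bullet> v)) ^ j * cis (2 * pi * ((\<xi> + t *\<^sub>R \<beta>) \<bullet> v))) has_vector_derivative
      (2 * pi * \<i> * (\<beta> \<bullet> v)) ^ j * ((2 * pi * \<i> * (\<beta> \<bullet> v)) * cis (2 * pi * ((\<xi> + 0 *\<^sub>R \<beta>) \<bullet> v)))) (at 0)"
    by (intro has_vector_derivative_mult_right cis_line_derivative)
  then show "((\<lambda>t. (2 * pi * \<i> * (\<beta> \<bullet> v)) ^ j * cis (2 * pi * ((\<xi> + t *\<^sub>R \<beta>) \<bullet> v))) has_vector_derivative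
      (2 * pi * \<i> * (\<beta> \<bullet> v)) ^ Suc j * cis (2 * pi * (\<xi> \<bullet> v))) (at 0)"
    unfolding power_Suc2 mult.assoc scaleR_zero_left add_0_right .
qed

lemma sum_power2_le:
  fixes a :: "nat \<Rightarrow> real"
  shows "(\<Sum>i\<le>N. a i)\<^sup>2 \<le> real (N + 1) * (\<Sum>i\<le>N. (a i)\<^sup>2)"
  using Cauchy_Schwarz_ineq_sum[of "\<lambda>_. 1" a "{..N}"] by simp

text \<open>Interchanging the integrals turns the left side into \<open>fmult\<close> at the single
  point \<open>diag a\<close>, with the multiplier \<tau>(\<xi>) times the integral over x of g(x)
  exp(2 \<pi> i \<xi> . diag(x - a)). Its supremum is at most of order A s^n; Plancherel on
  \<open>real^'n\<close> bounds its square integral by order A^2 \<rho>^(d-n) s^n, where the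
  supremum alone would give A^2 \<rho>^d s^(2n). The condition \<open>s * \<kappa> \<le> 1\<close>
  keeps the exponential smooth at the scale \<kappa>, so that \<open>fmult_bound\<close>
  applies.\<close>

lemma fmult_dual_bound:
  fixes F \<tau> :: "real^'n^'l \<Rightarrow> complex" and g :: "real^'n \<Rightarrow> complex"
  assumes r: "1 < r" "r \<le> 2" and q: "q = r / (r - 1)"
    and \<kappa>: "0 < \<kappa>" and A: "0 < A" and \<rho>: "0 < \<rho>" and s: "0 < s" "s * \<kappa> \<le> 1"
    and F: "integrable lborel F" and Fr: "integrable lborel (\<lambda>z. norm (F z) powr r)"
    and symb: "symb N A (1 / \<kappa>) \<rho> \<tau>"
    and g [measurable]: "g \<in> borel_measurable borel" and g1: "\<And>x. norm (g x) \<le> indicator (cube a s) x"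
  shows "norm (\<integral>x. g x * fmult F \<tau> (diag x) \<partial>lborel) \<le> real (DIM(real^'n^'l) + 1) ^ (N + 2) *
     ((A * 14 ^ N * s ^ CARD('n) * (2 * \<rho>) ^ DIM(real^'n^'l)) powr (q - 2) *
      (A\<^sup>2 * (real (N + 1))\<^sup>2 * 200 ^ N * ((4 * \<rho>) ^ DIM(real^'n^'l) * (real CARD('n) / \<rho>) ^ CARD('n)) * s ^ CARD('n))) powr (1 / q)
     * (\<kappa> powr (- real DIM(real^'n^'l) / r) * Phi r (real N * r) \<kappa> F (diag a) powr (1 / r))"
proof -
  let ?P = "cube a s" and ?d = "DIM(real^'n^'l)" and ?n = "CARD('n)"
  obtain D where D: "\<And>\<beta>. \<beta> \<in> Basis \<Longrightarrow> derseq N \<beta> (D \<beta>)" "\<And>\<beta>. \<beta> \<in> Basis \<Longrightarrow> D \<beta> 0 = \<tau>"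
    "\<And>\<beta> j \<xi>. \<beta> \<in> Basis \<Longrightarrow> j \<le> N \<Longrightarrow> norm (D \<beta> j \<xi>) \<le> A * (1 / \<kappa>) ^ j"
    "\<And>\<beta> j \<xi>. \<beta> \<in> Basis \<Longrightarrow> j \<le> N \<Longrightarrow> \<rho> < norm \<xi> \<Longrightarrow> D \<beta> j \<xi> = 0"
    using bchoice[OF symb[unfolded symb_def]] by blast
  have Dm: "D \<beta> j \<in> borel_measurable borel" if "\<beta> \<in> Basis" "j \<le> N" for \<beta> j
    using derseq_measurable[OF D(1)] that by auto
  obtain \<beta>0 :: "real^'n^'l" where \<beta>0: "\<beta>0 \<in> Basis" using nonempty_Basis by blast
  have "integrable lborel (D \<beta>0 0)"
    by (rule integrable_bounded_support(1)[OF Dm less_imp_le[OF \<rho>] D(3) D(4)]) (use \<beta>0 in auto)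
  then have \<tau>: "integrable lborel \<tau>" using \<beta>0 D(2) by simp
  have [measurable]: "\<tau> \<in> borel_measurable borel" "F \<in> borel_measurable borel" using \<tau> F by auto
  have "integrable lborel (\<lambda>x. complex_of_real (indicator ?P x))"
    using s emeasure_cube[of s a] by (intro integrable_of_real) simp
  then have gint: "integrable lborel g"
    by (rule Bochner_Integration.integrable_bound) (use g1 in auto)
  have gsupp: "g x = 0" if "x \<notin> ?P" for x using g1[of x] that by simp
  have s\<kappa>: "s \<le> 1 / \<kappa>" using s \<kappa> by (simp add: field_simps)
  \<comment> \<open>\<open>E \<beta> x j\<close> is the j-th derivative along \<beta> of the
    exponential centred at \<open>diag a\<close>; centring is what bounds |\<beta> . diag(x - a)| by
    s, hence by 1/\<kappa>.\<close>
  define E where "E \<beta> x j \<xi> = (2 * pi * \<i> * (\<beta> \<bullet> diag (x - a))) ^ j * cis (2 * pi * (\<xi> \<bullet> diag (x - a)))" for \<beta> \<xi> :: "real^'n^'l" and x j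
  have E_norm: "norm (E \<beta> x j \<xi>) = (2 * pi * \<bar>\<beta> \<bullet> diag (x - a)\<bar>) ^ j" for \<beta> x j \<xi>
    by (simp add: E_def norm_mult norm_power)
  have E_bd: "norm (E \<beta> x j \<xi>) \<le> 7 ^ N * (1 / \<kappa>) ^ j" if "\<beta> \<in> Basis" "x \<in> ?P" "j \<le> N" for \<beta> x j \<xi>
  proof -
    have "(2 * pi * \<bar>\<beta> \<bullet> diag (x - a)\<bar>) ^ j \<le> (7 * (1 / \<kappa>)) ^ j"
      using abs_diag_inner_Basis_le[OF that(1,2)] s\<kappa> pi_less_4 pi_approx(2) by (intro power_mono mult_mono) auto
    also have "\<dots> \<le> 7 ^ N * (1 / \<kappa>) ^ j"
      unfolding power_mult_distrib using that \<kappa> by (intro mult_right_mono power_increasing) auto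
    finally show ?thesis unfolding E_norm .
  qed
  have Eder: "derseq N \<beta> (E \<beta> x)" for \<beta> x unfolding E_def by (rule derseq_cis)
  define L where "L \<beta> j x \<xi> = leibniz (D \<beta>) (E \<beta> x) j \<xi>" for \<beta> j x \<xi>
  have Lder: "derseq N \<beta> (\<lambda>j. L \<beta> j x)" if "\<beta> \<in> Basis" for \<beta> x
    using derseq_leibniz[OF D(1)[OF that] Eder] unfolding L_def by simp
  \<comment> \<open>The 7 in \<open>E_bd\<close> bounds 2 \<pi>; in 14 = 2 * 7 the 2 is the factor
    of the Leibniz rule.\<close>
  have L_bd: "norm (L \<beta> j x \<xi>) \<le> A * 14 ^ N * (1 / \<kappa>) ^ j" if "\<beta> \<in> Basis" "x \<in> ?P" "j \<le> N" for \<beta> j x \<xi>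
  proof -
    have "norm (L \<beta> j x \<xi>) \<le> 2 ^ j * (A * 7 ^ N) * (1 / \<kappa>) ^ j"
      unfolding L_def by (rule norm_leibniz_le) (use that D(3) E_bd A \<kappa> in auto)
    also have "\<dots> \<le> 2 ^ N * (A * 7 ^ N) * (1 / \<kappa>) ^ j"
      using that A \<kappa> by (intro mult_right_mono power_increasing) auto
    also have "\<dots> = A * (2 * 7) ^ N * (1 / \<kappa>) ^ j" by (simp only: power_mult_distrib mult_ac)
    finally show ?thesis by simp
  qed
  have L_supp: "L \<beta> j x \<xi> = 0" if "\<beta> \<in> Basis" "\<rho> < norm \<xi>" "j \<le> N" for \<beta> j x \<xi>
    unfolding L_def leibniz_def using D(4) that by (intro sum.neutral) auto
  have L_meas: "(\<lambda>(x, \<xi>). L \<beta> j x \<xi>) \<in> borel_measurable (borel \<Otimes>\<^sub>M borel)" if "\<beta> \<in> Basis" "j \<le> N" for \<beta> j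
  proof -
    have [measurable]: "D \<beta> (j - i) \<in> borel_measurable borel" for i using Dm[OF that(1), of "j - i"] that by simp
    show ?thesis unfolding L_def leibniz_def E_def by measurable
  qed
  define bb where "bb \<beta> j \<xi> = (\<integral>x. g x * L \<beta> j x \<xi> \<partial>lborel)" for \<beta> j \<xi>
  have bb_meas: "bb \<beta> j \<in> borel_measurable borel" if "\<beta> \<in> Basis" "j \<le> N" for \<beta> j
  proof -
    note [measurable] = L_meas[OF that]
    have [measurable]: "(\<lambda>(\<xi>, x). L \<beta> j x \<xi>) \<in> borel_measurable (borel \<Otimes>\<^sub>M borel)"
      using measurable_pair_swap[OF L_meas[OF that]] by simp
    show ?thesis unfolding bb_def by (rule lborel.borel_measurable_lebesgue_integral) measurable
  qed
  have bb_bd: "norm (bb \<beta> j \<xi>) \<le> A * 14 ^ N * s ^ ?n * (1 / \<kappa>) ^ j" if "\<beta> \<in> Basis" "j \<le> N" for \<beta> j \<xi>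
  proof -
    have "ennreal (norm (bb \<beta> j \<xi>)) \<le> (\<integral>\<^sup>+x. norm (g x * L \<beta> j x \<xi>) \<partial>lborel)"
      unfolding bb_def by (rule norm_integral_le_nn_integral)
    also have "\<dots> \<le> (\<integral>\<^sup>+x. ennreal (A * 14 ^ N * (1 / \<kappa>) ^ j) * indicator ?P x \<partial>lborel)"
    proof (rule nn_integral_mono)
      fix x
      show "ennreal (norm (g x * L \<beta> j x \<xi>)) \<le> ennreal (A * 14 ^ N * (1 / \<kappa>) ^ j) * indicator ?P x"
      proof (cases "x \<in> ?P")
        case True
        have "norm (g x) * norm (L \<beta> j x \<xi>) \<le> 1 * (A * 14 ^ N * (1 / \<kappa>) ^ j)"
          using g1[of x] True L_bd[OF that(1) True that(2), of \<xi>] by (intro mult_mono) auto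
        then show ?thesis using True by (simp add: norm_mult ennreal_leI)
      qed (simp add: gsupp)
    qed
    also have "\<dots> = ennreal (A * 14 ^ N * (1 / \<kappa>) ^ j) * ennreal (s ^ ?n)"
      using s by (subst nn_integral_cmult_indicator) (auto simp: emeasure_cube)
    also have "\<dots> = ennreal (A * 14 ^ N * s ^ ?n * (1 / \<kappa>) ^ j)"
      using A s \<kappa> by (subst ennreal_mult[symmetric]) (auto simp: mult_ac)
    finally show ?thesis using A s \<kappa> by (simp add: ennreal_le_iff)
  qed
  have bb_supp: "bb \<beta> j \<xi> = 0" if "\<beta> \<in> Basis" "j \<le> N" "\<rho> < norm \<xi>" for \<beta> j \<xi>
    unfolding bb_def using L_supp that by simp
  have bbint: "integrable lborel (bb \<beta> j)" "(\<integral>\<xi>. norm (bb \<beta> j \<xi>) \<partial>lborel) \<le> A * 14 ^ N * s ^ ?n * (1 / \<kappa>) ^ j * (2 * \<rho>) ^ ?d"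
    if "\<beta> \<in> Basis" "j \<le> N" for \<beta> j
    using integrable_bounded_support(1,2)[OF bb_meas[OF that] less_imp_le[OF \<rho>] bb_bd[OF that] bb_supp[OF that]] by blast+
  have bb0: "bb \<beta> 0 = bb \<beta>0 0" if "\<beta> \<in> Basis" for \<beta>
    unfolding bb_def L_def leibniz_0 E_def using D(2) that \<beta>0 by simp
  have ft_bb: "ft (bb \<beta> j) y = (\<integral>x. g x * ft (L \<beta> j x) y \<partial>lborel)" if \<beta>: "\<beta> \<in> Basis" and j: "j \<le> N" for \<beta> j y
  proof -
    note [measurable] = L_meas[OF \<beta> j]
    have [measurable]: "(\<lambda>(\<xi>, x). L \<beta> j x \<xi>) \<in> borel_measurable (borel \<Otimes>\<^sub>M borel)"
      using measurable_pair_swap[OF L_meas[OF \<beta> j]] by simp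
    \<comment> \<open>The indicators of the ball and of the cube are inserted so that the
      interchange applies: \<open>?u\<close> becomes integrable and \<open>?h\<close> bounded, and
      neither changes the integrand.\<close>
    let ?u = "\<lambda>\<xi>. indicator (cball 0 \<rho>) \<xi> * cis (2 * pi * (\<xi> \<bullet> y))"
    have u: "integrable lborel ?u"
      by (rule integrable_bounded_support(1)[where \<rho> = \<rho> and A = 1]) (use \<rho> in \<open>auto simp: norm_mult indicator_def\<close>)
    let ?h = "\<lambda>\<xi> x. indicator ?P x * L \<beta> j x \<xi>"
    have "ft (bb \<beta> j) y = (\<integral>\<xi>. ?u \<xi> * (\<integral>x. g x * ?h \<xi> x \<partial>lborel) \<partial>lborel)"
      unfolding ft_def
    proof (intro Bochner_Integration.integral_cong refl)
      fix \<xi>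
      have "g x * ?h \<xi> x = g x * L \<beta> j x \<xi>" for x by (cases "x \<in> ?P") (auto simp: gsupp)
      then have "(\<integral>x. g x * ?h \<xi> x \<partial>lborel) = bb \<beta> j \<xi>" by (simp only: bb_def)
      then show "bb \<beta> j \<xi> * cis (2 * pi * (\<xi> \<bullet> y)) = ?u \<xi> * (\<integral>x. g x * ?h \<xi> x \<partial>lborel)"
        using bb_supp[OF \<beta> j, of \<xi>] by (cases "norm \<xi> \<le> \<rho>") auto
    qed
    also have "\<dots> = (\<integral>x. g x * (\<integral>\<xi>. ?u \<xi> * ?h \<xi> x \<partial>lborel) \<partial>lborel)"
    proof (rule integral_swap_bounded_kernel[where B = "A * 14 ^ N * (1 / \<kappa>) ^ j"])
      show "norm (?h \<xi> x) \<le> A * 14 ^ N * (1 / \<kappa>) ^ j" for \<xi> x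
        using L_bd[OF \<beta> _ j, of x \<xi>] A \<kappa> by (cases "x \<in> ?P") (auto simp: norm_mult)
    qed (use u gint in \<open>auto simp: lborel.sigma_finite_measure_axioms\<close>)
    also have "\<dots> = (\<integral>x. g x * ft (L \<beta> j x) y \<partial>lborel)"
    proof (intro Bochner_Integration.integral_cong refl)
      fix x
      have "(\<integral>\<xi>. ?u \<xi> * ?h \<xi> x \<partial>lborel) = ft (L \<beta> j x) y" if "x \<in> ?P"
        unfolding ft_def
      proof (intro Bochner_Integration.integral_cong refl)
        fix \<xi> show "?u \<xi> * ?h \<xi> x = L \<beta> j x \<xi> * cis (2 * pi * (\<xi> \<bullet> y))"
          using that L_supp[OF \<beta> _ j, of \<xi> x] by (cases "norm \<xi> \<le> \<rho>") auto
      qed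
      then show "g x * (\<integral>\<xi>. ?u \<xi> * ?h \<xi> x \<partial>lborel) = g x * ft (L \<beta> j x) y"
        by (cases "x \<in> ?P") (auto simp: gsupp)
    qed
    finally show ?thesis .
  qed
  \<comment> \<open>In place of differentiating \<open>bb\<close> under the integral sign, the
    relation between the transforms is taken for each fixed x and then integrated against
    \<open>g\<close>.\<close>
  have ft_rel: "ft (bb \<beta> N) y = (- (2 * pi * \<i> * (\<beta> \<bullet> y))) ^ N * ft (bb \<beta>0 0) y" if \<beta>: "\<beta> \<in> Basis" for \<beta> y
  proof -
    have "g x * ft (L \<beta> N x) y = (- (2 * pi * \<i> * (\<beta> \<bullet> y))) ^ N * (g x * ft (L \<beta> 0 x) y)" for x
    proof (cases "x \<in> ?P")
      case True
      have "integrable lborel (L \<beta> j x)" if "j \<le> N" for j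
        by (rule integrable_bounded_support(1)[OF derseq_measurable[OF Lder[OF \<beta>] that] less_imp_le[OF \<rho>] L_bd[OF \<beta> True that] L_supp[OF \<beta> _ that]])
      from ft_iterated_derivative[OF Lder[OF \<beta>] this, of y]
      show ?thesis by (simp add: mult_ac)
    qed (simp add: gsupp)
    then show ?thesis unfolding ft_bb[OF \<beta> order_refl] bb0[OF \<beta>, symmetric] ft_bb[OF \<beta> le0]
      by (simp only: integral_mult_right_zero)
  qed
  \<comment> \<open>The gain. \<open>bb\<close> is a combination of derivatives of \<tau> times
    transforms of functions on \<open>real^'n\<close> at \<open>vsum \<xi>\<close>;
    \<open>nn_integral_ball_vsum_le\<close> reduces the square integral to \<open>real^'n\<close>,
    where Plancherel yields s^n. The 200 exceeds 4 * 49, with 49 = 7^2 and \<open>4 ^ N\<close> from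
    the squared binomial coefficients.\<close>
  have L2: "(\<integral>\<^sup>+\<xi>. ennreal ((\<kappa> ^ j * norm (bb \<beta> j \<xi>))\<^sup>2) \<partial>lborel)
      \<le> ennreal (A\<^sup>2 * (real (N + 1))\<^sup>2 * 200 ^ N * ((4 * \<rho>) ^ ?d * (real ?n / \<rho>) ^ ?n) * s ^ ?n)" (is "_ \<le> ennreal ?A2")
    if \<beta>: "\<beta> \<in> Basis" and j: "j \<le> N" for \<beta> j
  proof -
    \<comment> \<open>Differentiating the exponential i times brings down a polynomial factor in x,
      which is absorbed into \<open>g\<close>; on the cube it is at most (7/\<kappa>)^i.\<close>
    define G where "G i x = g x * (2 * pi * \<i> * (\<beta> \<bullet> diag (x - a))) ^ i" for i x
    have [measurable]: "G i \<in> borel_measurable borel" for i unfolding G_def by measurable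
    have G_bd: "norm (G i x) \<le> (7 / \<kappa>) ^ i * indicator ?P x" for i x
    proof (cases "x \<in> ?P")
      case True
      have "(2 * pi * \<bar>\<beta> \<bullet> diag (x - a)\<bar>) ^ i \<le> (7 * (1 / \<kappa>)) ^ i"
        using abs_diag_inner_Basis_le[OF \<beta> True] s\<kappa> pi_approx(2) by (intro power_mono mult_mono) auto
      then have "norm (g x) * (2 * pi * \<bar>\<beta> \<bullet> diag (x - a)\<bar>) ^ i \<le> 1 * (7 / \<kappa>) ^ i"
        using g1[of x] True by (intro mult_mono) auto
      then show ?thesis using True by (simp add: G_def norm_mult norm_power)
    qed (simp add: G_def gsupp)
    have G_int: "integrable lborel (G i)" for i
    proof (rule Bochner_Integration.integrable_bound)
      show "integrable lborel (\<lambda>x. (7 / \<kappa>) ^ i * indicator ?P x)"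
        using s emeasure_cube[of s a] by simp
      show "AE x in lborel. norm (G i x) \<le> norm ((7 / \<kappa>) ^ i * indicator ?P x)"
        using G_bd[of i] by (auto intro: order_trans[OF _ abs_ge_self])
    qed measurable
    have ftG: "norm (\<integral>x. g x * E \<beta> x i \<xi> \<partial>lborel) = norm (ft (G i) (vsum \<xi>))" for i \<xi>
    proof -
      have "g x * E \<beta> x i \<xi> = cis (- (2 * pi * (\<xi> \<bullet> diag a))) * (G i x * cis (2 * pi * (x \<bullet> vsum \<xi>)))" for x
      proof -
        have "cis (2 * pi * (\<xi> \<bullet> diag (x - a))) = cis (- (2 * pi * (\<xi> \<bullet> diag a))) * cis (2 * pi * (x \<bullet> vsum \<xi>))"
          unfolding cis_mult diag_diff by (simp add: inner_diff_right inner_diag right_diff_distrib)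
        then show ?thesis unfolding E_def G_def by (simp only: mult_ac)
      qed
      then show ?thesis unfolding ft_def by (simp only: integral_mult_right_zero norm_mult norm_cis mult_1_left)
    qed
    have bb_le: "(\<kappa> ^ j * norm (bb \<beta> j \<xi>))\<^sup>2 \<le> indicator (cball 0 \<rho>) \<xi> *
        (A\<^sup>2 * real (N + 1) * 4 ^ N * (\<Sum>i\<le>j. (\<kappa> ^ i * norm (ft (G i) (vsum \<xi>)))\<^sup>2))" for \<xi>
    proof (cases "norm \<xi> \<le> \<rho>")
      case True
      have gE: "integrable lborel (\<lambda>x. g x * E \<beta> x i \<xi>)" for i
      proof -
        have "integrable lborel (\<lambda>x. G i x * cis (2 * pi * (\<xi> \<bullet> diag (x - a))))"
          by (rule integrable_mult_bounded[OF G_int, of _ 1]) auto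
        then show ?thesis by (simp add: G_def E_def mult.assoc)
      qed
      have "bb \<beta> j \<xi> = (\<Sum>i\<le>j. of_nat (j choose i) * D \<beta> (j - i) \<xi> * (\<integral>x. g x * E \<beta> x i \<xi> \<partial>lborel))"
      proof -
        have "bb \<beta> j \<xi> = (\<integral>x. (\<Sum>i\<le>j. of_nat (j choose i) * D \<beta> (j - i) \<xi> * (g x * E \<beta> x i \<xi>)) \<partial>lborel)"
          unfolding bb_def L_def leibniz_def by (simp add: sum_distrib_left mult_ac)
        then show ?thesis using gE by (simp add: Bochner_Integration.integral_sum)
      qed
      then have "norm (bb \<beta> j \<xi>) \<le> (\<Sum>i\<le>j. norm (of_nat (j choose i) * D \<beta> (j - i) \<xi> * (\<integral>x. g x * E \<beta> x i \<xi> \<partial>lborel)))"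
        by (simp only: norm_sum)
      also have "\<dots> \<le> (\<Sum>i\<le>j. 2 ^ N * (A * (1 / \<kappa>) ^ (j - i)) * norm (ft (G i) (vsum \<xi>)))"
      proof (rule sum_mono)
        fix i assume i: "i \<in> {..j}"
        have "real (j choose i) \<le> 2 ^ j" by (metis binomial_le_pow2 of_nat_le_iff of_nat_numeral of_nat_power)
        also have "\<dots> \<le> 2 ^ N" using j by (intro power_increasing) auto
        finally have "real (j choose i) * norm (D \<beta> (j - i) \<xi>) \<le> 2 ^ N * (A * (1 / \<kappa>) ^ (j - i))"
          using D(3)[OF \<beta>, of "j - i" \<xi>] j by (intro mult_mono) auto
        from mult_right_mono[OF this, of "norm (ft (G i) (vsum \<xi>))"]
        show "norm (of_nat (j choose i) * D \<beta> (j - i) \<xi> * (\<integral>x. g x * E \<beta> x i \<xi> \<partial>lborel)) \<le> 2 ^ N * (A * (1 / \<kappa>) ^ (j - i)) * norm (ft (G i) (vsum \<xi>))"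
          by (simp only: norm_mult ftG norm_of_nat) simp
      qed
      finally have "\<kappa> ^ j * norm (bb \<beta> j \<xi>) \<le> \<kappa> ^ j * (\<Sum>i\<le>j. 2 ^ N * (A * (1 / \<kappa>) ^ (j - i)) * norm (ft (G i) (vsum \<xi>)))"
        using \<kappa> by (intro mult_left_mono) auto
      also have "\<dots> = (\<Sum>i\<le>j. 2 ^ N * A * (\<kappa> ^ i * norm (ft (G i) (vsum \<xi>))))"
        unfolding sum_distrib_left
      proof (rule sum.cong[OF refl])
        fix i assume "i \<in> {..j}"
        then have "\<kappa> ^ j * (1 / \<kappa>) ^ (j - i) = \<kappa> ^ i"
          using \<kappa> by (simp add: power_one_over power_diff)
        then show "\<kappa> ^ j * (2 ^ N * (A * (1 / \<kappa>) ^ (j - i)) * norm (ft (G i) (vsum \<xi>))) = 2 ^ N * A * (\<kappa> ^ i * norm (ft (G i) (vsum \<xi>)))"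
          by (metis (no_types, opaque_lifting) mult.assoc mult.left_commute)
      qed
      also have "\<dots> = 2 ^ N * A * (\<Sum>i\<le>j. \<kappa> ^ i * norm (ft (G i) (vsum \<xi>)))" by (simp add: sum_distrib_left)
      finally have "(\<kappa> ^ j * norm (bb \<beta> j \<xi>))\<^sup>2 \<le> (2 ^ N * A * (\<Sum>i\<le>j. \<kappa> ^ i * norm (ft (G i) (vsum \<xi>))))\<^sup>2"
        using \<kappa> by (intro power_mono) auto
      also have "\<dots> = (A\<^sup>2 * 4 ^ N) * (\<Sum>i\<le>j. \<kappa> ^ i * norm (ft (G i) (vsum \<xi>)))\<^sup>2"
      proof -
        have "((2::real) ^ N)\<^sup>2 = 4 ^ N"
          by (simp only: power2_eq_square power_mult_distrib[symmetric]) simp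
        then show ?thesis by (simp only: power_mult_distrib mult_ac)
      qed
      also have "\<dots> \<le> (A\<^sup>2 * 4 ^ N) * (real (N + 1) * (\<Sum>i\<le>j. (\<kappa> ^ i * norm (ft (G i) (vsum \<xi>)))\<^sup>2))"
      proof (intro mult_left_mono)
        have "(\<Sum>i\<le>j. \<kappa> ^ i * norm (ft (G i) (vsum \<xi>)))\<^sup>2 \<le> real (j + 1) * (\<Sum>i\<le>j. (\<kappa> ^ i * norm (ft (G i) (vsum \<xi>)))\<^sup>2)"
          by (rule sum_power2_le)
        also have "\<dots> \<le> real (N + 1) * (\<Sum>i\<le>j. (\<kappa> ^ i * norm (ft (G i) (vsum \<xi>)))\<^sup>2)"
          using j by (intro mult_right_mono) (auto intro!: sum_nonneg)
        finally show "(\<Sum>i\<le>j. \<kappa> ^ i * norm (ft (G i) (vsum \<xi>)))\<^sup>2 \<le> \<dots>" .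
      qed auto
      finally show ?thesis using True by (simp add: mult_ac)
    next
      case False
      then show ?thesis using bb_supp[OF \<beta> j, of \<xi>] by simp
    qed
    have each: "(\<integral>\<^sup>+\<xi>. indicator (cball (0 :: real^'n^'l) \<rho>) \<xi> * ennreal ((\<kappa> ^ i * norm (ft (G i) (vsum \<xi>)))\<^sup>2) \<partial>lborel)
        \<le> ennreal ((4 * \<rho>) ^ ?d * (real ?n / \<rho>) ^ ?n * (49 ^ N * s ^ ?n))" if i: "i \<le> N" for i
    proof -
      have "(\<integral>\<^sup>+\<xi>. indicator (cball (0 :: real^'n^'l) \<rho>) \<xi> * ennreal ((\<kappa> ^ i * norm (ft (G i) (vsum \<xi>)))\<^sup>2) \<partial>lborel)
        \<le> ennreal ((4 * \<rho>) ^ ?d * (real ?n / \<rho>) ^ ?n) * (\<integral>\<^sup>+y. ennreal ((\<kappa> ^ i * norm (ft (G i) y))\<^sup>2) \<partial>lborel)"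
        by (rule nn_integral_ball_vsum_le[OF _ \<rho>]) measurable
      also have "(\<integral>\<^sup>+y. ennreal ((\<kappa> ^ i * norm (ft (G i) y))\<^sup>2) \<partial>lborel) = (\<integral>\<^sup>+y. ennreal ((\<kappa> ^ i)\<^sup>2) * ennreal ((norm (ft (G i) y))\<^sup>2) \<partial>lborel)"
        by (simp add: power_mult_distrib ennreal_mult)
      also have "\<dots> = ennreal ((\<kappa> ^ i)\<^sup>2) * (\<integral>\<^sup>+y. ennreal ((norm (ft (G i) y))\<^sup>2) \<partial>lborel)"
        by (rule nn_integral_cmult) measurable
      also have "(\<integral>\<^sup>+y. ennreal ((norm (ft (G i) y))\<^sup>2) \<partial>lborel) \<le> (\<integral>\<^sup>+x. ennreal ((norm (G i x))\<^sup>2) \<partial>lborel)"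
        by (rule plancherel_le[OF G_int])
      also have "\<dots> \<le> (\<integral>\<^sup>+x. ennreal (((7 / \<kappa>) ^ i)\<^sup>2) * indicator ?P x \<partial>lborel)"
      proof (rule nn_integral_mono)
        fix x
        show "ennreal ((norm (G i x))\<^sup>2) \<le> ennreal (((7 / \<kappa>) ^ i)\<^sup>2) * indicator ?P x"
          using power_mono[OF G_bd[of i x] norm_ge_zero, of 2] by (auto split: split_indicator_asm simp: ennreal_leI)
      qed
      also have "\<dots> = ennreal (((7 / \<kappa>) ^ i)\<^sup>2) * ennreal (s ^ ?n)"
        using s by (subst nn_integral_cmult_indicator) (auto simp: emeasure_cube)
      finally have "(\<integral>\<^sup>+\<xi>. indicator (cball (0 :: real^'n^'l) \<rho>) \<xi> * ennreal ((\<kappa> ^ i * norm (ft (G i) (vsum \<xi>)))\<^sup>2) \<partial>lborel)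
        \<le> ennreal ((4 * \<rho>) ^ ?d * (real ?n / \<rho>) ^ ?n) * (ennreal ((\<kappa> ^ i)\<^sup>2) * (ennreal (((7 / \<kappa>) ^ i)\<^sup>2) * ennreal (s ^ ?n)))"
        by (simp add: mult_left_mono)
      also have "\<dots> = ennreal ((4 * \<rho>) ^ ?d * (real ?n / \<rho>) ^ ?n * ((\<kappa> ^ i)\<^sup>2 * ((7 / \<kappa>) ^ i)\<^sup>2 * s ^ ?n))"
        using s \<rho> by (simp add: ennreal_mult mult.assoc)
      also have "(\<kappa> ^ i)\<^sup>2 * ((7 / \<kappa>) ^ i)\<^sup>2 = 49 ^ i"
      proof -
        have "(\<kappa> ^ i)\<^sup>2 * ((7 / \<kappa>) ^ i)\<^sup>2 = ((\<kappa> * (7 / \<kappa>)) ^ i)\<^sup>2" by (simp only: power_mult_distrib)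
        also have "\<kappa> * (7 / \<kappa>) = 7" using \<kappa> by simp
        also have "((7::real) ^ i)\<^sup>2 = 49 ^ i" by (simp only: power2_eq_square power_mult_distrib[symmetric]) simp
        finally show ?thesis .
      qed
      also have "ennreal ((4 * \<rho>) ^ ?d * (real ?n / \<rho>) ^ ?n * (49 ^ i * s ^ ?n)) \<le> ennreal ((4 * \<rho>) ^ ?d * (real ?n / \<rho>) ^ ?n * (49 ^ N * s ^ ?n))"
        using s \<rho> i by (intro ennreal_leI mult_left_mono mult_right_mono power_increasing) auto
      finally show ?thesis .
    qed
    have "(\<integral>\<^sup>+\<xi>. ennreal ((\<kappa> ^ j * norm (bb \<beta> j \<xi>))\<^sup>2) \<partial>lborel)
        \<le> (\<integral>\<^sup>+\<xi>. ennreal (A\<^sup>2 * real (N + 1) * 4 ^ N) * (\<Sum>i\<le>j. indicator (cball (0 :: real^'n^'l) \<rho>) \<xi> * ennreal ((\<kappa> ^ i * norm (ft (G i) (vsum \<xi>)))\<^sup>2)) \<partial>lborel)"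
    proof (rule nn_integral_mono)
      fix \<xi>
      have "ennreal ((\<kappa> ^ j * norm (bb \<beta> j \<xi>))\<^sup>2) \<le> ennreal (indicator (cball 0 \<rho>) \<xi> *
        (A\<^sup>2 * real (N + 1) * 4 ^ N * (\<Sum>i\<le>j. (\<kappa> ^ i * norm (ft (G i) (vsum \<xi>)))\<^sup>2)))"
        by (intro ennreal_leI bb_le)
      also have "\<dots> = ennreal (A\<^sup>2 * real (N + 1) * 4 ^ N) * (\<Sum>i\<le>j. indicator (cball (0 :: real^'n^'l) \<rho>) \<xi> * ennreal ((\<kappa> ^ i * norm (ft (G i) (vsum \<xi>)))\<^sup>2))"
        by (cases "\<xi> \<in> cball 0 \<rho>") (simp_all add: ennreal_mult sum_nonneg)
      finally show "ennreal ((\<kappa> ^ j * norm (bb \<beta> j \<xi>))\<^sup>2) \<le> \<dots>" .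
    qed
    also have "\<dots> = ennreal (A\<^sup>2 * real (N + 1) * 4 ^ N) * (\<Sum>i\<le>j. \<integral>\<^sup>+\<xi>. indicator (cball (0 :: real^'n^'l) \<rho>) \<xi> * ennreal ((\<kappa> ^ i * norm (ft (G i) (vsum \<xi>)))\<^sup>2) \<partial>lborel)"
      by (subst nn_integral_cmult, measurable) (subst nn_integral_sum, measurable)
    also have "\<dots> \<le> ennreal (A\<^sup>2 * real (N + 1) * 4 ^ N) * (\<Sum>i\<le>j. ennreal ((4 * \<rho>) ^ ?d * (real ?n / \<rho>) ^ ?n * (49 ^ N * s ^ ?n)))"
      using j by (intro mult_left_mono sum_mono each) auto
    also have "\<dots> = ennreal (A\<^sup>2 * real (N + 1) * 4 ^ N * (real (j + 1) * ((4 * \<rho>) ^ ?d * (real ?n / \<rho>) ^ ?n * (49 ^ N * s ^ ?n))))"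
      using s \<rho> by (subst sum_ennreal) (auto simp: ennreal_mult[symmetric] sum_nonneg)
    also have "\<dots> \<le> ennreal ?A2"
    proof (rule ennreal_leI)
      have "real (j + 1) * (4 ^ N * 49 ^ N) \<le> real (N + 1) * 200 ^ N"
        using j unfolding power_mult_distrib[symmetric] by (intro mult_mono power_mono) auto
      from mult_left_mono[OF this, of "A\<^sup>2 * real (N + 1) * ((4 * \<rho>) ^ ?d * (real ?n / \<rho>) ^ ?n) * s ^ ?n"]
      show "A\<^sup>2 * real (N + 1) * 4 ^ N * (real (j + 1) * ((4 * \<rho>) ^ ?d * (real ?n / \<rho>) ^ ?n * (49 ^ N * s ^ ?n))) \<le> ?A2"
        using s \<rho> by (simp add: power2_eq_square[of "real (N + 1)"] power2_eq_square[of "1 + real N"] mult_ac)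
    qed
    finally show ?thesis .
  qed
  \<comment> \<open>The phase at \<open>diag a\<close> that was built into \<open>E\<close> is
    undone by evaluating \<open>fmult\<close> at \<open>diag a\<close>.\<close>
  have dual: "fmult F (bb \<beta>0 0) (diag a) = (\<integral>x. g x * fmult F \<tau> (diag x) \<partial>lborel)"
  proof -
    let ?u = "\<lambda>\<xi>. \<tau> \<xi> * ft F (- \<xi>)"
    have u: "integrable lborel ?u"
      by (rule integrable_mult_bounded[OF \<tau>, of _ "\<integral>z. norm (F z) \<partial>lborel"]) (auto intro: norm_ft_le)
    have "fmult F (bb \<beta>0 0) (diag a) = (\<integral>\<xi>. ?u \<xi> * (\<integral>x. g x * cis (2 * pi * (\<xi> \<bullet> diag x)) \<partial>lborel) \<partial>lborel)"
      unfolding fmult_def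
    proof (intro Bochner_Integration.integral_cong refl)
      fix \<xi>
      have eq: "g x * L \<beta>0 0 x \<xi> = (\<tau> \<xi> * cis (- (2 * pi * (\<xi> \<bullet> diag a)))) * (g x * cis (2 * pi * (\<xi> \<bullet> diag x)))" for x
      proof -
        have "cis (2 * pi * (\<xi> \<bullet> diag (x - a))) = cis (- (2 * pi * (\<xi> \<bullet> diag a))) * cis (2 * pi * (\<xi> \<bullet> diag x))"
          unfolding cis_mult diag_diff by (simp add: inner_diff_right right_diff_distrib)
        then show ?thesis unfolding L_def leibniz_0 E_def D(2)[OF \<beta>0] by (simp only: power_0 mult_1_left mult_ac)
      qed
      let ?I = "\<integral>x. g x * cis (2 * pi * (\<xi> \<bullet> diag x)) \<partial>lborel"
      have bb_eq: "bb \<beta>0 0 \<xi> = (\<tau> \<xi> * cis (- (2 * pi * (\<xi> \<bullet> diag a)))) * ?I"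
        unfolding bb_def eq by (simp only: integral_mult_right_zero)
      have "bb \<beta>0 0 \<xi> * ft F (- \<xi>) * cis (2 * pi * (\<xi> \<bullet> diag a))
          = (?u \<xi> * ?I) * (cis (- (2 * pi * (\<xi> \<bullet> diag a))) * cis (2 * pi * (\<xi> \<bullet> diag a)))"
        unfolding bb_eq by (simp only: mult_ac)
      also have "cis (- (2 * pi * (\<xi> \<bullet> diag a))) * cis (2 * pi * (\<xi> \<bullet> diag a)) = 1"
        by (simp add: cis_mult)
      finally show "bb \<beta>0 0 \<xi> * ft F (- \<xi>) * cis (2 * pi * (\<xi> \<bullet> diag a)) = ?u \<xi> * ?I"
        by (simp only: mult_1_right)
    qed
    also have "\<dots> = (\<integral>x. g x * (\<integral>\<xi>. ?u \<xi> * cis (2 * pi * (\<xi> \<bullet> diag x)) \<partial>lborel) \<partial>lborel)"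
      by (rule integral_swap_bounded_kernel[where B = 1])
         (use u gint in \<open>auto simp: lborel.sigma_finite_measure_axioms\<close>)
    finally show ?thesis unfolding fmult_def .
  qed
  show ?thesis
    unfolding dual[symmetric]
  proof (rule fmult_bound[OF r q \<kappa> F Fr, where bb = "\<lambda>\<beta>. bb \<beta> N"])
    show "integrable lborel (bb \<beta>0 0)" by (rule bbint(1)[OF \<beta>0 le0])
    show "integrable lborel (bb \<beta> N)" if "\<beta> \<in> Basis" for \<beta> by (rule bbint(1)[OF that order_refl])
    show "norm (ft (bb \<beta> N) y) = (2 * pi * \<bar>\<beta> \<bullet> y\<bar>) ^ N * norm (ft (bb \<beta>0 0) y)" if "\<beta> \<in> Basis" for \<beta> y
      by (rule norm_ft_iterated_derivative[OF ft_rel[OF that]])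
    show "0 < A * 14 ^ N * s ^ ?n * (2 * \<rho>) ^ ?d" using A s \<rho> by simp
    show "0 < A\<^sup>2 * (real (N + 1))\<^sup>2 * 200 ^ N * ((4 * \<rho>) ^ ?d * (real ?n / \<rho>) ^ ?n) * s ^ ?n"
      using A s \<rho> by (intro mult_pos_pos) auto
    show "(\<integral>\<xi>. norm (bb \<beta>0 0 \<xi>) \<partial>lborel) \<le> A * 14 ^ N * s ^ ?n * (2 * \<rho>) ^ ?d"
      using bbint(2)[OF \<beta>0 le0] by simp
    show "\<kappa> ^ N * (\<integral>\<xi>. norm (bb \<beta> N \<xi>) \<partial>lborel) \<le> A * 14 ^ N * s ^ ?n * (2 * \<rho>) ^ ?d" if "\<beta> \<in> Basis" for \<beta>
      using mult_left_mono[OF bbint(2)[OF that order_refl], of "\<kappa> ^ N"] \<kappa> by (simp add: power_one_over)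
    show "(\<integral>\<^sup>+\<xi>. ennreal ((norm (bb \<beta>0 0 \<xi>))\<^sup>2) \<partial>lborel) \<le> ennreal (A\<^sup>2 * (real (N + 1))\<^sup>2 * 200 ^ N * ((4 * \<rho>) ^ ?d * (real ?n / \<rho>) ^ ?n) * s ^ ?n)"
      using L2[OF \<beta>0 le0] by simp
    show "(\<integral>\<^sup>+\<xi>. ennreal ((\<kappa> ^ N * norm (bb \<beta> N \<xi>))\<^sup>2) \<partial>lborel) \<le> ennreal (A\<^sup>2 * (real (N + 1))\<^sup>2 * 200 ^ N * ((4 * \<rho>) ^ ?d * (real ?n / \<rho>) ^ ?n) * s ^ ?n)"
      if "\<beta> \<in> Basis" for \<beta> using L2[OF that order_refl] .
  qed
qed


section \<open>Freezing the symbol and averages over small cubes\<close>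

lemma nth_add_One: "((a :: real^'n) + s *\<^sub>R One) $ i = a $ i + s" "((a :: real^'n) - s *\<^sub>R One) $ i = a $ i - s"
  by (simp_all add: cart_eq_inner_axis inner_add_left inner_diff_left)

lemma mem_cube: "x \<in> cube a s \<longleftrightarrow> (\<forall>i. a $ i \<le> x $ i \<and> x $ i \<le> a $ i + s)"
  unfolding cube_def mem_box_cart nth_add_One ..

lemma norm_diff_cube_le:
  fixes a :: "real^'n"
  assumes "x \<in> cube a s" "y \<in> cube a s"
  shows "norm (x - y) \<le> real CARD('n) * s"
proof -
  have "norm (x - y) \<le> (\<Sum>i\<in>UNIV. \<bar>(x - y) $ i\<bar>)" by (rule norm_le_l1_cart)
  also have "\<dots> \<le> (\<Sum>i\<in>(UNIV :: 'n set). s)"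
  proof (rule sum_mono)
    fix i
    show "\<bar>(x - y) $ i\<bar> \<le> s" using spec[OF assms(1)[unfolded mem_cube], of i] spec[OF assms(2)[unfolded mem_cube], of i] by (simp add: abs_le_iff)
  qed
  finally show ?thesis by simp
qed

lemma norm_diag_le: "norm (diag x :: real^'n^'l) \<le> real CARD('l) * norm x"
proof -
  have "norm (diag x :: real^'n^'l) \<le> (\<Sum>j\<in>(UNIV :: 'l set). norm ((diag x :: real^'n^'l) $ j))"
    unfolding norm_vec_def by (rule L2_set_le_sum) auto
  then show ?thesis by (simp add: diag_def)
qed

text \<open>The weights at two centres with \<kappa> |y - y'| <= c are comparable, as 1 + \<kappa>
  |y' - z| <= (1 + c) (1 + \<kappa> |y - z|).\<close>

lemma Phi_near:
  fixes F :: "'a::euclidean_space \<Rightarrow> complex"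
  assumes Fr: "integrable lborel (\<lambda>z. norm (F z) powr r)" and \<kappa>: "0 < \<kappa>" and p: "0 \<le> p" and c: "\<kappa> * dist y y' \<le> c"
  shows "Phi r p \<kappa> F y \<le> (1 + c) powr p * Phi r p \<kappa> F y'"
proof -
  have "0 \<le> \<kappa> * dist y y'" using \<kappa> by simp
  then have c0: "0 \<le> c" using c by linarith
  have "Phi r p \<kappa> F y \<le> (\<integral>z. (1 + c) powr p * (\<kappa> ^ DIM('a) * (norm (F z) powr r * (1 + \<kappa> * dist y' z) powr (- p))) \<partial>lborel)"
    unfolding Phi_def
  proof (rule integral_mono)
    show "integrable lborel (\<lambda>z. \<kappa> ^ DIM('a) * (norm (F z) powr r * (1 + \<kappa> * dist y z) powr (- p)))"
      using Phi_integrable[OF Fr, of \<kappa> p y] \<kappa> p by simp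
    show "integrable lborel (\<lambda>z. (1 + c) powr p * (\<kappa> ^ DIM('a) * (norm (F z) powr r * (1 + \<kappa> * dist y' z) powr (- p))))"
      using Phi_integrable[OF Fr, of \<kappa> p y'] \<kappa> p by simp
    fix z
    have "dist y' z \<le> dist y z + dist y y'" by (metis add.commute dist_commute dist_triangle)
    then have "\<kappa> * dist y' z \<le> \<kappa> * dist y z + \<kappa> * dist y y'"
      using \<kappa> by (metis distrib_left less_imp_le mult_left_mono)
    then have "1 + \<kappa> * dist y' z \<le> 1 + \<kappa> * dist y z + c * 1" using c by simp
    also have "\<dots> \<le> (1 + \<kappa> * dist y z) + c * (1 + \<kappa> * dist y z)"
      using \<kappa> c0 by (intro add_mono mult_left_mono) auto
    finally have w: "1 + \<kappa> * dist y' z \<le> (1 + c) * (1 + \<kappa> * dist y z)" by (simp add: algebra_simps)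
    have pos: "0 < 1 + \<kappa> * dist y z" "0 < 1 + \<kappa> * dist y' z" using \<kappa> by (auto intro: add_pos_nonneg)
    have "(1 + \<kappa> * dist y z) powr (- p) = (1 + c) powr p * ((1 + c) * (1 + \<kappa> * dist y z)) powr (- p)"
    proof -
      have "((1 + c) * (1 + \<kappa> * dist y z)) powr (- p) = (1 + c) powr (- p) * (1 + \<kappa> * dist y z) powr (- p)"
        by (rule powr_mult)
      moreover have "(1 + c) powr p * (1 + c) powr (- p) = 1" unfolding powr_add[symmetric] using c0 by simp
      ultimately show ?thesis by (simp add: mult.assoc[symmetric])
    qed
    also have "\<dots> \<le> (1 + c) powr p * (1 + \<kappa> * dist y' z) powr (- p)"
      using w pos p by (intro mult_left_mono powr_mono2') auto
    finally have "(1 + \<kappa> * dist y z) powr (- p) \<le> (1 + c) powr p * (1 + \<kappa> * dist y' z) powr (- p)" .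
    from mult_left_mono[OF this, of "\<kappa> ^ DIM('a) * norm (F z) powr r"]
    show "\<kappa> ^ DIM('a) * (norm (F z) powr r * (1 + \<kappa> * dist y z) powr (- p))
       \<le> (1 + c) powr p * (\<kappa> ^ DIM('a) * (norm (F z) powr r * (1 + \<kappa> * dist y' z) powr (- p)))"
      using \<kappa> by (simp add: mult_ac)
  qed
  then show ?thesis unfolding Phi_def by simp
qed

lemma Phi_near_root:
  fixes F :: "'a::euclidean_space \<Rightarrow> complex"
  assumes Fr: "integrable lborel (\<lambda>z. norm (F z) powr r)" and \<kappa>: "0 < \<kappa>" and r: "0 < r" and c: "\<kappa> * dist y y' \<le> c"
  shows "Phi r (real N * r) \<kappa> F y powr (1 / r) \<le> (1 + c) powr real N * Phi r (real N * r) \<kappa> F y' powr (1 / r)"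
proof -
  have "Phi r (real N * r) \<kappa> F y powr (1 / r) \<le> ((1 + c) powr (real N * r) * Phi r (real N * r) \<kappa> F y') powr (1 / r)"
    using Phi_near[OF Fr \<kappa> _ c, of "real N * r"] r \<kappa> Phi_nonneg[of \<kappa>] by (intro powr_mono2) auto
  also have "\<dots> = (1 + c) powr real N * Phi r (real N * r) \<kappa> F y' powr (1 / r)"
    using r by (simp add: powr_mult powr_powr)
  finally show ?thesis .
qed

lemma symb_mono: "symb N A \<mu> \<rho> b \<Longrightarrow> A \<le> B \<Longrightarrow> 0 \<le> \<mu> \<Longrightarrow> symb N B \<mu> \<rho> b"
  unfolding symb_def by (meson mult_right_mono order_trans zero_le_power)

lemma symb_integrable:
  fixes b :: "'a::euclidean_space \<Rightarrow> complex"
  assumes "symb N A \<mu> \<rho> b" "0 < \<rho>"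
  shows "integrable lborel b"
proof -
  obtain \<beta> :: 'a where "\<beta> \<in> Basis" using nonempty_Basis by blast
  then obtain D where D: "derseq N \<beta> D" "D 0 = b" "\<And>\<xi>. norm (D 0 \<xi>) \<le> A * \<mu> ^ 0" "\<And>\<xi>. \<rho> < norm \<xi> \<Longrightarrow> D 0 \<xi> = 0"
    using assms(1) unfolding symb_def by (metis le0)
  show ?thesis
    using integrable_bounded_support(1)[OF derseq_measurable[OF D(1) le0] less_imp_le[OF assms(2)] D(3,4)] D(2) by simp
qed

lemma fmult_integrable:
  fixes F b :: "'a::euclidean_space \<Rightarrow> complex"
  assumes F: "integrable lborel F" and b: "integrable lborel b"
  shows "integrable lborel (\<lambda>\<xi>. b \<xi> * ft F (- \<xi>) * cis (2 * pi * (\<xi> \<bullet> y)))"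
proof -
  have [measurable]: "F \<in> borel_measurable borel" using F by auto
  have "integrable lborel (\<lambda>\<xi>. b \<xi> * (ft F (- \<xi>) * cis (2 * pi * (\<xi> \<bullet> y))))"
    by (rule integrable_mult_bounded[OF b, of _ "\<integral>z. norm (F z) \<partial>lborel"]) (auto simp: norm_mult norm_ft_le)
  then show ?thesis by (simp add: mult.assoc)
qed

lemma fmult_diff:
  fixes F b :: "'a::euclidean_space \<Rightarrow> complex"
  assumes "integrable lborel F" and "integrable lborel b" "integrable lborel b'"
  shows "fmult F (\<lambda>\<xi>. b \<xi> - b' \<xi>) y = fmult F b y - fmult F b' y"
  unfolding fmult_def
  by (subst Bochner_Integration.integral_diff[symmetric]) (auto intro!: fmult_integrable assms simp: left_diff_distrib)

text \<open>Translation is modulation of the symbol; a difference of values at two points thus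
  becomes one multiplier with the factor exp(2 \<pi> i \<xi> . v) - 1.\<close>

lemma fmult_shift:
  "fmult F (\<lambda>\<xi>. b \<xi> * cis (2 * pi * (\<xi> \<bullet> v))) y = fmult F b (y + v)"
  unfolding fmult_def
  by (intro Bochner_Integration.integral_cong refl) (simp add: inner_add_right distrib_left cis_mult[symmetric] mult_ac)

text \<open>One derivative in x costs \<kappa>, as much as one derivative in \<xi> gains. It is
  recorded as a Lipschitz bound for all the \<xi>-derivatives at once, the form in which freezing
  uses it.\<close>

definition xsymb :: "nat \<Rightarrow> real \<Rightarrow> real \<Rightarrow> real \<Rightarrow> (real^'n \<Rightarrow> real^'n^'l \<Rightarrow> complex) \<Rightarrow> bool" where
  "xsymb N A \<kappa> \<rho> \<tau> \<longleftrightarrow> (\<forall>x. symb N A (1 / \<kappa>) \<rho> (\<tau> x)) \<and>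
     (\<forall>x y. symb N (A * \<kappa> * dist x y) (1 / \<kappa>) \<rho> (\<lambda>\<xi>. \<tau> x \<xi> - \<tau> y \<xi>))"

text \<open>The difference of the symbols at \<open>x\<close> and \<open>x0\<close> is itself a
  \<open>symb\<close>, with constant A \<kappa> \<delta>; the resulting mean about
  \<open>diag x\<close> is moved to \<open>diag x0\<close> by \<open>Phi_near_root\<close>.\<close>

lemma fmult_freeze:
  fixes F :: "real^'n^'l \<Rightarrow> complex"
  assumes r: "1 < r" "r \<le> 2" and \<kappa>: "0 < \<kappa>" and A: "0 < A" and \<rho>: "0 < \<rho>"
    and F: "integrable lborel F" and Fr: "integrable lborel (\<lambda>z. norm (F z) powr r)"
    and \<tau>: "xsymb N A \<kappa> \<rho> \<tau>" and \<delta>: "dist x x0 \<le> \<delta>" "0 < \<delta>" and c: "\<kappa> * dist (diag x) (diag x0 :: real^'n^'l) \<le> c"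
  shows "norm (fmult F (\<tau> x) (diag x) - fmult F (\<tau> x0) (diag x)) \<le> real (DIM(real^'n^'l) + 1) ^ (N + 2) * (1 + c) powr real N *
     (A * (2 * \<rho> / \<kappa>) powr (real DIM(real^'n^'l) / r) * (\<kappa> * \<delta>) * Phi r (real N * r) \<kappa> F (diag x0) powr (1 / r))"
proof -
  let ?K = "real (DIM(real^'n^'l) + 1) ^ (N + 2)" and ?P = "\<lambda>y. Phi r (real N * r) \<kappa> F y powr (1 / r)"
  have "symb N (A * \<kappa> * dist x x0) (1 / \<kappa>) \<rho> (\<lambda>\<xi>. \<tau> x \<xi> - \<tau> x0 \<xi>)" using \<tau> by (simp add: xsymb_def)
  then have s: "symb N (A * \<kappa> * \<delta>) (1 / \<kappa>) \<rho> (\<lambda>\<xi>. \<tau> x \<xi> - \<tau> x0 \<xi>)"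
    by (rule symb_mono) (use \<delta> A \<kappa> in auto)
  have i: "integrable lborel (\<tau> x)" "integrable lborel (\<tau> x0)"
    using \<tau> \<rho> unfolding xsymb_def by (auto intro: symb_integrable)
  have "norm (fmult F (\<tau> x) (diag x) - fmult F (\<tau> x0) (diag x)) = norm (fmult F (\<lambda>\<xi>. \<tau> x \<xi> - \<tau> x0 \<xi>) (diag x))"
    by (simp add: fmult_diff[OF F i])
  also have "\<dots> \<le> ?K * (A * \<kappa> * \<delta> * (2 * \<rho> / \<kappa>) powr (real DIM(real^'n^'l) / r) * ?P (diag x))"
    by (rule symb_fmult_bound[OF r \<kappa> _ \<rho> F Fr s]) (use A \<kappa> \<delta> in auto)
  also have "\<dots> \<le> ?K * (A * \<kappa> * \<delta> * (2 * \<rho> / \<kappa>) powr (real DIM(real^'n^'l) / r) * ((1 + c) powr real N * ?P (diag x0)))"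
    using A \<kappa> \<delta> r by (intro mult_left_mono Phi_near_root[OF Fr \<kappa> _ c]) auto
  finally show ?thesis by (simp only: mult_ac)
qed

text \<open>The arithmetic of the constant in \<open>fmult_dual_bound\<close>: U and w are the
  volumes (4\<rho>)^d and (2\<rho>)^d, S is s^n, and v is (n/\<rho>)^n, so that v/S is the gain
  (n/(\<rho> s))^n, which survives with the power 1/q. As c1 and c2 are at least 1, their powers can
  be rounded up.\<close>

lemma powr_gain_constant:
  fixes A c1 c2 S U v w q :: real
  assumes q: "2 \<le> q" and pos: "0 < A" "1 \<le> c1" "1 \<le> c2" "0 < S" "0 < U" "0 < v" "0 < w" "w \<le> U"
  shows "((A * c1 * S * w) powr (q - 2) * (A\<^sup>2 * c2 * (U * v) * S)) powr (1 / q)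
     \<le> c1 * c2 * (A * U powr (1 - 1 / q) * S * (v / S) powr (1 / q))"
proof -
  have "(A * c1 * S * w) powr (q - 2) * (A\<^sup>2 * c2 * (U * v) * S) \<le> (A * c1 * S * U) powr (q - 2) * (A\<^sup>2 * c2 * (U * v) * S)"
    using assms by (intro mult_right_mono powr_mono2 mult_left_mono) auto
  also have "\<dots> = (A powr (q - 2) * A powr 2) * (U powr (q - 2) * U powr 1) * (S powr (q - 2) * S powr 1) * (c1 powr (q - 2) * c2 * v)"
    using pos by (simp add: powr_mult)
  also have "\<dots> = A powr q * U powr (q - 1) * S powr (q - 1) * (c1 powr (q - 2) * c2 * v)"
    unfolding powr_add[symmetric] by simp
  also have "\<dots> \<le> A powr q * U powr (q - 1) * S powr (q - 1) * (c1 powr q * c2 powr q * v)"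
  proof (intro mult_left_mono mult_right_mono mult_mono)
    show "c1 powr (q - 2) \<le> c1 powr q" using pos by (intro powr_mono) auto
    show "c2 \<le> c2 powr q" using powr_mono[of 1 q c2] pos q by simp
  qed (use pos in auto)
  finally have "((A * c1 * S * w) powr (q - 2) * (A\<^sup>2 * c2 * (U * v) * S)) powr (1 / q)
     \<le> (A powr q * U powr (q - 1) * S powr (q - 1) * (c1 powr q * c2 powr q * v)) powr (1 / q)"
    using q pos by (intro powr_mono2) auto
  also have "\<dots> = A * U powr ((q - 1) / q) * S powr ((q - 1) / q) * (c1 * c2 * v powr (1 / q))"
    using pos q by (simp add: powr_mult powr_powr)
  also have "(q - 1) / q = 1 - 1 / q" using q by (simp add: field_simps)
  also have "S powr (1 - 1 / q) = S / S powr (1 / q)" using pos by (simp add: powr_diff)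
  also have "A * U powr (1 - 1 / q) * (S / S powr (1 / q)) * (c1 * c2 * v powr (1 / q)) = c1 * c2 * (A * U powr (1 - 1 / q) * S * (v / S) powr (1 / q))"
    using pos by (simp add: powr_divide)
  finally show ?thesis .
qed

text \<open>Duality: the modulus on the cube is integrated by testing against the conjugate phase of
  the function.\<close>

lemma fmult_gain:
  fixes F \<tau> :: "real^'n^'l \<Rightarrow> complex"
  assumes r: "1 < r" "r \<le> 2" and q: "q = r / (r - 1)"
    and \<kappa>: "0 < \<kappa>" and A: "0 < A" and \<rho>: "0 < \<rho>" and s: "0 < s" "s * \<kappa> \<le> 1"
    and F: "integrable lborel F" and Fr: "integrable lborel (\<lambda>z. norm (F z) powr r)"
    and symb: "symb N A (1 / \<kappa>) \<rho> \<tau>"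
    and K: "K = real (DIM(real^'n^'l) + 1) ^ (N + 2) * (14 ^ N * ((real (N + 1))\<^sup>2 * 200 ^ N)) * 2 powr (real DIM(real^'n^'l) / r) * real CARD('n) powr (real CARD('n) / q)"
  shows "(\<integral>\<^sup>+x. ennreal (norm (fmult F \<tau> (diag x))) * indicator (cube a s) x \<partial>lborel)
    \<le> ennreal (K * (A * (2 * \<rho> / \<kappa>) powr (real DIM(real^'n^'l) / r) * s ^ CARD('n) * (1 / (\<rho> * s)) powr (real CARD('n) / q)
        * Phi r (real N * r) \<kappa> F (diag a) powr (1 / r)))"
proof -
  let ?d = "DIM(real^'n^'l)" and ?n = "CARD('n)" and ?P = "Phi r (real N * r) \<kappa> F (diag a) powr (1 / r)"
  have q2: "2 \<le> q" using r by (simp add: q pos_le_divide_eq)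
  have qr: "1 - 1 / q = 1 / r" using r by (simp add: q field_simps)
  have \<tau>: "integrable lborel \<tau>" by (rule symb_integrable[OF symb \<rho>])
  have [measurable]: "F \<in> borel_measurable borel" "\<tau> \<in> borel_measurable borel" using F \<tau> by auto
  define u where "u x = fmult F \<tau> (diag x)" for x :: "real^'n"
  have [measurable]: "u \<in> borel_measurable borel"
    unfolding u_def fmult_def by (rule lborel.borel_measurable_lebesgue_integral) measurable
  define B where "B = (\<integral>\<xi>. norm (\<tau> \<xi> * ft F (- \<xi>)) \<partial>lborel)"
  have uB: "norm (u x) \<le> B" for x
    unfolding u_def fmult_def B_def
    using integral_norm_bound[of lborel "\<lambda>\<xi>. \<tau> \<xi> * ft F (- \<xi>) * cis (2 * pi * (\<xi> \<bullet> diag x))"] by (simp add: norm_mult)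
  \<comment> \<open>Where \<open>u\<close> vanishes the quotient is 0 by the convention for
    division, and g u = |u| still holds on the cube.\<close>
  define g where "g x = (if x \<in> cube a s then cnj (u x) / norm (u x) else 0)" for x
  have [measurable]: "g \<in> borel_measurable borel" unfolding g_def by measurable
  have g1: "norm (g x) \<le> indicator (cube a s) x" for x by (auto simp: g_def norm_divide)
  have gu: "g x * u x = complex_of_real (norm (u x) * indicator (cube a s) x)" for x
    unfolding g_def using complex_norm_square[of "u x"]
    by (cases "u x = 0") (auto simp: field_simps power2_eq_square split: split_indicator)
  have int: "integrable lborel (\<lambda>x. norm (u x) * indicator (cube a s) x)"
  proof (rule Bochner_Integration.integrable_bound)
    show "integrable lborel (\<lambda>x. B * indicator (cube a s) x)"
      using s emeasure_cube[of s a] by simp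
    show "AE x in lborel. norm (norm (u x) * indicator (cube a s) x) \<le> norm (B * indicator (cube a s) x)"
      using uB by (auto split: split_indicator intro: order_trans[OF _ abs_ge_self])
  qed measurable
  have "(\<integral>\<^sup>+x. ennreal (norm (u x)) * indicator (cube a s) x \<partial>lborel) = (\<integral>\<^sup>+x. ennreal (norm (u x) * indicator (cube a s) x) \<partial>lborel)"
    by (intro nn_integral_cong) (auto split: split_indicator)
  also have "\<dots> = ennreal (\<integral>x. norm (u x) * indicator (cube a s) x \<partial>lborel)"
    by (rule nn_integral_eq_integral[OF int]) auto
  also have "(\<integral>x. norm (u x) * indicator (cube a s) x \<partial>lborel) = norm (\<integral>x. g x * fmult F \<tau> (diag x) \<partial>lborel)"
    unfolding u_def[symmetric] gu integral_complex_of_real norm_of_real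
    by (subst abs_of_nonneg) (auto intro!: Bochner_Integration.integral_nonneg)
  also have "\<dots> \<le> real (?d + 1) ^ (N + 2) *
     ((A * 14 ^ N * s ^ ?n * (2 * \<rho>) ^ ?d) powr (q - 2) *
      (A\<^sup>2 * (real (N + 1))\<^sup>2 * 200 ^ N * ((4 * \<rho>) ^ ?d * (real ?n / \<rho>) ^ ?n) * s ^ ?n)) powr (1 / q)
     * (\<kappa> powr (- real ?d / r) * ?P)"
    by (rule fmult_dual_bound[OF r q \<kappa> A \<rho> s F Fr symb _ g1]) measurable
  also have "\<dots> \<le> real (?d + 1) ^ (N + 2) * (14 ^ N * ((real (N + 1))\<^sup>2 * 200 ^ N) *
      (A * ((4 * \<rho>) ^ ?d) powr (1 - 1 / q) * s ^ ?n * ((real ?n / \<rho>) ^ ?n / s ^ ?n) powr (1 / q))) * (\<kappa> powr (- real ?d / r) * ?P)"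
  proof (intro mult_right_mono mult_left_mono)
    have c2: "1 \<le> (real (N + 1))\<^sup>2 * 200 ^ N"
      using mult_mono[of 1 "(real (N + 1))\<^sup>2" 1 "200 ^ N"] by simp
    from powr_gain_constant[OF q2 A _ c2, of "14 ^ N" "s ^ ?n" "(4 * \<rho>) ^ ?d" "(real ?n / \<rho>) ^ ?n" "(2 * \<rho>) ^ ?d"] s \<rho>
    show "((A * 14 ^ N * s ^ ?n * (2 * \<rho>) ^ ?d) powr (q - 2) *
      (A\<^sup>2 * (real (N + 1))\<^sup>2 * 200 ^ N * ((4 * \<rho>) ^ ?d * (real ?n / \<rho>) ^ ?n) * s ^ ?n)) powr (1 / q)
      \<le> 14 ^ N * ((real (N + 1))\<^sup>2 * 200 ^ N) *
      (A * ((4 * \<rho>) ^ ?d) powr (1 - 1 / q) * s ^ ?n * ((real ?n / \<rho>) ^ ?n / s ^ ?n) powr (1 / q))"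
      by (simp add: mult.assoc power_mono)
  qed auto
  also have "((4 * \<rho>) ^ ?d) powr (1 - 1 / q) = 2 powr (real ?d / r) * (2 * \<rho>) powr (real ?d / r)"
  proof -
    have "((4 * \<rho>) ^ ?d) powr (1 / r) = ((4 * \<rho>) powr real ?d) powr (1 / r)"
      using \<rho> by (subst powr_realpow) auto
    also have "\<dots> = (2 * (2 * \<rho>)) powr (real ?d / r)" by (simp add: powr_powr)
    also have "\<dots> = 2 powr (real ?d / r) * (2 * \<rho>) powr (real ?d / r)" by (rule powr_mult)
    finally show ?thesis unfolding qr .
  qed
  also have "((real ?n / \<rho>) ^ ?n / s ^ ?n) powr (1 / q) = real ?n powr (real ?n / q) * (1 / (\<rho> * s)) powr (real ?n / q)"
  proof -
    have "(real ?n / \<rho>) ^ ?n / s ^ ?n = (real ?n * (1 / (\<rho> * s))) ^ ?n"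
      by (simp add: power_divide[symmetric])
    also have "\<dots> = (real ?n * (1 / (\<rho> * s))) powr real ?n"
      using \<rho> s by (subst powr_realpow) auto
    finally have "((real ?n / \<rho>) ^ ?n / s ^ ?n) powr (1 / q) = (real ?n * (1 / (\<rho> * s))) powr (real ?n / q)"
      by (simp add: powr_powr)
    also have "\<dots> = real ?n powr (real ?n / q) * (1 / (\<rho> * s)) powr (real ?n / q)" by (rule powr_mult)
    finally show ?thesis .
  qed
  also have "real (?d + 1) ^ (N + 2) * (14 ^ N * ((real (N + 1))\<^sup>2 * 200 ^ N) *
      (A * (2 powr (real ?d / r) * (2 * \<rho>) powr (real ?d / r)) * s ^ ?n * (real ?n powr (real ?n / q) * (1 / (\<rho> * s)) powr (real ?n / q)))) * (\<kappa> powr (- real ?d / r) * ?P)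
     = K * (A * (2 * \<rho> / \<kappa>) powr (real ?d / r) * s ^ ?n * (1 / (\<rho> * s)) powr (real ?n / q) * ?P)"
  proof -
    have "(2 * \<rho> / \<kappa>) powr (real ?d / r) = (2 * \<rho>) powr (real ?d / r) * \<kappa> powr (- real ?d / r)"
      using \<rho> \<kappa> powr_minus_divide[of \<kappa> "real ?d / r"] by (subst powr_divide) auto
    then show ?thesis unfolding K by (simp only: mult_ac)
  qed
  finally show ?thesis unfolding u_def by (simp add: ennreal_leI)
qed

lemma ennreal_add_le_of_norm:
  fixes u v :: complex
  assumes "norm (u - v) \<le> e"
  shows "ennreal (norm u) \<le> ennreal (norm v) + ennreal e"
proof -
  have "norm u \<le> norm v + e" using norm_triangle_ineq2[of u v] assms by simp
  moreover have "0 \<le> e" using assms by (rule order_trans[rotated]) simp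
  ultimately show ?thesis by (subst ennreal_plus[symmetric]) (auto intro!: ennreal_leI simp del: ennreal_plus)
qed

lemma local_average_bound:
  fixes r :: real and N :: nat
  assumes r: "1 < r" "r \<le> 2" and q: "q = r / (r - 1)"
  shows "\<exists>K>0. \<forall>(F :: real^'n^'l \<Rightarrow> complex) \<tau> \<kappa> A \<rho> s a. 0 < \<kappa> \<longrightarrow> 0 < A \<longrightarrow> 0 < \<rho> \<longrightarrow> 0 < s \<longrightarrow> s * \<kappa> \<le> 1 \<longrightarrow>
    integrable lborel F \<longrightarrow> integrable lborel (\<lambda>z. norm (F z) powr r) \<longrightarrow> xsymb N A \<kappa> \<rho> \<tau> \<longrightarrow>
    (\<integral>\<^sup>+x. ennreal (norm (fmult F (\<tau> x) (diag x))) * indicator (cube a s) x \<partial>lborel)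
    \<le> ennreal (K * (A * (2 * \<rho> / \<kappa>) powr (real DIM(real^'n^'l) / r)) * ((1 / (\<rho> * s)) powr (real CARD('n) / q) + \<kappa> * s)
        * Phi r (real N * r) \<kappa> F (diag a) powr (1 / r) * s ^ CARD('n))"
proof -
  let ?d = "DIM(real^'n^'l)" and ?n = "CARD('n)"
  define K1 where "K1 = real (?d + 1) ^ (N + 2) * (14 ^ N * ((real (N + 1))\<^sup>2 * 200 ^ N)) * 2 powr (real ?d / r) * real ?n powr (real ?n / q)"
  \<comment> \<open>The points \<open>diag x\<close> and \<open>diag a\<close> differ by at most c s
    when x is in the cube, so \<kappa> times their distance is at most c.\<close>
  define c where "c = real CARD('l) * real ?n"
  define K2 where "K2 = real (?d + 1) ^ (N + 2) * (1 + c) powr real N * real ?n"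
  have "0 < 1 + c" by (simp add: c_def add_pos_nonneg)
  moreover have "0 < real (?d + 1) ^ (N + 2)" by (rule zero_less_power, subst of_nat_0_less_iff, simp)
  ultimately have K0: "0 < K1" "0 < K2" unfolding K1_def K2_def by (intro mult_pos_pos; simp del: DIM_cart)+
  show ?thesis
  proof (intro exI[of _ "K1 + K2"] conjI allI impI)
    show "0 < K1 + K2" using K0 by simp
    fix F :: "real^'n^'l \<Rightarrow> complex" and \<tau> :: "real^'n \<Rightarrow> real^'n^'l \<Rightarrow> complex" and \<kappa> A \<rho> s :: real and a :: "real^'n"
    assume \<kappa>: "0 < \<kappa>" and A: "0 < A" and \<rho>: "0 < \<rho>" and s: "0 < s" "s * \<kappa> \<le> 1"
      and F: "integrable lborel F" "integrable lborel (\<lambda>z. norm (F z) powr r)" and \<tau>: "xsymb N A \<kappa> \<rho> \<tau>"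
    let ?P = "Phi r (real N * r) \<kappa> F (diag a) powr (1 / r)" and ?S = "A * (2 * \<rho> / \<kappa>) powr (real ?d / r)"
    define e where "e = K2 * ?S * (\<kappa> * s) * ?P"
    have e0: "0 \<le> e" using K0 A \<kappa> s by (auto simp: e_def)
    have err: "norm (fmult F (\<tau> x) (diag x) - fmult F (\<tau> a) (diag x)) \<le> e" if x: "x \<in> cube a s" for x
    proof -
      have "a \<in> cube a s" using s by (simp add: mem_cube)
      then have d: "dist x a \<le> real ?n * s" using norm_diff_cube_le[OF x] by (simp add: dist_norm)
      have "dist (diag x) (diag a :: real^'n^'l) \<le> real CARD('l) * dist x a"
        unfolding dist_norm diag_diff[symmetric] by (rule norm_diag_le)
      also have "\<dots> \<le> real CARD('l) * (real ?n * s)" using d by (intro mult_left_mono) auto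
      finally have "\<kappa> * dist (diag x) (diag a :: real^'n^'l) \<le> \<kappa> * (real CARD('l) * (real ?n * s))"
        using \<kappa> by (intro mult_left_mono) auto
      also have "\<dots> = c * (s * \<kappa>)" by (simp add: c_def mult_ac)
      also have "\<dots> \<le> c * 1" using s by (intro mult_left_mono) (auto simp: c_def)
      finally have "\<kappa> * dist (diag x) (diag a :: real^'n^'l) \<le> c" by simp
      from fmult_freeze[OF r \<kappa> A \<rho> F \<tau> d _ this] s
      show ?thesis unfolding e_def K2_def by (simp add: mult_ac)
    qed
    have [measurable]: "F \<in> borel_measurable borel" "\<tau> a \<in> borel_measurable borel"
      using F \<tau> symb_integrable[OF _ \<rho>, of N A "1 / \<kappa>" "\<tau> a"] unfolding xsymb_def by auto
    have um [measurable]: "(\<lambda>x. fmult F (\<tau> a) (diag x)) \<in> borel_measurable borel"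
      unfolding fmult_def by (rule lborel.borel_measurable_lebesgue_integral) measurable
    have "(\<integral>\<^sup>+x. ennreal (norm (fmult F (\<tau> x) (diag x))) * indicator (cube a s) x \<partial>lborel)
      \<le> (\<integral>\<^sup>+x. ennreal (norm (fmult F (\<tau> a) (diag x))) * indicator (cube a s) x + ennreal e * indicator (cube a s) x \<partial>lborel)"
      using ennreal_add_le_of_norm[OF err] by (intro nn_integral_mono) (auto split: split_indicator)
    also have "\<dots> = (\<integral>\<^sup>+x. ennreal (norm (fmult F (\<tau> a) (diag x))) * indicator (cube a s) x \<partial>lborel) + (\<integral>\<^sup>+x. ennreal e * indicator (cube a s) x \<partial>lborel)"
      by (rule nn_integral_add) measurable
    also have "(\<integral>\<^sup>+x. ennreal e * indicator (cube a s) x \<partial>lborel) = ennreal (e * s ^ ?n)"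
      using s e0 by (subst nn_integral_cmult_indicator) (auto simp: emeasure_cube ennreal_mult)
    also have "(\<integral>\<^sup>+x. ennreal (norm (fmult F (\<tau> a) (diag x))) * indicator (cube a s) x \<partial>lborel)
      \<le> ennreal (K1 * (A * (2 * \<rho> / \<kappa>) powr (real ?d / r) * s ^ ?n * (1 / (\<rho> * s)) powr (real ?n / q) * ?P))"
      by (rule fmult_gain[OF r q \<kappa> A \<rho> s F _ K1_def]) (use \<tau> in \<open>simp add: xsymb_def\<close>)
    also have "\<dots> + ennreal (e * s ^ ?n) = ennreal (K1 * (?S * s ^ ?n * (1 / (\<rho> * s)) powr (real ?n / q) * ?P) + e * s ^ ?n)"
      using K0 A s e0 by (intro ennreal_plus[symmetric]) auto
    also have "\<dots> \<le> ennreal ((K1 + K2) * ?S * ((1 / (\<rho> * s)) powr (real ?n / q) + \<kappa> * s) * ?P * s ^ ?n)"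
    proof (rule ennreal_leI)
      have "0 \<le> K1 * (\<kappa> * s) + K2 * (1 / (\<rho> * s)) powr (real ?n / q)" using K0 \<kappa> s by simp
      then have "0 \<le> (K1 * (\<kappa> * s) + K2 * (1 / (\<rho> * s)) powr (real ?n / q)) * (?S * ?P * s ^ ?n)"
        using A s by (intro mult_nonneg_nonneg) auto
      then show "K1 * (?S * s ^ ?n * (1 / (\<rho> * s)) powr (real ?n / q) * ?P) + e * s ^ ?n
        \<le> (K1 + K2) * ?S * ((1 / (\<rho> * s)) powr (real ?n / q) + \<kappa> * s) * ?P * s ^ ?n"
        unfolding e_def by (simp only: distrib_left distrib_right mult_ac)
    qed
    finally show "(\<integral>\<^sup>+x. ennreal (norm (fmult F (\<tau> x) (diag x))) * indicator (cube a s) x \<partial>lborel)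
      \<le> ennreal ((K1 + K2) * ?S * ((1 / (\<rho> * s)) powr (real ?n / q) + \<kappa> * s) * ?P * s ^ ?n)"
      by (simp add: add_right_mono)
  qed
qed

text \<open>Jensen's inequality for the exponent t <= 1 up to a factor 2, from y^t <= y + 1 with y =
  h/B.\<close>

lemma nn_integral_powr_le_of_average:
  fixes h :: "'a \<Rightarrow> real"
  assumes t: "0 < t" "t \<le> 1" and [measurable]: "h \<in> borel_measurable M" "P \<in> sets M" and h0: "\<And>x. 0 \<le> h x"
    and V: "emeasure M P = ennreal V" "0 \<le> V" and B: "0 \<le> B" and avg: "(\<integral>\<^sup>+x. ennreal (h x) * indicator P x \<partial>M) \<le> ennreal (B * V)"
  shows "(\<integral>\<^sup>+x. ennreal (h x powr t) * indicator P x \<partial>M) \<le> ennreal (2 * B powr t * V)"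
proof (cases "B = 0")
  case True
  then have "(\<integral>\<^sup>+x. ennreal (h x) * indicator P x \<partial>M) = 0" using avg by simp
  then have "AE x in M. ennreal (h x) * indicator P x = 0" by (subst (asm) nn_integral_0_iff_AE) auto
  then have "AE x in M. ennreal (h x powr t) * indicator P x = 0"
    by eventually_elim (use h0 in \<open>auto simp: ennreal_eq_0_iff order_antisym split: split_indicator_asm\<close>)
  then have "(\<integral>\<^sup>+x. ennreal (h x powr t) * indicator P x \<partial>M) = 0" by (subst nn_integral_0_iff_AE) auto
  then show ?thesis by simp
next
  case False
  then have B: "0 < B" using B by simp
  have pw: "h x powr t \<le> B powr t / B * h x + B powr t" for x
  proof -
    have "y powr t \<le> y + 1" if "0 \<le> y" for y
    proof (cases "y \<le> 1")
      case True
      then have "y powr t \<le> 1 powr t" using that t by (intro powr_mono2) auto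
      then show ?thesis using that by simp
    next
      case False
      then have "y powr t \<le> y powr 1" using t by (intro powr_mono) auto
      then show ?thesis using that by simp
    qed
    from this[of "h x / B"] have "h x powr t / B powr t \<le> h x / B + 1"
      using h0[of x] B by (simp add: powr_divide)
    then have "h x powr t \<le> (h x / B + 1) * B powr t" using B by (simp add: pos_divide_le_eq)
    then show ?thesis by (simp add: algebra_simps)
  qed
  have "(\<integral>\<^sup>+x. ennreal (h x powr t) * indicator P x \<partial>M) \<le> (\<integral>\<^sup>+x. ennreal (B powr t / B) * (ennreal (h x) * indicator P x) + ennreal (B powr t) * indicator P x \<partial>M)"
  proof (rule nn_integral_mono)
    fix x
    have "ennreal (h x powr t) \<le> ennreal (B powr t / B) * ennreal (h x) + ennreal (B powr t)"
      using ennreal_leI[OF pw[of x]] B h0[of x] by (simp add: ennreal_mult ennreal_plus del: times_divide_eq_left)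
    then show "ennreal (h x powr t) * indicator P x \<le> ennreal (B powr t / B) * (ennreal (h x) * indicator P x) + ennreal (B powr t) * indicator P x"
      by (auto split: split_indicator)
  qed
  also have "\<dots> = ennreal (B powr t / B) * (\<integral>\<^sup>+x. ennreal (h x) * indicator P x \<partial>M) + ennreal (B powr t) * ennreal V"
    by (subst nn_integral_add) (auto simp: nn_integral_cmult V nn_integral_cmult_indicator)
  also have "\<dots> \<le> ennreal (B powr t / B) * ennreal (B * V) + ennreal (B powr t) * ennreal V"
    by (intro add_right_mono mult_left_mono avg) auto
  also have "\<dots> = ennreal (2 * B powr t * V)"
    using B V by (simp add: ennreal_mult[symmetric] ennreal_plus[symmetric] del: ennreal_plus)
  finally show ?thesis .
qed

text \<open>Averaging over all translates replaces a partition into small cubes and works for every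
  ratio L/s. The corners \<open>a\<close> of the small cubes that contain x form a cube of volume
  s^n, and for x in the large cube these corners stay in the enlarged one.\<close>

lemma nn_integral_cube_average:
  fixes h :: "real^'n \<Rightarrow> ennreal"
  assumes [measurable]: "h \<in> borel_measurable borel" and s: "0 < s"
  shows "ennreal (s ^ CARD('n)) * (\<integral>\<^sup>+x. h x * indicator (cube a0 L) x \<partial>lborel)
    \<le> (\<integral>\<^sup>+a. (\<integral>\<^sup>+x. h x * indicator (cube a s) x \<partial>lborel) * indicator (cube (a0 - s *\<^sub>R One) (L + s)) a \<partial>lborel)"
proof -
  have ind: "indicator (cube a s) x = (indicator (cube 0 s) (x - a) :: ennreal)" for a x :: "real^'n"
    by (simp add: indicator_def mem_cube algebra_simps)
  have "ennreal (s ^ CARD('n)) * (\<integral>\<^sup>+x. h x * indicator (cube a0 L) x \<partial>lborel)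
     = (\<integral>\<^sup>+x. h x * indicator (cube a0 L) x * (\<integral>\<^sup>+a. indicator (cube (x - s *\<^sub>R One) s) a \<partial>lborel) \<partial>lborel)"
    using s by (subst nn_integral_cmult[symmetric]) (auto simp: emeasure_cube mult_ac)
  also have "\<dots> = (\<integral>\<^sup>+x. (\<integral>\<^sup>+a. h x * indicator (cube a0 L) x * indicator (cube (x - s *\<^sub>R One) s) a \<partial>lborel) \<partial>lborel)"
    by (intro nn_integral_cong nn_integral_cmult[symmetric]) measurable
  also have "\<dots> \<le> (\<integral>\<^sup>+x. (\<integral>\<^sup>+a. h x * indicator (cube 0 s) (x - a) * indicator (cube (a0 - s *\<^sub>R One) (L + s)) a \<partial>lborel) \<partial>lborel)"
  proof (intro nn_integral_mono)
    fix x a :: "real^'n"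
    have "x - a \<in> cube 0 s \<and> a \<in> cube (a0 - s *\<^sub>R One) (L + s)" if "x \<in> cube a0 L" "a \<in> cube (x - s *\<^sub>R One) s"
    proof -
      have "(0 :: real^'n) $ i \<le> (x - a) $ i \<and> (x - a) $ i \<le> (0 :: real^'n) $ i + s \<and> a0 $ i - s \<le> a $ i \<and> a $ i \<le> a0 $ i - s + (L + s)" for i
        using spec[OF that(1)[unfolded mem_cube], of i] spec[OF that(2)[unfolded mem_cube nth_add_One], of i] by simp
      then show ?thesis unfolding mem_cube nth_add_One by blast
    qed
    then show "h x * indicator (cube a0 L) x * indicator (cube (x - s *\<^sub>R One) s) a \<le> h x * indicator (cube 0 s) (x - a) * indicator (cube (a0 - s *\<^sub>R One) (L + s)) a"
      by (auto split: split_indicator)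
  qed
  also have "\<dots> = (\<integral>\<^sup>+a. (\<integral>\<^sup>+x. h x * indicator (cube 0 s) (x - a) * indicator (cube (a0 - s *\<^sub>R One) (L + s)) a \<partial>lborel) \<partial>lborel)"
    by (rule lborel_pair.Fubini') measurable
  also have "\<dots> = (\<integral>\<^sup>+a. (\<integral>\<^sup>+x. h x * indicator (cube a s) x \<partial>lborel) * indicator (cube (a0 - s *\<^sub>R One) (L + s)) a \<partial>lborel)"
    unfolding ind[symmetric] by (intro nn_integral_cong nn_integral_multc) measurable
  finally show ?thesis .
qed


section \<open>Oscillation of a low-frequency piece\<close>

lemma norm_cis_minus_one_le: "norm (cis \<theta> - 1) \<le> \<bar>\<theta>\<bar>"
proof -
  have "norm (cis \<theta> - 1) = 2 * \<bar>sin (\<theta> / 2)\<bar>"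
    using dist_exp_i_1[of \<theta>] by (simp add: cis_conv_exp)
  also have "\<dots> \<le> 2 * \<bar>\<theta> / 2\<bar>" using abs_sin_x_le_abs_x[of "\<theta> / 2"] by linarith
  finally show ?thesis by simp
qed

text \<open>Where |\<xi>| <= \<rho> the new factor is at most 2 \<pi> \<rho> \<delta>. Its
  derivative of order j >= 1 has size \<delta>^j; here \<delta> <= c/\<kappa> trades all factors but
  one for 1/\<kappa>, and the last is \<delta> = \<kappa>\<delta>/\<kappa> <=
  \<rho>\<delta>/\<kappa>. Every derivative thus keeps the small factor \<rho>\<delta>.\<close>

lemma symb_mult_cis_minus_one:
  fixes v :: "'a::euclidean_space"
  assumes b: "symb N A (1 / \<kappa>) \<rho> b" and pos: "0 < A" "0 < \<kappa>" "\<kappa> \<le> \<rho>" "1 \<le> c"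
    and v: "norm v \<le> \<delta>" "\<kappa> * \<delta> \<le> c"
  shows "symb N (2 ^ N * (A * ((7 * c) ^ (N + 1) * (\<rho> * \<delta>)))) (1 / \<kappa>) \<rho> (\<lambda>\<xi>. b \<xi> * (cis (2 * pi * (\<xi> \<bullet> v)) - 1))"
  unfolding symb_def
proof
  fix \<beta> :: 'a assume \<beta>: "\<beta> \<in> Basis"
  obtain D where D: "derseq N \<beta> D" "D 0 = b" "\<And>j \<xi>. j \<le> N \<Longrightarrow> norm (D j \<xi>) \<le> A * (1 / \<kappa>) ^ j"
    "\<And>j \<xi>. j \<le> N \<Longrightarrow> \<rho> < norm \<xi> \<Longrightarrow> D j \<xi> = 0"
    using b \<beta> unfolding symb_def by metis
  have \<delta>0: "0 \<le> \<delta>" using v(1) by (rule order_trans[OF norm_ge_zero])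
  define E where "E j \<xi> = (2 * pi * \<i> * (\<beta> \<bullet> v)) ^ j * cis (2 * pi * (\<xi> \<bullet> v)) - (if j = 0 then 1 else 0)" for j and \<xi> :: 'a
  have "derseq N \<beta> (\<lambda>j (\<xi>::'a). if j = 0 then 1 else 0 :: complex)"
    unfolding derseq_def by auto
  then have E: "derseq N \<beta> E" unfolding E_def by (intro derseq_diff derseq_cis)
  \<comment> \<open>The small factor for j = 0 is available only on the ball of radius \<rho>;
    outside it the derivatives of \<open>b\<close> vanish.\<close>
  have E_bd: "norm (E j \<xi>) \<le> (7 * c) ^ (N + 1) * (\<rho> * \<delta>) * (1 / \<kappa>) ^ j" if "j \<le> N" "norm \<xi> \<le> \<rho>" for j \<xi>
  proof (cases j)
    case 0
    have "norm (E j \<xi>) \<le> \<bar>2 * pi * (\<xi> \<bullet> v)\<bar>" unfolding 0 E_def using norm_cis_minus_one_le by simp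
    also have "\<dots> = 2 * pi * \<bar>\<xi> \<bullet> v\<bar>" by (simp add: abs_mult)
    also have "\<dots> \<le> 7 * (\<rho> * \<delta>)"
      using Cauchy_Schwarz_ineq2[of \<xi> v] that v mult_mono[OF that(2) v(1)] pos \<delta>0 pi_approx(2)
      by (intro mult_mono) auto
    also have "\<dots> \<le> (7 * c) ^ (N + 1) * (\<rho> * \<delta>)"
    proof (rule mult_right_mono)
      have "(7::real) \<le> (7 * c) ^ 1" using pos by simp
      also have "\<dots> \<le> (7 * c) ^ (N + 1)" using pos by (intro power_increasing) auto
      finally show "(7::real) \<le> (7 * c) ^ (N + 1)" .
    qed (use pos \<delta>0 in auto)
    finally show ?thesis using 0 by simp
  next
    case (Suc i)
    have "\<bar>\<beta> \<bullet> v\<bar> \<le> \<delta>" using Basis_le_norm[OF \<beta>, of v] v by (simp add: inner_commute)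
    then have "2 * pi * \<bar>\<beta> \<bullet> v\<bar> \<le> 7 * \<delta>" using \<delta>0 pi_approx(2) by (intro mult_mono) auto
    then have "(2 * pi * \<bar>\<beta> \<bullet> v\<bar>) ^ j \<le> (7 * \<delta>) ^ j" by (intro power_mono) auto
    moreover have "j \<noteq> 0" using Suc by simp
    then have "norm (E j \<xi>) = (2 * pi * \<bar>\<beta> \<bullet> v\<bar>) ^ j" by (simp add: E_def norm_mult norm_power)
    ultimately have "norm (E j \<xi>) \<le> (7 * \<delta>) ^ j" by (simp only:)
    also have "\<dots> = 7 ^ j * (\<delta> * \<delta> ^ i)" by (simp add: Suc power_mult_distrib)
    also have "\<dots> \<le> 7 ^ j * (\<delta> * (c / \<kappa>) ^ i)"
      using v pos \<delta>0 by (intro mult_left_mono power_mono) (auto simp: field_simps)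
    also have "\<dots> = 7 ^ j * c ^ i * (\<kappa> * \<delta> * (1 / \<kappa>) ^ j)"
      using pos by (simp add: Suc power_divide)
    also have "\<dots> \<le> 7 ^ j * c ^ i * (\<rho> * \<delta> * (1 / \<kappa>) ^ j)"
      using pos \<delta>0 by (intro mult_left_mono mult_right_mono) auto
    also have "\<dots> \<le> 7 ^ (N + 1) * c ^ (N + 1) * (\<rho> * \<delta> * (1 / \<kappa>) ^ j)"
      using pos \<delta>0 that Suc by (intro mult_right_mono mult_mono power_increasing) auto
    finally show ?thesis by (simp only: power_mult_distrib mult_ac)
  qed
  show "\<exists>D. derseq N \<beta> D \<and> D 0 = (\<lambda>\<xi>. b \<xi> * (cis (2 * pi * (\<xi> \<bullet> v)) - 1)) \<and>
     (\<forall>j\<le>N. \<forall>\<xi>. norm (D j \<xi>) \<le> 2 ^ N * (A * ((7 * c) ^ (N + 1) * (\<rho> * \<delta>))) * (1 / \<kappa>) ^ j \<and> (\<rho> < norm \<xi> \<longrightarrow> D j \<xi> = 0))"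
  proof (intro exI[of _ "leibniz D E"] conjI allI impI)
    show "derseq N \<beta> (leibniz D E)" by (rule derseq_leibniz[OF D(1) E])
    show "leibniz D E 0 = (\<lambda>\<xi>. b \<xi> * (cis (2 * pi * (\<xi> \<bullet> v)) - 1))" by (simp add: fun_eq_iff D(2) E_def)
    fix j \<xi> assume j: "j \<le> N"
    show zero: "leibniz D E j \<xi> = 0" if "\<rho> < norm \<xi>"
      unfolding leibniz_def using D(4) that j by (intro sum.neutral) auto
    let ?B = "A * ((7 * c) ^ (N + 1) * (\<rho> * \<delta>))"
    have B0: "0 \<le> ?B" using pos \<delta>0 by auto
    show "norm (leibniz D E j \<xi>) \<le> 2 ^ N * ?B * (1 / \<kappa>) ^ j"
    proof (cases "norm \<xi> \<le> \<rho>")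
      case True
      have "norm (leibniz D E j \<xi>) \<le> 2 ^ j * ?B * (1 / \<kappa>) ^ j"
        by (rule norm_leibniz_le) (use D(3) E_bd j True pos in auto)
      also have "\<dots> \<le> 2 ^ N * ?B * (1 / \<kappa>) ^ j"
        using B0 j pos by (intro mult_right_mono power_increasing) auto
      finally show ?thesis .
    next
      case False
      then show ?thesis using zero B0 pos by simp
    qed
  qed
qed

text \<open>First the symbol is frozen, at cost \<kappa>\<delta> <= \<rho>\<delta>; then the point
  is moved, which by \<open>fmult_shift\<close> is a multiplier of size \<rho>\<delta>. With \<rho>
  comparable to R and \<delta> to L this is the gain R L of the low frequencies.\<close>

lemma fmult_difference:
  fixes F :: "real^'n^'l \<Rightarrow> complex"
  assumes r: "1 < r" "r \<le> 2" and \<kappa>: "0 < \<kappa>" and A: "0 < A" and \<rho>: "\<kappa> \<le> \<rho>"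
    and F: "integrable lborel F" and Fr: "integrable lborel (\<lambda>z. norm (F z) powr r)"
    and \<tau>: "xsymb N A \<kappa> \<rho> \<tau>" and \<delta>: "dist x x0 \<le> \<delta>" "dist (diag x) (diag x0 :: real^'n^'l) \<le> \<delta>" "0 < \<delta>"
    and c: "\<kappa> * \<delta> \<le> c" "1 \<le> c"
  shows "norm (fmult F (\<tau> x) (diag x) - fmult F (\<tau> x0) (diag x0))
     \<le> real (DIM(real^'n^'l) + 1) ^ (N + 2) * ((1 + c) powr real N + 2 ^ N * (7 * c) ^ (N + 1)) *
     (A * (2 * \<rho> / \<kappa>) powr (real DIM(real^'n^'l) / r)) * (\<rho> * \<delta>) * Phi r (real N * r) \<kappa> F (diag x0) powr (1 / r)"
proof -
  let ?K = "real (DIM(real^'n^'l) + 1) ^ (N + 2)" and ?P = "Phi r (real N * r) \<kappa> F (diag x0) powr (1 / r)"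
    and ?U = "(2 * \<rho> / \<kappa>) powr (real DIM(real^'n^'l) / r)"
  have \<rho>0: "0 < \<rho>" using \<kappa> \<rho> by simp
  define v where "v = (diag x - diag x0 :: real^'n^'l)"
  have v: "norm v \<le> \<delta>" using \<delta> by (simp add: v_def dist_norm)
  have sx0: "symb N A (1 / \<kappa>) \<rho> (\<tau> x0)" using \<tau> by (simp add: xsymb_def)
  have int0: "integrable lborel (\<tau> x0)" by (rule symb_integrable[OF sx0 \<rho>0])
  have "\<kappa> * dist (diag x) (diag x0 :: real^'n^'l) \<le> \<kappa> * \<delta>" using \<delta> \<kappa> by (intro mult_left_mono) auto
  then have c': "\<kappa> * dist (diag x) (diag x0 :: real^'n^'l) \<le> c" using c by simp
  have 1: "norm (fmult F (\<tau> x) (diag x) - fmult F (\<tau> x0) (diag x)) \<le> ?K * (1 + c) powr real N * (A * ?U * (\<rho> * \<delta>) * ?P)"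
  proof -
    have "norm (fmult F (\<tau> x) (diag x) - fmult F (\<tau> x0) (diag x)) \<le> ?K * (1 + c) powr real N * (A * ?U * (\<kappa> * \<delta>) * ?P)"
      by (rule fmult_freeze[OF r \<kappa> A \<rho>0 F Fr \<tau> \<delta>(1) \<delta>(3) c'])
    also have "\<dots> \<le> ?K * (1 + c) powr real N * (A * ?U * (\<rho> * \<delta>) * ?P)"
      using A \<kappa> \<rho> \<delta> by (intro mult_left_mono mult_right_mono) auto
    finally show ?thesis .
  qed
  have shift: "fmult F (\<tau> x0) (diag x) - fmult F (\<tau> x0) (diag x0) = fmult F (\<lambda>\<xi>. \<tau> x0 \<xi> * (cis (2 * pi * (\<xi> \<bullet> v)) - 1)) (diag x0)"
  proof -
    have i: "integrable lborel (\<lambda>\<xi>. \<tau> x0 \<xi> * cis (2 * pi * (\<xi> \<bullet> v)))"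
      by (rule integrable_mult_bounded[OF int0, of _ 1]) auto
    have "fmult F (\<tau> x0) (diag x) = fmult F (\<lambda>\<xi>. \<tau> x0 \<xi> * cis (2 * pi * (\<xi> \<bullet> v))) (diag x0)"
      unfolding fmult_shift v_def by simp
    then show ?thesis
      using fmult_diff[OF F i int0, of "diag x0"] by (simp add: right_diff_distrib)
  qed
  have 2: "norm (fmult F (\<tau> x0) (diag x) - fmult F (\<tau> x0) (diag x0)) \<le> ?K * (2 ^ N * (A * ((7 * c) ^ (N + 1) * (\<rho> * \<delta>))) * ?U * ?P)"
    unfolding shift
    by (rule symb_fmult_bound[OF r \<kappa> _ \<rho>0 F Fr symb_mult_cis_minus_one[OF sx0 A \<kappa> \<rho> c(2) v c(1)]])
       (use A c \<rho>0 \<delta> in auto)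
  have "norm (fmult F (\<tau> x) (diag x) - fmult F (\<tau> x0) (diag x0))
     \<le> norm (fmult F (\<tau> x) (diag x) - fmult F (\<tau> x0) (diag x)) + norm (fmult F (\<tau> x0) (diag x) - fmult F (\<tau> x0) (diag x0))"
    unfolding dist_norm[symmetric] by (rule dist_triangle)
  also have "\<dots> \<le> ?K * (1 + c) powr real N * (A * ?U * (\<rho> * \<delta>) * ?P) + ?K * (2 ^ N * (A * ((7 * c) ^ (N + 1) * (\<rho> * \<delta>))) * ?U * ?P)"
    by (intro add_mono 1 2)
  also have "\<dots> = ?K * ((1 + c) powr real N + 2 ^ N * (7 * c) ^ (N + 1)) * (A * ?U) * (\<rho> * \<delta>) * ?P"
    by (simp only: distrib_left distrib_right mult_ac)
  finally show ?thesis .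
qed

section \<open>Product structure and maximal functions\<close>

lemma prod_Basis_vec:
  fixes g :: "real^'n^'l \<Rightarrow> real"
  shows "(\<Prod>\<beta>\<in>Basis. g \<beta>) = (\<Prod>j\<in>UNIV. \<Prod>b\<in>Basis. g (axis j b))"
proof -
  have eq: "(Basis :: (real^'n^'l) set) = (\<lambda>(j, b). axis j b) ` (UNIV \<times> Basis)" by (auto simp: Basis_vec_def)
  have inj: "inj_on (\<lambda>(j, b). axis j b :: real^'n^'l) (UNIV \<times> Basis)"
    by (auto simp: inj_on_def axis_eq_axis nonzero_Basis)
  show ?thesis unfolding eq prod.reindex[OF inj] by (simp add: prod.cartesian_product case_prod_unfold)
qed

lemma vec_lambda_PiM_measurable:
  "(\<lambda>f. \<chi> j. f j) \<in> (\<Pi>\<^sub>M j\<in>(UNIV :: 'l::finite set). (lborel :: (real^'n) measure)) \<rightarrow>\<^sub>M (borel :: (real^'n^'l) measure)"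
proof (subst borel_measurable_euclidean_space, rule ballI)
  fix \<beta> :: "real^'n^'l" assume "\<beta> \<in> Basis"
  then obtain j b where "\<beta> = axis j b" by (auto simp: Basis_vec_def)
  then have "(\<lambda>f. (\<chi> j. f j) \<bullet> \<beta>) = (\<lambda>f. f j \<bullet> b)" by (simp add: inner_axis)
  then show "(\<lambda>f. (\<chi> j. f j) \<bullet> \<beta>) \<in> borel_measurable (\<Pi>\<^sub>M j\<in>(UNIV :: 'l set). (lborel :: (real^'n) measure))"
    by simp
qed

text \<open>Lebesgue measure is determined by its values on boxes, and a box in
  \<open>real^'n^'l\<close> is a product of boxes in \<open>real^'n\<close>.\<close>

lemma lborel_vec_eq:
  "(lborel :: (real^'n^'l) measure) = distr (\<Pi>\<^sub>M j\<in>UNIV. lborel) borel (\<lambda>f. \<chi> j. f j)"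
proof (rule lborel_eqI)
  interpret product_sigma_finite "\<lambda>j::'l. lborel :: (real^'n) measure" ..
  note [measurable] = vec_lambda_PiM_measurable
  fix l u :: "real^'n^'l"
  assume lu: "\<And>b. b \<in> Basis \<Longrightarrow> l \<bullet> b \<le> u \<bullet> b"
  have le: "l $ j \<bullet> b \<le> u $ j \<bullet> b" if "b \<in> Basis" for j b
    using lu[of "axis j b"] that by (simp add: inner_axis)
  have "(\<lambda>f. \<chi> j. f j) -` box l u \<inter> space (\<Pi>\<^sub>M j\<in>UNIV. lborel) = Pi\<^sub>E UNIV (\<lambda>j. box (l $ j) (u $ j))"
  proof -
    have "(\<chi> j. f j) \<in> box l u \<longleftrightarrow> (\<forall>j. f j \<in> box (l $ j) (u $ j))" for f :: "'l \<Rightarrow> real^'n"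
      unfolding mem_box Basis_vec_def by (auto simp: inner_axis)
    then show ?thesis by (auto simp: space_PiM PiE_UNIV_domain)
  qed
  then have "emeasure (distr (\<Pi>\<^sub>M j\<in>UNIV. lborel) borel (\<lambda>f. \<chi> j. f j)) (box l u) = emeasure (\<Pi>\<^sub>M j\<in>UNIV. lborel) (Pi\<^sub>E UNIV (\<lambda>j. box (l $ j) (u $ j)))"
    by (subst emeasure_distr) auto
  also have "\<dots> = (\<Prod>j\<in>UNIV. emeasure lborel (box (l $ j) (u $ j)))"
    by (rule emeasure_PiM) auto
  also have "\<dots> = (\<Prod>j\<in>UNIV. ennreal (\<Prod>b\<in>Basis. (u $ j - l $ j) \<bullet> b))"
    using le by (intro prod.cong refl) (simp add: emeasure_lborel_box_eq)
  also have "\<dots> = ennreal (\<Prod>j\<in>UNIV. \<Prod>b\<in>Basis. (u $ j - l $ j) \<bullet> b)"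
    using le by (subst prod_ennreal) (auto intro!: prod_nonneg simp: inner_diff_left)
  also have "(\<Prod>j\<in>UNIV. \<Prod>b\<in>Basis. (u $ j - l $ j) \<bullet> b) = (\<Prod>b\<in>Basis. (u - l) \<bullet> b)"
    by (simp add: prod_Basis_vec inner_axis)
  finally show "emeasure (distr (\<Pi>\<^sub>M j\<in>UNIV. lborel) borel (\<lambda>f. \<chi> j. f j)) (box l u) = ennreal (\<Prod>b\<in>Basis. (u - l) \<bullet> b)" .
qed simp

lemma nn_integral_vec_prod:
  fixes g :: "'l::finite \<Rightarrow> real^'n \<Rightarrow> ennreal"
  assumes [measurable]: "\<And>j. g j \<in> borel_measurable borel"
  shows "(\<integral>\<^sup>+u. (\<Prod>j\<in>UNIV. g j (u $ j)) \<partial>(lborel :: (real^'n^'l) measure)) = (\<Prod>j\<in>UNIV. \<integral>\<^sup>+y. g j y \<partial>lborel)"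
proof -
  interpret product_sigma_finite "\<lambda>j::'l. lborel :: (real^'n) measure" ..
  have "(\<lambda>u :: real^'n^'l. u $ j) \<in> borel_measurable borel" for j
    by (intro borel_measurable_continuous_onI continuous_intros)
  then have m: "(\<lambda>u :: real^'n^'l. \<Prod>j\<in>UNIV. g j (u $ j)) \<in> borel_measurable borel"
    by (intro borel_measurable_prod_ennreal measurable_compose[OF _ assms]) auto
  show ?thesis
    by (subst lborel_vec_eq, subst nn_integral_distr, rule vec_lambda_PiM_measurable, simp add: m)
       (simp add: product_nn_integral_prod)
qed

lemma integral_vec_prod:
  fixes g :: "'l::finite \<Rightarrow> real^'n \<Rightarrow> complex"
  assumes "\<And>j. integrable lborel (g j)"
  shows "integrable (lborel :: (real^'n^'l) measure) (\<lambda>u. \<Prod>j\<in>UNIV. g j (u $ j))"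
    and "(\<integral>u. (\<Prod>j\<in>UNIV. g j (u $ j)) \<partial>(lborel :: (real^'n^'l) measure)) = (\<Prod>j\<in>UNIV. \<integral>y. g j y \<partial>lborel)"
proof -
  interpret product_sigma_finite "\<lambda>j::'l. lborel :: (real^'n) measure" ..
  have gm: "g j \<in> borel_measurable borel" for j using assms[of j] by auto
  have "(\<lambda>u :: real^'n^'l. u $ j) \<in> borel_measurable borel" for j
    by (intro borel_measurable_continuous_onI continuous_intros)
  then have m: "(\<lambda>u :: real^'n^'l. \<Prod>j\<in>UNIV. g j (u $ j)) \<in> borel_measurable borel"
    by (intro borel_measurable_prod measurable_compose[OF _ gm]) auto
  show "integrable (lborel :: (real^'n^'l) measure) (\<lambda>u. \<Prod>j\<in>UNIV. g j (u $ j))"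
    by (subst lborel_vec_eq, subst integrable_distr_eq[OF vec_lambda_PiM_measurable m])
       (simp add: product_integrable_prod assms)
  show "(\<integral>u. (\<Prod>j\<in>UNIV. g j (u $ j)) \<partial>(lborel :: (real^'n^'l) measure)) = (\<Prod>j\<in>UNIV. \<integral>y. g j y \<partial>lborel)"
    by (subst lborel_vec_eq, subst integral_distr[OF vec_lambda_PiM_measurable m])
       (simp add: product_integral_prod assms)
qed

lemma one_plus_sum_le_prod:
  fixes v :: "'i \<Rightarrow> real"
  assumes "finite I" "\<And>i. i \<in> I \<Longrightarrow> 0 \<le> v i"
  shows "1 + (\<Sum>i\<in>I. v i) \<le> (\<Prod>i\<in>I. 1 + v i)"
  using assms
proof (induction rule: finite_induct)
  case (insert x I)
  then have "1 + (\<Sum>i\<in>I. v i) \<le> (\<Prod>i\<in>I. 1 + v i)" "0 \<le> (\<Sum>i\<in>I. v i)" by (auto intro: sum_nonneg)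
  then have "(1 + v x) * (1 + (\<Sum>i\<in>I. v i)) \<le> (1 + v x) * (\<Prod>i\<in>I. 1 + v i)" "0 \<le> v x * (\<Sum>i\<in>I. v i)"
    using insert.prems by (auto intro!: mult_left_mono)
  then show ?case using insert by (simp add: algebra_simps)
qed simp

text \<open>Hoelder with equal exponents for several factors, obtained by integrating the
  arithmetic-geometric mean inequality for the normalised functions \<open>\<phi> i x / a i\<close>;
  a vanishing \<open>a i\<close> is treated apart.\<close>

lemma nn_integral_prod_root_le:
  fixes \<phi> :: "'i \<Rightarrow> 'a \<Rightarrow> real"
  assumes I: "finite I" "I \<noteq> {}" and m [measurable]: "\<And>i. i \<in> I \<Longrightarrow> \<phi> i \<in> borel_measurable M"
    and \<phi>0: "\<And>i x. i \<in> I \<Longrightarrow> 0 \<le> \<phi> i x" and a0: "\<And>i. i \<in> I \<Longrightarrow> 0 \<le> a i"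
    and le: "\<And>i. i \<in> I \<Longrightarrow> (\<integral>\<^sup>+x. ennreal (\<phi> i x) \<partial>M) \<le> ennreal (a i)"
  shows "(\<integral>\<^sup>+x. ennreal ((\<Prod>i\<in>I. \<phi> i x) powr (1 / real (card I))) \<partial>M) \<le> ennreal ((\<Prod>i\<in>I. a i) powr (1 / real (card I)))"
proof (cases "\<exists>i\<in>I. a i = 0")
  case True
  then obtain i where i: "i \<in> I" "a i = 0" by blast
  then have "(\<integral>\<^sup>+x. ennreal (\<phi> i x) \<partial>M) = 0" using le[OF i(1)] by simp
  then have "AE x in M. ennreal (\<phi> i x) = 0" using m[OF i(1)] by (subst (asm) nn_integral_0_iff_AE) auto
  then have "AE x in M. \<phi> i x = 0" by eventually_elim (use \<phi>0[OF i(1)] in \<open>auto simp: ennreal_eq_0_iff intro: order_antisym\<close>)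
  then have "AE x in M. ennreal ((\<Prod>i\<in>I. \<phi> i x) powr (1 / real (card I))) = 0"
  proof eventually_elim
    case (elim x)
    then have "(\<Prod>i\<in>I. \<phi> i x) = 0" using I i by auto
    then show ?case by simp
  qed
  then have "(\<integral>\<^sup>+x. ennreal ((\<Prod>i\<in>I. \<phi> i x) powr (1 / real (card I))) \<partial>M) = 0"
    by (subst nn_integral_0_iff_AE) auto
  then show ?thesis by simp
next
  case False
  then have a: "0 < a i" if "i \<in> I" for i using a0 that by (simp add: order_less_le)
  let ?k = "1 / real (card I)"
  define A where "A = (\<Prod>i\<in>I. a i) powr ?k"
  have k0: "0 < card I" using I by (simp add: card_gt_0_iff)
  have A0: "0 \<le> A" by (simp add: A_def)
  have pw: "(\<Prod>i\<in>I. \<phi> i x) powr ?k \<le> (\<Sum>i\<in>I. A / (a i * real (card I)) * \<phi> i x)" for x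
  proof -
    have "(\<Prod>i\<in>I. \<phi> i x) = (\<Prod>i\<in>I. a i) * (\<Prod>i\<in>I. \<phi> i x / a i)"
      unfolding prod.distrib[symmetric] using a by (intro prod.cong refl) (simp add: less_imp_neq[symmetric])
    then have "(\<Prod>i\<in>I. \<phi> i x) powr ?k = A * (\<Prod>i\<in>I. \<phi> i x / a i) powr ?k"
      by (simp only: powr_mult A_def)
    also have "\<dots> \<le> A * (\<Sum>i\<in>I. \<phi> i x / a i / real (card I))"
      using \<phi>0 a A0 by (intro mult_left_mono arith_geom_mean[OF I]) (auto simp: less_imp_le)
    finally show ?thesis by (simp add: sum_distrib_left mult_ac)
  qed
  have nn: "0 \<le> A / (a i * real (card I))" if "i \<in> I" for i using A0 a[OF that] by simp
  have "(\<integral>\<^sup>+x. ennreal ((\<Prod>i\<in>I. \<phi> i x) powr ?k) \<partial>M) \<le> (\<integral>\<^sup>+x. (\<Sum>i\<in>I. ennreal (A / (a i * real (card I))) * ennreal (\<phi> i x)) \<partial>M)"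
  proof (rule nn_integral_mono)
    fix x
    have "ennreal ((\<Prod>i\<in>I. \<phi> i x) powr ?k) \<le> ennreal (\<Sum>i\<in>I. A / (a i * real (card I)) * \<phi> i x)"
      by (intro ennreal_leI pw)
    also have "\<dots> = (\<Sum>i\<in>I. ennreal (A / (a i * real (card I)) * \<phi> i x))"
      by (rule sum_ennreal[symmetric]) (intro mult_nonneg_nonneg nn \<phi>0)
    also have "\<dots> = (\<Sum>i\<in>I. ennreal (A / (a i * real (card I))) * ennreal (\<phi> i x))"
      by (intro sum.cong refl ennreal_mult nn \<phi>0)
    finally show "ennreal ((\<Prod>i\<in>I. \<phi> i x) powr ?k) \<le> \<dots>" .
  qed
  also have "\<dots> = (\<Sum>i\<in>I. ennreal (A / (a i * real (card I))) * (\<integral>\<^sup>+x. ennreal (\<phi> i x) \<partial>M))"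
    by (subst nn_integral_sum) (auto simp: nn_integral_cmult)
  also have "\<dots> \<le> (\<Sum>i\<in>I. ennreal (A / (a i * real (card I))) * ennreal (a i))"
    by (intro sum_mono mult_left_mono le) auto
  also have "\<dots> = (\<Sum>i\<in>I. ennreal (A / real (card I)))"
  proof (rule sum.cong[OF refl])
    fix i assume "i \<in> I"
    then show "ennreal (A / (a i * real (card I))) * ennreal (a i) = ennreal (A / real (card I))"
      using a[of i] nn[of i] by (subst ennreal_mult[symmetric]) auto
  qed
  also have "\<dots> = ennreal (\<Sum>i\<in>I. A / real (card I))" using A0 by (intro sum_ennreal) auto
  also have "(\<Sum>i\<in>I. A / real (card I)) = A" using k0 by simp
  finally show ?thesis unfolding A_def .
qed


section \<open>The maximal function and weighted means over a cube\<close>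

definition tens :: "('l::finite \<Rightarrow> real^'n \<Rightarrow> complex) \<Rightarrow> real^'n^'l \<Rightarrow> complex" where
  "tens f z = (\<Prod>j\<in>UNIV. f j (z $ j))"

text \<open>\<open>M\<close> is a finite majorant at \<open>x0\<close> of the multilinear maximal
  function of the |f_j|^r, with the division by |Q|^l = s^d cleared. All estimates are made for a
  given real \<open>M\<close>; an infinite maximal function is dealt with only in the
  theorem.\<close>

definition max_bound :: "real \<Rightarrow> ('l::finite \<Rightarrow> real^'n \<Rightarrow> complex) \<Rightarrow> real^'n \<Rightarrow> real \<Rightarrow> bool" where
  "max_bound r f x0 M \<longleftrightarrow> 0 \<le> M \<and> (\<forall>a s. 0 < s \<longrightarrow> x0 \<in> cube a s \<longrightarrow>
     (\<integral>\<^sup>+u. ennreal (norm (tens f u) powr r) * indicator {u. \<forall>j. u $ j \<in> cube a s} u \<partial>lborel)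
       \<le> ennreal (M * s ^ DIM(real^'n^'l)))"

lemma powr_prod:
  fixes g :: "'i \<Rightarrow> real"
  shows "(\<Prod>i\<in>I. g i) powr r = (\<Prod>i\<in>I. g i powr r)"
  by (induction I rule: infinite_finite_induct) (auto simp: powr_mult)

lemma norm_tens_powr: "norm (tens f z) powr r = (\<Prod>j\<in>UNIV. norm (f j (z $ j)) powr r)"
  unfolding tens_def prod_norm[symmetric] powr_prod ..

lemma vec_nth_measurable [measurable (raw)]:
  "f \<in> borel_measurable M \<Longrightarrow> (\<lambda>x. (f x :: real^'n^'l) $ j) \<in> borel_measurable M"
  by (rule measurable_compose[OF _ borel_measurable_continuous_onI[of "\<lambda>u. u $ j"]]) (auto intro!: continuous_intros)

lemma tens_measurable:
  assumes "\<And>j. f j \<in> borel_measurable borel"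
  shows "tens f \<in> borel_measurable borel"
proof -
  note [measurable] = assms
  show ?thesis unfolding tens_def[abs_def] by measurable
qed

lemma dist_diag_ge: "dist x (z $ j) \<le> dist (diag x) (z :: real^'n^'l)"
proof -
  have "norm ((diag x - z) $ j) \<le> norm (diag x - z)"
    unfolding norm_vec_def[of "diag x - z"] by (rule member_le_L2_set) auto
  then show ?thesis by (simp add: dist_norm diag_def)
qed

lemma dist_diag_le: "dist (diag x) (z :: real^'n^'l) \<le> (\<Sum>j\<in>UNIV. dist x (z $ j))"
proof -
  have "norm (diag x - z) \<le> (\<Sum>j\<in>UNIV. norm ((diag x - z) $ j))"
    unfolding norm_vec_def by (rule L2_set_le_sum) auto
  then show ?thesis by (simp add: dist_norm diag_def)
qed

lemma max_bound_ball:
  fixes f :: "'l::finite \<Rightarrow> real^'n \<Rightarrow> complex"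
  assumes M: "max_bound r f x0 M" and \<rho>: "0 < \<rho>"
  shows "(\<integral>\<^sup>+u. ennreal (norm (tens f u) powr r) * indicator (cball (diag x0) \<rho>) u \<partial>lborel)
    \<le> ennreal (M * 2 ^ DIM(real^'n^'l)) * ennreal (\<rho> ^ DIM(real^'n^'l))"
proof -
  let ?a = "x0 - \<rho> *\<^sub>R One"
  have "x0 \<in> cube ?a (2 * \<rho>)" using \<rho> unfolding mem_cube nth_add_One by simp
  then have "(\<integral>\<^sup>+u. ennreal (norm (tens f u) powr r) * indicator {u. \<forall>j. u $ j \<in> cube ?a (2 * \<rho>)} u \<partial>lborel)
       \<le> ennreal (M * (2 * \<rho>) ^ DIM(real^'n^'l))"
    using spec[OF spec[OF M[unfolded max_bound_def, THEN conjunct2], of ?a], of "2 * \<rho>"] \<rho>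
    by (simp only: mult_pos_pos zero_less_numeral simp_thms)
  moreover have "(\<integral>\<^sup>+u. ennreal (norm (tens f u) powr r) * indicator (cball (diag x0) \<rho>) u \<partial>lborel)
    \<le> (\<integral>\<^sup>+u. ennreal (norm (tens f u) powr r) * indicator {u. \<forall>j. u $ j \<in> cube ?a (2 * \<rho>)} u \<partial>lborel)"
  proof (rule nn_integral_mono)
    fix u :: "real^'n^'l"
    have "u $ j \<in> cube ?a (2 * \<rho>)" if "dist (diag x0) u \<le> \<rho>" for j
    proof -
      have "dist x0 (u $ j) \<le> \<rho>" using dist_diag_ge[of x0 u j] that by simp
      then have "\<bar>(x0 - u $ j) $ i\<bar> \<le> \<rho>" for i using component_le_norm_cart[of "x0 - u $ j" i] by (simp add: dist_norm)
      then have "x0 $ i - \<rho> \<le> u $ j $ i \<and> u $ j $ i \<le> x0 $ i - \<rho> + 2 * \<rho>" for i by (simp add: abs_le_iff algebra_simps)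
      then show ?thesis unfolding mem_cube nth_add_One by blast
    qed
    then show "ennreal (norm (tens f u) powr r) * indicator (cball (diag x0) \<rho>) u \<le> ennreal (norm (tens f u) powr r) * indicator {u. \<forall>j. u $ j \<in> cube ?a (2 * \<rho>)} u"
      by (auto split: split_indicator)
  qed
  moreover have "0 \<le> M" using M by (simp add: max_bound_def)
  then have "ennreal (M * (2 * \<rho>) ^ DIM(real^'n^'l)) = ennreal (M * 2 ^ DIM(real^'n^'l)) * ennreal (\<rho> ^ DIM(real^'n^'l))"
    using \<rho> by (subst ennreal_mult[symmetric]) (simp_all only: power_mult_distrib mult_ac zero_le_power mult_nonneg_nonneg zero_le_numeral less_imp_le)
  ultimately show ?thesis by simp
qed

text \<open>A ball about \<open>diag x0\<close> lies in the l-fold product of a cube of twice the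
  radius, so \<open>max_bound\<close> supplies the growth condition of
  \<open>nn_integral_decay_weight\<close>.\<close>

lemma max_bound_weight:
  fixes f :: "'l::finite \<Rightarrow> real^'n \<Rightarrow> complex"
  assumes M: "max_bound r f x0 M" and f: "\<And>j. f j \<in> borel_measurable borel"
    and \<mu>: "0 < \<mu>" and p: "real DIM(real^'n^'l) + 1 \<le> p"
  shows "(\<integral>\<^sup>+u. ennreal (norm (tens f u) powr r) * ennreal ((1 + \<mu> * dist (diag x0) u) powr (- p)) \<partial>lborel)
    \<le> ennreal (2 powr (p + 1) * 2 ^ DIM(real^'n^'l) * M * (1 / \<mu>) ^ DIM(real^'n^'l))"
proof -
  have M0: "0 \<le> M" using M by (simp add: max_bound_def)
  have [measurable]: "tens f \<in> borel_measurable borel" by (rule tens_measurable[OF f])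
  have "(\<integral>\<^sup>+u. ennreal (norm (tens f u) powr r) * ennreal ((1 + \<mu> * dist (diag x0) u) powr (- p)) \<partial>lborel)
    \<le> ennreal (2 powr (p + 1)) * ennreal (M * 2 ^ DIM(real^'n^'l)) * ennreal ((1 / \<mu>) ^ DIM(real^'n^'l))"
    by (rule nn_integral_decay_weight[OF _ \<mu> p max_bound_ball[OF M]]) measurable
  also have "\<dots> = ennreal (2 powr (p + 1) * (M * 2 ^ DIM(real^'n^'l)) * (1 / \<mu>) ^ DIM(real^'n^'l))"
    using M0 \<mu> by (simp add: ennreal_mult del: DIM_cart)
  also have "2 powr (p + 1) * (M * 2 ^ DIM(real^'n^'l)) * (1 / \<mu>) ^ DIM(real^'n^'l) = 2 powr (p + 1) * 2 ^ DIM(real^'n^'l) * M * (1 / \<mu>) ^ DIM(real^'n^'l)"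
    by (simp only: mult_ac)
  finally show ?thesis .
qed

text \<open>The normalisation of \<open>Phi\<close> cancels the scale: at the point where
  \<open>M\<close> is given the bound is uniform in \<kappa>.\<close>

lemma Phi_max:
  fixes f :: "'l::finite \<Rightarrow> real^'n \<Rightarrow> complex"
  assumes M: "max_bound r f x0 M" and f: "\<And>j. f j \<in> borel_measurable borel"
    and fr: "integrable lborel (\<lambda>z. norm (tens f z) powr r)"
    and \<kappa>: "0 < \<kappa>" and p: "real DIM(real^'n^'l) + 1 \<le> p"
  shows "Phi r p \<kappa> (tens f) (diag x0) \<le> 2 powr (p + 1) * 2 ^ DIM(real^'n^'l) * M"
proof -
  let ?d = "DIM(real^'n^'l)"
  have M0: "0 \<le> M" using M by (simp add: max_bound_def)
  have inv: "\<kappa> ^ ?d * (1 / \<kappa>) ^ ?d = 1" unfolding power_mult_distrib[symmetric] using \<kappa> by simp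
  have "ennreal (Phi r p \<kappa> (tens f) (diag x0)) = ennreal (\<kappa> ^ ?d) * (\<integral>\<^sup>+u. ennreal (norm (tens f u) powr r) * ennreal ((1 + \<kappa> * dist (diag x0) u) powr (- p)) \<partial>lborel)"
    using ennreal_Phi[OF fr, of \<kappa> p "diag x0"] \<kappa> p by (simp add: ennreal_mult)
  also have "\<dots> \<le> ennreal (\<kappa> ^ ?d) * ennreal (2 powr (p + 1) * 2 ^ ?d * M * (1 / \<kappa>) ^ ?d)"
    by (intro mult_left_mono max_bound_weight[OF M f \<kappa> p]) auto
  also have "\<dots> = ennreal (\<kappa> ^ ?d * (2 powr (p + 1) * 2 ^ ?d * M * (1 / \<kappa>) ^ ?d))"
    using \<kappa> by (intro ennreal_mult'[symmetric]) simp
  also have "\<kappa> ^ ?d * (2 powr (p + 1) * 2 ^ ?d * M * (1 / \<kappa>) ^ ?d) = 2 powr (p + 1) * 2 ^ ?d * M * (\<kappa> ^ ?d * (1 / \<kappa>) ^ ?d)"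
    by (simp only: mult_ac)
  finally show ?thesis unfolding inv using M0 by (subst (asm) ennreal_le_iff) auto
qed

text \<open>Integrating a weight of scale 1/\<kappa> over a cube of side L >= 1/\<kappa> produces a
  weight of scale L. For y near \<open>x0\<close> relative to L the total mass of the fine weight is
  enough. For y far away |x - y| >= |x0 - y|/2, and (\<kappa> L)^(-p) <= (\<kappa> L)^(-n) absorbs
  \<kappa>^n and the volume L^n.\<close>

lemma weight_average_cube:
  fixes a x0 y :: "real^'n"
  assumes L: "0 < L" "1 \<le> \<kappa> * L" and \<kappa>: "0 < \<kappa>" and p: "real CARD('n) + 1 \<le> p" and x0: "x0 \<in> cube a L"
  shows "(\<integral>\<^sup>+x. ennreal (\<kappa> ^ CARD('n) * (1 + \<kappa> * dist x y) powr (- p)) * indicator (cube a L) x \<partial>lborel)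
    \<le> ennreal ((2 powr (p + 1) * 2 ^ CARD('n) * (1 + 2 * real CARD('n)) powr p + 4 powr p) * (1 + dist x0 y / L) powr (- p))"
    (is "?I \<le> ennreal (?C * ?w)")
proof (cases "dist x0 y \<le> 2 * real CARD('n) * L")
  case True
  let ?n = "CARD('n)"
  have inv: "\<kappa> ^ ?n * (1 / \<kappa>) ^ ?n = 1" unfolding power_mult_distrib[symmetric] using \<kappa> by simp
  have "?I \<le> (\<integral>\<^sup>+x. ennreal (\<kappa> ^ ?n) * (1 * ennreal ((1 + \<kappa> * dist y x) powr (- p))) \<partial>lborel)"
    using \<kappa> by (intro nn_integral_mono) (auto simp: ennreal_mult dist_commute split: split_indicator)
  also have "\<dots> = ennreal (\<kappa> ^ ?n) * (\<integral>\<^sup>+x. 1 * ennreal ((1 + \<kappa> * dist y x) powr (- p)) \<partial>lborel)"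
    by (rule nn_integral_cmult) measurable
  also have "\<dots> \<le> ennreal (\<kappa> ^ ?n) * (ennreal (2 powr (p + 1)) * ennreal (2 ^ ?n) * ennreal ((1 / \<kappa>) ^ DIM(real^'n)))"
  proof (intro mult_left_mono nn_integral_decay_weight \<kappa>)
    fix \<rho> :: real assume "0 < \<rho>"
    then show "(\<integral>\<^sup>+x. 1 * indicator (cball y \<rho>) x \<partial>lborel) \<le> ennreal (2 ^ ?n) * ennreal (\<rho> ^ DIM(real^'n))"
      using emeasure_cball_le[of \<rho> y] by (simp add: ennreal_mult[symmetric] power_mult_distrib)
  qed (use p in auto)
  also have "\<dots> = ennreal (\<kappa> ^ ?n * (2 powr (p + 1) * 2 ^ ?n * (1 / \<kappa>) ^ ?n))"
    using \<kappa> by (simp add: ennreal_mult)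
  also have "\<kappa> ^ ?n * (2 powr (p + 1) * 2 ^ ?n * (1 / \<kappa>) ^ ?n) = 2 powr (p + 1) * 2 ^ ?n * (\<kappa> ^ ?n * (1 / \<kappa>) ^ ?n)"
    by (simp only: mult_ac)
  also have "\<dots> = 2 powr (p + 1) * 2 ^ ?n" unfolding inv by simp
  also have "ennreal (2 powr (p + 1) * 2 ^ ?n) \<le> ennreal (?C * ?w)"
  proof (rule ennreal_leI)
    have "1 + dist x0 y / L \<le> 1 + 2 * real ?n" using True L by (simp add: pos_divide_le_eq)
    then have "(1 + 2 * real ?n) powr (- p) \<le> ?w" using p L by (intro powr_mono2') (auto intro: add_pos_nonneg)
    then have "(1 + 2 * real ?n) powr p * (1 + 2 * real ?n) powr (- p) \<le> (1 + 2 * real ?n) powr p * ?w" by (intro mult_left_mono) auto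
    moreover have "(1 + 2 * real ?n) powr p * (1 + 2 * real ?n) powr (- p) = 1"
      unfolding powr_add[symmetric] by (simp add: add_pos_nonneg)
    ultimately have "1 \<le> (1 + 2 * real ?n) powr p * ?w" by simp
    from mult_left_mono[OF this, of "2 powr (p + 1) * 2 ^ ?n"]
    have "2 powr (p + 1) * 2 ^ ?n \<le> (2 powr (p + 1) * 2 ^ ?n * (1 + 2 * real ?n) powr p) * ?w" by (simp add: mult.assoc)
    also have "\<dots> \<le> ?C * ?w" by (intro mult_right_mono) auto
    finally show "2 powr (p + 1) * 2 ^ ?n \<le> ?C * ?w" .
  qed
  finally show ?thesis .
next
  case False
  let ?n = "CARD('n)"
  define v where "v = dist x0 y / L"
  have v: "2 * real ?n \<le> v" using False L by (simp add: v_def pos_le_divide_eq)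
  have "1 \<le> real ?n" by (simp add: Suc_leI)
  then have v1: "2 \<le> v" using v by linarith
  have pw: "\<kappa> ^ ?n * (1 + \<kappa> * dist x y) powr (- p) \<le> (1 / L) ^ ?n * (4 powr p * ?w)" if x: "x \<in> cube a L" for x
  proof -
    have "dist x x0 \<le> real ?n * L" using norm_diff_cube_le[OF x x0] by (simp add: dist_norm)
    moreover have "dist x0 y \<le> dist x x0 + dist x y" using dist_triangle[of x0 y x] by (simp add: dist_commute)
    ultimately have "dist x0 y / 2 \<le> dist x y" using False by linarith
    then have "\<kappa> * (dist x0 y / 2) \<le> \<kappa> * dist x y" using \<kappa> by (intro mult_left_mono) auto
    moreover have "\<kappa> * L * ((1 + v) / 4) \<le> \<kappa> * L * (v / 2)" using v1 \<kappa> L by (intro mult_left_mono) auto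
    moreover have "\<kappa> * L * (v / 2) = \<kappa> * (dist x0 y / 2)" using L by (simp add: v_def)
    ultimately have "\<kappa> * L * ((1 + v) / 4) \<le> 1 + \<kappa> * dist x y" by linarith
    then have "(1 + \<kappa> * dist x y) powr (- p) \<le> (\<kappa> * L * ((1 + v) / 4)) powr (- p)"
      using \<kappa> L v1 p by (intro powr_mono2') auto
    also have "\<dots> = (\<kappa> * L) powr (- p) * ((1 + v) / 4) powr (- p)" by (rule powr_mult)
    also have "((1 + v) / 4) powr (- p) = 4 powr p * ?w"
      using v1 by (simp add: powr_divide powr_minus_divide v_def)
    also have "(\<kappa> * L) powr (- p) \<le> (\<kappa> * L) powr (- real ?n)" using L p by (intro powr_mono) auto
    also have "(\<kappa> * L) powr (- real ?n) = 1 / (\<kappa> * L) ^ ?n" using L \<kappa> by (simp add: powr_minus_divide powr_realpow)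
    finally have "(1 + \<kappa> * dist x y) powr (- p) \<le> 1 / (\<kappa> * L) ^ ?n * (4 powr p * ?w)"
      by (simp add: mult_right_mono)
    then have "\<kappa> ^ ?n * (1 + \<kappa> * dist x y) powr (- p) \<le> \<kappa> ^ ?n * (1 / (\<kappa> * L) ^ ?n * (4 powr p * ?w))"
      using \<kappa> by (intro mult_left_mono) auto
    also have "\<dots> = (1 / L) ^ ?n * (4 powr p * ?w)"
      using \<kappa> L by (simp add: power_mult_distrib power_one_over)
    finally show ?thesis .
  qed
  have "?I \<le> (\<integral>\<^sup>+x. ennreal ((1 / L) ^ ?n * (4 powr p * ?w)) * indicator (cube a L) x \<partial>lborel)"
    using pw by (intro nn_integral_mono) (auto split: split_indicator intro!: ennreal_leI)
  also have "\<dots> = ennreal ((1 / L) ^ ?n * (4 powr p * ?w)) * ennreal (L ^ ?n)"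
    using L by (subst nn_integral_cmult_indicator) (auto simp: emeasure_cube)
  also have "\<dots> = ennreal (4 powr p * ?w)"
    using L by (subst ennreal_mult[symmetric]) (auto simp: power_one_over)
  also have "\<dots> \<le> ennreal (?C * ?w)"
    by (intro ennreal_leI mult_right_mono) auto
  finally show ?thesis .
qed

text \<open>Each |x - z_j| is at most the distance from \<open>diag x\<close> to z, so a weight of
  exponent l p splits into l one-variable weights of exponent p.\<close>

lemma Phi_diag_le_prod:
  fixes f :: "'l::finite \<Rightarrow> real^'n \<Rightarrow> complex"
  assumes f: "\<And>j. f j \<in> borel_measurable borel" and fr: "integrable lborel (\<lambda>z. norm (tens f z) powr r)"
    and \<kappa>: "0 < \<kappa>" and p: "0 \<le> p"
  shows "ennreal (Phi r (real CARD('l) * p) \<kappa> (tens f) (diag x))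
    \<le> (\<Prod>j\<in>UNIV. \<integral>\<^sup>+y. ennreal (\<kappa> ^ CARD('n) * (norm (f j y) powr r * (1 + \<kappa> * dist x y) powr (- p))) \<partial>lborel)"
proof -
  let ?d = "DIM(real^'n^'l)" and ?n = "CARD('n)" and ?l = "CARD('l)"
  note [measurable] = f
  have [measurable]: "tens f \<in> borel_measurable borel" by (rule tens_measurable[OF f])
  have dd: "?d = ?n * ?l" by simp
  have "ennreal (Phi r (real ?l * p) \<kappa> (tens f) (diag x)) = ennreal (\<kappa> ^ ?d) * (\<integral>\<^sup>+z. ennreal (norm (tens f z) powr r * (1 + \<kappa> * dist (diag x) z) powr (- (real ?l * p))) \<partial>lborel)"
    by (rule ennreal_Phi[OF fr]) (use \<kappa> p in auto)
  also have "\<dots> = (\<integral>\<^sup>+z. ennreal (\<kappa> ^ ?d) * ennreal (norm (tens f z) powr r * (1 + \<kappa> * dist (diag x) z) powr (- (real ?l * p))) \<partial>lborel)"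
    by (rule nn_integral_cmult[symmetric]) measurable
  also have "\<dots> \<le> (\<integral>\<^sup>+z. (\<Prod>j\<in>UNIV. ennreal (\<kappa> ^ ?n * (norm (f j (z $ j)) powr r * (1 + \<kappa> * dist x (z $ j)) powr (- p)))) \<partial>lborel)"
  proof (rule nn_integral_mono)
    fix z :: "real^'n^'l"
    have "(1 + \<kappa> * dist (diag x) z) powr (- (real ?l * p)) = (\<Prod>j\<in>(UNIV :: 'l set). (1 + \<kappa> * dist (diag x) z) powr (- p))"
    proof -
      have "((1 + \<kappa> * dist (diag x) z) powr (- p)) ^ ?l = ((1 + \<kappa> * dist (diag x) z) powr (- p)) powr real ?l"
        using \<kappa> by (subst powr_realpow) (auto simp: add_nonneg_eq_0_iff)
      also have "\<dots> = (1 + \<kappa> * dist (diag x) z) powr (- (real ?l * p))" by (simp add: powr_powr mult.commute)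
      finally show ?thesis by simp
    qed
    also have "\<dots> \<le> (\<Prod>j\<in>UNIV. (1 + \<kappa> * dist x (z $ j)) powr (- p))"
      using \<kappa> p dist_diag_ge[of x z] by (intro prod_mono conjI powr_mono2') (auto intro: add_pos_nonneg)
    finally have "\<kappa> ^ ?d * (norm (tens f z) powr r * (1 + \<kappa> * dist (diag x) z) powr (- (real ?l * p)))
      \<le> \<kappa> ^ ?d * ((\<Prod>j\<in>UNIV. norm (f j (z $ j)) powr r) * (\<Prod>j\<in>UNIV. (1 + \<kappa> * dist x (z $ j)) powr (- p)))"
      unfolding norm_tens_powr using \<kappa> by (intro mult_left_mono prod_nonneg) auto
    also have "\<dots> = (\<Prod>j\<in>UNIV. \<kappa> ^ ?n * (norm (f j (z $ j)) powr r * (1 + \<kappa> * dist x (z $ j)) powr (- p)))"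
      unfolding dd power_mult by (simp add: prod.distrib)
    finally show "ennreal (\<kappa> ^ ?d) * ennreal (norm (tens f z) powr r * (1 + \<kappa> * dist (diag x) z) powr (- (real ?l * p)))
      \<le> (\<Prod>j\<in>UNIV. ennreal (\<kappa> ^ ?n * (norm (f j (z $ j)) powr r * (1 + \<kappa> * dist x (z $ j)) powr (- p))))"
      using \<kappa> by (subst prod_ennreal) (auto simp: ennreal_mult[symmetric] intro!: ennreal_leI)
  qed
  also have "\<dots> = (\<Prod>j\<in>UNIV. \<integral>\<^sup>+y. ennreal (\<kappa> ^ ?n * (norm (f j y) powr r * (1 + \<kappa> * dist x y) powr (- p))) \<partial>lborel)"
    by (rule nn_integral_vec_prod) measurable
  finally show ?thesis .
qed

text \<open>\<open>Phi\<close> is at most a product of one-variable means \<Psi>; Hoelder with l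
  factors separates them, and Fubini turns the integral of each \<Psi> over the cube into one of
  |f_j|^r against a weight of scale L about \<open>x0\<close>. The product of these l integrals is
  again one integral over \<open>real^'n^'l\<close>, whose product weight is at most the joint one
  because 1 + sum <= product. Recombining the factors in this way is what leads to the multilinear
  maximal function rather than to the product of l separate ones.\<close>

lemma Phi_root_large_cube_le:
  fixes f :: "'l::finite \<Rightarrow> real^'n \<Rightarrow> complex"
  assumes M: "max_bound r f x0 M" and f: "\<And>j. f j \<in> borel_measurable borel"
    and fj: "\<And>j. integrable lborel (\<lambda>y. norm (f j y) powr r)"
    and fr: "integrable lborel (\<lambda>z. norm (tens f z) powr r)"
    and \<kappa>: "0 < \<kappa>" and p: "real DIM(real^'n^'l) + 1 \<le> p" and L: "0 < L" "1 \<le> \<kappa> * L" and x0: "x0 \<in> cube a L"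
    and C: "C = 2 powr (p + 1) * 2 ^ CARD('n) * (1 + 2 * real CARD('n)) powr p + 4 powr p"
  shows "(\<integral>\<^sup>+x. ennreal (Phi r (real CARD('l) * p) \<kappa> (tens f) (diag x) powr (1 / real CARD('l))) * indicator (cube a L) x \<partial>lborel)
    \<le> ennreal ((C ^ CARD('l) * (2 powr (p + 1) * 2 ^ DIM(real^'n^'l) * M * L ^ DIM(real^'n^'l))) powr (1 / real CARD('l)))"
proof -
  let ?d = "DIM(real^'n^'l)" and ?n = "CARD('n)" and ?l = "CARD('l)"
  note [measurable] = f
  have [measurable]: "tens f \<in> borel_measurable borel" by (rule tens_measurable[OF f])
  have M0: "0 \<le> M" using M by (simp add: max_bound_def)
  have C0: "0 \<le> C" unfolding C by auto
  have "?n \<le> ?d" by simp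
  then have "real ?n \<le> real ?d" by (rule of_nat_mono)
  then have pn: "real ?n + 1 \<le> p" and p0: "0 \<le> p" using p by linarith+
  define \<Psi> where "\<Psi> j x = (\<integral>\<^sup>+y. ennreal (\<kappa> ^ ?n * (norm (f j y) powr r * (1 + \<kappa> * dist x y) powr (- p))) \<partial>lborel)" for j x
  have \<Psi>m [measurable]: "\<Psi> j \<in> borel_measurable borel" for j
    unfolding \<Psi>_def by (rule lborel.borel_measurable_nn_integral) measurable
  have \<Psi>_fin: "\<Psi> j x < top" for j x
  proof -
    have "\<Psi> j x \<le> (\<integral>\<^sup>+y. ennreal (\<kappa> ^ ?n * (norm (f j y) powr r)) \<partial>lborel)"
      unfolding \<Psi>_def
    proof (intro nn_integral_mono ennreal_leI mult_left_mono)
      fix y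
      have "(1 + \<kappa> * dist x y) powr (- p) \<le> (1 + \<kappa> * dist x y) powr 0" using \<kappa> p0 by (intro powr_mono) auto
      also have "\<dots> \<le> 1" by simp
      finally show "norm (f j y) powr r * (1 + \<kappa> * dist x y) powr (- p) \<le> norm (f j y) powr r" by (simp add: mult_left_le)
    qed (use \<kappa> in auto)
    also have "\<dots> < top"
      using integrable_mult_right[OF fj, of "\<kappa> ^ ?n" j] \<kappa> unfolding integrable_iff_bounded by (simp add: abs_mult)
    finally show ?thesis .
  qed
  \<comment> \<open>A real-valued version of \<Psi> cut off to the cube; \<open>\<Psi>_fin\<close>
    ensures that \<open>enn2real\<close> loses nothing.\<close>
  define \<phi> where "\<phi> j x = enn2real (\<Psi> j x) * indicator (cube a L) x" for j x
  have \<phi>: "ennreal (\<phi> j x) = \<Psi> j x * indicator (cube a L) x" for j x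
    unfolding \<phi>_def using \<Psi>_fin[of j x] by (auto split: split_indicator)
  define \<omega> where "\<omega> y = (\<integral>\<^sup>+x. ennreal (\<kappa> ^ ?n * (1 + \<kappa> * dist x y) powr (- p)) * indicator (cube a L) x \<partial>lborel)" for y :: "real^'n"
  have [measurable]: "\<omega> \<in> borel_measurable borel"
    unfolding \<omega>_def by (rule lborel.borel_measurable_nn_integral) measurable
  define I where "I j = (\<integral>\<^sup>+x. ennreal (\<phi> j x) \<partial>lborel)" for j
  have I_eq: "I j = (\<integral>\<^sup>+y. ennreal (norm (f j y) powr r) * \<omega> y \<partial>lborel)" for j
  proof -
    have "I j = (\<integral>\<^sup>+x. (\<integral>\<^sup>+y. ennreal (\<kappa> ^ ?n * (norm (f j y) powr r * (1 + \<kappa> * dist x y) powr (- p))) * indicator (cube a L) x \<partial>lborel) \<partial>lborel)"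
      unfolding I_def \<phi> \<Psi>_def by (intro nn_integral_cong nn_integral_multc[symmetric]) measurable
    also have "\<dots> = (\<integral>\<^sup>+y. (\<integral>\<^sup>+x. ennreal (\<kappa> ^ ?n * (norm (f j y) powr r * (1 + \<kappa> * dist x y) powr (- p))) * indicator (cube a L) x \<partial>lborel) \<partial>lborel)"
      by (rule lborel_pair.Fubini') measurable
    also have "\<dots> = (\<integral>\<^sup>+y. (\<integral>\<^sup>+x. ennreal (norm (f j y) powr r) * (ennreal (\<kappa> ^ ?n * (1 + \<kappa> * dist x y) powr (- p)) * indicator (cube a L) x) \<partial>lborel) \<partial>lborel)"
      using \<kappa> by (intro nn_integral_cong) (simp add: ennreal_mult mult_ac)
    also have "\<dots> = (\<integral>\<^sup>+y. ennreal (norm (f j y) powr r) * \<omega> y \<partial>lborel)"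
      unfolding \<omega>_def by (intro nn_integral_cong nn_integral_cmult) measurable
    finally show ?thesis .
  qed
  have \<omega>_le: "\<omega> y \<le> ennreal (C * (1 + dist x0 y / L) powr (- p))" for y
    unfolding \<omega>_def C by (rule weight_average_cube[OF L \<kappa> pn x0])
  have prod_I: "(\<Prod>j\<in>UNIV. I j) \<le> ennreal (C ^ ?l * (2 powr (p + 1) * 2 ^ ?d * M * L ^ ?d))"
  proof -
    have "(\<Prod>j\<in>UNIV. I j) = (\<integral>\<^sup>+z. (\<Prod>j\<in>UNIV. ennreal (norm (f j (z $ j)) powr r) * \<omega> (z $ j)) \<partial>lborel)"
      unfolding I_eq by (rule nn_integral_vec_prod[symmetric]) measurable
    also have "\<dots> \<le> (\<integral>\<^sup>+z. ennreal (C ^ ?l) * (ennreal (norm (tens f z) powr r) * ennreal ((1 + 1 / L * dist (diag x0) z) powr (- p))) \<partial>lborel)"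
    proof (rule nn_integral_mono)
      fix z :: "real^'n^'l"
      have pos: "0 < 1 + dist x0 (z $ j) / L" for j using L by (auto intro: add_pos_nonneg)
      have "(\<Prod>j\<in>UNIV. ennreal (norm (f j (z $ j)) powr r) * \<omega> (z $ j)) \<le> (\<Prod>j\<in>UNIV. ennreal (norm (f j (z $ j)) powr r) * ennreal (C * (1 + dist x0 (z $ j) / L) powr (- p)))"
        by (intro prod_mono_ennreal mult_left_mono \<omega>_le) auto
      also have "\<dots> = ennreal (\<Prod>j\<in>UNIV. norm (f j (z $ j)) powr r * (C * (1 + dist x0 (z $ j) / L) powr (- p)))"
        using C0 by (subst prod_ennreal[symmetric]) (auto simp: ennreal_mult)
      also have "(\<Prod>j\<in>UNIV. norm (f j (z $ j)) powr r * (C * (1 + dist x0 (z $ j) / L) powr (- p)))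
          = C ^ ?l * (norm (tens f z) powr r * (\<Prod>j\<in>UNIV. 1 + dist x0 (z $ j) / L) powr (- p))"
        unfolding norm_tens_powr powr_prod by (simp add: prod.distrib mult_ac)
      also have "\<dots> \<le> C ^ ?l * (norm (tens f z) powr r * (1 + 1 / L * dist (diag x0) z) powr (- p))"
      proof (intro mult_left_mono powr_mono2')
        have "1 / L * dist (diag x0) z \<le> 1 / L * (\<Sum>j\<in>UNIV. dist x0 (z $ j))"
          using L by (intro mult_left_mono dist_diag_le) auto
        also have "\<dots> = (\<Sum>j\<in>UNIV. dist x0 (z $ j) / L)" by (simp add: sum_divide_distrib)
        finally have "1 + 1 / L * dist (diag x0) z \<le> 1 + (\<Sum>j\<in>UNIV. dist x0 (z $ j) / L)" by simp
        also have "\<dots> \<le> (\<Prod>j\<in>UNIV. 1 + dist x0 (z $ j) / L)"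
          using L by (intro one_plus_sum_le_prod) auto
        finally show "1 + 1 / L * dist (diag x0) z \<le> (\<Prod>j\<in>UNIV. 1 + dist x0 (z $ j) / L)" .
        show "0 < 1 + 1 / L * dist (diag x0) z" using L by (auto intro: add_pos_nonneg)
      qed (use C0 p0 in auto)
      finally have "(\<Prod>j\<in>UNIV. ennreal (norm (f j (z $ j)) powr r) * \<omega> (z $ j)) \<le> ennreal (C ^ ?l * (norm (tens f z) powr r * (1 + 1 / L * dist (diag x0) z) powr (- p)))"
        by (simp add: ennreal_leI)
      then show "(\<Prod>j\<in>UNIV. ennreal (norm (f j (z $ j)) powr r) * \<omega> (z $ j)) \<le> ennreal (C ^ ?l) * (ennreal (norm (tens f z) powr r) * ennreal ((1 + 1 / L * dist (diag x0) z) powr (- p)))"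
        using C0 by (simp only: ennreal_mult zero_le_power powr_ge_zero mult_nonneg_nonneg)
    qed
    also have "\<dots> = ennreal (C ^ ?l) * (\<integral>\<^sup>+z. ennreal (norm (tens f z) powr r) * ennreal ((1 + 1 / L * dist (diag x0) z) powr (- p)) \<partial>lborel)"
      by (rule nn_integral_cmult) measurable
    also have "\<dots> \<le> ennreal (C ^ ?l) * ennreal (2 powr (p + 1) * 2 ^ ?d * M * (1 / (1 / L)) ^ ?d)"
      using L by (intro mult_left_mono max_bound_weight[OF M f _ p]) auto
    also have "\<dots> = ennreal (C ^ ?l * (2 powr (p + 1) * 2 ^ ?d * M * L ^ ?d))"
      using C0 by (subst ennreal_mult') auto
    finally show ?thesis .
  qed
  have RHS0: "0 \<le> C ^ ?l * (2 powr (p + 1) * 2 ^ ?d * M * L ^ ?d)" using C0 M0 L by (intro mult_nonneg_nonneg) auto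
  show ?thesis
  \<comment> \<open>If some \<open>I j\<close> is 0, another could be infinite without the product
    showing it, but then \<open>Phi\<close> vanishes almost everywhere on the cube. Otherwise
    finiteness of the product makes every factor finite.\<close>
  proof (cases "\<exists>j. I j = 0")
    case True
    then obtain j where "I j = 0" by blast
    then have "AE x in lborel. ennreal (\<phi> j x) = 0" unfolding I_def \<phi> by (subst (asm) nn_integral_0_iff_AE) auto
    then have "AE x in lborel. ennreal (Phi r (real ?l * p) \<kappa> (tens f) (diag x) powr (1 / real ?l)) * indicator (cube a L) x = 0"
    proof eventually_elim
      case (elim x)
      show ?case
      proof (cases "x \<in> cube a L")
        case True
        then have "\<Psi> j x = 0" using elim unfolding \<phi> by simp
        then have z: "(\<Prod>j\<in>UNIV. \<Psi> j x) = 0" by (meson UNIV_I finite_class.finite_UNIV prod_zero)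
        have "Phi r (real ?l * p) \<kappa> (tens f) (diag x) \<le> 0"
          using Phi_diag_le_prod[OF f fr \<kappa> p0, of x] unfolding \<Psi>_def[symmetric] z by (simp add: ennreal_eq_0_iff)
        then show ?thesis using Phi_nonneg[of \<kappa> r "real ?l * p" "tens f" "diag x"] \<kappa> by simp
      qed simp
    qed
    then have "(\<integral>\<^sup>+x. ennreal (Phi r (real ?l * p) \<kappa> (tens f) (diag x) powr (1 / real ?l)) * indicator (cube a L) x \<partial>lborel) = (\<integral>\<^sup>+(x::real^'n). 0 \<partial>lborel)"
      by (rule nn_integral_cong_AE)
    then show ?thesis by simp
  next
    case False
    have I_fin: "I j < top" for j
    proof -
      have "(\<Prod>j\<in>UNIV. I j) < top" using prod_I by (rule order.strict_trans1) simp
      then show ?thesis using False by (auto simp: ennreal_prod_eq_top less_top[symmetric])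
    qed
    have "(\<integral>\<^sup>+x. ennreal (Phi r (real ?l * p) \<kappa> (tens f) (diag x) powr (1 / real ?l)) * indicator (cube a L) x \<partial>lborel)
       \<le> (\<integral>\<^sup>+x. ennreal ((\<Prod>j\<in>UNIV. \<phi> j x) powr (1 / real (card (UNIV :: 'l set)))) \<partial>lborel)"
    proof (rule nn_integral_mono)
      fix x
      show "ennreal (Phi r (real ?l * p) \<kappa> (tens f) (diag x) powr (1 / real ?l)) * indicator (cube a L) x
        \<le> ennreal ((\<Prod>j\<in>UNIV. \<phi> j x) powr (1 / real (card (UNIV :: 'l set))))"
      proof (cases "x \<in> cube a L")
        case True
        have "ennreal (Phi r (real ?l * p) \<kappa> (tens f) (diag x)) \<le> (\<Prod>j\<in>UNIV. ennreal (\<phi> j x))"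
          using Phi_diag_le_prod[OF f fr \<kappa> p0, of x] True unfolding \<Psi>_def[symmetric] \<phi> by simp
        also have "\<dots> = ennreal (\<Prod>j\<in>UNIV. \<phi> j x)" by (rule prod_ennreal) (simp add: \<phi>_def)
        finally have "Phi r (real ?l * p) \<kappa> (tens f) (diag x) \<le> (\<Prod>j\<in>UNIV. \<phi> j x)"
          by (subst (asm) ennreal_le_iff) (auto intro!: prod_nonneg simp: \<phi>_def)
        then have "Phi r (real ?l * p) \<kappa> (tens f) (diag x) powr (1 / real ?l) \<le> (\<Prod>j\<in>UNIV. \<phi> j x) powr (1 / real ?l)"
          using \<kappa> by (intro powr_mono2 Phi_nonneg) auto
        then show ?thesis using True by (simp add: ennreal_leI)
      qed simp
    qed
    also have "\<dots> \<le> ennreal ((\<Prod>j\<in>UNIV. enn2real (I j)) powr (1 / real (card (UNIV :: 'l set))))"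
    proof (rule nn_integral_prod_root_le)
      show "\<phi> j \<in> borel_measurable lborel" for j unfolding \<phi>_def by measurable
      show "(\<integral>\<^sup>+x. ennreal (\<phi> j x) \<partial>lborel) \<le> ennreal (enn2real (I j))" for j
        using I_fin[of j] unfolding I_def by simp
    qed (auto simp: \<phi>_def)
    also have "\<dots> \<le> ennreal ((C ^ ?l * (2 powr (p + 1) * 2 ^ ?d * M * L ^ ?d)) powr (1 / real ?l))"
    proof (intro ennreal_leI powr_mono2)
      have "ennreal (\<Prod>j\<in>UNIV. enn2real (I j)) = (\<Prod>j\<in>UNIV. I j)"
        using I_fin by (subst prod_ennreal[symmetric]) auto
      then have "ennreal (\<Prod>j\<in>UNIV. enn2real (I j)) \<le> ennreal (C ^ ?l * (2 powr (p + 1) * 2 ^ ?d * M * L ^ ?d))" using prod_I by simp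
      then show "(\<Prod>j\<in>UNIV. enn2real (I j)) \<le> C ^ ?l * (2 powr (p + 1) * 2 ^ ?d * M * L ^ ?d)"
        using RHS0 by (simp only: ennreal_le_iff)
    qed (auto intro!: prod_nonneg)
    finally show ?thesis .
  qed
qed

text \<open>For \<kappa> L < 1 the cube stays within a multiple of 1/\<kappa> from
  \<open>x0\<close>, and \<open>Phi_near\<close> with \<open>Phi_max\<close> gives a pointwise
  bound. The Hoelder argument is for \<kappa> L >= 1, where the averaging over the cube is
  essential.\<close>

lemma Phi_root_cube_le:
  assumes p: "real DIM(real^'n^'l) + 1 \<le> p"
  shows "\<exists>K>0. \<forall>(f :: 'l::finite \<Rightarrow> real^'n \<Rightarrow> complex) r x0 M \<kappa> L a. max_bound r f x0 M \<longrightarrow> (\<forall>j. f j \<in> borel_measurable borel) \<longrightarrow>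
    (\<forall>j. integrable lborel (\<lambda>y. norm (f j y) powr r)) \<longrightarrow> integrable lborel (\<lambda>z. norm (tens f z) powr r) \<longrightarrow>
    0 < \<kappa> \<longrightarrow> 0 < L \<longrightarrow> x0 \<in> cube a L \<longrightarrow>
    (\<integral>\<^sup>+x. ennreal (Phi r (real CARD('l) * p) \<kappa> (tens f) (diag x) powr (1 / real CARD('l))) * indicator (cube a L) x \<partial>lborel)
    \<le> ennreal (K * M powr (1 / real CARD('l)) * L ^ CARD('n))"
proof -
  let ?d = "DIM(real^'n^'l)" and ?n = "CARD('n)" and ?l = "CARD('l)"
  define C where "C = 2 powr (p + 1) * 2 ^ ?n * (1 + 2 * real ?n) powr p + 4 powr p"
  define c where "c = real ?l * real ?n"
  define P where "P = real ?l * p"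
  define K1 where "K1 = (C ^ ?l * (2 powr (p + 1) * 2 ^ ?d)) powr (1 / real ?l)"
  define K2 where "K2 = ((1 + c) powr P * (2 powr (P + 1) * 2 ^ ?d)) powr (1 / real ?l)"
  have C0: "0 < C" unfolding C_def by (intro add_nonneg_pos) auto
  have c0: "0 \<le> c" by (simp add: c_def)
  have "1 * (real ?d + 1) \<le> real ?l * p" using p by (intro mult_mono) (auto simp: Suc_leI)
  then have Pd: "real ?d + 1 \<le> P" by (simp add: P_def)
  have K0: "0 < K1" "0 \<le> K2" using C0 by (auto simp: K1_def K2_def)
  show ?thesis
  proof (intro exI[of _ "K1 + K2"] conjI allI impI)
    show "0 < K1 + K2" using K0 by simp
    fix f :: "'l \<Rightarrow> real^'n \<Rightarrow> complex" and r M \<kappa> L :: real and x0 a :: "real^'n"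
    assume M: "max_bound r f x0 M" and f: "\<forall>j. f j \<in> borel_measurable borel"
      and fj: "\<forall>j. integrable lborel (\<lambda>y. norm (f j y) powr r)" and fr: "integrable lborel (\<lambda>z. norm (tens f z) powr r)"
      and \<kappa>: "0 < \<kappa>" and L: "0 < L" and x0: "x0 \<in> cube a L"
    have M0: "0 \<le> M" using M by (simp add: max_bound_def)
    have Lroot: "(L ^ ?d) powr (1 / real ?l) = L ^ ?n"
    proof -
      have "(L ^ ?d) powr (1 / real ?l) = (L powr real (?n * ?l)) powr (1 / real ?l)" using L by (subst powr_realpow) (auto simp: mult.commute)
      also have "\<dots> = L powr real ?n" by (simp add: powr_powr)
      finally show ?thesis using L by (simp add: powr_realpow)
    qed
    show "(\<integral>\<^sup>+x. ennreal (Phi r (real ?l * p) \<kappa> (tens f) (diag x) powr (1 / real ?l)) * indicator (cube a L) x \<partial>lborel)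
      \<le> ennreal ((K1 + K2) * M powr (1 / real ?l) * L ^ ?n)"
    proof (cases "1 \<le> \<kappa> * L")
      case True
      have "(\<integral>\<^sup>+x. ennreal (Phi r (real ?l * p) \<kappa> (tens f) (diag x) powr (1 / real ?l)) * indicator (cube a L) x \<partial>lborel)
        \<le> ennreal ((C ^ ?l * (2 powr (p + 1) * 2 ^ ?d * M * L ^ ?d)) powr (1 / real ?l))"
        using f fj by (intro Phi_root_large_cube_le[OF M _ _ fr \<kappa> p L True x0 C_def]) auto
      also have "(C ^ ?l * (2 powr (p + 1) * 2 ^ ?d * M * L ^ ?d)) powr (1 / real ?l) = K1 * M powr (1 / real ?l) * L ^ ?n"
        unfolding Lroot[symmetric] K1_def powr_mult[symmetric] by (simp only: mult_ac)
      also have "ennreal (K1 * M powr (1 / real ?l) * L ^ ?n) \<le> ennreal ((K1 + K2) * M powr (1 / real ?l) * L ^ ?n)"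
        using K0 L by (intro ennreal_leI mult_right_mono) auto
      finally show ?thesis .
    next
      case False
      have bd: "Phi r P \<kappa> (tens f) (diag x) powr (1 / real ?l) \<le> K2 * M powr (1 / real ?l)" if x: "x \<in> cube a L" for x
      proof -
        have d: "dist x x0 \<le> real ?n * L" using norm_diff_cube_le[OF x x0] by (simp add: dist_norm)
        have "dist (diag x) (diag x0 :: real^'n^'l) \<le> real ?l * dist x x0"
          unfolding dist_norm diag_diff[symmetric] by (rule norm_diag_le)
        also have "\<dots> \<le> real ?l * (real ?n * L)" using d by (intro mult_left_mono) auto
        finally have "\<kappa> * dist (diag x) (diag x0 :: real^'n^'l) \<le> \<kappa> * (real ?l * (real ?n * L))"
          using \<kappa> by (intro mult_left_mono) auto
        also have "\<dots> = c * (\<kappa> * L)" by (simp add: c_def mult_ac)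
        also have "\<dots> \<le> c * 1" using False c0 by (intro mult_left_mono) auto
        finally have c': "\<kappa> * dist (diag x) (diag x0 :: real^'n^'l) \<le> c" by simp
        have "Phi r P \<kappa> (tens f) (diag x) \<le> (1 + c) powr P * Phi r P \<kappa> (tens f) (diag x0)"
          by (rule Phi_near[OF fr \<kappa> _ c']) (use Pd in linarith)
        also have "\<dots> \<le> (1 + c) powr P * (2 powr (P + 1) * 2 ^ ?d * M)"
          using f by (intro mult_left_mono Phi_max[OF M _ fr \<kappa> Pd]) auto
        finally have "Phi r P \<kappa> (tens f) (diag x) powr (1 / real ?l) \<le> ((1 + c) powr P * (2 powr (P + 1) * 2 ^ ?d * M)) powr (1 / real ?l)"
          using \<kappa> by (intro powr_mono2 Phi_nonneg) auto
        also have "\<dots> = K2 * M powr (1 / real ?l)"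
          unfolding K2_def powr_mult[symmetric] by (simp only: mult_ac)
        finally show ?thesis .
      qed
      have "(\<integral>\<^sup>+x. ennreal (Phi r (real ?l * p) \<kappa> (tens f) (diag x) powr (1 / real ?l)) * indicator (cube a L) x \<partial>lborel)
        \<le> (\<integral>\<^sup>+x. ennreal (K2 * M powr (1 / real ?l)) * indicator (cube a L) x \<partial>lborel)"
        using bd unfolding P_def[symmetric] by (intro nn_integral_mono) (auto split: split_indicator intro!: ennreal_leI)
      also have "\<dots> = ennreal (K2 * M powr (1 / real ?l)) * ennreal (L ^ ?n)"
        using L by (subst nn_integral_cmult_indicator) (auto simp: emeasure_cube)
      also have "\<dots> = ennreal (K2 * M powr (1 / real ?l) * L ^ ?n)"
        using K0 L by (subst ennreal_mult) auto
      also have "\<dots> \<le> ennreal ((K1 + K2) * M powr (1 / real ?l) * L ^ ?n)"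
        using K0 L by (intro ennreal_leI mult_right_mono) auto
      finally show ?thesis .
    qed
  qed
qed


section \<open>Dyadic decomposition of the symbol\<close>

text \<open>\<open>dirderiv\<close> is a choice made by \<open>vector_derivative\<close>, meaningful
  only where a derivative exists; \<open>smooth_fun\<close> gives total differentiability of every
  iterated derivative, hence differentiability along lines.\<close>

lemma iter_deriv_line:
  fixes \<sigma> :: "'a::euclidean_space \<Rightarrow> complex"
  assumes "smooth_fun \<sigma>" "set ds \<subseteq> Basis" "v \<in> Basis"
  shows "((\<lambda>t. iter_deriv ds \<sigma> (z + t *\<^sub>R v)) has_vector_derivative iter_deriv (v # ds) \<sigma> z) (at 0)"
proof -
  have "iter_deriv ds \<sigma> differentiable (at (z + 0 *\<^sub>R v))"
    using assms unfolding smooth_fun_def differentiable_on_def by auto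
  then have "(\<lambda>t. iter_deriv ds \<sigma> (z + t *\<^sub>R v)) differentiable (at 0)"
    by (rule differentiable_compose) (auto intro!: derivative_intros)
  then show ?thesis
    by (simp add: dirderiv_def vector_derivative_works[symmetric])
qed

lemma smooth_fun_continuous:
  "smooth_fun \<sigma> \<Longrightarrow> set ds \<subseteq> Basis \<Longrightarrow> continuous_on UNIV (iter_deriv ds \<sigma>)"
  unfolding smooth_fun_def by (auto intro: differentiable_imp_continuous_on)

lemma derseq_iter_deriv:
  fixes f :: "'a::euclidean_space \<Rightarrow> complex"
  assumes "smooth_fun f" "\<beta> \<in> Basis"
  shows "derseq N \<beta> (\<lambda>j. iter_deriv (replicate j \<beta>) f)"
  unfolding derseq_def
proof (intro conjI allI impI)
  fix j \<xi>
  have s: "set (replicate j \<beta>) \<subseteq> Basis" using assms(2) by (simp add: set_replicate_conv_if)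
  show "continuous_on UNIV (iter_deriv (replicate j \<beta>) f)" by (rule smooth_fun_continuous[OF assms(1) s])
  show "((\<lambda>t. iter_deriv (replicate j \<beta>) f (\<xi> + t *\<^sub>R \<beta>)) has_vector_derivative iter_deriv (replicate (Suc j) \<beta>) f \<xi>) (at 0)"
    unfolding replicate_Suc by (rule iter_deriv_line[OF assms(1) s assms(2)])
qed

definition japan :: "real^'n^'l \<Rightarrow> real" where
  "japan \<xi> = 1 + (\<Sum>j\<in>UNIV. norm (\<xi> $ j))"

definition xi_deriv :: "((real^'n) \<times> (real^'n^'l) \<Rightarrow> complex) \<Rightarrow> real^'n^'l \<Rightarrow> nat \<Rightarrow> real^'n \<Rightarrow> real^'n^'l \<Rightarrow> complex" where
  "xi_deriv \<sigma> \<beta> j x \<xi> = iter_deriv (replicate j (0, \<beta>)) \<sigma> (x, \<xi>)"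

lemma snd_Basis: "\<beta> \<in> Basis \<Longrightarrow> (0, \<beta>) \<in> Basis" and fst_Basis: "b \<in> Basis \<Longrightarrow> (b, 0) \<in> Basis"
  by (auto simp: Basis_prod_def)

lemma derseq_xi_deriv:
  assumes \<sigma>: "smooth_fun \<sigma>" and \<beta>: "\<beta> \<in> Basis"
  shows "derseq N \<beta> (\<lambda>j. xi_deriv \<sigma> \<beta> j x)"
  unfolding derseq_def
proof (intro conjI allI impI)
  fix j
  have s: "set (replicate j (0 :: real^'a, \<beta>)) \<subseteq> Basis" using snd_Basis[OF \<beta>] by auto
  show "continuous_on UNIV (xi_deriv \<sigma> \<beta> j x)"
    unfolding xi_deriv_def[abs_def]
    by (rule continuous_on_compose2[OF smooth_fun_continuous[OF \<sigma> s]]) (auto intro!: continuous_intros)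
  show "((\<lambda>t. xi_deriv \<sigma> \<beta> j x (\<xi> + t *\<^sub>R \<beta>)) has_vector_derivative xi_deriv \<sigma> \<beta> (Suc j) x \<xi>) (at 0)" for \<xi>
    using iter_deriv_line[OF \<sigma> s snd_Basis[OF \<beta>], of "(x, \<xi>)"] unfolding xi_deriv_def replicate_Suc by simp
qed

lemma multi_symbol_bound:
  fixes \<sigma> :: "(real^'n) \<times> (real^'n^'l) \<Rightarrow> complex"
  assumes \<sigma>: "\<sigma> \<in> multi_symbol_class m \<rho> \<rho>" and ds: "set ds \<subseteq> Basis" "n_xdirs ds = i" "n_xidirs ds = j"
  shows "\<exists>C. \<forall>x \<xi>. norm (iter_deriv ds \<sigma> (x, \<xi>)) \<le> C * japan \<xi> powr (m + \<rho> * real i - \<rho> * real j)"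
proof -
  have "\<forall>ds. set ds \<subseteq> Basis \<longrightarrow> (\<exists>C. \<forall>x \<xi>. norm (iter_deriv ds \<sigma> (x, \<xi>)) \<le>
      C * (1 + (\<Sum>j\<in>UNIV. norm (\<xi> $ j))) powr (m + \<rho> * real (n_xdirs ds) - \<rho> * real (n_xidirs ds)))"
    using \<sigma> unfolding multi_symbol_class_def mem_Collect_eq by (rule conjunct2)
  from this[rule_format, OF ds(1)] show ?thesis unfolding ds(2,3) japan_def .
qed

text \<open>The symbol class gives one constant for each list of directions; there are finitely many
  \<beta> and j, so the sum of their absolute values is a common one, and adding 1 makes it
  positive.\<close>

lemma xi_deriv_bound:
  fixes \<sigma> :: "(real^'n) \<times> (real^'n^'l) \<Rightarrow> complex"
  assumes \<sigma>: "\<sigma> \<in> multi_symbol_class m \<rho> \<rho>"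
  shows "\<exists>C>0. \<forall>\<beta>\<in>Basis. \<forall>j\<le>N. \<forall>x \<xi>. norm (xi_deriv \<sigma> \<beta> j x \<xi>) \<le> C * japan \<xi> powr (m - \<rho> * real j)"
proof -
  have ex: "\<exists>C. \<forall>x \<xi>. norm (xi_deriv \<sigma> \<beta> j x \<xi>) \<le> C * japan \<xi> powr (m - \<rho> * real j)" if \<beta>: "\<beta> \<in> Basis" for \<beta> j
  proof -
    have "set (replicate j (0 :: real^'n, \<beta>)) \<subseteq> Basis" using snd_Basis[OF \<beta>] by auto
    moreover have "n_xdirs (replicate j (0 :: real^'n, \<beta>)) = 0" "n_xidirs (replicate j (0 :: real^'n, \<beta>)) = j"
      using \<beta> nonzero_Basis[of \<beta>] by (auto simp: n_xdirs_def n_xidirs_def filter_replicate)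
    ultimately show ?thesis
      unfolding xi_deriv_def using multi_symbol_bound[OF \<sigma>, of "replicate j (0, \<beta>)" 0 j] by simp
  qed
  obtain C where C: "\<And>\<beta> j x \<xi>. \<beta> \<in> Basis \<Longrightarrow> norm (xi_deriv \<sigma> \<beta> j x \<xi>) \<le> C \<beta> j * japan \<xi> powr (m - \<rho> * real j)"
    using ex by metis
  define C' where "C' = 1 + (\<Sum>\<beta>\<in>Basis. \<Sum>j\<le>N. \<bar>C \<beta> j\<bar>)"
  have "C \<beta> j \<le> C'" if "\<beta> \<in> Basis" "j \<le> N" for \<beta> j
  proof -
    have "\<bar>C \<beta> j\<bar> \<le> (\<Sum>j\<le>N. \<bar>C \<beta> j\<bar>)" using that by (intro member_le_sum) auto
    also have "\<dots> \<le> (\<Sum>\<beta>\<in>Basis. \<Sum>j\<le>N. \<bar>C \<beta> j\<bar>)" using that by (intro member_le_sum[of \<beta> Basis]) (auto intro!: sum_nonneg)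
    finally show ?thesis by (simp add: C'_def)
  qed
  moreover have "0 < C'" unfolding C'_def by (intro add_pos_nonneg sum_nonneg) auto
  ultimately show ?thesis
    by (intro exI[of _ C']) (meson C mult_right_mono order_trans powr_ge_zero)
qed

text \<open>Mean value inequality in x for the total derivative of the j-th \<xi>-derivative. The
  x-direction stands at the head of the list and is therefore applied last, so the bound on that
  iterated derivative is a bound on a directional derivative of the function in question. It costs
  one factor of \<open>japan \<xi>\<close> to the power \<rho>.\<close>

lemma xi_deriv_lipschitz:
  fixes \<sigma> :: "(real^'n) \<times> (real^'n^'l) \<Rightarrow> complex"
  assumes \<sigma>: "\<sigma> \<in> multi_symbol_class m \<rho> \<rho>"
  shows "\<exists>C>0. \<forall>\<beta>\<in>Basis. \<forall>j\<le>N. \<forall>x y \<xi>. norm (xi_deriv \<sigma> \<beta> j x \<xi> - xi_deriv \<sigma> \<beta> j y \<xi>) \<le> C * japan \<xi> powr (m + \<rho> - \<rho> * real j) * dist x y"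
proof -
  have sm: "smooth_fun \<sigma>" using \<sigma> by (simp add: multi_symbol_class_def)
  have ex: "\<exists>C. \<forall>x \<xi>. norm (iter_deriv ((b, 0) # replicate j (0, \<beta>)) \<sigma> (x, \<xi>)) \<le> C * japan \<xi> powr (m + \<rho> - \<rho> * real j)"
    if \<beta>: "\<beta> \<in> Basis" and b: "b \<in> Basis" for \<beta> b j
  proof -
    have "set ((b, 0) # replicate j (0, \<beta>)) \<subseteq> Basis" using snd_Basis[OF \<beta>] fst_Basis[OF b] by auto
    moreover have "n_xdirs ((b, 0) # replicate j (0 :: real^'n, \<beta>)) = 1" "n_xidirs ((b, 0) # replicate j (0 :: real^'n, \<beta>)) = j"
      using \<beta> b nonzero_Basis[of \<beta>] nonzero_Basis[of b] by (auto simp: n_xdirs_def n_xidirs_def filter_replicate)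
    ultimately have "\<exists>C. \<forall>x \<xi>. norm (iter_deriv ((b, 0) # replicate j (0, \<beta>)) \<sigma> (x, \<xi>)) \<le> C * japan \<xi> powr (m + \<rho> * real 1 - \<rho> * real j)"
      by (rule multi_symbol_bound[OF \<sigma>])
    then show ?thesis unfolding of_nat_1 mult_1_right .
  qed
  obtain C where C: "\<And>\<beta> b j x \<xi>. \<beta> \<in> Basis \<Longrightarrow> b \<in> Basis \<Longrightarrow>
      norm (iter_deriv ((b, 0) # replicate j (0, \<beta>)) \<sigma> (x, \<xi>)) \<le> C \<beta> b j * japan \<xi> powr (m + \<rho> - \<rho> * real j)"
    using ex by metis
  define C' where "C' = 1 + (\<Sum>\<beta>\<in>Basis. \<Sum>j\<le>N. \<Sum>b\<in>Basis. \<bar>C \<beta> b j\<bar>)"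
  have C'le: "(\<Sum>b\<in>Basis. \<bar>C \<beta> b j\<bar>) \<le> C'" if "\<beta> \<in> Basis" "j \<le> N" for \<beta> j
  proof -
    have "(\<Sum>b\<in>Basis. \<bar>C \<beta> b j\<bar>) \<le> (\<Sum>j\<le>N. \<Sum>b\<in>Basis. \<bar>C \<beta> b j\<bar>)" using that by (intro member_le_sum) (auto intro!: sum_nonneg)
    also have "\<dots> \<le> (\<Sum>\<beta>\<in>Basis. \<Sum>j\<le>N. \<Sum>b\<in>Basis. \<bar>C \<beta> b j\<bar>)" using that by (intro member_le_sum[of \<beta> Basis]) (auto intro!: sum_nonneg)
    finally show ?thesis by (simp add: C'_def)
  qed
  have C'0: "0 < C'" unfolding C'_def by (intro add_pos_nonneg sum_nonneg) auto
  have main: "norm (xi_deriv \<sigma> \<beta> j x \<xi> - xi_deriv \<sigma> \<beta> j y \<xi>) \<le> C' * japan \<xi> powr (m + \<rho> - \<rho> * real j) * dist x y"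
    if \<beta>: "\<beta> \<in> Basis" and j: "j \<le> N" for \<beta> j x y \<xi>
  proof -
    let ?S = "iter_deriv (replicate j (0 :: real^'n, \<beta>)) \<sigma>" and ?W = "japan \<xi> powr (m + \<rho> - \<rho> * real j)"
    have s: "set (replicate j (0 :: real^'n, \<beta>)) \<subseteq> Basis" using snd_Basis[OF \<beta>] by auto
    have "\<forall>z\<in>UNIV. ?S differentiable (at z)" using sm s unfolding smooth_fun_def differentiable_on_def by blast
    then obtain S' where S': "\<And>z. (?S has_derivative S' z) (at z)" unfolding differentiable_def by (metis UNIV_I)
    have S'b: "S' (z, \<xi>) (b, 0) = iter_deriv ((b, 0) # replicate j (0, \<beta>)) \<sigma> (z, \<xi>)" if b: "b \<in> Basis" for z b
    proof -
      have "((\<lambda>t. ?S ((z, \<xi>) + t *\<^sub>R (b, 0))) has_derivative (\<lambda>t. S' ((z, \<xi>) + 0 *\<^sub>R (b, 0)) (t *\<^sub>R (b, 0)))) (at (0::real))"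
        by (rule has_derivative_compose[OF _ S']) (auto intro!: derivative_eq_intros)
      moreover have lin: "linear (S' (z, \<xi>))" using has_derivative_bounded_linear[OF S'] by (rule bounded_linear.linear)
      ultimately have "((\<lambda>t. ?S ((z, \<xi>) + t *\<^sub>R (b, 0))) has_vector_derivative S' (z, \<xi>) (b, 0)) (at 0)"
        unfolding has_vector_derivative_def by (simp only: scaleR_zero_left add_0_right linear_cmul[OF lin])
      then show ?thesis
        using vector_derivative_unique_at[OF _ iter_deriv_line[OF sm s fst_Basis[OF b], of "(z, \<xi>)"]] by blast
    qed
    have S'v: "norm (S' (z, \<xi>) (v, 0)) \<le> C' * ?W * norm v" for z v
    proof -
      have lin: "linear (S' (z, \<xi>))" using has_derivative_bounded_linear[OF S'] by (rule bounded_linear.linear)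
      have "(v, 0 :: real^'n^'l) = (\<Sum>b\<in>Basis. (v \<bullet> b) *\<^sub>R (b, 0))"
        by (simp add: prod_eq_iff fst_sum snd_sum euclidean_representation)
      then have "S' (z, \<xi>) (v, 0) = (\<Sum>b\<in>Basis. (v \<bullet> b) *\<^sub>R S' (z, \<xi>) (b, 0))"
        by (simp add: linear_sum[OF lin] linear_cmul[OF lin] del: scaleR_Pair)
      also have "norm \<dots> \<le> (\<Sum>b\<in>Basis. norm v * (\<bar>C \<beta> b j\<bar> * ?W))"
      proof (rule sum_norm_le)
        fix b :: "real^'n" assume b: "b \<in> Basis"
        have "norm (S' (z, \<xi>) (b, 0)) \<le> C \<beta> b j * ?W" unfolding S'b[OF b] by (rule C[OF \<beta> b])
        also have "\<dots> \<le> \<bar>C \<beta> b j\<bar> * ?W" by (intro mult_right_mono) auto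
        finally show "norm ((v \<bullet> b) *\<^sub>R S' (z, \<xi>) (b, 0)) \<le> norm v * (\<bar>C \<beta> b j\<bar> * ?W)"
          using Basis_le_norm[OF b, of v] by (auto intro!: mult_mono)
      qed
      also have "\<dots> = (\<Sum>b\<in>Basis. \<bar>C \<beta> b j\<bar>) * ?W * norm v" by (simp add: sum_distrib_left sum_distrib_right mult_ac)
      also have "\<dots> \<le> C' * ?W * norm v" using C'le[OF \<beta> j] by (intro mult_right_mono) auto
      finally show ?thesis .
    qed
    have "norm (?S (x, \<xi>) - ?S (y, \<xi>)) \<le> C' * ?W * norm (x - y)"
    proof (rule differentiable_bound[where f = "\<lambda>z. ?S (z, \<xi>)" and f' = "\<lambda>z v. S' (z, \<xi>) (v, 0)" and S = UNIV])
      show "((\<lambda>z. ?S (z, \<xi>)) has_derivative (\<lambda>v. S' (z, \<xi>) (v, 0))) (at z within UNIV)" for z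
        by (rule has_derivative_compose[OF _ S']) (auto intro!: derivative_eq_intros)
      show "onorm (\<lambda>v. S' (z, \<xi>) (v, 0)) \<le> C' * ?W" for z
        by (rule onorm_bound) (use C'0 S'v in auto)
    qed auto
    then show ?thesis by (simp add: xi_deriv_def dist_norm)
  qed
  show ?thesis using main C'0 by blast
qed

section \<open>Smooth dyadic cutoffs\<close>

text \<open>The j-th derivative along \<beta> of a tensor product cutoff at scale R with profile
  \<open>h 0\<close>: only the factor in direction \<beta> is differentiated. For j = 0 the basis
  vector \<beta> does not influence the value (\<open>cut_0\<close>).\<close>

definition cut :: "(nat \<Rightarrow> real \<Rightarrow> real) \<Rightarrow> real \<Rightarrow> 'a::euclidean_space \<Rightarrow> nat \<Rightarrow> 'a \<Rightarrow> complex" where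
  "cut h R \<beta> j \<xi> = complex_of_real ((1 / R) ^ j * h j (\<xi> \<bullet> \<beta> / R) * (\<Prod>\<gamma>\<in>Basis - {\<beta>}. h 0 (\<xi> \<bullet> \<gamma> / R)))"

locale bump =
  fixes h :: "nat \<Rightarrow> real \<Rightarrow> real" and N :: nat and B :: real
  assumes h_cont: "j \<le> N \<Longrightarrow> continuous_on UNIV (h j)"
    and h_der: "j < N \<Longrightarrow> (h j has_real_derivative h (Suc j) t) (at t)"
    and h_one: "\<bar>t\<bar> \<le> 1 \<Longrightarrow> h 0 t = 1" and h_flat: "\<bar>t\<bar> \<le> 1 \<Longrightarrow> 1 \<le> j \<Longrightarrow> j \<le> N \<Longrightarrow> h j t = 0"
    and h_zero: "2 \<le> \<bar>t\<bar> \<Longrightarrow> j \<le> N \<Longrightarrow> h j t = 0"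
    and h_bound: "j \<le> N \<Longrightarrow> \<bar>h j t\<bar> \<le> B" and B1: "1 \<le> B"
begin

lemma cut_0: "\<beta> \<in> Basis \<Longrightarrow> cut h R \<beta> 0 \<xi> = complex_of_real (\<Prod>\<gamma>\<in>Basis. h 0 (\<xi> \<bullet> \<gamma> / R))"
  by (simp add: cut_def prod.remove[of Basis \<beta>])

lemma cut_derseq:
  fixes \<beta> :: "'a::euclidean_space"
  assumes \<beta>: "\<beta> \<in> Basis" and R: "0 < R"
  shows "derseq N \<beta> (cut h R \<beta>)"
  unfolding derseq_def
proof (intro conjI allI impI)
  fix j assume j: "j \<le> N"
  show "continuous_on UNIV (cut h R \<beta> j)"
    unfolding cut_def[abs_def] using R
    by (intro continuous_intros continuous_on_compose2[OF h_cont[OF j]] continuous_on_compose2[OF h_cont[OF le0]]) auto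
next
  fix j \<xi> assume j: "j < N"
  let ?p = "\<Prod>\<gamma>\<in>Basis - {\<beta>}. h 0 (\<xi> \<bullet> \<gamma> / R)"
  have eq: "(\<lambda>t. cut h R \<beta> j (\<xi> + t *\<^sub>R \<beta>)) = (\<lambda>t. complex_of_real ((1 / R) ^ j * h j ((\<xi> \<bullet> \<beta> + t) / R) * ?p))"
  proof
    fix t
    have "(\<Prod>\<gamma>\<in>Basis - {\<beta>}. h 0 ((\<xi> + t *\<^sub>R \<beta>) \<bullet> \<gamma> / R)) = ?p"
      using \<beta> by (intro prod.cong refl) (auto simp: inner_add_left inner_not_same_Basis)
    then show "cut h R \<beta> j (\<xi> + t *\<^sub>R \<beta>) = complex_of_real ((1 / R) ^ j * h j ((\<xi> \<bullet> \<beta> + t) / R) * ?p)"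
      using \<beta> by (simp add: cut_def inner_add_left)
  qed
  have "((\<lambda>t. (\<xi> \<bullet> \<beta> + t) / R) has_real_derivative 1 / R) (at 0)"
    using R by (auto intro!: derivative_eq_intros)
  from DERIV_chain2[OF h_der[OF j] this]
  have "((\<lambda>t. h j ((\<xi> \<bullet> \<beta> + t) / R)) has_real_derivative h (Suc j) (\<xi> \<bullet> \<beta> / R) * (1 / R)) (at 0)" by simp
  from DERIV_cmult_right[OF DERIV_cmult[OF this, of "(1 / R) ^ j"], of ?p]
  have "((\<lambda>t. (1 / R) ^ j * h j ((\<xi> \<bullet> \<beta> + t) / R) * ?p) has_real_derivative (1 / R) ^ j * (h (Suc j) (\<xi> \<bullet> \<beta> / R) * (1 / R)) * ?p) (at 0)" .
  then have "((\<lambda>t. complex_of_real ((1 / R) ^ j * h j ((\<xi> \<bullet> \<beta> + t) / R) * ?p)) has_vector_derivative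
     complex_of_real ((1 / R) ^ j * (h (Suc j) (\<xi> \<bullet> \<beta> / R) * (1 / R)) * ?p)) (at 0)"
    by (intro has_vector_derivative_of_real) (simp add: has_real_derivative_iff_has_vector_derivative)
  then show "((\<lambda>t. cut h R \<beta> j (\<xi> + t *\<^sub>R \<beta>)) has_vector_derivative cut h R \<beta> (Suc j) \<xi>) (at 0)"
    unfolding eq by (simp add: cut_def mult_ac)
qed

lemma cut_zero:
  fixes \<beta> \<gamma> \<xi> :: "'a::euclidean_space"
  assumes \<beta>: "\<beta> \<in> Basis" and \<gamma>: "\<gamma> \<in> Basis" and R: "0 < R" and \<xi>: "2 * R \<le> \<bar>\<xi> \<bullet> \<gamma>\<bar>" and j: "j \<le> N"
  shows "cut h R \<beta> j \<xi> = 0"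
proof -
  have t: "2 \<le> \<bar>\<xi> \<bullet> \<gamma> / R\<bar>" using \<xi> R by (simp add: abs_divide pos_le_divide_eq)
  show ?thesis
  proof (cases "\<gamma> = \<beta>")
    case True
    then show ?thesis using h_zero[OF t j] by (simp add: cut_def)
  next
    case False
    then have "(\<Prod>\<gamma>\<in>Basis - {\<beta>}. h 0 (\<xi> \<bullet> \<gamma> / R)) = 0"
      using h_zero[OF t le0] \<gamma> by (intro prod_zero) auto
    then show ?thesis by (simp add: cut_def)
  qed
qed

lemma cut_flat:
  fixes \<beta> \<xi> :: "'a::euclidean_space"
  assumes \<beta>: "\<beta> \<in> Basis" and R: "0 < R" and \<xi>: "\<And>\<gamma>. \<gamma> \<in> Basis \<Longrightarrow> \<bar>\<xi> \<bullet> \<gamma>\<bar> \<le> R" and j: "j \<le> N"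
  shows "cut h R \<beta> j \<xi> = (if j = 0 then 1 else 0)"
proof -
  have t: "\<bar>\<xi> \<bullet> \<gamma> / R\<bar> \<le> 1" if "\<gamma> \<in> Basis" for \<gamma> using \<xi>[OF that] R by (simp add: abs_divide)
  show ?thesis
  proof (cases "j = 0")
    case True
    then show ?thesis using h_one[OF t] \<beta> by (simp add: cut_0)
  next
    case False
    then show ?thesis using h_flat[OF t[OF \<beta>], of j] j by (simp add: cut_def)
  qed
qed

lemma norm_cut_le:
  fixes \<beta> \<xi> :: "'a::euclidean_space"
  assumes \<beta>: "\<beta> \<in> Basis" and R: "0 < R" and j: "j \<le> N"
  shows "norm (cut h R \<beta> j \<xi>) \<le> B ^ DIM('a) * (1 / R) ^ j"
proof -
  have "\<bar>\<Prod>\<gamma>\<in>Basis - {\<beta>}. h 0 (\<xi> \<bullet> \<gamma> / R)\<bar> \<le> (\<Prod>\<gamma>\<in>Basis - {\<beta>}. B)"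
    unfolding abs_prod by (intro prod_mono) (auto simp: h_bound)
  also have "\<dots> = B ^ (DIM('a) - 1)" using \<beta> by simp
  finally have "\<bar>h j (\<xi> \<bullet> \<beta> / R)\<bar> * \<bar>\<Prod>\<gamma>\<in>Basis - {\<beta>}. h 0 (\<xi> \<bullet> \<gamma> / R)\<bar> \<le> B * B ^ (DIM('a) - 1)"
    using h_bound[OF j] B1 by (intro mult_mono) auto
  also have "\<dots> = B ^ DIM('a)" by (simp add: power_Suc[symmetric] del: power_Suc)
  finally show ?thesis using R by (simp add: cut_def norm_mult abs_mult norm_power mult.assoc mult.commute[of _ "(1 / R) ^ j"] mult_left_mono del: of_real_mult of_real_power of_real_prod power_one_over)
qed

text \<open>Telescoping differences. Piece 0 is the whole cutoff at scale 1, so pieces 0 to n sum to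
  the cutoff at scale 2^n.\<close>

definition dy :: "nat \<Rightarrow> 'a::euclidean_space \<Rightarrow> nat \<Rightarrow> 'a \<Rightarrow> complex" where
  "dy k \<beta> j \<xi> = (case k of 0 \<Rightarrow> cut h 1 \<beta> j \<xi> | Suc i \<Rightarrow> cut h (2 ^ Suc i) \<beta> j \<xi> - cut h (2 ^ i) \<beta> j \<xi>)"

lemma dy_derseq: "\<beta> \<in> Basis \<Longrightarrow> derseq N \<beta> (dy k \<beta>)"
  unfolding dy_def[abs_def] by (cases k) (auto intro!: cut_derseq derseq_diff)

lemma dy_sum: "(\<Sum>k<Suc n. dy k \<beta> 0 \<xi>) = cut h (2 ^ n) \<beta> 0 \<xi>"
  by (induction n) (auto simp: dy_def)

text \<open>In a difference the cutoff at the smaller scale costs 2^j more than the other, and 1 +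
  2^j <= 2^(N+1).\<close>

lemma norm_dy_le:
  fixes \<beta> \<xi> :: "'a::euclidean_space"
  assumes \<beta>: "\<beta> \<in> Basis" and j: "j \<le> N"
  shows "norm (dy k \<beta> j \<xi>) \<le> 2 ^ (N + 1) * B ^ DIM('a) * (1 / 2 ^ k) ^ j"
proof (cases k)
  case 0
  have "norm (dy k \<beta> j \<xi>) \<le> B ^ DIM('a) * (1 / 1) ^ j"
    unfolding dy_def 0 nat.case by (rule norm_cut_le[OF \<beta> _ j]) simp
  also have "\<dots> = 1 * (B ^ DIM('a) * (1 / 1) ^ j)" by simp
  also have "\<dots> \<le> 2 ^ (N + 1) * (B ^ DIM('a) * (1 / 1) ^ j)"
    by (rule mult_right_mono[OF one_le_power]) (use B1 in auto)
  finally show ?thesis using 0 by (simp add: mult.assoc)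
next
  case (Suc i)
  have "norm (dy k \<beta> j \<xi>) \<le> norm (cut h (2 ^ Suc i) \<beta> j \<xi>) + norm (cut h (2 ^ i) \<beta> j \<xi>)"
    unfolding dy_def Suc nat.case by (rule norm_triangle_ineq4)
  also have "\<dots> \<le> B ^ DIM('a) * (1 / 2 ^ Suc i) ^ j + B ^ DIM('a) * (1 / 2 ^ i) ^ j"
    by (intro add_mono norm_cut_le[OF \<beta> _ j]) auto
  also have "(1 / 2 ^ i :: real) ^ j = 2 ^ j * (1 / 2 ^ Suc i) ^ j"
    unfolding power_mult_distrib[symmetric] by simp
  also have "B ^ DIM('a) * (1 / 2 ^ Suc i) ^ j + B ^ DIM('a) * (2 ^ j * (1 / 2 ^ Suc i) ^ j) = (1 + 2 ^ j) * (B ^ DIM('a) * (1 / 2 ^ Suc i) ^ j)"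
  proof -
    have "X * u + X * (w * u) = (1 + w) * (X * u)" for X u w :: real by (simp add: algebra_simps)
    then show ?thesis .
  qed
  also have "\<dots> \<le> 2 ^ (N + 1) * (B ^ DIM('a) * (1 / 2 ^ Suc i) ^ j)"
  proof (rule mult_right_mono)
    have "(2::real) ^ j \<le> 2 ^ N" "1 \<le> (2::real) ^ N" using j by (auto intro: power_increasing)
    moreover have "(2::real) ^ (N + 1) = 2 ^ N + 2 ^ N" by simp
    ultimately show "1 + (2::real) ^ j \<le> 2 ^ (N + 1)" by linarith
  qed (use B1 in auto)
  finally show ?thesis using Suc by (simp only: mult.assoc)
qed

text \<open>The upper bounds come from \<open>cut_zero\<close>. For k > 0 the lower one comes from
  \<open>cut_flat\<close>: both cutoffs are constant where all coordinates are at most 2^(k-1). For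
  k = 0 it is just 1 <= \<open>japan \<xi>\<close>.\<close>

lemma dy_support:
  fixes \<beta> \<xi> :: "real^'n^'l"
  assumes \<beta>: "\<beta> \<in> Basis" and j: "j \<le> N" and nz: "dy k \<beta> j \<xi> \<noteq> 0"
  shows "norm \<xi> \<le> 2 * real DIM(real^'n^'l) * 2 ^ k" "2 ^ k \<le> 2 * japan \<xi>"
    "japan \<xi> \<le> (1 + 2 * real CARD('l) * real DIM(real^'n^'l)) * 2 ^ k"
proof -
  let ?d = "DIM(real^'n^'l)"
  have bd: "\<bar>\<xi> \<bullet> \<gamma>\<bar> \<le> 2 * 2 ^ k" if "\<gamma> \<in> Basis" for \<gamma>
  proof (rule ccontr)
    assume a: "\<not> \<bar>\<xi> \<bullet> \<gamma>\<bar> \<le> 2 * 2 ^ k"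
    have "cut h (2 ^ i) \<beta> j \<xi> = 0" if "i \<le> k" for i
    proof -
      have "(2::real) ^ i \<le> 2 ^ k" using that by (intro power_increasing) auto
      then have "2 * 2 ^ i \<le> \<bar>\<xi> \<bullet> \<gamma>\<bar>" using a by linarith
      then show ?thesis by (intro cut_zero[OF \<beta> \<open>\<gamma> \<in> Basis\<close> _ _ j]) auto
    qed
    from this[of k] this[of "k - 1"] have "dy k \<beta> j \<xi> = 0" by (cases k) (auto simp: dy_def)
    then show False using nz by simp
  qed
  have "norm \<xi> \<le> (\<Sum>\<gamma>\<in>Basis. \<bar>\<xi> \<bullet> \<gamma>\<bar>)" by (rule norm_le_l1)
  also have "\<dots> \<le> (\<Sum>\<gamma>\<in>(Basis :: (real^'n^'l) set). 2 * 2 ^ k)" by (intro sum_mono bd)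
  finally show n: "norm \<xi> \<le> 2 * real ?d * 2 ^ k" by (simp add: mult_ac)
  have nj: "norm (\<xi> $ j) \<le> norm \<xi>" for j unfolding norm_vec_def[of \<xi>] by (rule member_le_L2_set) auto
  have "(\<Sum>j\<in>UNIV. norm (\<xi> $ j)) \<le> (\<Sum>j\<in>(UNIV :: 'l set). 2 * real ?d * 2 ^ k)"
    by (intro sum_mono order_trans[OF nj n])
  then have "(\<Sum>j\<in>UNIV. norm (\<xi> $ j)) \<le> real CARD('l) * (2 * real ?d * 2 ^ k)" by (simp only: sum_constant)
  moreover have "1 \<le> (2::real) ^ k" by simp
  ultimately have "japan \<xi> \<le> 2 ^ k + real CARD('l) * (2 * real ?d * 2 ^ k)"
    unfolding japan_def by linarith
  then show "japan \<xi> \<le> (1 + 2 * real CARD('l) * real ?d) * 2 ^ k" by (simp add: algebra_simps)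
  have J1: "1 \<le> japan \<xi>" unfolding japan_def by (simp add: sum_nonneg)
  show "2 ^ k \<le> 2 * japan \<xi>"
  proof (cases k)
    case 0
    then show ?thesis using J1 by simp
  next
    case (Suc i)
    have "\<exists>\<gamma>\<in>Basis. 2 ^ i < \<bar>\<xi> \<bullet> \<gamma>\<bar>"
    proof (rule ccontr)
      assume "\<not> (\<exists>\<gamma>\<in>Basis. 2 ^ i < \<bar>\<xi> \<bullet> \<gamma>\<bar>)"
      then have le: "\<bar>\<xi> \<bullet> \<gamma>\<bar> \<le> 2 ^ i" if "\<gamma> \<in> Basis" for \<gamma> using that by force
      have "\<bar>\<xi> \<bullet> \<gamma>\<bar> \<le> 2 ^ Suc i" if "\<gamma> \<in> Basis" for \<gamma>
        using le[OF that] by (rule order_trans) simp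
      then have "cut h (2 ^ Suc i) \<beta> j \<xi> = cut h (2 ^ i) \<beta> j \<xi>"
        using cut_flat[OF \<beta> _ le j] cut_flat[OF \<beta> _ _ j, of "2 ^ Suc i"] by simp
      then show False using nz by (simp add: dy_def Suc)
    qed
    then obtain \<gamma> where \<gamma>: "\<gamma> \<in> Basis" "2 ^ i < \<bar>\<xi> \<bullet> \<gamma>\<bar>" by blast
    then obtain j' b where b: "b \<in> Basis" "\<gamma> = axis j' b" by (auto simp: Basis_vec_def)
    have "2 ^ i < \<bar>\<xi> $ j' \<bullet> b\<bar>" using \<gamma> b by (simp add: inner_axis)
    also have "\<dots> \<le> norm (\<xi> $ j')" by (rule Basis_le_norm[OF b(1)])
    also have "\<dots> \<le> (\<Sum>j\<in>UNIV. norm (\<xi> $ j))" by (rule member_le_sum) auto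
    also have "\<dots> \<le> japan \<xi>" by (simp add: japan_def)
    finally show ?thesis using Suc by simp
  qed
qed

text \<open>Where \<open>japan \<xi>\<close> is comparable to 2^k its powers can be evaluated at
  2^k; exponents of both signs occur, which is why both bounds on \<open>japan \<xi>\<close> are
  used.\<close>

lemma japan_powr_le:
  fixes \<xi> :: "real^'n^'l"
  assumes c: "2 \<le> c" and J: "2 ^ k \<le> 2 * japan \<xi>" "japan \<xi> \<le> c * 2 ^ k" and e: "\<bar>e\<bar> \<le> E"
  shows "japan \<xi> powr e \<le> c powr E * (2 ^ k) powr e"
proof -
  have J0: "0 < japan \<xi>" unfolding japan_def by (simp add: add_pos_nonneg sum_nonneg)
  have "japan \<xi> powr e \<le> c powr \<bar>e\<bar> * (2 ^ k) powr e"
  proof (cases "0 \<le> e")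
    case True
    then have "japan \<xi> powr e \<le> (c * 2 ^ k) powr e" using J J0 by (intro powr_mono2) auto
    then show ?thesis using True by (simp add: powr_mult)
  next
    case False
    then have "japan \<xi> powr e \<le> (2 ^ k / 2) powr e" using J by (intro powr_mono2') auto
    also have "\<dots> = (2 ^ k) powr e * 2 powr (- e)" by (simp add: powr_divide powr_minus_divide)
    also have "\<dots> \<le> (2 ^ k) powr e * c powr (- e)" using c False by (intro mult_left_mono powr_mono2) auto
    finally show ?thesis using False by (simp add: mult.commute)
  qed
  also have "\<dots> \<le> c powr E * (2 ^ k) powr e" using c e by (intro mult_right_mono powr_mono) auto
  finally show ?thesis .
qed

text \<open>Each derivative of the symbol gains about 2^(-k \<rho>) on the support of the piece and
  each derivative of the cutoff even 2^(-k), so the product is smooth at the scale 2^(k \<rho>).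
  \<open>S\<close> is abstract because the lemma serves twice: for \<sigma> at a fixed x, and for
  the difference of \<sigma> at two points.\<close>

lemma symb_dyadic_piece:
  fixes b :: "real^'n^'l \<Rightarrow> complex" and S :: "real^'n^'l \<Rightarrow> nat \<Rightarrow> real^'n^'l \<Rightarrow> complex"
  assumes S: "\<And>\<beta>. \<beta> \<in> Basis \<Longrightarrow> derseq N \<beta> (S \<beta>)" and S0: "\<And>\<beta>. \<beta> \<in> Basis \<Longrightarrow> S \<beta> 0 = b"
    and bd: "\<And>\<beta> j \<xi>. \<beta> \<in> Basis \<Longrightarrow> j \<le> N \<Longrightarrow> norm (S \<beta> j \<xi>) \<le> C * japan \<xi> powr (e - \<rho> * real j)"
    and C: "0 \<le> C" and \<rho>: "0 < \<rho>" "\<rho> < 1" and \<beta>0: "\<beta>0 \<in> Basis" and E: "\<bar>e\<bar> + real N \<le> E"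
    and c: "c = 2 + 2 * real CARD('l) * real DIM(real^'n^'l)"
  shows "symb N (2 ^ N * ((C * c powr E * (2 ^ k) powr e) * (2 ^ (N + 1) * B ^ DIM(real^'n^'l)))) (1 / (2 ^ k) powr \<rho>)
     (c * 2 ^ k) (\<lambda>\<xi>. b \<xi> * dy k \<beta>0 0 \<xi>)"
  unfolding symb_def
proof
  fix \<beta> :: "real^'n^'l" assume \<beta>: "\<beta> \<in> Basis"
  let ?\<mu> = "1 / (2 ^ k) powr \<rho> :: real" and ?d = "DIM(real^'n^'l)"
  have c2: "2 \<le> c" unfolding c by simp
  \<comment> \<open>The undifferentiated cutoff is the same for all basis vectors, so the fixed
    \<beta>0 in the statement agrees with the \<beta> being differentiated.\<close>
  have dyc: "dy k \<beta>' 0 \<xi> = dy k \<beta>0 0 \<xi>" if "\<beta>' \<in> Basis" for \<beta>' \<xi>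
    using that \<beta>0 by (simp add: dy_def cut_0 split: nat.split)
  have \<mu>: "(1 / 2 ^ k) ^ j \<le> ?\<mu> ^ j" for j
  proof (rule power_mono)
    have "(2 ^ k :: real) powr \<rho> \<le> (2 ^ k) powr 1" using \<rho> by (intro powr_mono) auto
    then show "1 / 2 ^ k \<le> ?\<mu>" by (simp add: frac_le)
  qed auto
  have zero: "leibniz (S \<beta>) (dy k \<beta>) j \<xi> = 0" if "j \<le> N" "\<And>i. i \<le> j \<Longrightarrow> dy k \<beta> i \<xi> = 0" for j \<xi>
    unfolding leibniz_def using that by (intro sum.neutral) auto
  let ?A = "2 ^ N * ((C * c powr E * (2 ^ k) powr e) * (2 ^ (N + 1) * B ^ ?d))"
  have A0: "0 \<le> ?A" using C B1 by auto
  show "\<exists>D. derseq N \<beta> D \<and> D 0 = (\<lambda>\<xi>. b \<xi> * dy k \<beta>0 0 \<xi>) \<and>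
     (\<forall>j\<le>N. \<forall>\<xi>. norm (D j \<xi>) \<le> ?A * ?\<mu> ^ j \<and> (c * 2 ^ k < norm \<xi> \<longrightarrow> D j \<xi> = 0))"
  proof (intro exI[of _ "leibniz (S \<beta>) (dy k \<beta>)"] conjI allI impI)
    show "derseq N \<beta> (leibniz (S \<beta>) (dy k \<beta>))" by (intro derseq_leibniz S dy_derseq \<beta>)
    show "leibniz (S \<beta>) (dy k \<beta>) 0 = (\<lambda>\<xi>. b \<xi> * dy k \<beta>0 0 \<xi>)" by (simp add: fun_eq_iff S0[OF \<beta>] dyc[OF \<beta>])
    fix j \<xi> assume j: "j \<le> N"
    show "leibniz (S \<beta>) (dy k \<beta>) j \<xi> = 0" if far: "c * 2 ^ k < norm \<xi>"
    proof (rule zero[OF j], rule ccontr)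
      fix i assume i: "i \<le> j" and "dy k \<beta> i \<xi> \<noteq> 0"
      then have "norm \<xi> \<le> 2 * real ?d * 2 ^ k" using j by (intro dy_support(1)[OF \<beta>, of i]) auto
      moreover have "2 * real ?d * 2 ^ k \<le> c * 2 ^ k"
      proof (rule mult_right_mono)
        have "1 * real ?d \<le> real CARD('l) * real ?d" by (intro mult_right_mono) (auto simp: Suc_leI)
        then show "2 * real ?d \<le> c" unfolding c by linarith
      qed simp
      ultimately show False using far by linarith
    qed
    show "norm (leibniz (S \<beta>) (dy k \<beta>) j \<xi>) \<le> ?A * ?\<mu> ^ j"
    proof (cases "\<forall>i\<le>j. dy k \<beta> i \<xi> = 0")
      case True
      then show ?thesis using zero[OF j, of \<xi>] A0 by simp
    next
      case False
      then obtain i0 where i0: "i0 \<le> j" "dy k \<beta> i0 \<xi> \<noteq> 0" by blast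
      then have i0N: "i0 \<le> N" using j by simp
      have J: "2 ^ k \<le> 2 * japan \<xi>" by (rule dy_support(2)[OF \<beta> i0N i0(2)])
      have "japan \<xi> \<le> (1 + 2 * real CARD('l) * real ?d) * 2 ^ k" by (rule dy_support(3)[OF \<beta> i0N i0(2)])
      also have "\<dots> \<le> c * 2 ^ k" unfolding c by (intro mult_right_mono) auto
      finally have J': "japan \<xi> \<le> c * 2 ^ k" .
      have "norm (leibniz (S \<beta>) (dy k \<beta>) j \<xi>) \<le> 2 ^ j * ((C * c powr E * (2 ^ k) powr e) * (2 ^ (N + 1) * B ^ ?d)) * ?\<mu> ^ j"
      proof (rule norm_leibniz_le)
        fix i assume i: "i \<le> j"
        have "\<rho> * real i \<le> 1 * real N" using i j \<rho> by (intro mult_mono) auto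
        moreover have "0 \<le> \<rho> * real i" using \<rho> by simp
        ultimately have "\<bar>e - \<rho> * real i\<bar> \<le> E" using E by linarith
        from japan_powr_le[OF c2 J J' this]
        have "norm (S \<beta> i \<xi>) \<le> C * (c powr E * (2 ^ k) powr (e - \<rho> * real i))"
          using bd[OF \<beta>, of i \<xi>] i j C by (meson mult_left_mono order_trans)
        also have "(2 ^ k :: real) powr (e - \<rho> * real i) = (2 ^ k) powr e * ?\<mu> ^ i"
        proof -
          have "(2 ^ k :: real) powr (\<rho> * real i) = ((2 ^ k) powr \<rho>) ^ i"
          proof -
            have "((2 ^ k :: real) powr \<rho>) ^ i = ((2 ^ k) powr \<rho>) powr real i" by (rule powr_realpow[symmetric]) simp
            then show ?thesis by (simp only: powr_powr)
          qed
          then show ?thesis by (simp add: powr_diff power_one_over)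
        qed
        finally show "norm (S \<beta> i \<xi>) \<le> C * c powr E * (2 ^ k) powr e * ?\<mu> ^ i" by (simp only: mult.assoc)
        have "norm (dy k \<beta> i \<xi>) \<le> 2 ^ (N + 1) * B ^ ?d * (1 / 2 ^ k) ^ i" using i j by (intro norm_dy_le[OF \<beta>]) auto
        also have "\<dots> \<le> 2 ^ (N + 1) * B ^ ?d * ?\<mu> ^ i" using B1 by (intro mult_left_mono \<mu>) auto
        finally show "norm (dy k \<beta> i \<xi>) \<le> 2 ^ (N + 1) * B ^ ?d * ?\<mu> ^ i" .
      qed (use C in auto)
      also have "\<dots> \<le> ?A * ?\<mu> ^ j"
        using j C B1 by (intro mult_right_mono power_increasing) auto
      finally show ?thesis .
    qed
  qed
qed

end

section \<open>The pieces of the symbol\<close>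

text \<open>The Lipschitz half of \<open>xsymb\<close> is \<open>symb_dyadic_piece\<close> at order
  m + \<rho>, applied to differences in x; the extra 2^(k \<rho>) is the \<kappa> that
  \<open>xsymb\<close> allows. The last two clauses are what dominated convergence asks of the
  partial sums, which for each \<xi> are eventually equal to \<sigma>.\<close>

lemma symbol_pieces:
  fixes \<sigma> :: "(real^'n) \<times> (real^'n^'l) \<Rightarrow> complex"
  assumes \<sigma>: "\<sigma> \<in> multi_symbol_class m \<rho> \<rho>" and \<rho>: "0 < \<rho>" "\<rho> < 1"
  shows "\<exists>\<tau> A K B. 0 < A \<and> 1 \<le> K \<and>
    (\<forall>k. xsymb N (A * (2 ^ k) powr m) ((2 ^ k) powr \<rho>) (K * 2 ^ k) (\<tau> k)) \<and>
    (\<forall>k. continuous_on UNIV (\<lambda>(x, \<xi>). \<tau> k x \<xi>)) \<and>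
    (\<forall>x \<xi>. (\<lambda>n. \<Sum>k<n. \<tau> k x \<xi>) \<longlonglongrightarrow> \<sigma> (x, \<xi>)) \<and>
    (\<forall>n x \<xi>. norm (\<Sum>k<n. \<tau> k x \<xi>) \<le> B * norm (\<sigma> (x, \<xi>)))"
proof -
  let ?d = "DIM(real^'n^'l)"
  obtain h B0 where h: "\<forall>j\<le>N. continuous_on UNIV (h j)" "\<forall>j<N. \<forall>t. (h j has_real_derivative h (Suc j) t) (at t)"
    "\<forall>t. \<bar>t\<bar> \<le> 1 \<longrightarrow> h 0 t = 1 \<and> (\<forall>j. 1 \<le> j \<and> j \<le> N \<longrightarrow> h j t = 0)"
    "\<forall>t. 2 \<le> \<bar>t\<bar> \<longrightarrow> (\<forall>j\<le>N. h j t = (0::real))" "\<forall>j\<le>N. \<forall>t. \<bar>h j t\<bar> \<le> B0"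
  proof -
    have "0 \<le> (1::real)" "1 < (2::real)" by auto
    from bump_exists[OF this, of N] show thesis
      apply (elim exE conjE)
      subgoal premises prems for D B
        by (rule that[of D B]; use prems in blast)
      done
  qed
  define B where "B = max 1 B0"
  interpret bump h N B
    by standard (use h in \<open>auto simp: B_def intro: le_max_iff_disj[THEN iffD2]\<close>)
  have sm: "smooth_fun \<sigma>" using \<sigma> by (simp add: multi_symbol_class_def)
  obtain \<beta>0 :: "real^'n^'l" where \<beta>0: "\<beta>0 \<in> Basis" using nonempty_Basis by blast
  obtain C1 where C1: "0 < C1" "\<And>\<beta> j x \<xi>. \<beta> \<in> Basis \<Longrightarrow> j \<le> N \<Longrightarrow> norm (xi_deriv \<sigma> \<beta> j x \<xi>) \<le> C1 * japan \<xi> powr (m - \<rho> * real j)"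
    using xi_deriv_bound[OF \<sigma>, of N] by blast
  obtain C2 where C2: "0 < C2" "\<And>\<beta> j x y \<xi>. \<beta> \<in> Basis \<Longrightarrow> j \<le> N \<Longrightarrow>
      norm (xi_deriv \<sigma> \<beta> j x \<xi> - xi_deriv \<sigma> \<beta> j y \<xi>) \<le> C2 * japan \<xi> powr (m + \<rho> - \<rho> * real j) * dist x y"
    using xi_deriv_lipschitz[OF \<sigma>, of N] by blast
  define c where "c = 2 + 2 * real CARD('l) * real ?d"
  define E where "E = \<bar>m\<bar> + 1 + real N"
  define Q where "Q = 2 ^ N * (c powr E * (2 ^ (N + 1) * B ^ ?d))"
  have c1: "1 \<le> c" unfolding c_def by simp
  have Q0: "0 < Q" unfolding Q_def using c1 B1 by (intro mult_pos_pos) auto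
  define \<tau> where "\<tau> k x \<xi> = \<sigma> (x, \<xi>) * dy k \<beta>0 0 \<xi>" for k x \<xi>
  \<comment> \<open>\<open>C1\<close> serves the size bound and \<open>C2\<close> the Lipschitz
    bound; \<open>Q\<close> collects the constants of \<open>symb_dyadic_piece\<close>.\<close>
  define A where "A = (C1 + C2) * Q"
  have A0: "0 < A" using C1 C2 Q0 by (simp add: A_def)
  have xi0: "xi_deriv \<sigma> \<beta> 0 x = (\<lambda>\<xi>. \<sigma> (x, \<xi>))" for \<beta> x by (simp add: xi_deriv_def fun_eq_iff)
  have xs: "xsymb N (A * (2 ^ k) powr m) ((2 ^ k) powr \<rho>) (c * 2 ^ k) (\<tau> k)" for k
    unfolding xsymb_def
  proof (intro conjI allI)
    fix x
    have s1: "symb N (2 ^ N * ((C1 * c powr E * (2 ^ k) powr m) * (2 ^ (N + 1) * B ^ ?d))) (1 / (2 ^ k) powr \<rho>) (c * 2 ^ k) (\<lambda>\<xi>. \<sigma> (x, \<xi>) * dy k \<beta>0 0 \<xi>)"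
      by (rule symb_dyadic_piece[where S = "\<lambda>\<beta> j. xi_deriv \<sigma> \<beta> j x", OF derseq_xi_deriv[OF sm] xi0 C1(2) _ \<rho> \<beta>0 _ c_def])
         (use C1(1) in \<open>auto simp: E_def\<close>)
    have e1: "2 ^ N * ((C1 * c powr E * (2 ^ k) powr m) * (2 ^ (N + 1) * B ^ ?d)) = C1 * Q * (2 ^ k) powr m"
      unfolding Q_def by (simp only: mult_ac)
    have l1: "C1 * Q * (2 ^ k) powr m \<le> A * (2 ^ k) powr m" unfolding A_def using C2 Q0 by (intro mult_right_mono) auto
    show "symb N (A * (2 ^ k) powr m) (1 / (2 ^ k) powr \<rho>) (c * 2 ^ k) (\<tau> k x)"
      unfolding \<tau>_def[abs_def] by (rule symb_mono[OF s1[unfolded e1] l1]) simp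
    fix y
    have s2: "symb N (2 ^ N * (((C2 * dist x y) * c powr E * (2 ^ k) powr (m + \<rho>)) * (2 ^ (N + 1) * B ^ ?d))) (1 / (2 ^ k) powr \<rho>) (c * 2 ^ k)
       (\<lambda>\<xi>. (\<sigma> (x, \<xi>) - \<sigma> (y, \<xi>)) * dy k \<beta>0 0 \<xi>)"
    proof (rule symb_dyadic_piece[where S = "\<lambda>\<beta> j \<xi>. xi_deriv \<sigma> \<beta> j x \<xi> - xi_deriv \<sigma> \<beta> j y \<xi>", OF derseq_diff[OF derseq_xi_deriv[OF sm] derseq_xi_deriv[OF sm]] _ _ _ \<rho> \<beta>0 _ c_def])
      show "norm (xi_deriv \<sigma> \<beta> j x \<xi> - xi_deriv \<sigma> \<beta> j y \<xi>) \<le> (C2 * dist x y) * japan \<xi> powr (m + \<rho> - \<rho> * real j)" if "\<beta> \<in> Basis" "j \<le> N" for \<beta> j \<xi>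
        using C2(2)[OF that, of x \<xi> y] by (simp add: mult_ac)
      show "\<bar>m + \<rho>\<bar> + real N \<le> E" unfolding E_def using \<rho> by linarith
    qed (use C2(1) in \<open>auto simp: xi0\<close>)
    have e2: "2 ^ N * (((C2 * dist x y) * c powr E * (2 ^ k) powr (m + \<rho>)) * (2 ^ (N + 1) * B ^ ?d)) = C2 * Q * (2 ^ k) powr m * (2 ^ k) powr \<rho> * dist x y"
      unfolding Q_def powr_add by (simp only: mult_ac)
    have l2: "C2 * Q * (2 ^ k) powr m * (2 ^ k) powr \<rho> * dist x y \<le> A * (2 ^ k) powr m * (2 ^ k) powr \<rho> * dist x y"
      unfolding A_def using C1 Q0 by (intro mult_right_mono) auto
    show "symb N (A * (2 ^ k) powr m * (2 ^ k) powr \<rho> * dist x y) (1 / (2 ^ k) powr \<rho>) (c * 2 ^ k) (\<lambda>\<xi>. \<tau> k x \<xi> - \<tau> k y \<xi>)"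
      unfolding \<tau>_def left_diff_distrib[symmetric] by (rule symb_mono[OF s2[unfolded e2] l2]) simp
  qed
  have cont: "continuous_on UNIV (\<lambda>(x, \<xi>). \<tau> k x \<xi>)" for k
  proof -
    have "continuous_on UNIV \<sigma>" using smooth_fun_continuous[OF sm, of "[]"] by simp
    moreover have "continuous_on UNIV (dy k \<beta>0 0)" using dy_derseq[OF \<beta>0, of k] by (simp add: derseq_def)
    then have "continuous_on UNIV (\<lambda>z :: (real^'n) \<times> (real^'n^'l). dy k \<beta>0 0 (snd z))"
      by (rule continuous_on_compose2) (auto intro!: continuous_intros)
    ultimately have "continuous_on UNIV (\<lambda>z. \<sigma> z * dy k \<beta>0 0 (snd z))" by (intro continuous_intros)
    then show ?thesis by (simp add: \<tau>_def case_prod_unfold)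
  qed
  have sum_eq: "(\<Sum>k<Suc n. \<tau> k x \<xi>) = \<sigma> (x, \<xi>) * cut h (2 ^ n) \<beta>0 0 \<xi>" for n x \<xi>
    unfolding \<tau>_def sum_distrib_left[symmetric] dy_sum ..
  have lim: "(\<lambda>n. \<Sum>k<n. \<tau> k x \<xi>) \<longlonglongrightarrow> \<sigma> (x, \<xi>)" for x \<xi>
  proof -
    obtain n0 :: nat where n0: "norm \<xi> < 2 ^ n0" using real_arch_pow[of 2 "norm \<xi>"] by auto
    have "(\<Sum>k<Suc n. \<tau> k x \<xi>) = \<sigma> (x, \<xi>)" if "n0 \<le> n" for n
    proof -
      have "(2::real) ^ n0 \<le> 2 ^ n" using that by (intro power_increasing) auto
      then have "\<bar>\<xi> \<bullet> \<gamma>\<bar> \<le> 2 ^ n" if "\<gamma> \<in> Basis" for \<gamma> using Basis_le_norm[OF that, of \<xi>] n0 by linarith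
      then have "cut h (2 ^ n) \<beta>0 0 \<xi> = 1" using cut_flat[OF \<beta>0, of "2 ^ n" \<xi> 0] by simp
      then show ?thesis unfolding sum_eq by simp
    qed
    then have "\<forall>\<^sub>F n in sequentially. (\<Sum>k<Suc n. \<tau> k x \<xi>) = \<sigma> (x, \<xi>)" unfolding eventually_sequentially by blast
    then have "(\<lambda>n. \<Sum>k<Suc n. \<tau> k x \<xi>) \<longlonglongrightarrow> \<sigma> (x, \<xi>)" by (rule tendsto_eventually)
    then show ?thesis by (rule filterlim_sequentially_Suc[THEN iffD1])
  qed
  have bd: "norm (\<Sum>k<n. \<tau> k x \<xi>) \<le> B ^ ?d * norm (\<sigma> (x, \<xi>))" for n x \<xi>
  proof (cases n)
    case 0
    then show ?thesis using B1 by simp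
  next
    case (Suc i)
    have "norm (cut h (2 ^ i) \<beta>0 0 \<xi>) \<le> B ^ ?d * (1 / 2 ^ i) ^ 0" by (rule norm_cut_le[OF \<beta>0]) auto
    from mult_left_mono[OF this, of "norm (\<sigma> (x, \<xi>))"] show ?thesis
      unfolding Suc sum_eq norm_mult by (simp add: mult.commute)
  qed
  show ?thesis
    using A0 c1 xs cont lim bd by (intro exI[of _ \<tau>] exI[of _ A] exI[of _ c] exI[of _ "B ^ ?d"] conjI allI)
qed


section \<open>Schwartz functions\<close>

text \<open>Decay of order n + 1, enough for \<open>integrable_decay_weight\<close>.\<close>

lemma schwartz_decay:
  fixes f :: "real^'n \<Rightarrow> complex"
  assumes f: "schwartz f" and ds: "set ds \<subseteq> Basis"
  shows "\<exists>C\<ge>0. \<forall>x. norm (iter_deriv ds f x) \<le> C * (1 + 1 * dist 0 x) powr (- (real CARD('n) + 1))"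
proof -
  obtain C where C: "\<And>x. (1 + norm x) ^ (CARD('n) + 1) * norm (iter_deriv ds f x) \<le> C"
    using f ds unfolding schwartz_def by blast
  have "norm (iter_deriv ds f x) \<le> C * (1 + 1 * dist 0 x) powr (- (real CARD('n) + 1))" for x
  proof -
    have pos: "0 < 1 + norm x" by (simp add: add_pos_nonneg)
    have e: "(1 + norm x) powr (- (real CARD('n) + 1)) = 1 / (1 + norm x) ^ (CARD('n) + 1)"
      using powr_realpow[OF pos, of "CARD('n) + 1"] by (simp only: powr_minus_divide of_nat_add of_nat_1)
    have "norm (iter_deriv ds f x) \<le> C / (1 + norm x) ^ (CARD('n) + 1)"
      using C[of x] pos by (simp add: pos_le_divide_eq mult.commute)
    then show ?thesis using e by simp
  qed
  moreover have "0 \<le> C" using C[of 0] by (rule order_trans[rotated]) simp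
  ultimately show ?thesis by blast
qed

lemma schwartz_integrable:
  fixes f :: "real^'n \<Rightarrow> complex"
  assumes f: "schwartz f" and ds: "set ds \<subseteq> Basis"
  shows "integrable lborel (iter_deriv ds f)"
proof -
  obtain C where C: "0 \<le> C" "\<And>x. norm (iter_deriv ds f x) \<le> C * (1 + 1 * dist 0 x) powr (- (real CARD('n) + 1))"
    using schwartz_decay[OF assms] by blast
  show ?thesis
  proof (rule Bochner_Integration.integrable_bound)
    show "integrable lborel (\<lambda>x::real^'n. C * (1 + 1 * dist 0 x) powr (- (real CARD('n) + 1)))"
      by (intro integrable_mult_right integrable_decay_weight) auto
    have "continuous_on UNIV (iter_deriv ds f)" using f ds by (auto simp: schwartz_def intro: smooth_fun_continuous)
    then show "iter_deriv ds f \<in> borel_measurable lborel" using borel_measurable_continuous_onI by simp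
    show "AE x in lborel. norm (iter_deriv ds f x) \<le> norm (C * (1 + 1 * dist 0 x) powr (- (real CARD('n) + 1)))"
      by (intro AE_I2 order_trans[OF C(2)]) simp
  qed
qed

lemma schwartz_powr_integrable:
  fixes f :: "real^'n \<Rightarrow> complex"
  assumes f: "schwartz f" and r: "1 \<le> r"
  shows "integrable lborel (\<lambda>x. norm (f x) powr r)"
proof -
  obtain C where C: "0 \<le> C" "\<And>x. norm (f x) \<le> C * (1 + 1 * dist 0 x) powr (- (real CARD('n) + 1))"
    using schwartz_decay[OF f, of "[]"] by auto
  have f1: "integrable lborel f" using schwartz_integrable[OF f, of "[]"] by simp
  then have [measurable]: "f \<in> borel_measurable borel" by auto
  show ?thesis
  proof (rule Bochner_Integration.integrable_bound)
    show "integrable lborel (\<lambda>x. C powr (r - 1) * norm (f x))" using f1 by simp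
    show "AE x in lborel. norm (norm (f x) powr r) \<le> norm (C powr (r - 1) * norm (f x))"
    proof (rule AE_I2)
      fix x :: "real^'n"
      have "(1 + 1 * dist 0 x) powr (- (real CARD('n) + 1)) \<le> (1 + 1 * dist 0 x) powr 0" by (intro powr_mono) auto
      also have "\<dots> \<le> 1" by simp
      finally have "norm (f x) \<le> C" using C(2)[of x] mult_left_le[OF _ C(1)] by (meson order_trans)
      then have "norm (f x) powr (r - 1) \<le> C powr (r - 1)" using r by (intro powr_mono2) auto
      then have "norm (f x) powr (r - 1) * norm (f x) \<le> C powr (r - 1) * norm (f x)" by (intro mult_right_mono) auto
      moreover have "norm (f x) powr r = norm (f x) powr (r - 1) * norm (f x)"
        using powr_add[of "norm (f x)" "r - 1" 1] by (cases "f x = 0") auto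
      ultimately show "norm (norm (f x) powr r) \<le> norm (C powr (r - 1) * norm (f x))" by simp
    qed
  qed measurable
qed

text \<open>n + 1 integrations by parts in each basis direction give the transform decay of order n
  + 1.\<close>

lemma schwartz_ft_integrable:
  fixes f :: "real^'n \<Rightarrow> complex"
  assumes f: "schwartz f"
  shows "integrable lborel (ft f)"
proof -
  let ?N = "CARD('n) + 1" and ?D = "\<lambda>\<beta> j. iter_deriv (replicate j \<beta>) f"
  have sm: "smooth_fun f" using f by (simp add: schwartz_def)
  have int: "integrable lborel (?D \<beta> j)" if "\<beta> \<in> Basis" for \<beta> j
    by (rule schwartz_integrable[OF f]) (use that in \<open>auto simp: set_replicate_conv_if\<close>)
  have f1: "integrable lborel f" using schwartz_integrable[OF f, of "[]"] by simp
  then have [measurable]: "f \<in> borel_measurable borel" by auto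
  define C0 where "C0 = (\<integral>x. norm (f x) \<partial>lborel) + (\<Sum>\<beta>\<in>Basis. \<integral>x. norm (?D \<beta> ?N x) \<partial>lborel)"
  define C where "C = real (DIM(real^'n) + 1) ^ ?N * C0"
  have C0: "0 \<le> C0" unfolding C0_def by (intro add_nonneg_nonneg sum_nonneg Bochner_Integration.integral_nonneg) auto
  have bd: "norm (ft f y) \<le> C * (1 + 1 * dist 0 y) powr (- (real CARD('n) + 1))" for y
  proof -
    have pos: "0 < 1 + norm y" by (simp add: add_pos_nonneg)
    have each: "\<bar>\<beta> \<bullet> y\<bar> ^ ?N * norm (ft f y) \<le> (\<integral>x. norm (?D \<beta> ?N x) \<partial>lborel)" if \<beta>: "\<beta> \<in> Basis" for \<beta>
    proof -
      have "\<bar>\<beta> \<bullet> y\<bar> ^ ?N \<le> (2 * pi * \<bar>\<beta> \<bullet> y\<bar>) ^ ?N"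
        using pi_gt3 by (intro power_mono) (auto simp: mult_le_cancel_right1)
      then have "\<bar>\<beta> \<bullet> y\<bar> ^ ?N * norm (ft f y) \<le> (2 * pi * \<bar>\<beta> \<bullet> y\<bar>) ^ ?N * norm (ft f y)" by (intro mult_right_mono) auto
      also have "\<dots> = norm (ft (?D \<beta> ?N) y)"
        using norm_ft_iterated_derivative[OF ft_iterated_derivative[OF derseq_iter_deriv[OF sm \<beta>] int[OF \<beta>]], of ?N y] by simp
      also have "\<dots> \<le> (\<integral>x. norm (?D \<beta> ?N x) \<partial>lborel)" by (rule norm_ft_le)
      finally show ?thesis .
    qed
    have "(1 + 1 * norm y) ^ ?N * norm (ft f y) \<le> real (DIM(real^'n) + 1) ^ ?N * (1 + (\<Sum>\<beta>\<in>Basis. (1 * \<bar>\<beta> \<bullet> y\<bar>) ^ ?N)) * norm (ft f y)"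
      by (intro mult_right_mono weight_le_coordinates) auto
    also have "\<dots> = real (DIM(real^'n) + 1) ^ ?N * (norm (ft f y) + (\<Sum>\<beta>\<in>Basis. \<bar>\<beta> \<bullet> y\<bar> ^ ?N * norm (ft f y)))"
      by (simp only: mult_1_left distrib_right sum_distrib_right mult.assoc)
    also have "\<dots> \<le> C"
      unfolding C_def C0_def by (intro mult_left_mono add_mono norm_ft_le sum_mono each) auto
    finally have "(1 + norm y) ^ ?N * norm (ft f y) \<le> C" by simp
    then have "norm (ft f y) \<le> C / (1 + norm y) ^ ?N" using pos by (simp add: pos_le_divide_eq mult.commute)
    moreover have "(1 + norm y) powr (- (real CARD('n) + 1)) = 1 / (1 + norm y) ^ ?N"
      using powr_realpow[OF pos, of ?N] by (simp only: powr_minus_divide of_nat_add of_nat_1)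
    ultimately show ?thesis by simp
  qed
  show ?thesis
  proof (rule Bochner_Integration.integrable_bound)
    show "integrable lborel (\<lambda>x::real^'n. C * (1 + 1 * dist 0 x) powr (- (real CARD('n) + 1)))"
      by (intro integrable_mult_right integrable_decay_weight) auto
    show "AE x in lborel. norm (ft f x) \<le> norm (C * (1 + 1 * dist 0 x) powr (- (real CARD('n) + 1)))"
      by (intro AE_I2 order_trans[OF bd]) (simp del: mult_1_left)
  qed measurable
qed

lemma fourier_eq_ft: "fourier f \<xi> = ft f (- \<xi>)"
proof -
  have "exp (- 2 * pi * \<i> * complex_of_real (y \<bullet> \<xi>)) = cis (2 * pi * (y \<bullet> - \<xi>))" for y
    by (simp add: cis_conv_exp mult_ac)
  then show ?thesis unfolding fourier_def ft_def by (simp only:)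
qed

lemma ft_tens:
  fixes f :: "'l::finite \<Rightarrow> real^'n \<Rightarrow> complex"
  assumes "\<And>j. integrable lborel (f j)"
  shows "ft (tens f) \<xi> = (\<Prod>j\<in>UNIV. ft (f j) (\<xi> $ j))"
proof -
  have i: "integrable lborel (\<lambda>y. f j y * cis (2 * pi * (y \<bullet> (\<xi> $ j))))" for j
    by (rule integrable_mult_bounded[OF assms, of _ 1]) auto
  have "tens f z * cis (2 * pi * (z \<bullet> \<xi>)) = (\<Prod>j\<in>UNIV. f j (z $ j) * cis (2 * pi * (z $ j \<bullet> \<xi> $ j)))" for z
  proof -
    have "2 * pi * (z \<bullet> \<xi>) = (\<Sum>j\<in>UNIV. 2 * pi * (z $ j \<bullet> \<xi> $ j))" by (subst inner_vec_def) (simp add: sum_distrib_left)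
    then show ?thesis unfolding tens_def prod.distrib by (simp only: prod_cis[OF finite_class.finite_UNIV])
  qed
  then show ?thesis unfolding ft_def using integral_vec_prod(2)[OF i] by (simp only:)
qed

lemma T_op_eq:
  fixes fs :: "'l::finite \<Rightarrow> real^'n \<Rightarrow> complex"
  assumes "\<And>j. integrable lborel (fs j)"
  shows "T_op \<sigma> fs x = (\<integral>\<xi>. \<sigma> (x, \<xi>) * ft (tens fs) (- \<xi>) * cis (2 * pi * (\<xi> \<bullet> diag x)) \<partial>lborel)"
proof -
  have "exp (2 * pi * \<i> * complex_of_real (x \<bullet> (\<Sum>j\<in>UNIV. \<xi> $ j))) = cis (2 * pi * (\<xi> \<bullet> diag x))" for \<xi> :: "real^'n^'l"
    unfolding inner_diag vsum_def by (simp add: cis_conv_exp mult_ac)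
  moreover have "(\<Prod>j\<in>UNIV. fourier (fs j) (\<xi> $ j)) = ft (tens fs) (- \<xi>)" for \<xi>
    unfolding ft_tens[OF assms] fourier_eq_ft by simp
  ultimately show ?thesis unfolding T_op_def by (simp only:)
qed

text \<open>Dominated convergence: the order m <= 0 makes the symbol bounded in \<xi>, and the
  transform of a tensor product of Schwartz functions is integrable.\<close>

lemma T_op_limit:
  fixes fs :: "'l::finite \<Rightarrow> real^'n \<Rightarrow> complex" and \<tau> :: "nat \<Rightarrow> real^'n \<Rightarrow> real^'n^'l \<Rightarrow> complex"
  assumes fs: "\<And>j. schwartz (fs j)" and \<sigma>: "\<sigma> \<in> multi_symbol_class m \<rho> \<rho>" and m: "m \<le> 0"
    and int: "\<And>k. integrable lborel (\<tau> k x)"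
    and lim: "\<And>\<xi>. (\<lambda>n. \<Sum>k<n. \<tau> k x \<xi>) \<longlonglongrightarrow> \<sigma> (x, \<xi>)"
    and bd: "\<And>n \<xi>. norm (\<Sum>k<n. \<tau> k x \<xi>) \<le> B * norm (\<sigma> (x, \<xi>))"
  shows "(\<lambda>n. \<Sum>k<n. fmult (tens fs) (\<tau> k x) (diag x)) \<longlonglongrightarrow> T_op \<sigma> fs x"
proof -
  have f1: "integrable lborel (fs j)" for j using schwartz_integrable[OF fs, of "[]"] by simp
  have F: "integrable lborel (tens fs)" unfolding tens_def[abs_def] by (rule integral_vec_prod(1)[OF f1])
  then have [measurable]: "tens fs \<in> borel_measurable borel" by auto
  have \<tau>m [measurable]: "\<tau> k x \<in> borel_measurable borel" for k using int[of k] by auto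
  have "integrable lborel (ft (tens fs))"
    unfolding ft_tens[OF f1, abs_def] by (rule integral_vec_prod(1)[OF schwartz_ft_integrable[OF fs]])
  then have Fh: "integrable lborel (\<lambda>\<xi>. ft (tens fs) (- \<xi>))"
    using nn_integral_lborel_reflect[of "\<lambda>\<xi>. ennreal (norm (ft (tens fs) \<xi>))" 0]
    unfolding integrable_iff_bounded by simp
  obtain C where C: "\<And>\<xi>. norm (\<sigma> (x, \<xi>)) \<le> C * japan \<xi> powr m"
    using multi_symbol_bound[OF \<sigma>, of "[]" 0 0] by (auto simp: n_xdirs_def n_xidirs_def)
  have sC: "norm (\<sigma> (x, \<xi>)) \<le> \<bar>C\<bar>" for \<xi>
  proof -
    have "japan \<xi> powr m \<le> 1 powr m" using m by (intro powr_mono2') (auto simp: japan_def sum_nonneg)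
    then have "\<bar>C\<bar> * japan \<xi> powr m \<le> \<bar>C\<bar> * 1" by (intro mult_left_mono) auto
    moreover have "C * japan \<xi> powr m \<le> \<bar>C\<bar> * japan \<xi> powr m" by (intro mult_right_mono) auto
    ultimately show ?thesis using C[of \<xi>] by simp
  qed
  have sm: "(\<lambda>\<xi>. \<sigma> (x, \<xi>)) \<in> borel_measurable borel"
  proof (rule borel_measurable_LIMSEQ_metric[OF _ lim])
    show "(\<lambda>\<xi>. \<Sum>k<n. \<tau> k x \<xi>) \<in> borel_measurable borel" for n by measurable
  qed
  let ?e = "\<lambda>\<xi>. ft (tens fs) (- \<xi>) * cis (2 * pi * (\<xi> \<bullet> diag x))"
  have "(\<lambda>n. \<integral>\<xi>. (\<Sum>k<n. \<tau> k x \<xi>) * ?e \<xi> \<partial>lborel) \<longlonglongrightarrow> (\<integral>\<xi>. \<sigma> (x, \<xi>) * ?e \<xi> \<partial>lborel)"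
  proof (rule integral_dominated_convergence)
    show "integrable lborel (\<lambda>\<xi>. \<bar>B\<bar> * \<bar>C\<bar> * norm (ft (tens fs) (- \<xi>)))" using Fh by simp
    show "AE \<xi> in lborel. (\<lambda>n. (\<Sum>k<n. \<tau> k x \<xi>) * ?e \<xi>) \<longlonglongrightarrow> \<sigma> (x, \<xi>) * ?e \<xi>"
      by (intro AE_I2 tendsto_mult_right lim)
    show "AE \<xi> in lborel. norm ((\<Sum>k<n. \<tau> k x \<xi>) * ?e \<xi>) \<le> \<bar>B\<bar> * \<bar>C\<bar> * norm (ft (tens fs) (- \<xi>))" for n
    proof (rule AE_I2)
      fix \<xi>
      have "norm (\<Sum>k<n. \<tau> k x \<xi>) \<le> \<bar>B\<bar> * norm (\<sigma> (x, \<xi>))"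
        using bd[of \<xi> n] by (rule order_trans) (intro mult_right_mono, auto)
      also have "\<dots> \<le> \<bar>B\<bar> * \<bar>C\<bar>" by (intro mult_left_mono sC) auto
      finally show "norm ((\<Sum>k<n. \<tau> k x \<xi>) * ?e \<xi>) \<le> \<bar>B\<bar> * \<bar>C\<bar> * norm (ft (tens fs) (- \<xi>))"
        by (simp add: norm_mult mult_right_mono)
    qed
    show "(\<lambda>\<xi>. \<sigma> (x, \<xi>) * ?e \<xi>) \<in> borel_measurable lborel" using sm by measurable
  qed measurable
  moreover have "(\<integral>\<xi>. (\<Sum>k<n. \<tau> k x \<xi>) * ?e \<xi> \<partial>lborel) = (\<Sum>k<n. fmult (tens fs) (\<tau> k x) (diag x))" for n
  proof -
    have "(\<Sum>k<n. fmult (tens fs) (\<tau> k x) (diag x)) = (\<integral>\<xi>. (\<Sum>k<n. \<tau> k x \<xi> * ft (tens fs) (- \<xi>) * cis (2 * pi * (\<xi> \<bullet> diag x))) \<partial>lborel)"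
      unfolding fmult_def by (rule Bochner_Integration.integral_sum[symmetric]) (rule fmult_integrable[OF F int])
    then show ?thesis by (simp only: sum_distrib_right mult.assoc)
  qed
  ultimately show ?thesis unfolding T_op_eq[OF f1] by (simp only: mult.assoc)
qed


section \<open>The sharp maximal estimate\<close>

text \<open>Since t <= 1, x/(a+b) is at most its t-th power for x = a and x = b, and the two
  fractions sum to 1.\<close>

lemma powr_add_le:
  fixes a b t :: real
  assumes "0 \<le> a" "0 \<le> b" "0 < t" "t \<le> 1"
  shows "(a + b) powr t \<le> a powr t + b powr t"
proof (cases "a + b = 0")
  case True
  then show ?thesis using assms by simp
next
  case False
  then have pos: "0 < a + b" using assms by simp
  have *: "x / (a + b) * (a + b) powr t \<le> x powr t" if "0 \<le> x" "x \<le> a + b" for x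
  proof -
    have "x / (a + b) \<le> (x / (a + b)) powr t"
    proof (cases "x = 0")
      case False
      then have "(x / (a + b)) powr 1 \<le> (x / (a + b)) powr t"
        using that pos assms by (intro powr_mono') (auto simp: field_simps)
      then show ?thesis using that pos by simp
    qed simp
    then have "x / (a + b) * (a + b) powr t \<le> (x / (a + b)) powr t * (a + b) powr t" by (intro mult_right_mono) auto
    also have "\<dots> = x powr t" using pos that by (simp add: powr_divide)
    finally show ?thesis .
  qed
  have "(a + b) powr t = a / (a + b) * (a + b) powr t + b / (a + b) * (a + b) powr t"
    using pos by (simp add: distrib_right[symmetric] add_divide_distrib[symmetric])
  also have "\<dots> \<le> a powr t + b powr t" using * assms by (intro add_mono) auto
  finally show ?thesis .
qed

lemma powr_sum_le_sum_powr:
  fixes g :: "'i \<Rightarrow> real"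
  assumes "finite I" "\<And>i. i \<in> I \<Longrightarrow> 0 \<le> g i" and t: "0 < t" "t \<le> 1"
  shows "(\<Sum>i\<in>I. g i) powr t \<le> (\<Sum>i\<in>I. g i powr t)"
  using assms(1,2)
proof (induction rule: finite_induct)
  case (insert x I)
  then have "(g x + (\<Sum>i\<in>I. g i)) powr t \<le> g x powr t + (\<Sum>i\<in>I. g i) powr t"
    by (intro powr_add_le t sum_nonneg) auto
  then show ?case using insert by fastforce
qed simp

text \<open>All that the estimates for the pieces use of the Schwartz functions; these are called
  upon again only for the convergence in \<open>T_op_limit\<close>.\<close>

definition nice :: "real \<Rightarrow> ('l::finite \<Rightarrow> real^'n \<Rightarrow> complex) \<Rightarrow> bool" where
  "nice r f \<longleftrightarrow> (\<forall>j. f j \<in> borel_measurable borel) \<and> (\<forall>j. integrable lborel (\<lambda>y. norm (f j y) powr r)) \<and>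
     integrable lborel (tens f) \<and> integrable lborel (\<lambda>z. norm (tens f z) powr r)"

lemma schwartz_nice:
  fixes f :: "'l::finite \<Rightarrow> real^'n \<Rightarrow> complex"
  assumes f: "\<And>j. schwartz (f j)" and r: "1 \<le> r"
  shows "nice r f"
proof -
  have f1: "integrable lborel (f j)" for j using schwartz_integrable[OF f, of "[]"] by simp
  have fr: "integrable lborel (\<lambda>y. norm (f j y) powr r)" for j by (rule schwartz_powr_integrable[OF f r])
  have "integrable lborel (\<lambda>z :: real^'n^'l. \<Prod>j\<in>UNIV. complex_of_real (norm (f j (z $ j)) powr r))"
    by (rule integral_vec_prod(1)) (use fr in simp)
  then have "integrable lborel (\<lambda>z. norm (tens f z) powr r)"
    unfolding norm_tens_powr of_real_prod[symmetric] complex_of_real_integrable_eq .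
  moreover have "integrable lborel (tens f)" unfolding tens_def[abs_def] by (rule integral_vec_prod(1)[OF f1])
  ultimately show ?thesis using f1 fr unfolding nice_def by auto
qed

section \<open>Estimates for the pieces\<close>

text \<open>\<open>N\<close> is chosen so that N r = l p with p = (d + 1) r (see \<open>Nr\<close>):
  \<open>Phi_diag_le_prod\<close> splits an exponent of the form l p, and p >= d + 1 is what decay
  in \<open>real^'n^'l\<close> requires. From here on \<rho> is the exponent of the symbol class;
  the radius is K 2^k and \<kappa> is 2^(k \<rho>).\<close>

locale dyadic_pieces =
  fixes \<tau> :: "nat \<Rightarrow> real^'n \<Rightarrow> real^'n^'l \<Rightarrow> complex" and A K \<rho> r m q t :: real and N :: nat
  assumes r: "1 < r" "r \<le> 2" and \<rho>: "0 < \<rho>" "\<rho> < 1" and q: "q = r / (r - 1)" and l2: "2 \<le> CARD('l)"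
    and t: "t = r / real CARD('l)"
    and m: "m = - (real CARD('n) * real CARD('l) / r) * (1 - \<rho>)" and A: "0 < A" and K: "1 \<le> K"
    and N: "N = CARD('l) * (DIM(real^'n^'l) + 1)"
    and xs: "\<And>k. xsymb N (A * (2 ^ k) powr m) ((2 ^ k) powr \<rho>) (K * 2 ^ k) (\<tau> k)"
    and cont: "\<And>k. continuous_on UNIV (\<lambda>(x, \<xi>). \<tau> k x \<xi>)"
begin

definition piece :: "nat \<Rightarrow> ('l \<Rightarrow> real^'n \<Rightarrow> complex) \<Rightarrow> real^'n \<Rightarrow> complex" where
  "piece k f x = fmult (tens f) (\<tau> k x) (diag x)"

definition S :: real where "S = A * (2 * K) powr (real DIM(real^'n^'l) / r)"

lemma t_bounds: "0 < t" "t \<le> 1"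
  using r l2 unfolding t by (auto simp: pos_divide_le_eq)

lemma Nr: "real N * r = real CARD('l) * ((real DIM(real^'n^'l) + 1) * r)"
  unfolding N by (simp only: of_nat_mult of_nat_add of_nat_1 mult_ac)

lemma p_ge: "real DIM(real^'n^'l) + 1 \<le> (real DIM(real^'n^'l) + 1) * r"
  using r mult_left_mono[of 1 r "real DIM(real^'n^'l) + 1"] by simp

lemma Nr_ge: "real DIM(real^'n^'l) + 1 \<le> real N * r"
proof -
  have "1 * (real DIM(real^'n^'l) + 1) \<le> real CARD('l) * ((real DIM(real^'n^'l) + 1) * r)"
    using p_ge l2 by (intro mult_mono) auto
  then show ?thesis unfolding Nr by simp
qed

lemma S_pos: "0 < S" using A K by (simp add: S_def)

text \<open>The order of the symbol is exactly the one for which the kernel bounds at all frequency scales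
  have the same normalisation.\<close>
lemma scale_const:
  "A * (2 ^ k) powr m * (2 * (K * 2 ^ k) / (2 ^ k) powr \<rho>) powr (real DIM(real^'n^'l) / r) = S"
proof -
  let ?R = "2 ^ k :: real" and ?e = "real DIM(real^'n^'l) / r"
  have "2 * (K * ?R) / ?R powr \<rho> = 2 * K * (?R powr 1 / ?R powr \<rho>)" by simp
  also have "?R powr 1 / ?R powr \<rho> = ?R powr (1 - \<rho>)" by (rule powr_diff[symmetric])
  finally have "(2 * (K * ?R) / ?R powr \<rho>) powr ?e = (2 * K) powr ?e * ?R powr ((1 - \<rho>) * ?e)"
    by (simp only: powr_mult powr_powr)
  then have "A * ?R powr m * (2 * (K * ?R) / ?R powr \<rho>) powr ?e = S * (?R powr m * ?R powr ((1 - \<rho>) * ?e))"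
    unfolding S_def by (simp only: mult_ac)
  also have "?R powr m * ?R powr ((1 - \<rho>) * ?e) = 1"
  proof -
    have "m + (1 - \<rho>) * ?e = 0" unfolding m by (simp add: field_simps)
    then show ?thesis unfolding powr_add[symmetric] by simp
  qed
  finally show ?thesis by simp
qed

lemma piece_measurable:
  assumes "nice r f"
  shows "piece k f \<in> borel_measurable borel"
proof -
  have [measurable]: "tens f \<in> borel_measurable borel" using assms by (auto simp: nice_def)
  have "(\<lambda>(x, \<xi>). \<tau> k x \<xi>) \<in> borel_measurable (borel \<Otimes>\<^sub>M borel)"
    unfolding borel_prod by (rule borel_measurable_continuous_onI[OF cont])
  then have [measurable]: "(\<lambda>z. \<tau> k (fst z) (snd z)) \<in> borel_measurable (borel \<Otimes>\<^sub>M borel)" by (simp add: case_prod_unfold)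
  show ?thesis unfolding piece_def[abs_def] fmult_def
    by (rule lborel.borel_measurable_lebesgue_integral) (simp add: case_prod_unfold)
qed

text \<open>The decay rate that \<open>gain_le\<close> can guarantee: n/q is the rate in R L when s
  = L, and (1-\<rho>)/2 times n/q or times 1 are the rates in R of the duality gain and of the
  freezing error when s = R^(-(1+\<rho>)/2).\<close>

definition \<epsilon> :: real where "\<epsilon> = min (real CARD('n) / q) ((1 - \<rho>) / 2 * min 1 (real CARD('n) / q))"

lemma q_pos: "0 < q" using r by (simp add: q)

lemma \<epsilon>_pos: "0 < \<epsilon>" using \<rho> q_pos by (auto simp: \<epsilon>_def)

text \<open>At the geometric mean s = R^(-(1+\<rho>)/2) of 1/R and R^(-\<rho>), R s =
  R^((1-\<rho>)/2) is large while R^\<rho> s = R^(-(1-\<rho>)/2) is small. On a shorter cube s = L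
  and the duality gain is a power of R L alone. The 2 counts one R^(-\<epsilon>) from the gain and
  one from freezing.\<close>

lemma gain_le:
  fixes k :: nat and L s :: real
  defines "R \<equiv> 2 ^ k"
  assumes L: "0 < L" "1 \<le> R * L" and s: "s = min L (R powr (- ((1 + \<rho>) / 2)))"
  shows "((1 / (K * R * s)) powr (real CARD('n) / q) + R powr \<rho> * s) powr t
    \<le> (R * L) powr (- (\<epsilon> * t)) + 2 * R powr (- (\<epsilon> * t))"
proof -
  have R1: "1 \<le> R" unfolding R_def by simp
  then have R0: "0 < R" by simp
  have s0: "0 < s" using L R0 by (simp add: s)
  let ?n = "real CARD('n) / q"
  have n0: "0 \<le> ?n" using q_pos by simp
  have e1: "\<epsilon> \<le> ?n" and e2: "\<epsilon> \<le> (1 - \<rho>) / 2 * ?n" and e3: "\<epsilon> \<le> (1 - \<rho>) / 2"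
  proof -
    show "\<epsilon> \<le> ?n" by (simp add: \<epsilon>_def)
    have "(1 - \<rho>) / 2 * min 1 ?n \<le> (1 - \<rho>) / 2 * ?n" using \<rho> by (intro mult_left_mono) auto
    then show "\<epsilon> \<le> (1 - \<rho>) / 2 * ?n" unfolding \<epsilon>_def by linarith
    have "(1 - \<rho>) / 2 * min 1 ?n \<le> (1 - \<rho>) / 2 * 1" using \<rho> by (intro mult_left_mono) auto
    then show "\<epsilon> \<le> (1 - \<rho>) / 2" unfolding \<epsilon>_def by linarith
  qed
  have "1 * (R * s) \<le> K * (R * s)" using K R0 s0 by (intro mult_right_mono) auto
  then have "1 / (K * R * s) \<le> 1 / (R * s)" using R0 s0 by (intro divide_left_mono) (auto simp: mult.assoc)
  then have "(1 / (K * R * s)) powr ?n \<le> (1 / (R * s)) powr ?n" using K R0 s0 n0 by (intro powr_mono2) auto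
  also have "\<dots> = (R * s) powr (- ?n)" using R0 s0 by (simp add: powr_divide powr_minus_divide)
  also have "\<dots> \<le> (R * L) powr (- \<epsilon>) + R powr (- \<epsilon>)"
  proof (cases "L \<le> R powr (- ((1 + \<rho>) / 2))")
    case True
    then have "s = L" by (simp add: s)
    moreover have "(R * L) powr (- ?n) \<le> (R * L) powr (- \<epsilon>)" using L e1 by (intro powr_mono) auto
    ultimately show ?thesis by (simp add: add_increasing2)
  next
    case False
    then have "R * s = R powr 1 * R powr (- ((1 + \<rho>) / 2))" using R0 by (simp add: s)
    also have "\<dots> = R powr ((1 - \<rho>) / 2)" unfolding powr_add[symmetric] by (simp add: field_simps)
    finally have "(R * s) powr (- ?n) = R powr (- ((1 - \<rho>) / 2 * ?n))" by (simp add: powr_powr)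
    also have "\<dots> \<le> R powr (- \<epsilon>)" using R1 e2 by (intro powr_mono) auto
    finally show ?thesis by (simp add: add_increasing)
  qed
  finally have 1: "(1 / (K * R * s)) powr ?n \<le> (R * L) powr (- \<epsilon>) + R powr (- \<epsilon>)" .
  have "R powr \<rho> * s \<le> R powr \<rho> * R powr (- ((1 + \<rho>) / 2))" by (intro mult_left_mono) (auto simp: s)
  also have "\<dots> = R powr (- ((1 - \<rho>) / 2))"
  proof -
    have "\<rho> + - ((1 + \<rho>) / 2) = - ((1 - \<rho>) / 2)" by (simp add: field_simps)
    then show ?thesis unfolding powr_add[symmetric] by (simp only:)
  qed
  also have "\<dots> \<le> R powr (- \<epsilon>)" using R1 e3 by (intro powr_mono) auto
  finally have "(1 / (K * R * s)) powr ?n + R powr \<rho> * s \<le> (R * L) powr (- \<epsilon>) + (R powr (- \<epsilon>) + R powr (- \<epsilon>))" using 1 by simp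
  then have "((1 / (K * R * s)) powr ?n + R powr \<rho> * s) powr t \<le> ((R * L) powr (- \<epsilon>) + (R powr (- \<epsilon>) + R powr (- \<epsilon>))) powr t"
    using t_bounds s0 by (intro powr_mono2) auto
  also have "\<dots> \<le> ((R * L) powr (- \<epsilon>)) powr t + (R powr (- \<epsilon>) + R powr (- \<epsilon>)) powr t"
    by (intro powr_add_le t_bounds) auto
  also have "\<dots> \<le> ((R * L) powr (- \<epsilon>)) powr t + ((R powr (- \<epsilon>)) powr t + (R powr (- \<epsilon>)) powr t)"
    by (intro add_left_mono powr_add_le t_bounds) auto
  finally show ?thesis by (simp add: powr_powr)
qed

text \<open>The averages over cubes of side s are raised to the power t and then averaged over the
  corners a' of these cubes. As 1/r times t is 1/l, what remains is the integral of
  \<open>Phi\<close> to the power 1/l, bounded by \<open>Phi_root_cube_le\<close>.\<close>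

lemma high_piece:
  "\<exists>C>0. \<forall>f x0 M a L k. nice r f \<longrightarrow> max_bound r f x0 M \<longrightarrow> 0 < L \<longrightarrow> x0 \<in> cube a L \<longrightarrow> 1 \<le> 2 ^ k * L \<longrightarrow>
    (\<integral>\<^sup>+x. ennreal (norm (piece k f x) powr t) * indicator (cube a L) x \<partial>lborel)
     \<le> ennreal (C * M powr (1 / real CARD('l)) * L ^ CARD('n) * ((2 ^ k * L) powr (- (\<epsilon> * t)) + 2 * (2 ^ k) powr (- (\<epsilon> * t))))"
proof -
  let ?n = "CARD('n)" and ?l = "real CARD('l)"
  obtain K1 where K1: "0 < K1" and avg: "\<And>(F :: real^'n^'l \<Rightarrow> complex) \<tau> \<kappa> A \<rho> s a. 0 < \<kappa> \<Longrightarrow> 0 < A \<Longrightarrow> 0 < \<rho> \<Longrightarrow> 0 < s \<Longrightarrow> s * \<kappa> \<le> 1 \<Longrightarrow>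
    integrable lborel F \<Longrightarrow> integrable lborel (\<lambda>z. norm (F z) powr r) \<Longrightarrow> xsymb N A \<kappa> \<rho> \<tau> \<Longrightarrow>
    (\<integral>\<^sup>+x. ennreal (norm (fmult F (\<tau> x) (diag x))) * indicator (cube a s) x \<partial>lborel)
    \<le> ennreal (K1 * (A * (2 * \<rho> / \<kappa>) powr (real DIM(real^'n^'l) / r)) * ((1 / (\<rho> * s)) powr (real ?n / q) + \<kappa> * s)
        * Phi r (real N * r) \<kappa> F (diag a) powr (1 / r) * s ^ ?n)"
    using local_average_bound[OF r q, of N, where 'n = 'n and 'l = 'l] by blast
  obtain K2 where K2: "0 < K2" and root: "\<And>(f :: 'l \<Rightarrow> real^'n \<Rightarrow> complex) r' x0 M \<kappa> L a. max_bound r' f x0 M \<Longrightarrow> (\<forall>j. f j \<in> borel_measurable borel) \<Longrightarrow>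
    (\<forall>j. integrable lborel (\<lambda>y. norm (f j y) powr r')) \<Longrightarrow> integrable lborel (\<lambda>z. norm (tens f z) powr r') \<Longrightarrow>
    0 < \<kappa> \<Longrightarrow> 0 < L \<Longrightarrow> x0 \<in> cube a L \<Longrightarrow>
    (\<integral>\<^sup>+x. ennreal (Phi r' (?l * ((real DIM(real^'n^'l) + 1) * r)) \<kappa> (tens f) (diag x) powr (1 / ?l)) * indicator (cube a L) x \<partial>lborel)
    \<le> ennreal (K2 * M powr (1 / ?l) * L ^ ?n)"
    using Phi_root_cube_le[OF p_ge] by blast
  \<comment> \<open>The first 2 comes from \<open>nn_integral_powr_le_of_average\<close>, and 2^n
    from the enlarged cube, whose side is L + s <= 2 L.\<close>
  define C where "C = 2 * (K1 * S) powr t * (K2 * 2 ^ ?n)"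
  show ?thesis
  proof (intro exI[of _ C] conjI allI impI)
    show "0 < C" unfolding C_def using K1 K2 S_pos by simp
    fix f :: "'l \<Rightarrow> real^'n \<Rightarrow> complex" and x0 a :: "real^'n" and M L :: real and k :: nat
    assume f: "nice r f" and M: "max_bound r f x0 M" and L: "0 < L" and x0: "x0 \<in> cube a L" and kL: "1 \<le> 2 ^ k * L"
    let ?R = "2 ^ k :: real" and ?\<kappa> = "(2 ^ k :: real) powr \<rho>"
    have M0: "0 \<le> M" using M by (simp add: max_bound_def)
    have R1: "1 \<le> ?R" by simp
    define s where "s = min L (?R powr (- ((1 + \<rho>) / 2)))"
    have s: "0 < s" "s \<le> L" using L by (auto simp: s_def)
    have "s * ?\<kappa> \<le> ?R powr (- ((1 + \<rho>) / 2)) * ?\<kappa>" by (intro mult_right_mono) (auto simp: s_def)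
    also have "\<dots> = ?R powr (- ((1 - \<rho>) / 2))"
    proof -
      have "- ((1 + \<rho>) / 2) + \<rho> = - ((1 - \<rho>) / 2)" by (simp add: field_simps)
      then show ?thesis unfolding powr_add[symmetric] by (simp only:)
    qed
    also have "\<dots> \<le> ?R powr 0" using \<rho> by (intro powr_mono) auto
    finally have s\<kappa>: "s * ?\<kappa> \<le> 1" by simp
    define g where "g = (1 / (K * ?R * s)) powr (real ?n / q) + ?\<kappa> * s"
    have g0: "0 \<le> g" using s by (simp add: g_def)
    have gt: "g powr t \<le> (?R * L) powr (- (\<epsilon> * t)) + 2 * ?R powr (- (\<epsilon> * t))"
      unfolding g_def using gain_le[OF L _ s_def] kL by simp
    define P where "P y = Phi r (real N * r) ?\<kappa> (tens f) (diag y)" for y :: "real^'n"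
    have P0: "0 \<le> P y" for y unfolding P_def by (rule Phi_nonneg) simp
    have [measurable]: "tens f \<in> borel_measurable borel" using f by (auto simp: nice_def)
    have [measurable]: "P \<in> borel_measurable borel"
      unfolding P_def[abs_def] Phi_def by (rule lborel.borel_measurable_lebesgue_integral) measurable
    note [measurable] = piece_measurable[OF f]
    have K1Sg: "0 \<le> K1 * S * g" using K1 S_pos g0 by simp
    have loc: "(\<integral>\<^sup>+x. ennreal (norm (piece k f x) powr t) * indicator (cube a' s) x \<partial>lborel)
       \<le> ennreal (2 * (K1 * S * g) powr t * s ^ ?n) * ennreal (P a' powr (1 / ?l))" for a'
    proof -
      have "(\<integral>\<^sup>+x. ennreal (norm (piece k f x)) * indicator (cube a' s) x \<partial>lborel)
        \<le> ennreal (K1 * (A * ?R powr m * (2 * (K * ?R) / ?\<kappa>) powr (real DIM(real^'n^'l) / r)) * g * P a' powr (1 / r) * s ^ ?n)"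
        unfolding piece_def g_def P_def
        by (rule avg[OF _ _ _ s(1) s\<kappa> _ _ xs]) (use f A K in \<open>auto simp: nice_def\<close>)
      then have "(\<integral>\<^sup>+x. ennreal (norm (piece k f x)) * indicator (cube a' s) x \<partial>lborel) \<le> ennreal ((K1 * S * g * P a' powr (1 / r)) * s ^ ?n)"
        unfolding scale_const .
      then have "(\<integral>\<^sup>+x. ennreal (norm (piece k f x) powr t) * indicator (cube a' s) x \<partial>lborel)
        \<le> ennreal (2 * (K1 * S * g * P a' powr (1 / r)) powr t * s ^ ?n)"
        using s K1Sg by (intro nn_integral_powr_le_of_average[OF t_bounds]) (auto simp: emeasure_cube)
      also have "(K1 * S * g * P a' powr (1 / r)) powr t = (K1 * S * g) powr t * P a' powr (1 / ?l)"
        using r by (simp add: powr_mult powr_powr t)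
      also have "2 * ((K1 * S * g) powr t * P a' powr (1 / ?l)) * s ^ ?n = (2 * (K1 * S * g) powr t * s ^ ?n) * P a' powr (1 / ?l)"
        by (simp only: mult_ac)
      also have "ennreal \<dots> = ennreal (2 * (K1 * S * g) powr t * s ^ ?n) * ennreal (P a' powr (1 / ?l))"
        using s by (intro ennreal_mult) auto
      finally show ?thesis .
    qed
    let ?Q' = "cube (a - s *\<^sub>R One) (L + s)"
    \<comment> \<open>The enlarged cube has to contain \<open>x0\<close>, the point at which the
      maximal function is controlled.\<close>
    have x0': "x0 \<in> ?Q'"
    proof -
      have "a $ i - s \<le> x0 $ i \<and> x0 $ i \<le> a $ i - s + (L + s)" for i
        using spec[OF x0[unfolded mem_cube], of i] s by simp
      then show ?thesis unfolding mem_cube nth_add_One by blast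
    qed
    define X where "X = (\<integral>\<^sup>+x. ennreal (norm (piece k f x) powr t) * indicator (cube a L) x \<partial>lborel)"
    have "ennreal (s ^ ?n) * X \<le> (\<integral>\<^sup>+a'. (\<integral>\<^sup>+x. ennreal (norm (piece k f x) powr t) * indicator (cube a' s) x \<partial>lborel) * indicator ?Q' a' \<partial>lborel)"
      unfolding X_def by (rule nn_integral_cube_average[OF _ s(1)]) measurable
    also have "\<dots> \<le> (\<integral>\<^sup>+a'. ennreal (2 * (K1 * S * g) powr t * s ^ ?n) * (ennreal (P a' powr (1 / ?l)) * indicator ?Q' a') \<partial>lborel)"
      using loc by (intro nn_integral_mono) (auto split: split_indicator)
    also have "\<dots> = ennreal (2 * (K1 * S * g) powr t * s ^ ?n) * (\<integral>\<^sup>+a'. ennreal (P a' powr (1 / ?l)) * indicator ?Q' a' \<partial>lborel)"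
      by (rule nn_integral_cmult) measurable
    also have "\<dots> \<le> ennreal (2 * (K1 * S * g) powr t * s ^ ?n) * ennreal (K2 * M powr (1 / ?l) * (L + s) ^ ?n)"
      unfolding P_def Nr using f s L by (intro mult_left_mono root[OF M _ _ _ _ _ x0']) (auto simp: nice_def)
    also have "\<dots> = ennreal (2 * (K1 * S * g) powr t * s ^ ?n * (K2 * M powr (1 / ?l) * (L + s) ^ ?n))"
      using s L K2 by (intro ennreal_mult[symmetric]) auto
    finally have sX: "ennreal (s ^ ?n) * X \<le> ennreal (2 * (K1 * S * g) powr t * s ^ ?n * (K2 * M powr (1 / ?l) * (L + s) ^ ?n))" .
    have inv: "(1 / s) ^ ?n * s ^ ?n = 1" unfolding power_mult_distrib[symmetric] using s by simp
    have "X = ennreal ((1 / s) ^ ?n) * (ennreal (s ^ ?n) * X)"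
      unfolding mult.assoc[symmetric] using s inv by (simp add: ennreal_mult[symmetric])
    also have "\<dots> \<le> ennreal ((1 / s) ^ ?n) * ennreal (2 * (K1 * S * g) powr t * s ^ ?n * (K2 * M powr (1 / ?l) * (L + s) ^ ?n))"
      by (intro mult_left_mono sX) simp
    also have "\<dots> = ennreal ((1 / s) ^ ?n * (2 * (K1 * S * g) powr t * s ^ ?n * (K2 * M powr (1 / ?l) * (L + s) ^ ?n)))"
      using s by (intro ennreal_mult'[symmetric]) simp
    also have "(1 / s) ^ ?n * (2 * (K1 * S * g) powr t * s ^ ?n * (K2 * M powr (1 / ?l) * (L + s) ^ ?n))
       = ((1 / s) ^ ?n * s ^ ?n) * (2 * (K1 * S * g) powr t * (K2 * M powr (1 / ?l) * (L + s) ^ ?n))"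
      by (simp only: mult_ac)
    also have "\<dots> \<le> 2 * (K1 * S * g) powr t * (K2 * M powr (1 / ?l) * (2 * L) ^ ?n)"
      unfolding inv mult_1_left using s K2 by (intro mult_left_mono power_mono) auto
    also have "\<dots> = C * M powr (1 / ?l) * L ^ ?n * g powr t"
      unfolding C_def powr_mult power_mult_distrib by (simp only: mult_ac)
    also have "\<dots> \<le> C * M powr (1 / ?l) * L ^ ?n * ((?R * L) powr (- (\<epsilon> * t)) + 2 * ?R powr (- (\<epsilon> * t)))"
      using gt \<open>0 < C\<close> L by (intro mult_left_mono) auto
    finally show "(\<integral>\<^sup>+x. ennreal (norm (piece k f x) powr t) * indicator (cube a L) x \<partial>lborel)
     \<le> ennreal (C * M powr (1 / ?l) * L ^ ?n * ((?R * L) powr (- (\<epsilon> * t)) + 2 * ?R powr (- (\<epsilon> * t))))"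
      unfolding X_def by (simp add: ennreal_leI)
  qed
qed

text \<open>\<open>fmult_difference\<close> with \<delta> = c L, where c = l n bounds the
  displacement along the diagonal of two points of a cube of side 1. The condition 2^k L <= 1 gives
  \<kappa>\<delta> <= c.\<close>

lemma low_piece:
  "\<exists>C>0. \<forall>f x0 x M a L k. nice r f \<longrightarrow> max_bound r f x0 M \<longrightarrow> 0 < L \<longrightarrow> x0 \<in> cube a L \<longrightarrow> x \<in> cube a L \<longrightarrow> 2 ^ k * L \<le> 1 \<longrightarrow>
    norm (piece k f x - piece k f x0) \<le> C * (2 ^ k * L) * M powr (1 / r)"
proof -
  let ?n = "CARD('n)" and ?l = "CARD('l)" and ?d = "DIM(real^'n^'l)"
  define c where "c = real ?l * real ?n"
  define K0 where "K0 = real (?d + 1) ^ (N + 2) * ((1 + c) powr real N + 2 ^ N * (7 * c) ^ (N + 1))"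
  define PC where "PC = (2 powr (real N * r + 1) * 2 ^ ?d) powr (1 / r)"
  define C where "C = 1 + K0 * S * (K * c) * PC"
  have "1 * 1 \<le> c" unfolding c_def by (intro mult_mono) (auto simp: Suc_leI)
  then have c1: "1 \<le> c" by simp
  have K00: "0 \<le> K0" unfolding K0_def using c1 by (intro mult_nonneg_nonneg add_nonneg_nonneg) auto
  show ?thesis
  proof (intro exI[of _ C] conjI allI impI)
    show "0 < C" unfolding C_def using K00 S_pos K c1 by (intro add_pos_nonneg mult_nonneg_nonneg) (auto simp: PC_def)
    fix f :: "'l \<Rightarrow> real^'n \<Rightarrow> complex" and x0 x a :: "real^'n" and M L :: real and k :: nat
    assume f: "nice r f" and M: "max_bound r f x0 M" and L: "0 < L" and x0: "x0 \<in> cube a L" and x: "x \<in> cube a L" and kL: "2 ^ k * L \<le> 1"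
    let ?R = "2 ^ k :: real" and ?\<kappa> = "(2 ^ k :: real) powr \<rho>"
    have M0: "0 \<le> M" using M by (simp add: max_bound_def)
    have "?\<kappa> \<le> ?R powr 1" using \<rho> by (intro powr_mono) auto
    then have \<kappa>R: "?\<kappa> \<le> ?R" by simp
    have "1 * ?R \<le> K * ?R" using K by (intro mult_right_mono) auto
    then have KR: "?\<kappa> \<le> K * ?R" using \<kappa>R by linarith
    have d1: "dist x x0 \<le> real ?n * L" using norm_diff_cube_le[OF x x0] by (simp add: dist_norm)
    have "dist (diag x) (diag x0 :: real^'n^'l) \<le> real ?l * dist x x0"
      unfolding dist_norm diag_diff[symmetric] by (rule norm_diag_le)
    also have "\<dots> \<le> real ?l * (real ?n * L)" using d1 by (intro mult_left_mono) auto
    finally have d2: "dist (diag x) (diag x0 :: real^'n^'l) \<le> c * L" by (simp add: c_def mult.assoc)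
    have "1 * (real ?n * L) \<le> real ?l * (real ?n * L)" using L by (intro mult_right_mono) (auto simp: Suc_leI)
    then have d3: "dist x x0 \<le> c * L" using d1 unfolding c_def mult.assoc by linarith
    have "?\<kappa> * (c * L) \<le> ?R * (c * L)" using \<kappa>R c1 L by (intro mult_right_mono) auto
    also have "\<dots> = c * (?R * L)" by (simp only: mult_ac)
    also have "\<dots> \<le> c * 1" using kL c1 by (intro mult_left_mono) auto
    finally have c: "?\<kappa> * (c * L) \<le> c" by simp
    have "norm (piece k f x - piece k f x0) \<le> K0 * (A * ?R powr m * (2 * (K * ?R) / ?\<kappa>) powr (real ?d / r)) * (K * ?R * (c * L)) * Phi r (real N * r) ?\<kappa> (tens f) (diag x0) powr (1 / r)"
      unfolding piece_def K0_def
      by (rule fmult_difference[OF r _ _ KR _ _ xs d3 d2 _ c c1]) (use f A c1 L in \<open>auto simp: nice_def\<close>)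
    also have "\<dots> = K0 * S * (K * ?R * (c * L)) * Phi r (real N * r) ?\<kappa> (tens f) (diag x0) powr (1 / r)"
      unfolding scale_const ..
    also have "\<dots> \<le> K0 * S * (K * ?R * (c * L)) * (2 powr (real N * r + 1) * 2 ^ ?d * M) powr (1 / r)"
    proof (intro mult_left_mono powr_mono2)
      show "Phi r (real N * r) ?\<kappa> (tens f) (diag x0) \<le> 2 powr (real N * r + 1) * 2 ^ ?d * M"
        using f by (intro Phi_max[OF M _ _ _ Nr_ge]) (auto simp: nice_def)
    qed (use r K00 S_pos K c1 L in \<open>auto intro!: Phi_nonneg mult_nonneg_nonneg\<close>)
    also have "\<dots> = K0 * S * (K * c) * PC * (?R * L) * M powr (1 / r)"
      unfolding powr_mult[of _ M] PC_def by (simp only: mult_ac)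
    also have "\<dots> \<le> C * (?R * L) * M powr (1 / r)"
      unfolding C_def using L by (intro mult_right_mono) auto
    finally show "norm (piece k f x - piece k f x0) \<le> C * (?R * L) * M powr (1 / r)" .
  qed
qed

text \<open>The constant c is the value at \<open>x0\<close> of the low pieces, those with 2^k L <
  1; the high ones are small in the mean without any subtraction. For L >= 1 there are no low pieces
  and c = 0, so one statement serves both suprema of \<open>sharp_max\<close>.\<close>

lemma cube_estimate:
  "\<exists>C>0. \<forall>f x0 M a L G. nice r f \<longrightarrow> max_bound r f x0 M \<longrightarrow> 0 < L \<longrightarrow> x0 \<in> cube a L \<longrightarrow>
    (\<forall>x. (\<lambda>n. \<Sum>k<n. piece k f x) \<longlonglongrightarrow> G x) \<longrightarrow>
    (\<exists>c. (1 \<le> L \<longrightarrow> c = 0) \<and> (\<integral>\<^sup>+x. ennreal (norm (G x - c) powr t) * indicator (cube a L) x \<partial>lborel)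
      \<le> ennreal (C * M powr (1 / real CARD('l)) * L ^ CARD('n)))"
proof -
  let ?n = "CARD('n)" and ?l = "real CARD('l)"
  obtain C1 where C1: "0 < C1" and high: "\<And>f x0 M a L k. nice r f \<Longrightarrow> max_bound r f x0 M \<Longrightarrow> 0 < L \<Longrightarrow> x0 \<in> cube a L \<Longrightarrow> 1 \<le> 2 ^ k * L \<Longrightarrow>
    (\<integral>\<^sup>+x. ennreal (norm (piece k f x) powr t) * indicator (cube a L) x \<partial>lborel)
     \<le> ennreal (C1 * M powr (1 / ?l) * L ^ ?n * ((2 ^ k * L) powr (- (\<epsilon> * t)) + 2 * (2 ^ k) powr (- (\<epsilon> * t))))"
    using high_piece by blast
  obtain C2 where C2: "0 < C2" and low: "\<And>f x0 x M a L k. nice r f \<Longrightarrow> max_bound r f x0 M \<Longrightarrow> 0 < L \<Longrightarrow> x0 \<in> cube a L \<Longrightarrow> x \<in> cube a L \<Longrightarrow> 2 ^ k * L \<le> 1 \<Longrightarrow>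
    norm (piece k f x - piece k f x0) \<le> C2 * (2 ^ k * L) * M powr (1 / r)"
    using low_piece by blast
  define \<theta> where "\<theta> = 2 powr (- (\<epsilon> * t))"
  have et: "0 < \<epsilon> * t" using \<epsilon>_pos t_bounds by simp
  have "\<theta> < 2 powr 0" unfolding \<theta>_def using et by (intro powr_less_mono) auto
  then have \<theta>: "0 < \<theta>" "\<theta> < 1" by (auto simp: \<theta>_def)
  have \<theta>pow: "(2 ^ k :: real) powr (- (\<epsilon> * t)) = \<theta> ^ k" for k
  proof (induction k)
    case (Suc k)
    have "(2 ^ Suc k :: real) powr (- (\<epsilon> * t)) = 2 powr (- (\<epsilon> * t)) * (2 ^ k) powr (- (\<epsilon> * t))"
      unfolding power_Suc by (rule powr_mult)
    also have "\<dots> = \<theta> * \<theta> ^ k" unfolding Suc.IH \<theta>_def ..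
    finally show ?case by (simp only: power_Suc[of \<theta>])
  qed simp
  define C where "C = (2 * C2) powr t + 3 * C1 * (1 / (1 - \<theta>))"
  show ?thesis
  proof (intro exI[of _ C] conjI allI impI)
    show "0 < C" unfolding C_def using C1 \<theta> by (intro add_nonneg_pos) auto
    fix f :: "'l \<Rightarrow> real^'n \<Rightarrow> complex" and x0 a :: "real^'n" and M L :: real and G
    assume f: "nice r f" and M: "max_bound r f x0 M" and L: "0 < L" and x0: "x0 \<in> cube a L"
      and lim: "\<forall>x. (\<lambda>n. \<Sum>k<n. piece k f x) \<longlonglongrightarrow> G x"
    note [measurable] = piece_measurable[OF f]
    let ?M = "M powr (1 / ?l)"
    obtain k1 :: nat where "1 / L < 2 ^ k1" using real_arch_pow[of 2 "1 / L"] by auto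
    then have k1: "1 \<le> 2 ^ k1 * L" using L by (simp add: field_simps)
    define k0 where "k0 = (LEAST k::nat. 1 \<le> 2 ^ k * L)"
    have k0: "1 \<le> 2 ^ k0 * L" unfolding k0_def by (rule LeastI) (rule k1)
    have below: "2 ^ k * L < 1" if "k < k0" for k using not_less_Least[of k "\<lambda>k. 1 \<le> 2 ^ k * L"] that by (simp add: k0_def)
    define c where "c = (\<Sum>k<k0. piece k f x0)"
    define U where "U = 2 * C2 * M powr (1 / r)"
    have U0: "0 \<le> U" using C2 by (simp add: U_def)
    have Ut: "U powr t = (2 * C2) powr t * ?M"
      unfolding U_def using C2 r by (simp add: powr_mult powr_powr t)
    have lowsum: "norm ((\<Sum>k<k0. piece k f x) - c) \<le> U" if x: "x \<in> cube a L" for x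
    proof (cases k0)
      case 0
      then show ?thesis using U0 by (simp add: c_def)
    next
      case (Suc i)
      have geo: "(\<Sum>k<j. (2::real) ^ k) \<le> 2 ^ j" for j by (induction j) auto
      \<comment> \<open>By minimality of \<open>k0\<close> the last low frequency has 2^(k0-1) L <
        1, so the geometric sum of the low gains is at most 2.\<close>
      have "2 ^ k0 * L \<le> 2" using below[of i] Suc by simp
      have "norm ((\<Sum>k<k0. piece k f x) - c) \<le> (\<Sum>k<k0. norm (piece k f x - piece k f x0))"
        unfolding c_def sum_subtractf[symmetric] by (rule norm_sum)
      also have "\<dots> \<le> (\<Sum>k<k0. C2 * (2 ^ k * L) * M powr (1 / r))"
        by (intro sum_mono low[OF f M L x0 x]) (use below in \<open>auto intro: less_imp_le\<close>)
      also have "\<dots> = (C2 * L * M powr (1 / r)) * (\<Sum>k<k0. 2 ^ k)" by (simp add: sum_distrib_left mult_ac)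
      also have "\<dots> \<le> (C2 * L * M powr (1 / r)) * 2 ^ k0" using C2 L by (intro mult_left_mono geo) auto
      also have "\<dots> = C2 * M powr (1 / r) * (2 ^ k0 * L)" by (simp only: mult_ac)
      also have "\<dots> \<le> C2 * M powr (1 / r) * 2" using C2 \<open>2 ^ k0 * L \<le> 2\<close> by (intro mult_left_mono) auto
      finally show ?thesis by (simp add: U_def mult_ac)
    qed
    \<comment> \<open>Subadditivity of the t-th power is applied to the finite partial sums, whose
      bound by the full series does not depend on n; only then is the limit taken.\<close>
    have pw: "ennreal (norm (G x - c) powr t) \<le> ennreal (U powr t) + (\<Sum>j. ennreal (norm (piece (j + k0) f x) powr t))" if x: "x \<in> cube a L" for x
    proof (rule LIMSEQ_le_const2)
      have "(\<lambda>n. (\<Sum>k<n + k0. piece k f x)) \<longlonglongrightarrow> G x" using lim by (intro LIMSEQ_ignore_initial_segment) auto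
      then have "(\<lambda>n. norm ((\<Sum>k<n + k0. piece k f x) - c)) \<longlonglongrightarrow> norm (G x - c)" by (intro tendsto_intros)
      then have "(\<lambda>n. norm ((\<Sum>k<n + k0. piece k f x) - c) powr t) \<longlonglongrightarrow> norm (G x - c) powr t"
        using t_bounds by (intro tendsto_powr') auto
      then show "(\<lambda>n. ennreal (norm ((\<Sum>k<n + k0. piece k f x) - c) powr t)) \<longlonglongrightarrow> ennreal (norm (G x - c) powr t)"
        by (rule tendsto_ennrealI)
      show "\<exists>n0. \<forall>n\<ge>n0. ennreal (norm ((\<Sum>k<n + k0. piece k f x) - c) powr t) \<le> ennreal (U powr t) + (\<Sum>j. ennreal (norm (piece (j + k0) f x) powr t))"
      proof (intro exI[of _ 0] allI impI)
        fix n
        have "(\<Sum>k<n + k0. piece k f x) - c = ((\<Sum>k<k0. piece k f x) - c) + (\<Sum>j<n. piece (j + k0) f x)"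
        proof -
          have "(\<Sum>k<n + k0. piece k f x) = (\<Sum>k<k0. piece k f x) + (\<Sum>k=k0..<n + k0. piece k f x)"
            by (simp add: lessThan_atLeast0 sum.atLeastLessThan_concat)
          also have "(\<Sum>k=k0..<n + k0. piece k f x) = (\<Sum>j<n. piece (j + k0) f x)"
            using sum.shift_bounds_nat_ivl[of "\<lambda>k. piece k f x" 0 k0 n] by (simp add: lessThan_atLeast0)
          finally show ?thesis by simp
        qed
        also have "norm \<dots> \<le> U + (\<Sum>j<n. norm (piece (j + k0) f x))"
          by (rule order_trans[OF norm_triangle_ineq add_mono[OF lowsum[OF x] norm_sum]])
        finally have "norm ((\<Sum>k<n + k0. piece k f x) - c) powr t \<le> (U + (\<Sum>j<n. norm (piece (j + k0) f x))) powr t"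
          using t_bounds by (intro powr_mono2) auto
        also have "\<dots> \<le> U powr t + (\<Sum>j<n. norm (piece (j + k0) f x)) powr t"
          by (intro powr_add_le U0 t_bounds sum_nonneg) auto
        also have "\<dots> \<le> U powr t + (\<Sum>j<n. norm (piece (j + k0) f x) powr t)"
          by (intro add_left_mono powr_sum_le_sum_powr t_bounds) auto
        finally have le: "ennreal (norm ((\<Sum>k<n + k0. piece k f x) - c) powr t) \<le> ennreal (U powr t) + ennreal (\<Sum>j<n. norm (piece (j + k0) f x) powr t)"
          by (subst ennreal_plus[symmetric]) (auto intro!: ennreal_leI sum_nonneg simp del: ennreal_plus)
        have "ennreal (\<Sum>j<n. norm (piece (j + k0) f x) powr t) = (\<Sum>j<n. ennreal (norm (piece (j + k0) f x) powr t))"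
          by (rule sum_ennreal[symmetric]) simp
        also have "\<dots> \<le> (\<Sum>j. ennreal (norm (piece (j + k0) f x) powr t))" by (rule sum_le_suminf) auto
        finally show "ennreal (norm ((\<Sum>k<n + k0. piece k f x) - c) powr t) \<le> ennreal (U powr t) + (\<Sum>j. ennreal (norm (piece (j + k0) f x) powr t))"
          by (rule order_trans[OF le add_left_mono])
      qed
    qed
    \<comment> \<open>At k = j + k0 both terms of the gain are at most \<theta>^j: the first because
      2^k0 L >= 1, the second because 2^k0 >= 1. Their coefficients add up to 3.\<close>
    have each: "(\<integral>\<^sup>+x. ennreal (norm (piece (j + k0) f x) powr t) * indicator (cube a L) x \<partial>lborel) \<le> ennreal (3 * C1 * ?M * L ^ ?n * \<theta> ^ j)" for j
    proof -
      have jL: "2 ^ (j + k0) * L = 2 ^ j * (2 ^ k0 * L)" by (simp add: power_add)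
      have "2 ^ j * 1 \<le> 2 ^ j * (2 ^ k0 * L)" using k0 by (intro mult_left_mono) auto
      then have j1: "2 ^ j \<le> 2 ^ (j + k0) * L" unfolding jL by simp
      have j2: "1 \<le> 2 ^ (j + k0) * L" using j1 by (rule order_trans[rotated]) simp
      have "(2 ^ (j + k0) * L) powr (- (\<epsilon> * t)) \<le> (2 ^ j) powr (- (\<epsilon> * t))" using j1 et by (intro powr_mono2') auto
      then have e1: "(2 ^ (j + k0) * L) powr (- (\<epsilon> * t)) \<le> \<theta> ^ j" unfolding \<theta>pow .
      have e2: "(2 ^ (j + k0)) powr (- (\<epsilon> * t)) \<le> \<theta> ^ j" unfolding \<theta>pow using \<theta> by (intro power_decreasing) auto
      have "(\<integral>\<^sup>+x. ennreal (norm (piece (j + k0) f x) powr t) * indicator (cube a L) x \<partial>lborel)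
        \<le> ennreal (C1 * ?M * L ^ ?n * ((2 ^ (j + k0) * L) powr (- (\<epsilon> * t)) + 2 * (2 ^ (j + k0)) powr (- (\<epsilon> * t))))"
        by (rule high[OF f M L x0 j2])
      also have "\<dots> \<le> ennreal (C1 * ?M * L ^ ?n * (\<theta> ^ j + 2 * \<theta> ^ j))"
        using C1 L e1 e2 by (intro ennreal_leI mult_left_mono add_mono) auto
      also have "C1 * ?M * L ^ ?n * (\<theta> ^ j + 2 * \<theta> ^ j) = 3 * C1 * ?M * L ^ ?n * \<theta> ^ j" by simp
      finally show ?thesis .
    qed
    show "\<exists>c. (1 \<le> L \<longrightarrow> c = 0) \<and> (\<integral>\<^sup>+x. ennreal (norm (G x - c) powr t) * indicator (cube a L) x \<partial>lborel)
      \<le> ennreal (C * ?M * L ^ ?n)"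
    proof (intro exI[of _ c] conjI impI)
      show "c = 0" if "1 \<le> L"
      proof -
        have "k0 = 0" using below[of 0] that by (cases k0) auto
        then show ?thesis by (simp add: c_def)
      qed
      have "(\<integral>\<^sup>+x. (\<Sum>j. ennreal (norm (piece (j + k0) f x) powr t) * indicator (cube a L) x) \<partial>lborel)
         = (\<Sum>j. \<integral>\<^sup>+x. ennreal (norm (piece (j + k0) f x) powr t) * indicator (cube a L) x \<partial>lborel)"
        by (rule nn_integral_suminf) measurable
      also have "\<dots> \<le> (\<Sum>j. ennreal (3 * C1 * ?M * L ^ ?n * \<theta> ^ j))" by (intro suminf_le each) auto
      also have "\<dots> = ennreal (\<Sum>j. 3 * C1 * ?M * L ^ ?n * \<theta> ^ j)"
        using C1 L \<theta> by (intro suminf_ennreal2) (auto intro!: summable_mult summable_geometric)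
      also have "(\<Sum>j. 3 * C1 * ?M * L ^ ?n * \<theta> ^ j) = 3 * C1 * ?M * L ^ ?n * (1 / (1 - \<theta>))"
        using \<theta> by (subst suminf_mult) (auto simp: suminf_geometric intro!: summable_geometric)
      finally have tail: "(\<integral>\<^sup>+x. (\<Sum>j. ennreal (norm (piece (j + k0) f x) powr t) * indicator (cube a L) x) \<partial>lborel)
         \<le> ennreal (3 * C1 * ?M * L ^ ?n * (1 / (1 - \<theta>)))" .
      have "(\<integral>\<^sup>+x. ennreal (norm (G x - c) powr t) * indicator (cube a L) x \<partial>lborel)
        \<le> (\<integral>\<^sup>+x. ennreal (U powr t) * indicator (cube a L) x + (\<Sum>j. ennreal (norm (piece (j + k0) f x) powr t) * indicator (cube a L) x) \<partial>lborel)"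
      proof (rule nn_integral_mono)
        fix x
        show "ennreal (norm (G x - c) powr t) * indicator (cube a L) x
          \<le> ennreal (U powr t) * indicator (cube a L) x + (\<Sum>j. ennreal (norm (piece (j + k0) f x) powr t) * indicator (cube a L) x)"
        proof (cases "x \<in> cube a L")
          case True
          then have one: "indicator (cube a L) x = (1::ennreal)" by simp
          show ?thesis unfolding one mult_1_right by (rule pw[OF True])
        qed simp
      qed
      also have "\<dots> = (\<integral>\<^sup>+x. ennreal (U powr t) * indicator (cube a L) x \<partial>lborel) + (\<integral>\<^sup>+x. (\<Sum>j. ennreal (norm (piece (j + k0) f x) powr t) * indicator (cube a L) x) \<partial>lborel)"
        by (rule nn_integral_add) measurable
      also have "(\<integral>\<^sup>+x. ennreal (U powr t) * indicator (cube a L) x \<partial>lborel) = ennreal (U powr t * L ^ ?n)"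
        using L by (subst nn_integral_cmult_indicator) (auto simp: emeasure_cube ennreal_mult)
      also have "ennreal (U powr t * L ^ ?n) + (\<integral>\<^sup>+x. (\<Sum>j. ennreal (norm (piece (j + k0) f x) powr t) * indicator (cube a L) x) \<partial>lborel)
        \<le> ennreal (U powr t * L ^ ?n) + ennreal (3 * C1 * ?M * L ^ ?n * (1 / (1 - \<theta>)))"
        by (rule add_left_mono[OF tail])
      also have "ennreal (U powr t * L ^ ?n) + ennreal (3 * C1 * ?M * L ^ ?n * (1 / (1 - \<theta>))) = ennreal (U powr t * L ^ ?n + 3 * C1 * ?M * L ^ ?n * (1 / (1 - \<theta>)))"
        using C1 L \<theta> by (intro ennreal_plus[symmetric]) auto
      also have "U powr t * L ^ ?n + 3 * C1 * ?M * L ^ ?n * (1 / (1 - \<theta>)) = C * ?M * L ^ ?n"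
      proof -
        have "u * v * w + 3 * C1 * v * w * h = (u + 3 * C1 * h) * v * w" for u v w h :: real by (simp add: algebra_simps)
        then show ?thesis unfolding C_def Ut .
      qed
      finally show "(\<integral>\<^sup>+x. ennreal (norm (G x - c) powr t) * indicator (cube a L) x \<partial>lborel) \<le> ennreal (C * ?M * L ^ ?n)" .
    qed
  qed
qed

end

section \<open>From cubes to the maximal functions\<close>

lemma ennroot_le:
  assumes "x \<le> ennreal b" "0 \<le> b" "0 < p"
  shows "ennroot p x \<le> ennreal (b powr (1 / p))"
proof -
  have "x < \<infinity>" using assms(1) by (rule order.strict_trans1) simp
  moreover have "enn2real x \<le> b" using assms by (intro enn2real_leI) auto
  ultimately show ?thesis
    unfolding ennroot_def using assms by (auto intro!: ennreal_leI powr_mono2)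
qed

lemma avg_t_cube_le:
  fixes a :: "real^'n"
  assumes F: "(\<integral>\<^sup>+y. ennreal (norm (F y) powr t) * indicator (cube a L) y \<partial>lborel) \<le> ennreal (b * L ^ CARD('n))"
    and L: "0 < L" and b: "0 \<le> b" and t: "0 < t"
  shows "avg_t t F (cube a L) \<le> ennreal (b powr (1 / t))"
  unfolding avg_t_def
proof (rule ennroot_le[OF _ b t])
  have "(\<integral>\<^sup>+y. ennreal (norm (F y) powr t) * indicator (cube a L) y \<partial>lborel) / emeasure lborel (cube a L) \<le> ennreal (b * L ^ CARD('n)) / ennreal (L ^ CARD('n))"
    using L by (simp only: emeasure_cube less_imp_le) (intro divide_right_mono_ennreal F)
  also have "\<dots> = ennreal b" using L b by (subst divide_ennreal) auto
  finally show "(\<integral>\<^sup>+y. ennreal (norm (F y) powr t) * indicator (cube a L) y \<partial>lborel) / emeasure lborel (cube a L) \<le> ennreal b" .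
qed

lemma max_bound_multi_max:
  fixes fs :: "'l::finite \<Rightarrow> real^'n \<Rightarrow> complex"
  assumes fin: "multi_max (\<lambda>j y. complex_of_real (norm (fs j y) powr r)) x < \<infinity>"
  shows "max_bound r fs x (enn2real (multi_max (\<lambda>j y. complex_of_real (norm (fs j y) powr r)) x))"
proof -
  define M where "M = enn2real (multi_max (\<lambda>j y. complex_of_real (norm (fs j y) powr r)) x)"
  have M: "multi_max (\<lambda>j y. complex_of_real (norm (fs j y) powr r)) x = ennreal M" using fin by (simp add: M_def)
  have M0: "0 \<le> M" by (simp add: M_def)
  have "(\<integral>\<^sup>+u. ennreal (norm (tens fs u) powr r) * indicator {u. \<forall>j. u $ j \<in> cube a s} u \<partial>lborel) \<le> ennreal (M * s ^ DIM(real^'n^'l))"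
    if s: "0 < s" and x: "x \<in> cube a s" for a s
  proof -
    define I where "I = (\<integral>\<^sup>+u. ennreal (norm (tens fs u) powr r) * indicator {u. \<forall>j. u $ j \<in> cube a s} u \<partial>lborel)"
    have em: "emeasure lborel (cube a s) ^ CARD('l) = ennreal (s ^ DIM(real^'n^'l))"
      using s by (simp add: emeasure_cube ennreal_power power_mult[symmetric] mult.commute)
    have "I / emeasure lborel (cube a s) ^ CARD('l) \<le> multi_max (\<lambda>j y. complex_of_real (norm (fs j y) powr r)) x"
    proof -
      have "I = (\<integral>\<^sup>+u. ennreal (\<Prod>j\<in>UNIV. norm (complex_of_real (norm (fs j (u $ j)) powr r))) * indicator {u. \<forall>j. u $ j \<in> cube a s} u \<partial>lborel)"
        unfolding I_def norm_tens_powr by simp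
      then show ?thesis
        unfolding multi_max_def by (intro SUP_upper2[of "(a, s)"]) (use s x in auto)
    qed
    then have "I / ennreal (s ^ DIM(real^'n^'l)) \<le> ennreal M" unfolding em M .
    then have "I / ennreal (s ^ DIM(real^'n^'l)) * ennreal (s ^ DIM(real^'n^'l)) \<le> ennreal M * ennreal (s ^ DIM(real^'n^'l))"
      by (intro mult_right_mono) auto
    moreover have "I / ennreal (s ^ DIM(real^'n^'l)) * ennreal (s ^ DIM(real^'n^'l)) = I"
    proof -
      have "I / ennreal (s ^ DIM(real^'n^'l)) * ennreal (s ^ DIM(real^'n^'l)) = I * (ennreal (s ^ DIM(real^'n^'l)) / ennreal (s ^ DIM(real^'n^'l)))"
        by (simp only: ennreal_times_divide ennreal_divide_times mult.commute)
      also have "ennreal (s ^ DIM(real^'n^'l)) / ennreal (s ^ DIM(real^'n^'l)) = 1"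
        using s by (intro ennreal_divide_self) auto
      finally show ?thesis by simp
    qed
    ultimately show ?thesis unfolding I_def using M0 s by (simp add: ennreal_mult)
  qed
  then show ?thesis unfolding max_bound_def M_def[symmetric] using M0 by blast
qed

theorem theorem1p6:
  fixes \<sigma> :: "(real^'n) \<times> (real^'n^'l) \<Rightarrow> complex" and \<rho> r m :: real
  assumes "CARD('l) \<ge> 2"
    and "0 < \<rho>" and "\<rho> < 1"
    and "1 < r" and "r \<le> 2"
    and "m = - (real CARD('n) * real CARD('l) / r) * (1 - \<rho>)"
    and "\<sigma> \<in> multi_symbol_class m \<rho> \<rho>"
  shows "\<exists>C>0. \<forall>(fs :: 'l \<Rightarrow> real^'n \<Rightarrow> complex) x. (\<forall>j. schwartz (fs j)) \<longrightarrow>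
           sharp_max (r / real CARD('l)) (T_op \<sigma> fs) x \<le> ennreal C * multi_max_r r fs x"
proof -
  define N where "N = CARD('l) * (DIM(real^'n^'l) + 1)"
  define t where "t = r / real CARD('l)"
  obtain \<tau> A K B where A: "0 < A" and K: "1 \<le> K"
    and xs: "\<And>k. xsymb N (A * (2 ^ k) powr m) ((2 ^ k) powr \<rho>) (K * 2 ^ k) (\<tau> k)"
    and cont: "\<And>k. continuous_on UNIV (\<lambda>(x, \<xi>). \<tau> k x \<xi>)"
    and lim: "\<And>x \<xi>. (\<lambda>n. \<Sum>k<n. \<tau> k x \<xi>) \<longlonglongrightarrow> \<sigma> (x, \<xi>)"
    and bd: "\<And>n x \<xi>. norm (\<Sum>k<n. \<tau> k x \<xi>) \<le> B * norm (\<sigma> (x, \<xi>))"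
    using symbol_pieces[OF assms(7,2,3), of N] by blast
  interpret dyadic_pieces \<tau> A K \<rho> r m "r / (r - 1)" t N
    by standard (use assms A K xs cont in \<open>auto simp: N_def t_def\<close>)
  have m0: "m \<le> 0" unfolding assms(6) using assms(3,4) by (simp add: mult_nonneg_nonneg)
  obtain C where C: "0 < C" and est: "\<And>f x0 M a L G. nice r f \<Longrightarrow> max_bound r f x0 M \<Longrightarrow> 0 < L \<Longrightarrow> x0 \<in> cube a L \<Longrightarrow>
    (\<forall>x. (\<lambda>n. \<Sum>k<n. piece k f x) \<longlonglongrightarrow> G x) \<Longrightarrow>
    \<exists>c. (1 \<le> L \<longrightarrow> c = 0) \<and> (\<integral>\<^sup>+x. ennreal (norm (G x - c) powr t) * indicator (cube a L) x \<partial>lborel)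
      \<le> ennreal (C * M powr (1 / real CARD('l)) * L ^ CARD('n))"
    using cube_estimate by blast
  have t0: "0 < t" by (rule t_bounds)
  \<comment> \<open>Taking the power 1/t of C M^(1/l) gives D M^(1/r), because l t = r. The witness
    2 D counts the two suprema in \<open>sharp_max\<close>.\<close>
  define D where "D = C powr (1 / t)"
  have D0: "0 < D" using C by (simp add: D_def)
  show ?thesis
  proof (intro exI[of _ "2 * D"] conjI allI impI)
    show "0 < 2 * D" using D0 by simp
    fix fs :: "'l \<Rightarrow> real^'n \<Rightarrow> complex" and x :: "real^'n"
    assume fs: "\<forall>j. schwartz (fs j)"
    have nice: "nice r fs" using fs assms(4) by (intro schwartz_nice) auto
    have conv: "\<forall>y. (\<lambda>n. \<Sum>k<n. piece k fs y) \<longlonglongrightarrow> T_op \<sigma> fs y"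
    proof
      fix y
      have int: "integrable lborel (\<tau> k y)" for k
        using xs[of k] K unfolding xsymb_def by (intro symb_integrable[of N _ _ "K * 2 ^ k"]) auto
      show "(\<lambda>n. \<Sum>k<n. piece k fs y) \<longlonglongrightarrow> T_op \<sigma> fs y"
        unfolding piece_def
      proof (rule T_op_limit[where \<tau> = \<tau> and x = y and B = B, OF _ assms(7) m0])
        show "schwartz (fs j)" for j using fs by simp
      qed (rule int lim bd)+
    qed
    show "sharp_max (r / real CARD('l)) (T_op \<sigma> fs) x \<le> ennreal (2 * D) * multi_max_r r fs x"
    proof (cases "multi_max (\<lambda>j y. complex_of_real (norm (fs j y) powr r)) x = \<infinity>")
      \<comment> \<open>An infinite maximal function makes the right side infinite, as its factor 2
        D is positive.\<close>
      case True
      then have "multi_max_r r fs x = \<infinity>" by (simp add: multi_max_r_def ennroot_def)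
      then show ?thesis using D0 by (simp add: ennreal_mult_eq_top_iff ennreal_mult_top)
    next
      case False
      define M where "M = enn2real (multi_max (\<lambda>j y. complex_of_real (norm (fs j y) powr r)) x)"
      have M: "max_bound r fs x M"
        unfolding M_def by (rule max_bound_multi_max) (use False in \<open>simp add: less_top\<close>)
      have Mr: "multi_max_r r fs x = ennreal (M powr (1 / r))"
        using False by (simp add: multi_max_r_def ennroot_def M_def)
      have CM: "(C * M powr (1 / real CARD('l))) powr (1 / t) = D * M powr (1 / r)"
        using assms(4) by (simp add: D_def powr_mult powr_powr t_def)
      have CM0: "0 \<le> C * M powr (1 / real CARD('l))" using C by simp
      have big: "avg_t t (T_op \<sigma> fs) (cube a s) \<le> ennreal (D * M powr (1 / r))" if s1: "1 \<le> s" and x: "x \<in> cube a s" for a s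
      proof -
        have s: "0 < s" using s1 by simp
        obtain c where "1 \<le> s \<longrightarrow> c = 0" "(\<integral>\<^sup>+y. ennreal (norm (T_op \<sigma> fs y - c) powr t) * indicator (cube a s) y \<partial>lborel)
          \<le> ennreal (C * M powr (1 / real CARD('l)) * s ^ CARD('n))"
          using est[OF nice M s x conv] by blast
        then have "(\<integral>\<^sup>+y. ennreal (norm (T_op \<sigma> fs y) powr t) * indicator (cube a s) y \<partial>lborel)
          \<le> ennreal (C * M powr (1 / real CARD('l)) * s ^ CARD('n))" using s1 by simp
        from avg_t_cube_le[OF this s CM0 t0] show ?thesis unfolding CM .
      qed
      have small: "(INF c::complex. avg_t t (\<lambda>y. T_op \<sigma> fs y - c) (cube a s)) \<le> ennreal (D * M powr (1 / r))" if s: "0 < s" and x: "x \<in> cube a s" for a s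
      proof -
        obtain c where "(\<integral>\<^sup>+y. ennreal (norm (T_op \<sigma> fs y - c) powr t) * indicator (cube a s) y \<partial>lborel)
          \<le> ennreal (C * M powr (1 / real CARD('l)) * s ^ CARD('n))"
          using est[OF nice M s x conv] by blast
        from avg_t_cube_le[OF this s CM0 t0] show ?thesis unfolding CM by (rule INF_lower2[OF UNIV_I])
      qed
      have "sharp_max t (T_op \<sigma> fs) x \<le> ennreal (D * M powr (1 / r)) + ennreal (D * M powr (1 / r))"
        unfolding sharp_max_def by (intro add_mono SUP_least) (auto intro!: big small)
      also have "\<dots> = ennreal (2 * D) * multi_max_r r fs x"
        unfolding Mr using D0 by (simp add: ennreal_plus[symmetric] ennreal_mult[symmetric] del: ennreal_plus)
      finally show ?thesis unfolding t_def .
    qed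
  qed
qed

end
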